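(* Let $M$ be a connected $C^\infty$-smooth Riemannian manifold of dimension $n\ge 2$, $\Theta$ a compact set of parameters, and let $f_1,\dots,f_s$ be $C^\infty$-smooth vector fields on $M$ which are bounded on $M$ together with their covariant derivatives of each order. Let $\alpha,\omega:\Theta\to M$ be two ensembles of points joined by a diffeotopy $\gamma_t(\theta)$, $t\in[0,T]$. If the control system $$\dot x=\sum_{j=1}^s f_j(x)u_j(t)$$ satisfies the Lie bracket $C^0$-approximating condition along the diffeotopy $\gamma_t$, then $\alpha(\cdot)$ can be steered $C^0$-approximately to $\omega(\cdot)$ by this system in time $T$.
   Context: $\Theta$ is a compact (Lebesgue measurable) set, read as a subset of a Euclidean space; an ensemble of points is a continuous map $\gamma:\Theta\to M$. $d$ is the Riemannian distance on $M$. Controls are $u=(u_1,\dots,u_s)\in L_\infty([0,T],\mathbb{R}^s)$; $P^{u(\cdot)}_t$ denotes the flow generated by the system under the control $u(\cdot)$, i.e. $P_t^{u(\cdot)}(x_0)$ is the value at time $t$ of the solution with $x(0)=x_0$. $C^0$-approximate steering: $\alpha$ can be steered $C^0$-approximately to $\omega$ in time $T$ if for each $\varepsilon>0$ there is a control $u(\cdot)$ such that $\sup_{\theta\in\Theta}d\big(\omega(\theta),P_T^{u(\cdot)}(\alpha(\theta))\big)\le\varepsilon$. Diffeotopy: $\alpha$ and $\omega$ are joined by a diffeotopy $\gamma_t$ if $\gamma_t(\theta)=R_t(\alpha(\theta))$, $\gamma_0=\alpha$, $\gamma_T=\omega$, where $R_t$, $t\in[0,T]$, $R_0=\mathrm{Id}$,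 is a flow on $M$ generated by a time-variant vector field $Y_t(x)$ with $Y_t(x)$ and $D_xY_t(x)$ continuous. The flow $R_t$ is a priori unrelated to the control system. Seminorm: for compact $K\subset M$, $\|X\|_{1,K}=\sup_{x\in K}\big(\sum_{0\le|\beta|\le 1}|D^\beta X(x)|\big)$, i.e. the supremum over $K$ of the size of $X$ plus its first covariant derivatives. $\mathrm{Lie}\{f\}$ is the (real) Lie algebra generated by $f_1,\dots,f_s$, and for $\lambda>0$, $\mathrm{Lie}^\lambda_{1,K}\{f\}=\{X\in\mathrm{Lie}\{f\}:\ \|X\|_{1,K}<\lambda\}$. Lie bracket $C^0$-approximating condition along the diffeotopy $\gamma_t$ generated by $Y_t$: there exist $\lambda>0$ and a compact neighborhood $\mathcal{O}_\Gamma$ of the set $\Gamma=\{\gamma_t(\theta):\theta\in\Theta,\ t\in[0,T]\}$ such that for all $t\in[0,T]$ $$\inf\Big\{\sup_{\theta\in\Theta}\big|Y_t(\gamma_t(\theta))-X(\gamma_t(\theta))\big|\ :\ X\in\mathrm{Lie}^\lambda_{1,\mathcal{O}_\Gamma}\{f\}\Big\}=0.$$ *)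

theory Defs
  imports "HOL-Analysis.Analysis"
begin

section \<open>Smooth functions on open subsets of a Euclidean space\<close>

primrec Ck_on :: "nat \<Rightarrow> 'a::euclidean_space set \<Rightarrow> ('a \<Rightarrow> 'b::real_normed_vector) \<Rightarrow> bool" where
  "Ck_on 0 S f \<longleftrightarrow> continuous_on S f"
| "Ck_on (Suc k) S f \<longleftrightarrow>
     (\<forall>x\<in>S. f differentiable (at x)) \<and> (\<forall>v. Ck_on k S (\<lambda>x. frechet_derivative f (at x) v))"

definition smooth_on :: "'a::euclidean_space set \<Rightarrow> ('a \<Rightarrow> 'b::real_normed_vector) \<Rightarrow> bool" where
  "smooth_on S f \<longleftrightarrow> (\<forall>k. Ck_on k S f)"

section \<open>Smooth manifolds, vector fields, Riemannian metrics\<close>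

text \<open>
  The manifold is the whole of a Hausdorff, second countable type \<open>'m\<close>, with an atlas of charts
  into \<open>'e\<close>. A tangent vector at a point is the family of its coordinate representations in the
  charts around that point, so vector fields and metrics take a chart as first argument. Their
  values are meaningful only for charts of the atlas and points of the chart domain.
\<close>

type_synonym ('m, 'e) chart = "'m set \<times> ('m \<Rightarrow> 'e)"
type_synonym ('m, 'e) vector_field = "('m, 'e) chart \<Rightarrow> 'm \<Rightarrow> 'e"
type_synonym ('m, 'e) metric_tensor = "('m, 'e) chart \<Rightarrow> 'm \<Rightarrow> 'e \<Rightarrow> 'e \<Rightarrow> real"

abbreviation cdom :: "('m, 'e) chart \<Rightarrow> 'm set" where
  "cdom c \<equiv> fst c"

abbreviation cmap :: "('m, 'e) chart \<Rightarrow> 'm \<Rightarrow> 'e" where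
  "cmap c \<equiv> snd c"

definition crange :: "('m, 'e) chart \<Rightarrow> 'e set" where
  "crange c = cmap c ` cdom c"

definition cinv :: "('m, 'e) chart \<Rightarrow> 'e \<Rightarrow> 'm" where
  "cinv c = inv_into (cdom c) (cmap c)"

definition is_chart :: "('m::topological_space, 'e::euclidean_space) chart \<Rightarrow> bool" where
  "is_chart c \<longleftrightarrow> open (cdom c) \<and> open (crange c) \<and>
     homeomorphism (cdom c) (crange c) (cmap c) (cinv c)"

definition smooth_atlas :: "('m::topological_space, 'e::euclidean_space) chart set \<Rightarrow> bool" where
  "smooth_atlas A \<longleftrightarrow> (\<Union>c\<in>A. cdom c) = UNIV \<and> (\<forall>c\<in>A. is_chart c) \<and>
     (\<forall>c\<in>A. \<forall>c'\<in>A. smooth_on (cmap c ` (cdom c \<inter> cdom c')) (cmap c' \<circ> cinv c))"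

definition transition_deriv ::
    "('m, 'e::euclidean_space) chart \<Rightarrow> ('m, 'e) chart \<Rightarrow> 'm \<Rightarrow> 'e \<Rightarrow> 'e" where
  "transition_deriv c c' p = frechet_derivative (cmap c' \<circ> cinv c) (at (cmap c p))"

definition is_vector_field ::
    "('m, 'e::euclidean_space) chart set \<Rightarrow> ('m, 'e) vector_field \<Rightarrow> bool" where
  "is_vector_field A X \<longleftrightarrow> (\<forall>c\<in>A. \<forall>c'\<in>A. \<forall>p\<in>cdom c \<inter> cdom c'.
     X c' p = transition_deriv c c' p (X c p))"

definition smooth_vector_field ::
    "('m, 'e::euclidean_space) chart set \<Rightarrow> ('m, 'e) vector_field \<Rightarrow> bool" where
  "smooth_vector_field A X \<longleftrightarrow> is_vector_field A X \<and>
     (\<forall>c\<in>A. smooth_on (crange c) (\<lambda>x. X c (cinv c x)))"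

definition riemannian_metric ::
    "('m, 'e::euclidean_space) chart set \<Rightarrow> ('m, 'e) metric_tensor \<Rightarrow> bool" where
  "riemannian_metric A g \<longleftrightarrow>
     (\<forall>c\<in>A. \<forall>p\<in>cdom c. bilinear (g c p) \<and> (\<forall>v w. g c p v w = g c p w v) \<and>
        (\<forall>v. v \<noteq> 0 \<longrightarrow> 0 < g c p v v)) \<and>
     (\<forall>c\<in>A. \<forall>c'\<in>A. \<forall>p\<in>cdom c \<inter> cdom c'. \<forall>v w.
        g c p v w = g c' p (transition_deriv c c' p v) (transition_deriv c c' p w)) \<and>
     (\<forall>c\<in>A. \<forall>v w. smooth_on (crange c) (\<lambda>x. g c (cinv c x) v w))"

definition riemannian_manifold ::
    "('m::topological_space, 'e::euclidean_space) chart set \<Rightarrow> ('m, 'e) metric_tensor \<Rightarrow> bool" where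
  "riemannian_manifold A g \<longleftrightarrow> smooth_atlas A \<and> riemannian_metric A g"

text \<open>
  Lengths of tangent vectors do not depend on the chart; they are evaluated in an arbitrarily
  chosen chart around the point.
\<close>

definition chart_at :: "('m, 'e) chart set \<Rightarrow> 'm \<Rightarrow> ('m, 'e) chart" where
  "chart_at A p = (SOME c. c \<in> A \<and> p \<in> cdom c)"

definition gnorm :: "('m, 'e) metric_tensor \<Rightarrow> ('m, 'e) chart \<Rightarrow> 'm \<Rightarrow> 'e \<Rightarrow> real" where
  "gnorm g c p v = sqrt (g c p v v)"

definition tangent_norm ::
    "('m, 'e) chart set \<Rightarrow> ('m, 'e) metric_tensor \<Rightarrow> 'm \<Rightarrow> (('m, 'e) chart \<Rightarrow> 'e) \<Rightarrow> real" where
  "tangent_norm A g p v = gnorm g (chart_at A p) p (v (chart_at A p))"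

section \<open>Riemannian distance\<close>

definition piecewise_C1_curve ::
    "('m::topological_space, 'e::euclidean_space) chart set \<Rightarrow> (real \<Rightarrow> 'm) \<Rightarrow> bool" where
  "piecewise_C1_curve A \<sigma> \<longleftrightarrow> continuous_on {0..1} \<sigma> \<and>
     (\<forall>c\<in>A. \<forall>a b. 0 \<le> a \<and> a \<le> b \<and> b \<le> 1 \<and> \<sigma> ` {a..b} \<subseteq> cdom c \<longrightarrow>
        (cmap c \<circ> \<sigma>) piecewise_C1_differentiable_on {a..b})"

definition speed ::
    "('m, 'e::euclidean_space) chart set \<Rightarrow> ('m, 'e) metric_tensor \<Rightarrow> (real \<Rightarrow> 'm) \<Rightarrow> real \<Rightarrow> real" where
  "speed A g \<sigma> t =
     tangent_norm A g (\<sigma> t) (\<lambda>c. vector_derivative (\<lambda>r. cmap c (\<sigma> r)) (at t))"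

text \<open>
  The derivative of a curve that is piecewise \<open>C1\<close> in the library's sense may blow up at a break
  point. The length is therefore required to exist through \<open>has_integral\<close>, which excludes
  curves of infinite length.
\<close>

definition riemannian_dist ::
    "('m::topological_space, 'e::euclidean_space) chart set \<Rightarrow> ('m, 'e) metric_tensor \<Rightarrow> 'm \<Rightarrow> 'm \<Rightarrow> real" where
  "riemannian_dist A g p q =
     Inf {L. \<exists>\<sigma>. piecewise_C1_curve A \<sigma> \<and> \<sigma> 0 = p \<and> \<sigma> 1 = q \<and>
       (speed A g \<sigma> has_integral L) {0..1}}"

section \<open>Covariant derivatives\<close>

text \<open>
  Directional derivative of a function on \<open>'m\<close> in the coordinates of a chart, and the Levi-Civita
  Christoffel map, determined by the metric through the Koszul formula for coordinate fields.
\<close>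

definition chart_deriv ::
    "('m, 'e::euclidean_space) chart \<Rightarrow> ('m \<Rightarrow> 'b::real_normed_vector) \<Rightarrow> 'm \<Rightarrow> 'e \<Rightarrow> 'b" where
  "chart_deriv c F p v = frechet_derivative (F \<circ> cinv c) (at (cmap c p)) v"

definition christoffel ::
    "('m, 'e::euclidean_space) metric_tensor \<Rightarrow> ('m, 'e) chart \<Rightarrow> 'm \<Rightarrow> 'e \<Rightarrow> 'e \<Rightarrow> 'e" where
  "christoffel g c p v w = (THE u. \<forall>z. g c p u z =
     (chart_deriv c (\<lambda>q. g c q w z) p v + chart_deriv c (\<lambda>q. g c q v z) p w
       - chart_deriv c (\<lambda>q. g c q v w) p z) / 2)"

text \<open>
  A tensor field of type \<open>(k, 1)\<close> sends a list of \<open>k\<close> tangent vectors to a tangent vector. Its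
  covariant derivative takes the direction of differentiation as an additional first argument:
  \<open>(\<nabla>S)(v, w\<^sub>1, \<dots>, w\<^sub>k) = \<nabla>\<^sub>v (S(w\<^sub>1, \<dots>, w\<^sub>k)) - (\<Sum>i. S(w\<^sub>1, \<dots>, \<nabla>\<^sub>v w\<^sub>i, \<dots>, w\<^sub>k))\<close>,
  computed with \<open>w\<^sub>i\<close> extended by constant coordinates.
\<close>

type_synonym ('m, 'e) tensor_field = "('m, 'e) chart \<Rightarrow> 'm \<Rightarrow> 'e list \<Rightarrow> 'e"

definition cov_deriv ::
    "('m, 'e::euclidean_space) metric_tensor \<Rightarrow> ('m, 'e) tensor_field \<Rightarrow> ('m, 'e) tensor_field" where
  "cov_deriv g S c p vs = (case vs of [] \<Rightarrow> 0 | v # ws \<Rightarrow>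
     chart_deriv c (\<lambda>q. S c q ws) p v + christoffel g c p v (S c p ws)
       - (\<Sum>i<length ws. S c p (ws[i := christoffel g c p v (ws ! i)])))"

definition nabla ::
    "('m, 'e::euclidean_space) metric_tensor \<Rightarrow> nat \<Rightarrow> ('m, 'e) vector_field \<Rightarrow> ('m, 'e) tensor_field" where
  "nabla g k X = (cov_deriv g ^^ k) (\<lambda>c p vs. X c p)"

definition nabla_norm ::
    "('m, 'e::euclidean_space) chart set \<Rightarrow> ('m, 'e) metric_tensor \<Rightarrow> nat \<Rightarrow> ('m, 'e) vector_field \<Rightarrow> 'm \<Rightarrow> real" where
  "nabla_norm A g k X p = (let c = chart_at A p in
     Sup {gnorm g c p (nabla g k X c p vs) | vs.
       length vs = k \<and> (\<forall>v\<in>set vs. gnorm g c p v \<le> 1)})"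

definition bounded_with_cov_derivs ::
    "('m, 'e::euclidean_space) chart set \<Rightarrow> ('m, 'e) metric_tensor \<Rightarrow> ('m, 'e) vector_field \<Rightarrow> bool" where
  "bounded_with_cov_derivs A g X \<longleftrightarrow> (\<forall>k. \<exists>C. \<forall>p. nabla_norm A g k X p \<le> C)"

definition C1_seminorm ::
    "('m, 'e::euclidean_space) chart set \<Rightarrow> ('m, 'e) metric_tensor \<Rightarrow> 'm set \<Rightarrow> ('m, 'e) vector_field \<Rightarrow> real" where
  "C1_seminorm A g K X = (SUP p\<in>K. \<Sum>k\<le>1. nabla_norm A g k X p)"

section \<open>Lie algebra generated by vector fields\<close>

definition lie_bracket ::
    "('m, 'e::euclidean_space) vector_field \<Rightarrow> ('m, 'e) vector_field \<Rightarrow> ('m, 'e) vector_field" where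
  "lie_bracket X Y c p = chart_deriv c (Y c) p (X c p) - chart_deriv c (X c) p (Y c p)"

inductive_set lie_algebra ::
    "('k \<Rightarrow> ('m, 'e::euclidean_space) vector_field) \<Rightarrow> ('m, 'e) vector_field set"
  for f :: "'k \<Rightarrow> ('m, 'e) vector_field" where
  generator: "f j \<in> lie_algebra f"
| add: "X \<in> lie_algebra f \<Longrightarrow> Y \<in> lie_algebra f \<Longrightarrow> (\<lambda>c p. X c p + Y c p) \<in> lie_algebra f"
| scale: "X \<in> lie_algebra f \<Longrightarrow> (\<lambda>c p. (r::real) *\<^sub>R X c p) \<in> lie_algebra f"
| bracket: "X \<in> lie_algebra f \<Longrightarrow> Y \<in> lie_algebra f \<Longrightarrow> lie_bracket X Y \<in> lie_algebra f"

definition lie_ball ::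
    "('m, 'e::euclidean_space) chart set \<Rightarrow> ('m, 'e) metric_tensor \<Rightarrow> ('k \<Rightarrow> ('m, 'e) vector_field) \<Rightarrow>
     real \<Rightarrow> 'm set \<Rightarrow> ('m, 'e) vector_field set" where
  "lie_ball A g f l K = {X \<in> lie_algebra f. C1_seminorm A g K X < l}"

section \<open>Trajectories, diffeotopies, steering\<close>

text \<open>
  Solutions on \<open>[0,T]\<close> of the equation given by a time-variant vector field \<open>Z\<close>, in the sense of
  Caratheodory (integral form, in every chart). If \<open>Z\<close> is continuous these are the classical
  \<open>C1\<close> solutions.
\<close>

definition trajectory ::
    "('m::topological_space, 'e::euclidean_space) chart set \<Rightarrow> (real \<Rightarrow> ('m, 'e) vector_field) \<Rightarrow>
     real \<Rightarrow> (real \<Rightarrow> 'm) \<Rightarrow> bool" where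
  "trajectory A Z T x \<longleftrightarrow> continuous_on {0..T} x \<and>
     (\<forall>c\<in>A. \<forall>a b. 0 \<le> a \<and> a \<le> b \<and> b \<le> T \<and> x ` {a..b} \<subseteq> cdom c \<longrightarrow>
        ((\<lambda>t. Z t c (x t)) has_integral (cmap c (x b) - cmap c (x a))) {a..b})"

text \<open>
  The solution starting at \<open>p\<close> exists on \<open>[0,T]\<close> and has value \<open>q\<close> at time \<open>T\<close>.
\<close>

definition flow_value ::
    "('m::topological_space, 'e::euclidean_space) chart set \<Rightarrow> (real \<Rightarrow> ('m, 'e) vector_field) \<Rightarrow>
     real \<Rightarrow> 'm \<Rightarrow> 'm \<Rightarrow> bool" where
  "flow_value A Z T p q \<longleftrightarrow> (\<exists>x. trajectory A Z T x \<and> x 0 = p \<and> x T = q)"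

definition C1_time_variant_field ::
    "('m::topological_space, 'e::euclidean_space) chart set \<Rightarrow> real \<Rightarrow> (real \<Rightarrow> ('m, 'e) vector_field) \<Rightarrow> bool" where
  "C1_time_variant_field A T Y \<longleftrightarrow> (\<forall>t\<in>{0..T}. is_vector_field A (Y t)) \<and>
     (\<forall>c\<in>A. continuous_on ({0..T} \<times> cdom c) (\<lambda>(t, p). Y t c p) \<and>
        (\<forall>t\<in>{0..T}. \<forall>p\<in>cdom c. (Y t c \<circ> cinv c) differentiable (at (cmap c p))) \<and>
        (\<forall>v. continuous_on ({0..T} \<times> cdom c) (\<lambda>(t, p). chart_deriv c (Y t c) p v)))"

definition diffeotopy ::
    "('m::topological_space, 'e::euclidean_space) chart set \<Rightarrow> real \<Rightarrow> 'p set \<Rightarrow>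
     (real \<Rightarrow> ('m, 'e) vector_field) \<Rightarrow> (real \<Rightarrow> 'p \<Rightarrow> 'm) \<Rightarrow> ('p \<Rightarrow> 'm) \<Rightarrow> ('p \<Rightarrow> 'm) \<Rightarrow> bool" where
  "diffeotopy A T \<Theta> Y \<gamma> \<alpha> \<omega> \<longleftrightarrow> C1_time_variant_field A T Y \<and>
     (\<exists>R. (\<forall>p. R 0 p = p \<and> trajectory A Y T (\<lambda>t. R t p)) \<and>
        (\<forall>t\<in>{0..T}. \<forall>\<theta>\<in>\<Theta>. \<gamma> t \<theta> = R t (\<alpha> \<theta>))) \<and>
     (\<forall>\<theta>\<in>\<Theta>. \<gamma> 0 \<theta> = \<alpha> \<theta> \<and> \<gamma> T \<theta> = \<omega> \<theta>)"

definition lie_bracket_C0_approximating ::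
    "('m::topological_space, 'e::euclidean_space) chart set \<Rightarrow> ('m, 'e) metric_tensor \<Rightarrow> ('k \<Rightarrow> ('m, 'e) vector_field) \<Rightarrow>
     real \<Rightarrow> 'p set \<Rightarrow> (real \<Rightarrow> ('m, 'e) vector_field) \<Rightarrow> (real \<Rightarrow> 'p \<Rightarrow> 'm) \<Rightarrow> bool" where
  "lie_bracket_C0_approximating A g f T \<Theta> Y \<gamma> \<longleftrightarrow>
     (\<exists>l>0. \<exists>K. compact K \<and> {\<gamma> t \<theta> | t \<theta>. t \<in> {0..T} \<and> \<theta> \<in> \<Theta>} \<subseteq> interior K \<and>
       (\<forall>t\<in>{0..T}.
          (INF X\<in>lie_ball A g f l K. SUP \<theta>\<in>\<Theta>.
             tangent_norm A g (\<gamma> t \<theta>) (\<lambda>c. Y t c (\<gamma> t \<theta>) - X c (\<gamma> t \<theta>))) = 0))"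

text \<open>Measurable, essentially bounded controls.\<close>

definition admissible_control :: "real \<Rightarrow> (real \<Rightarrow> real ^ 'k) \<Rightarrow> bool" where
  "admissible_control T u \<longleftrightarrow> u \<in> borel_measurable (lebesgue_on {0..T}) \<and>
     (\<exists>C. AE t in lebesgue_on {0..T}. norm (u t) \<le> C)"

definition control_field ::
    "('k::finite \<Rightarrow> ('m, 'e::euclidean_space) vector_field) \<Rightarrow> (real \<Rightarrow> real ^ 'k) \<Rightarrow>
     real \<Rightarrow> ('m, 'e) vector_field" where
  "control_field f u t c p = (\<Sum>j\<in>UNIV. (u t $ j) *\<^sub>R f j c p)"

text \<open>
  The bound on the supremum over \<open>\<Theta>\<close> is written pointwise. The flow of the control system need not
  be globally defined; its existence up to time \<open>T\<close> on the ensemble is part of the claim.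
\<close>

definition C0_approximately_steerable ::
    "('m::topological_space, 'e::euclidean_space) chart set \<Rightarrow> ('m, 'e) metric_tensor \<Rightarrow>
     ('k::finite \<Rightarrow> ('m, 'e) vector_field) \<Rightarrow> 'p set \<Rightarrow> ('p \<Rightarrow> 'm) \<Rightarrow> ('p \<Rightarrow> 'm) \<Rightarrow> real \<Rightarrow> bool" where
  "C0_approximately_steerable A g f \<Theta> \<alpha> \<omega> T \<longleftrightarrow>
     (\<forall>\<epsilon>>0. \<exists>u. admissible_control T u \<and>
        (\<forall>\<theta>\<in>\<Theta>. \<exists>q. flow_value A (control_field f u) T (\<alpha> \<theta>) q \<and>
           riemannian_dist A g (\<omega> \<theta>) q \<le> \<epsilon>))"

end

theory Submission
  imports Defs
begin

text \<open>
  Call a vector field attainable if its Euler steps of length \<open>h\<close> are reproduced by the control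
  system up to \<open>o(h)\<close>, uniformly on compact sets. The generators and their negatives are attainable
  by Picard iteration. Iterating small steps improves the accuracy to second order, and then the
  commutator of four such motions shows that brackets of attainable fields are attainable, so all of
  \<open>Lie{f}\<close> is. The step size for which a step along \<open>X\<close> is accurate depends only on \<open>C1\<close>
  bounds of \<open>X\<close>, which are uniform on \<open>Lie\<^sup>\<lambda>{f}\<close>. Therefore Euler polygons of \<open>Y\<close>,
  with \<open>Y\<^sub>t\<close> replaced at each node by an element of \<open>Lie\<^sup>\<lambda>{f}\<close> close to it along the moving
  ensemble, can be followed by the control system, and a discrete Gronwall estimate with the uniform
  Lipschitz constant bounds the distance to the diffeotopy.
\<close>

section \<open>Calculus of smooth functions\<close>

text \<open>The condition controls elements of \<open>Lie{f}\<close> only through their value and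
  first derivative, while the words that realise them may involve brackets of any depth, and the
  step length below which attainability holds depends on the field. So two scales are separated. At
  the fine scale a step is subdivided as much as the particular field demands; at the coarse scale
  only the bound and the Lipschitz constant of the field survive, and the Gronwall factor is fixed
  before the accuracy is chosen. Subdivision also explains the second order accuracy: n substeps of
  length s/n, each with error e' s/n, accumulate the error e' s, and e' may be taken much smaller
  than s.

  All estimates live in coordinates. A compact set is covered by finitely many compact pieces of
  charts, and one word has to work for all points and in every chart whose piece contains the point.
  Time is cut into intervals on which each member of the ensemble stays inside one chart; closeness
  is carried over to the other charts at the ends of these intervals.\<close>

lemma Ck_on_cong:
  assumes "open S" and "\<And>x. x \<in> S \<Longrightarrow> f x = g x"
  shows "Ck_on k S f \<longleftrightarrow> Ck_on k S g"
  using assms(2)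
proof (induction k arbitrary: f g)
  case 0
  then show ?case by (auto intro: continuous_on_cong)
next
  case (Suc k)
  have der: "(f has_derivative D) (at x) \<longleftrightarrow> (g has_derivative D) (at x)" if "x \<in> S" for x D
    using Suc.prems that assms(1) has_derivative_transform_within_open[of f D x UNIV S g]
      has_derivative_transform_within_open[of g D x UNIV S f] by auto
  have "f differentiable (at x) \<longleftrightarrow> g differentiable (at x)" if "x \<in> S" for x
    unfolding differentiable_def using der[OF that] by simp
  moreover have "frechet_derivative f (at x) = frechet_derivative g (at x)" if "x \<in> S" for x
    unfolding frechet_derivative_def using der[OF that] by simp
  ultimately show ?case
    using Suc.IH[of "\<lambda>x. frechet_derivative f (at x) v" "\<lambda>x. frechet_derivative g (at x) v" for v] by simp
qed

lemma Ck_on_SucD: "Ck_on (Suc k) S f \<Longrightarrow> Ck_on k S f"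
proof (induction k arbitrary: f)
  case 0
  then show ?case
    by (auto intro!: continuous_at_imp_continuous_on differentiable_imp_continuous_within)
next
  case (Suc k)
  then show ?case by (metis Ck_on.simps(2))
qed

lemma smooth_onD: "smooth_on S f \<Longrightarrow> Ck_on k S f"
  by (simp add: smooth_on_def)

lemma smooth_on_derivative:
  "smooth_on S f \<Longrightarrow> smooth_on S (\<lambda>x. frechet_derivative f (at x) v)"
  unfolding smooth_on_def by (metis Ck_on.simps(2))

text \<open>\<open>frechet_derivative\<close> is a choice term, whereas the calculus rules produce
  \<open>has_derivative\<close> statements. On an open set the two agree pointwise, and
  \<open>Ck_on_cong\<close> carries the regularity of \<open>D\<close> over to the chosen
  derivative.\<close>

lemma Ck_on_SucI:
  assumes "open S" and "\<And>x. x \<in> S \<Longrightarrow> (f has_derivative D x) (at x)"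
    and "\<And>v. Ck_on k S (\<lambda>x. D x v)"
  shows "Ck_on (Suc k) S f"
proof -
  have "frechet_derivative f (at x) = D x" if "x \<in> S" for x
    using frechet_derivative_at[OF assms(2)[OF that]] by simp
  then have "Ck_on k S (\<lambda>x. frechet_derivative f (at x) v)" for v
    using assms(3)[of v] Ck_on_cong[OF assms(1), of "\<lambda>x. frechet_derivative f (at x) v" "\<lambda>x. D x v"]
    by simp
  then show ?thesis using assms(2) by (auto simp: differentiable_def)
qed

section \<open>Closure properties of the classes \<open>Ck_on\<close>\<close>

lemma Ck_on_has_derivative:
  "Ck_on (Suc k) S f \<Longrightarrow> x \<in> S \<Longrightarrow> (f has_derivative frechet_derivative f (at x)) (at x)"
  using frechet_derivative_works by auto

lemma Ck_on_const: "open S \<Longrightarrow> Ck_on k S (\<lambda>x. a)"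
proof (induction k arbitrary: a)
  case (Suc k)
  show ?case by (rule Ck_on_SucI[where D = "\<lambda>x v. 0"]) (use Suc in auto)
qed simp

lemma Ck_on_linear:
  assumes "open S" "bounded_linear L"
  shows "Ck_on k S f \<Longrightarrow> Ck_on k S (\<lambda>x. L (f x))"
proof (induction k arbitrary: f)
  case 0
  then show ?case
    by (auto intro!: bounded_linear.continuous_on[OF assms(2)])
next
  case (Suc k)
  show ?case
  proof (rule Ck_on_SucI[OF assms(1)])
    show "((\<lambda>x. L (f x)) has_derivative (\<lambda>v. L (frechet_derivative f (at x) v))) (at x)" if "x \<in> S" for x
      by (rule bounded_linear.has_derivative[OF assms(2) Ck_on_has_derivative[OF Suc.prems that]])
    show "Ck_on k S (\<lambda>x. L (frechet_derivative f (at x) v))" for v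
      using Suc by simp
  qed
qed

lemma Ck_on_add:
  assumes "open S"
  shows "Ck_on k S f \<Longrightarrow> Ck_on k S g \<Longrightarrow> Ck_on k S (\<lambda>x. f x + g x)"
proof (induction k arbitrary: f g)
  case 0
  then show ?case by (auto intro: continuous_on_add)
next
  case (Suc k)
  show ?case
    by (rule Ck_on_SucI[OF assms has_derivative_add[OF Ck_on_has_derivative[OF Suc.prems(1)]
          Ck_on_has_derivative[OF Suc.prems(2)]]]) (use Suc in auto)
qed

lemma Ck_on_scaleR:
  assumes "open S"
  shows "Ck_on k S a \<Longrightarrow> Ck_on k S f \<Longrightarrow> Ck_on k S (\<lambda>x. a x *\<^sub>R f x)"
proof (induction k arbitrary: a f)
  case 0
  then show ?case by (auto intro: continuous_on_scaleR)
next
  case (Suc k)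
  show ?case
    by (rule Ck_on_SucI[OF assms has_derivative_scaleR[OF Ck_on_has_derivative[OF Suc.prems(1)]
          Ck_on_has_derivative[OF Suc.prems(2)]]])
      (use Suc.prems Suc.prems[THEN Ck_on_SucD] in \<open>auto intro!: Ck_on_add[OF assms] Suc.IH\<close>)
qed

lemma Ck_on_sum:
  assumes "open S" "finite I" "\<And>i. i \<in> I \<Longrightarrow> Ck_on k S (f i)"
  shows "Ck_on k S (\<lambda>x. \<Sum>i\<in>I. f i x)"
  using assms(2,3)
  by (induction I rule: finite_induct) (auto intro!: Ck_on_add[OF assms(1)] Ck_on_const[OF assms(1)])

lemma linear_basis_expansion:
  fixes L :: "'a::euclidean_space \<Rightarrow> 'b::real_vector"
  assumes "linear L"
  shows "L v = (\<Sum>b\<in>Basis. (v \<bullet> b) *\<^sub>R L b)"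
proof -
  have "L v = L (\<Sum>b\<in>Basis. (v \<bullet> b) *\<^sub>R b)" by (simp add: euclidean_representation)
  then show ?thesis
    using assms by (simp add: linear_sum linear_cmul)
qed

text \<open>\<open>Ck_on\<close> speaks of derivatives in fixed directions. A variable direction is
  expanded in the basis, which leaves smooth coefficients times derivatives in fixed directions.
  Smoothness of brackets rests on this.\<close>

lemma smooth_on_directional_derivative:
  fixes f :: "'a::euclidean_space \<Rightarrow> 'b::real_normed_vector" and h :: "'a \<Rightarrow> 'a"
  assumes "open S" "smooth_on S f" "smooth_on S h"
  shows "smooth_on S (\<lambda>x. frechet_derivative f (at x) (h x))"
  unfolding smooth_on_def
proof
  fix k
  let ?g = "\<lambda>x. \<Sum>b\<in>Basis. (h x \<bullet> b) *\<^sub>R frechet_derivative f (at x) b"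
  have "f differentiable (at x)" if "x \<in> S" for x
    using smooth_onD[OF assms(2), of 1] that by simp
  then have "frechet_derivative f (at x) (h x) = ?g x" if "x \<in> S" for x
    using linear_basis_expansion[OF linear_frechet_derivative] that by blast
  moreover have "Ck_on k S ?g"
    by (intro Ck_on_sum[OF assms(1)] Ck_on_scaleR[OF assms(1)] finite_Basis
        smooth_onD[OF smooth_on_derivative[OF assms(2)]]
        Ck_on_linear[OF assms(1) bounded_linear_inner_left] smooth_onD[OF assms(3)])
  ultimately show "Ck_on k S (\<lambda>x. frechet_derivative f (at x) (h x))"
    by (subst Ck_on_cong[OF assms(1)])
qed

lemma smooth_on_add:
  "open S \<Longrightarrow> smooth_on S f \<Longrightarrow> smooth_on S h \<Longrightarrow> smooth_on S (\<lambda>x. f x + h x)"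
  by (simp add: smooth_on_def Ck_on_add)

lemma smooth_on_cmul: "open S \<Longrightarrow> smooth_on S f \<Longrightarrow> smooth_on S (\<lambda>x. r *\<^sub>R f x)"
  by (simp add: smooth_on_def Ck_on_scaleR Ck_on_const)

lemma smooth_on_cong:
  "open S \<Longrightarrow> (\<And>x. x \<in> S \<Longrightarrow> f x = g x) \<Longrightarrow> smooth_on S f \<longleftrightarrow> smooth_on S g"
  unfolding smooth_on_def using Ck_on_cong[of S f g] by simp

section \<open>Uniform estimates on compact sets\<close>

text \<open>Written as a union of closed balls: compactness becomes that of a Minkowski sum, and the
  ball around each point of \<open>D\<close> lies inside, which supplies the convex sets for mean
  value estimates.\<close>

definition thicken :: "real \<Rightarrow> 'a::metric_space set \<Rightarrow> 'a set" where
  "thicken r D = (\<Union>x\<in>D. cball x r)"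

lemma compact_thicken: "compact D \<Longrightarrow> compact (thicken r D)" for D :: "'a::euclidean_space set"
  unfolding thicken_def by (rule compact_minkowski_sum_cball)

lemma thicken_mono: "r \<le> s \<Longrightarrow> thicken r D \<subseteq> thicken s D"
  unfolding thicken_def by (intro UN_mono) auto

lemma thicken_base: "0 \<le> r \<Longrightarrow> D \<subseteq> thicken r D"
  unfolding thicken_def by auto

lemma thickenI: "x \<in> D \<Longrightarrow> norm (y - x) \<le> r \<Longrightarrow> y \<in> thicken r D"
  for D :: "'a::real_normed_vector set"
  unfolding thicken_def by (auto simp: dist_norm norm_minus_commute)

lemma thicken_thicken: "thicken r (thicken s D) \<subseteq> thicken (r + s) D"
  for D :: "'a::real_normed_vector set"
proof
  fix z assume "z \<in> thicken r (thicken s D)"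
  then obtain x y where "x \<in> D" "dist x y \<le> s" "dist y z \<le> r" unfolding thicken_def by auto
  then show "z \<in> thicken (r + s) D"
    unfolding thicken_def using dist_triangle[of x z y] by (auto intro!: bexI[of _ x])
qed

lemma eventually_thicken_subset:
  fixes D :: "'a::euclidean_space set"
  assumes "compact D" "open U" "D \<subseteq> U"
  shows "\<forall>\<^sub>F r in at_right 0. thicken r D \<subseteq> U"
proof -
  obtain e where "e > 0" "thicken e D \<subseteq> U"
    using compact_subset_open_imp_cball_epsilon_subset[OF assms] unfolding thicken_def by metis
  then show ?thesis
    unfolding eventually_at_right_field using thicken_mono[of _ e D] by (meson less_imp_le order_trans)
qed

text \<open>Regularity is known separately in each fixed direction. Bounds in the finitely many
  basis directions become an operator bound, at the price of the factor
  \<open>DIM('a)\<close>.\<close>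

lemma norm_linear_le_basis:
  fixes L :: "'a::euclidean_space \<Rightarrow> 'b::real_normed_vector"
  assumes "linear L" "\<And>b. b \<in> Basis \<Longrightarrow> norm (L b) \<le> N"
  shows "norm (L v) \<le> real DIM('a) * N * norm v"
proof -
  have "norm (L v) = norm (\<Sum>b\<in>Basis. (v \<bullet> b) *\<^sub>R L b)"
    using linear_basis_expansion[OF assms(1)] by metis
  also have "\<dots> \<le> (\<Sum>b\<in>(Basis :: 'a set). norm v * N)"
  proof (rule sum_norm_le)
    fix b :: 'a assume b: "b \<in> Basis"
    have "norm ((v \<bullet> b) *\<^sub>R L b) \<le> \<bar>v \<bullet> b\<bar> * N"
      using assms(2)[OF b] by (simp add: mult_left_mono)
    also have "\<dots> \<le> norm v * N"
      using Basis_le_norm[OF b] assms(2)[OF b] order_trans[OF norm_ge_zero assms(2)[OF b]]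
      by (simp add: mult_right_mono)
    finally show "norm ((v \<bullet> b) *\<^sub>R L b) \<le> norm v * N" .
  qed
  finally show ?thesis by (simp add: mult_ac)
qed

lemma compact_bound:
  fixes F :: "'a::euclidean_space \<Rightarrow> 'b::real_normed_vector"
  assumes "continuous_on U F" "compact D" "D \<subseteq> U"
  shows "\<exists>B. \<forall>x\<in>D. norm (F x) \<le> B"
  using compact_imp_bounded[OF compact_continuous_image[OF continuous_on_subset[OF assms(1,3)] assms(2)]]
  unfolding bounded_iff by auto

lemma C1_derivative_bound:
  fixes F :: "'a::euclidean_space \<Rightarrow> 'b::real_normed_vector"
  assumes "Ck_on (Suc 0) U F" "compact D" "D \<subseteq> U"
  shows "\<exists>N. \<forall>x\<in>D. \<forall>v. norm (frechet_derivative F (at x) v) \<le> N * norm v"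
proof -
  have "\<exists>B. \<forall>x\<in>D. norm (frechet_derivative F (at x) b) \<le> B" for b
    by (rule compact_bound[of U]) (use assms in auto)
  then obtain B where B: "\<And>x b. x \<in> D \<Longrightarrow> norm (frechet_derivative F (at x) b) \<le> B b" by metis
  define N where "N = Max (B ` Basis)"
  have "norm (frechet_derivative F (at x) v) \<le> real DIM('a) * N * norm v" if "x \<in> D" for x v
  proof (rule norm_linear_le_basis)
    show "linear (frechet_derivative F (at x))"
      by (rule linear_frechet_derivative) (use assms that in auto)
    show "norm (frechet_derivative F (at x) b) \<le> N" if "b \<in> Basis" for b
    proof -
      have "B b \<le> N" unfolding N_def by (rule Max_ge) (use that in auto)
      then show ?thesis using B[OF \<open>x \<in> D\<close>, of b] by linarith
    qed
  qed
  then show ?thesis by blast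
qed

lemma Lipschitz_on_convex:
  fixes F :: "'a::euclidean_space \<Rightarrow> 'b::real_normed_vector"
  assumes "convex C" "\<And>x. x \<in> C \<Longrightarrow> (F has_derivative D x) (at x)"
    and "\<And>x v. x \<in> C \<Longrightarrow> norm (D x v) \<le> N * norm v" and "x \<in> C" "y \<in> C"
  shows "norm (F x - F y) \<le> N * norm (x - y)"
proof (rule differentiable_bound[OF assms(1) _ _ assms(4,5)])
  show "(F has_derivative D z) (at z within C)" if "z \<in> C" for z
    using assms(2)[OF that] by (rule has_derivative_at_withinI)
  show "onorm (D z) \<le> N" if "z \<in> C" for z
    by (rule onorm_le) (rule assms(3)[OF that])
qed

text \<open>Only the base point \<open>x\<close> is confined to \<open>D\<close>; \<open>y\<close>
  may leave it. Uniform continuity is therefore used on a closed thickening of \<open>D\<close> that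
  still lies in \<open>U\<close>.\<close>

lemma uniformly_continuous_near:
  fixes F :: "'a::euclidean_space \<Rightarrow> 'b::metric_space"
  assumes "continuous_on U F" "open U" "compact D" "D \<subseteq> U" "e > 0"
  shows "\<forall>\<^sub>F d in at_right 0. \<forall>x\<in>D. \<forall>y. norm (y - x) \<le> d \<longrightarrow> y \<in> U \<and> dist (F y) (F x) \<le> e"
proof -
  obtain r where r: "r > 0" "thicken r D \<subseteq> U"
    using compact_subset_open_imp_cball_epsilon_subset[OF assms(3,2,4)] unfolding thicken_def by metis
  have "uniformly_continuous_on (thicken r D) F"
    by (rule compact_uniformly_continuous[OF continuous_on_subset[OF assms(1) r(2)]
          compact_thicken[OF assms(3)]])
  then obtain d where d: "d > 0"
    "\<And>x y. x \<in> thicken r D \<Longrightarrow> y \<in> thicken r D \<Longrightarrow> dist y x < d \<Longrightarrow> dist (F y) (F x) < e"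
    unfolding uniformly_continuous_on_def using assms(5) by metis
  have "y \<in> U \<and> dist (F y) (F x) \<le> e"
    if "0 < s" "s < min r d" "x \<in> D" "norm (y - x) \<le> s" for s x y
  proof -
    have "y \<in> thicken r D" "x \<in> thicken r D"
      using that r thicken_base[of r D] by (auto intro: thickenI[of x])
    then show ?thesis using d(2)[of x y] that r(2) by (auto simp: dist_norm)
  qed
  then show ?thesis
    unfolding eventually_at_right_field using r(1) d(1) by (intro exI[of _ "min r d"]) auto
qed

text \<open>The mean value inequality is applied on the ball around \<open>x\<close> to
  \<open>F\<close> minus its linear part at \<open>x\<close>, whose derivative is the oscillation of
  the derivative of \<open>F\<close>. Both \<open>y\<close> and \<open>z\<close> vary, and the
  radius is the same for all \<open>x\<close> in the compact set.\<close>

lemma C1_strict_derivative: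
  fixes F :: "'a::euclidean_space \<Rightarrow> 'b::real_normed_vector"
  assumes "Ck_on (Suc 0) U F" "open U" "compact D" "D \<subseteq> U" "e > 0"
  shows "\<forall>\<^sub>F d in at_right 0. \<forall>x\<in>D. \<forall>y z. norm (y - x) \<le> d \<longrightarrow> norm (z - x) \<le> d \<longrightarrow>
    y \<in> U \<and> norm (F y - F z - frechet_derivative F (at x) (y - z)) \<le> e * norm (y - z)"
proof -
  let ?D = "\<lambda>x. frechet_derivative F (at x)"
  \<comment> \<open>The passage from basis vectors to an operator bound multiplies by
    \<open>DIM('a)\<close>.\<close>
  define e' where "e' = e / real DIM('a)"
  have e': "e' > 0" using assms(5) unfolding e'_def by simp
  have "\<forall>\<^sub>F d in at_right 0. \<forall>x\<in>D. \<forall>y. norm (y - x) \<le> d \<longrightarrow> y \<in> U \<and> dist (?D y b) (?D x b) \<le> e'" for b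
    by (rule uniformly_continuous_near) (use assms e' in auto)
  then have "\<forall>\<^sub>F d in at_right 0. \<forall>b\<in>Basis. \<forall>x\<in>D. \<forall>y. norm (y - x) \<le> d \<longrightarrow>
      y \<in> U \<and> dist (?D y b) (?D x b) \<le> e'"
    by (intro eventually_ball_finite) auto
  then show ?thesis
  proof (rule eventually_mono, intro ballI allI impI)
    fix d x y z
    assume *: "\<forall>b\<in>Basis. \<forall>x\<in>D. \<forall>y. norm (y - x) \<le> d \<longrightarrow> y \<in> U \<and> dist (?D y b) (?D x b) \<le> e'"
      and x: "x \<in> D" and yz: "norm (y - x) \<le> d" "norm (z - x) \<le> d"
    have U: "w \<in> U" if "w \<in> cball x d" for w
    proof -
      \<comment> \<open>Membership in \<open>U\<close> is stated once per basis vector, so one basis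
        vector has to be exhibited to extract it.\<close>
      obtain b :: 'a where "b \<in> Basis" using nonempty_Basis by blast
      moreover have "norm (w - x) \<le> d" using that by (simp add: dist_norm norm_minus_commute)
      ultimately show ?thesis using * x by blast
    qed
    have der: "(F has_derivative ?D w) (at w)" if "w \<in> U" for w
      using Ck_on_has_derivative[OF assms(1) that] .
    have lin: "linear (?D w)" if "w \<in> U" for w
      using der[OF that] has_derivative_linear by blast
    have xU: "x \<in> U" using x assms(4) by auto
    let ?G = "\<lambda>w. F w - ?D x w"
    have "norm (?G y - ?G z) \<le> e * norm (y - z)"
    proof (rule Lipschitz_on_convex[of "cball x d" ?G "\<lambda>w v. ?D w v - ?D x v"])
      show "(?G has_derivative (\<lambda>v. ?D w v - ?D x v)) (at w)" if "w \<in> cball x d" for w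
        by (intro has_derivative_diff der U that
            bounded_linear_imp_has_derivative has_derivative_bounded_linear[OF der[OF xU]])
      show "norm (?D w v - ?D x v) \<le> e * norm v" if w: "w \<in> cball x d" for w v
      proof -
        have "norm (?D w v - ?D x v) \<le> real DIM('a) * e' * norm v"
        proof (intro norm_linear_le_basis linear_compose_sub lin[OF U[OF w]] lin[OF xU])
          have "norm (w - x) \<le> d" using w by (simp add: dist_norm norm_minus_commute)
          then show "norm (?D w b - ?D x b) \<le> e'" if "b \<in> Basis" for b
            using * x that by (simp add: dist_norm)
        qed
        then show ?thesis unfolding e'_def by simp
      qed
    qed (use yz in \<open>auto simp: dist_norm norm_minus_commute\<close>)
    moreover have "?G y - ?G z = F y - F z - ?D x (y - z)"
      by (simp add: linear_diff[OF lin[OF xU]])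
    moreover have "y \<in> U" using U yz by (simp add: dist_norm norm_minus_commute)
    ultimately show "y \<in> U \<and> norm (F y - F z - ?D x (y - z)) \<le> e * norm (y - z)" by simp
  qed
qed

text \<open>Along the segment in direction \<open>v\<close>, the difference of \<open>F\<close> at
  the two translates has a derivative equal to \<open>h\<close> times an increment of the
  directional derivative in direction \<open>v\<close> over the vector \<open>h *\<^sub>R w\<close>.
  Strict differentiability at \<open>x\<close> compares that increment with the second
  derivative.\<close>

lemma second_difference_bound:
  fixes F :: "'a::euclidean_space \<Rightarrow> 'b::euclidean_space"
  assumes "Ck_on (Suc (Suc 0)) U F" "open U" "x \<in> U" "e > 0"
  shows "\<forall>\<^sub>F h in at_right 0. norm (F (x + h *\<^sub>R v + h *\<^sub>R w) - F (x + h *\<^sub>R v) - F (x + h *\<^sub>R w) + F x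
    - h\<^sup>2 *\<^sub>R frechet_derivative (\<lambda>y. frechet_derivative F (at y) v) (at x) w) \<le> e * h\<^sup>2"
proof -
  let ?D = "\<lambda>x. frechet_derivative F (at x)"
  let ?H = "frechet_derivative (\<lambda>y. ?D y v) (at x)"
  \<comment> \<open>The two points compared below differ by \<open>h *\<^sub>R w\<close>, so a
    relative error \<open>e'\<close> costs \<open>e' * norm w\<close>; the added 1 covers
    \<open>w = 0\<close>.\<close>
  define e' where "e' = e / (norm w + 1)"
  have e': "e' > 0" using assms(4) unfolding e'_def by (simp add: add_nonneg_pos)
  have "\<forall>\<^sub>F d in at_right 0. \<forall>x\<in>{x}. \<forall>y z. norm (y - x) \<le> d \<longrightarrow> norm (z - x) \<le> d \<longrightarrow>
      y \<in> U \<and> norm (?D y v - ?D z v - frechet_derivative (\<lambda>y. ?D y v) (at x) (y - z)) \<le> e' * norm (y - z)"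
    by (rule C1_strict_derivative) (use assms e' in auto)
  then obtain d where d: "d > 0" "\<And>y z. norm (y - x) \<le> d \<Longrightarrow> norm (z - x) \<le> d \<Longrightarrow>
      y \<in> U \<and> norm (?D y v - ?D z v - ?H (y - z)) \<le> e' * norm (y - z)"
    unfolding eventually_at_right_field by (metis field_lbound_gt_zero singletonI zero_less_one)
  have linH: "linear ?H" using assms by (intro linear_frechet_derivative) auto
  \<comment> \<open>For \<open>h\<close> below this bound the whole parallelogram spanned by
    \<open>h *\<^sub>R v\<close> and \<open>h *\<^sub>R w\<close> at \<open>x\<close> stays in the
    ball of radius \<open>d\<close>.\<close>
  define b where "b = d / (norm v + norm w + 1)"
  have b: "b > 0" using d(1) unfolding b_def by (simp add: add_nonneg_pos)
  have "norm (F (x + h *\<^sub>R v + h *\<^sub>R w) - F (x + h *\<^sub>R v) - F (x + h *\<^sub>R w) + F x - h\<^sup>2 *\<^sub>R ?H w) \<le> e * h\<^sup>2"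
    if h: "0 < h" "h < b" for h
  proof -
    have hd: "h * norm v + h * norm w \<le> d"
    proof -
      have "h * (norm v + norm w + 1) \<le> b * (norm v + norm w + 1)"
        using h by (intro mult_right_mono) auto
      also have "\<dots> = d" unfolding b_def using norm_ge_zero[of v] norm_ge_zero[of w]
        by (simp add: add_nonneg_eq_0_iff)
      finally show ?thesis using h by (simp add: algebra_simps)
    qed
    have near: "norm ((x + (s * h) *\<^sub>R v + h *\<^sub>R w) - x) \<le> d" "norm ((x + (s * h) *\<^sub>R v) - x) \<le> d"
      if "0 \<le> s" "s \<le> 1" for s
    proof -
      have "norm ((s * h) *\<^sub>R v) \<le> h * norm v" "norm (h *\<^sub>R w) = h * norm w" "0 \<le> h * norm w"
        using that h by (auto intro!: mult_right_mono simp: mult_left_le_one_le)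
      then show "norm ((x + (s * h) *\<^sub>R v + h *\<^sub>R w) - x) \<le> d" "norm ((x + (s * h) *\<^sub>R v) - x) \<le> d"
        using hd norm_triangle_ineq[of "(s * h) *\<^sub>R v" "h *\<^sub>R w"] by auto
    qed
    \<comment> \<open>\<open>\<phi> 1 - \<phi> 0\<close> is the quantity to be bounded. The term
      linear in \<open>s\<close> is subtracted beforehand, so that the derivative of
      \<open>\<phi>\<close> consists of the error alone.\<close>
    define \<phi> where "\<phi> s = F (x + (s * h) *\<^sub>R v + h *\<^sub>R w) - F (x + (s * h) *\<^sub>R v) - (s * h\<^sup>2) *\<^sub>R ?H w" for s
    define \<phi>' where "\<phi>' s r = ?D (x + (s * h) *\<^sub>R v + h *\<^sub>R w) ((r * h) *\<^sub>R v)
        - ?D (x + (s * h) *\<^sub>R v) ((r * h) *\<^sub>R v) - (r * h\<^sup>2) *\<^sub>R ?H w" for s r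
    have der: "(\<phi> has_derivative \<phi>' s) (at s)" if "0 \<le> s" "s \<le> 1" for s
    proof -
      have A: "(F has_derivative ?D y) (at y)" if "norm (y - x) \<le> d" for y
        using Ck_on_has_derivative[OF assms(1)] d(2)[OF that that] by simp
      show ?thesis
        unfolding \<phi>_def \<phi>'_def
      proof (intro has_derivative_diff)
        show "((\<lambda>s. F (x + (s * h) *\<^sub>R v + h *\<^sub>R w)) has_derivative
            (\<lambda>r. ?D (x + (s * h) *\<^sub>R v + h *\<^sub>R w) ((r * h) *\<^sub>R v))) (at s)"
          by (rule has_derivative_compose[of "\<lambda>s. x + (s * h) *\<^sub>R v + h *\<^sub>R w",
                OF _ A[OF near(1)[OF that]]]) (auto intro!: derivative_eq_intros)
        show "((\<lambda>s. F (x + (s * h) *\<^sub>R v)) has_derivative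
            (\<lambda>r. ?D (x + (s * h) *\<^sub>R v) ((r * h) *\<^sub>R v))) (at s)"
          by (rule has_derivative_compose[of "\<lambda>s. x + (s * h) *\<^sub>R v",
                OF _ A[OF near(2)[OF that]]]) (auto intro!: derivative_eq_intros)
        show "((\<lambda>s. (s * h\<^sup>2) *\<^sub>R ?H w) has_derivative (\<lambda>r. (r * h\<^sup>2) *\<^sub>R ?H w)) (at s)"
          by (auto intro!: derivative_eq_intros)
      qed
    qed
    have "\<exists>s\<in>{0<..<1::real}. norm (\<phi> 1 - \<phi> 0) \<le> norm (\<phi>' s (1 - 0))"
      using der by (intro mvt_general continuous_at_imp_continuous_on ballI)
        (auto intro: has_derivative_continuous)
    then obtain s where s: "0 < s" "s < 1" "norm (\<phi> 1 - \<phi> 0) \<le> norm (\<phi>' s 1)" by auto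
    let ?y = "x + (s * h) *\<^sub>R v + h *\<^sub>R w" and ?z = "x + (s * h) *\<^sub>R v"
    have nr: "norm (?y - x) \<le> d" "norm (?z - x) \<le> d" using near[of s] s by auto
    have linD: "linear (?D y)" if "norm (y - x) \<le> d" for y
      using Ck_on_has_derivative[OF assms(1)] d(2)[OF that that] has_derivative_linear by blast
    have "\<phi>' s 1 = h *\<^sub>R (?D ?y v - ?D ?z v - ?H (?y - ?z))"
      unfolding \<phi>'_def using linD[OF nr(1)] linD[OF nr(2)] linH
      by (simp add: linear_cmul algebra_simps power2_eq_square)
    then have "norm (\<phi>' s 1) = h * norm (?D ?y v - ?D ?z v - ?H (?y - ?z))" using h by simp
    also have "\<dots> \<le> h * (e' * norm (?y - ?z))"
      using d(2)[OF nr] h by (intro mult_left_mono) auto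
    also have "\<dots> = h\<^sup>2 * (e' * norm w)" using h by (simp add: power2_eq_square)
    also have "\<dots> \<le> h\<^sup>2 * e"
    proof (rule mult_left_mono)
      have "e' * norm w \<le> e' * (norm w + 1)" using e' by (intro mult_left_mono) auto
      also have "\<dots> = e" unfolding e'_def using norm_ge_zero[of w] by (simp add: add_nonneg_eq_0_iff)
      finally show "e' * norm w \<le> e" .
    qed simp
    finally show ?thesis using s(3) unfolding \<phi>_def by (simp add: algebra_simps)
  qed
  then show ?thesis unfolding eventually_at_right_field using b by blast
qed

text \<open>The second difference does not change when \<open>v\<close> and \<open>w\<close> are
  exchanged, so both mixed derivatives are its limit after division by
  \<open>h\<^sup>2\<close>.\<close>

lemma second_derivative_symmetric:
  fixes F :: "'a::euclidean_space \<Rightarrow> 'b::euclidean_space"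
  assumes "Ck_on (Suc (Suc 0)) U F" "open U" "x \<in> U"
  shows "frechet_derivative (\<lambda>y. frechet_derivative F (at y) v) (at x) w =
    frechet_derivative (\<lambda>y. frechet_derivative F (at y) w) (at x) v" (is "?a = ?b")
proof (rule ccontr)
  assume "?a \<noteq> ?b"
  \<comment> \<open>The two approximations bound the distance by \<open>2 * e\<close>, while it
    equals \<open>3 * e\<close>.\<close>
  define e where "e = norm (?a - ?b) / 3"
  have e: "e > 0" using \<open>?a \<noteq> ?b\<close> unfolding e_def by simp
  have "\<forall>\<^sub>F h in at_right (0::real). h > 0" by (simp add: eventually_at_right_less)
  then have "\<forall>\<^sub>F h in at_right (0::real). False"
    using second_difference_bound[OF assms e, of v w] second_difference_bound[OF assms e, of w v]
  proof eventually_elim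
    case (elim h)
    let ?d = "F (x + h *\<^sub>R v + h *\<^sub>R w) - F (x + h *\<^sub>R v) - F (x + h *\<^sub>R w) + F x"
    have d: "F (x + h *\<^sub>R w + h *\<^sub>R v) - F (x + h *\<^sub>R w) - F (x + h *\<^sub>R v) + F x = ?d"
      by (simp add: algebra_simps)
    have "norm (?d - h\<^sup>2 *\<^sub>R ?a) \<le> e * h\<^sup>2" "norm (?d - h\<^sup>2 *\<^sub>R ?b) \<le> e * h\<^sup>2"
      using elim(2) elim(3)[unfolded d] .
    then have "norm ((?d - h\<^sup>2 *\<^sub>R ?b) - (?d - h\<^sup>2 *\<^sub>R ?a)) \<le> 2 * e * h\<^sup>2"
      using norm_triangle_ineq4[of "?d - h\<^sup>2 *\<^sub>R ?b" "?d - h\<^sup>2 *\<^sub>R ?a"] by simp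
    moreover have "(?d - h\<^sup>2 *\<^sub>R ?b) - (?d - h\<^sup>2 *\<^sub>R ?a) = h\<^sup>2 *\<^sub>R (?a - ?b)"
      by (simp add: algebra_simps)
    ultimately have "h\<^sup>2 * norm (?a - ?b) \<le> 2 * e * h\<^sup>2" by simp
    then have "norm (?a - ?b) \<le> 2 * e" using elim(1) by (simp add: mult.commute)
    then show ?case using e unfolding e_def by simp
  qed
  then show False by simp
qed

section \<open>Charts and compact cells\<close>

text \<open>Membership is tested through coordinates, so \<open>D\<close> may be any set, for
  instance an open ball that leaves the range of the chart. If \<open>D\<close> lies in the range,
  the cell is the image of \<open>D\<close> under \<open>cinv c\<close>.\<close>

definition cell :: "('m, 'e) chart \<Rightarrow> 'e set \<Rightarrow> 'm set" where
  "cell c D = {p \<in> cdom c. cmap c p \<in> D}"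

definition overlap :: "('m, 'e) chart \<Rightarrow> ('m, 'e) chart \<Rightarrow> 'e set" where
  "overlap c c' = cmap c ` (cdom c \<inter> cdom c')"

definition cells_union :: "(('m, 'e) chart \<times> 'e set) set \<Rightarrow> 'm set" where
  "cells_union S = (\<Union>(c, D)\<in>S. cell c D)"

definition enlarge ::
    "real \<Rightarrow> (('m, 'e::metric_space) chart \<times> 'e set) set \<Rightarrow> (('m, 'e) chart \<times> 'e set) set" where
  "enlarge r S = (\<lambda>(c, D). (c, thicken r D)) ` S"

lemma mem_cells_union: "p \<in> cells_union S \<longleftrightarrow> (\<exists>(c, D)\<in>S. p \<in> cell c D)"
  by (auto simp: cells_union_def)

lemma mem_cell_thicken:
  fixes c :: "('m, 'e::real_normed_vector) chart"
  assumes "p \<in> cell c D" "q \<in> cdom c" "norm (cmap c q - cmap c p) \<le> r"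
  shows "q \<in> cell c (thicken r D)"
  using assms thickenI[of "cmap c p" D "cmap c q" r] by (simp add: cell_def)

locale smooth_manifold =
  fixes A :: "('m::t2_space, 'e::euclidean_space) chart set"
  assumes atlas: "smooth_atlas A"
begin

text \<open>Coordinates can be compared within a single chart only. Uniform estimates are stated for
  finite families of compact coordinate pieces; the pieces may overlap, and a chart may occur more
  than once.\<close>

definition cell_family :: "(('m, 'e) chart \<times> 'e set) set \<Rightarrow> bool" where
  "cell_family S \<longleftrightarrow> finite S \<and> (\<forall>(c, D)\<in>S. c \<in> A \<and> compact D \<and> D \<subseteq> crange c)"

lemma ex_chart: "\<exists>c\<in>A. p \<in> cdom c"
  using atlas unfolding smooth_atlas_def by auto

lemma chart_at: "chart_at A p \<in> A" "p \<in> cdom (chart_at A p)"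
  using someI_ex[of "\<lambda>c. c \<in> A \<and> p \<in> cdom c"] ex_chart[of p] unfolding chart_at_def by blast+

context
  fixes c assumes c: "c \<in> A"
begin

lemma is_chart: "is_chart c"
  using atlas c unfolding smooth_atlas_def by auto

lemma open_cdom: "open (cdom c)" and open_crange: "open (crange c)"
  and homeo: "homeomorphism (cdom c) (crange c) (cmap c) (cinv c)"
  using is_chart unfolding is_chart_def by auto

lemma continuous_cmap: "continuous_on (cdom c) (cmap c)"
  and continuous_cinv: "continuous_on (crange c) (cinv c)"
  using homeo unfolding homeomorphism_def by auto

lemma cinv_cmap: "p \<in> cdom c \<Longrightarrow> cinv c (cmap c p) = p"
  using homeo unfolding homeomorphism_def by auto

lemma cmap_cinv: "x \<in> crange c \<Longrightarrow> cmap c (cinv c x) = x"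
  using homeo unfolding homeomorphism_def by auto

lemma cinv_in: "x \<in> crange c \<Longrightarrow> cinv c x \<in> cdom c"
  using homeo unfolding homeomorphism_def by auto

lemma cmap_in: "p \<in> cdom c \<Longrightarrow> cmap c p \<in> crange c"
  unfolding crange_def by auto

lemma open_cell: "open V \<Longrightarrow> open (cell c V)"
  using continuous_open_preimage[OF continuous_cmap open_cdom, of V]
  by (simp add: cell_def vimage_def Int_def)

lemma open_cmap_image:
  assumes "open W" shows "open (cmap c ` (cdom c \<inter> W))"
proof -
  have "cmap c ` (cdom c \<inter> W) = crange c \<inter> cinv c -` W"
    using cinv_cmap cmap_cinv cinv_in cmap_in by (force simp: image_iff)
  then show ?thesis
    using continuous_open_preimage[OF continuous_cinv open_crange assms] by simp
qed

lemma cell_eq: "D \<subseteq> crange c \<Longrightarrow> cell c D = cinv c ` D"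
  using cinv_cmap cmap_cinv cinv_in by (force simp: cell_def image_iff)

lemma compact_cell: "compact D \<Longrightarrow> D \<subseteq> crange c \<Longrightarrow> compact (cell c D)"
  using compact_continuous_image[OF continuous_on_subset[OF continuous_cinv]] cell_eq by metis

end

lemma open_overlap: "c \<in> A \<Longrightarrow> c' \<in> A \<Longrightarrow> open (overlap c c')"
  unfolding overlap_def using open_cmap_image open_cdom by blast

lemma smooth_transition:
  "c \<in> A \<Longrightarrow> c' \<in> A \<Longrightarrow> smooth_on (overlap c c') (cmap c' \<circ> cinv c)"
  using atlas unfolding smooth_atlas_def overlap_def by blast

lemma overlapD:
  assumes "c \<in> A" "x \<in> overlap c c'"
  shows "x \<in> crange c" "cinv c x \<in> cdom c" "cinv c x \<in> cdom c'"
proof -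
  obtain p where "x = cmap c p" "p \<in> cdom c" "p \<in> cdom c'" using assms(2) by (auto simp: overlap_def)
  then show "x \<in> crange c" "cinv c x \<in> cdom c" "cinv c x \<in> cdom c'"
    using cinv_cmap[OF assms(1)] by (auto simp: crange_def)
qed

lemma overlapI: "p \<in> cdom c \<Longrightarrow> p \<in> cdom c' \<Longrightarrow> cmap c p \<in> overlap c c'"
  by (auto simp: overlap_def)

lemma transition_has_derivative:
  assumes "c \<in> A" "c' \<in> A" "p \<in> cdom c" "p \<in> cdom c'"
  shows "((cmap c' \<circ> cinv c) has_derivative transition_deriv c c' p) (at (cmap c p))"
  unfolding transition_deriv_def
  by (rule Ck_on_has_derivative[OF smooth_onD[OF smooth_transition[OF assms(1,2)]]
        overlapI[OF assms(3,4)]])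

lemma linear_transition_deriv:
  assumes "c \<in> A" "c' \<in> A" "p \<in> cdom c" "p \<in> cdom c'"
  shows "linear (transition_deriv c c' p)"
  using transition_has_derivative[OF assms] has_derivative_linear by blast

lemma transition_deriv_inverse:
  assumes "c \<in> A" "c' \<in> A" "p \<in> cdom c" "p \<in> cdom c'"
  shows "transition_deriv c' c p (transition_deriv c c' p v) = v"
proof -
  let ?x = "cmap c p"
  have eq: "(cmap c' \<circ> cinv c) ?x = cmap c' p" using cinv_cmap[OF assms(1,3)] by simp
  have "((\<lambda>x. (cmap c \<circ> cinv c') ((cmap c' \<circ> cinv c) x)) has_derivative
      (\<lambda>v. transition_deriv c' c p (transition_deriv c c' p v))) (at ?x)"
    using has_derivative_compose[OF transition_has_derivative[OF assms]
        transition_has_derivative[OF assms(2,1,4,3), folded eq]] .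
  moreover have "((\<lambda>x. (cmap c \<circ> cinv c') ((cmap c' \<circ> cinv c) x)) has_derivative (\<lambda>v. v)) (at ?x)"
  proof (rule has_derivative_transform_within_open[OF has_derivative_ident
        open_overlap[OF assms(1,2)] overlapI[OF assms(3,4)]])
    show "x = (cmap c \<circ> cinv c') ((cmap c' \<circ> cinv c) x)" if "x \<in> overlap c c'" for x
      using overlapD[OF assms(1) that] cinv_cmap[OF assms(2)] cmap_cinv[OF assms(1)] by simp
  qed
  ultimately show ?thesis using has_derivative_unique by metis
qed

text \<open>Closeness is assumed in \<open>c\<close> alone, and that \<open>q\<close> lies in
  \<open>cdom c'\<close> is part of the claim. The points in both cells form a compact set whose
  \<open>c\<close>-coordinates lie in the open set \<open>overlap c c'\<close>, and the transition
  map is uniformly continuous near it.\<close>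

lemma chart_change_near:
  assumes "c \<in> A" "c' \<in> A" "compact D" "D \<subseteq> crange c" "compact D'" "D' \<subseteq> crange c'" "e > 0"
  shows "\<forall>\<^sub>F d in at_right 0. \<forall>p q. p \<in> cell c D \<longrightarrow> p \<in> cell c' D' \<longrightarrow> q \<in> cdom c \<longrightarrow>
    norm (cmap c q - cmap c p) \<le> d \<longrightarrow> q \<in> cdom c' \<and> norm (cmap c' q - cmap c' p) \<le> e"
proof -
  let ?P = "cell c D \<inter> cell c' D'"
  have "compact (cmap c ` ?P)"
  proof (rule compact_continuous_image)
    show "continuous_on ?P (cmap c)"
      by (rule continuous_on_subset[OF continuous_cmap[OF assms(1)]]) (auto simp: cell_def)
    show "compact ?P" using compact_cell assms by (intro compact_Int) auto
  qed
  moreover have "cmap c ` ?P \<subseteq> overlap c c'" by (auto simp: overlap_def cell_def)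
  moreover have "continuous_on (overlap c c') (cmap c' \<circ> cinv c)"
    using smooth_onD[OF smooth_transition[OF assms(1,2)], of 0] by simp
  ultimately have "\<forall>\<^sub>F d in at_right 0. \<forall>x\<in>cmap c ` ?P. \<forall>y. norm (y - x) \<le> d \<longrightarrow>
      y \<in> overlap c c' \<and> dist ((cmap c' \<circ> cinv c) y) ((cmap c' \<circ> cinv c) x) \<le> e"
    using uniformly_continuous_near open_overlap assms by blast
  then show ?thesis
  proof (rule eventually_mono, intro allI impI)
    fix d p q
    assume *: "\<forall>x\<in>cmap c ` ?P. \<forall>y. norm (y - x) \<le> d \<longrightarrow>
      y \<in> overlap c c' \<and> dist ((cmap c' \<circ> cinv c) y) ((cmap c' \<circ> cinv c) x) \<le> e"
      and p: "p \<in> cell c D" "p \<in> cell c' D'" and q: "q \<in> cdom c" "norm (cmap c q - cmap c p) \<le> d"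
    have "cmap c q \<in> overlap c c'"
      "dist ((cmap c' \<circ> cinv c) (cmap c q)) ((cmap c' \<circ> cinv c) (cmap c p)) \<le> e"
      using * p q by auto
    moreover have "p \<in> cdom c" using p by (auto simp: cell_def)
    ultimately show "q \<in> cdom c' \<and> norm (cmap c' q - cmap c' p) \<le> e"
      using overlapD(3)[OF assms(1), of "cmap c q" c'] cinv_cmap[OF assms(1)] q by (simp add: dist_norm)
  qed
qed

lemma cell_familyD:
  "cell_family S \<Longrightarrow> (c, D) \<in> S \<Longrightarrow> c \<in> A"
  "cell_family S \<Longrightarrow> (c, D) \<in> S \<Longrightarrow> compact D"
  "cell_family S \<Longrightarrow> (c, D) \<in> S \<Longrightarrow> D \<subseteq> crange c"
  "cell_family S \<Longrightarrow> finite S"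
  unfolding cell_family_def by auto

lemma cell_family_enlarge:
  assumes "cell_family S" "\<And>c D. (c, D) \<in> S \<Longrightarrow> thicken r D \<subseteq> crange c"
  shows "cell_family (enlarge r S)"
  using assms(1) assms(2) compact_thicken[OF cell_familyD(2)[OF assms(1)]]
  unfolding cell_family_def enlarge_def by (simp add: split_beta) (metis prod.collapse)

lemma eventually_cells_in_open:
  assumes "cell_family S" "\<And>c D. (c, D) \<in> S \<Longrightarrow> open (W c) \<and> D \<subseteq> W c"
  shows "\<forall>\<^sub>F r in at_right 0. \<forall>(c, D)\<in>S. thicken r D \<subseteq> W c"
proof (rule eventually_ball_finite)
  show "finite S" using assms(1) by (simp add: cell_family_def)
  show "\<forall>s\<in>S. \<forall>\<^sub>F r in at_right 0. case s of (c, D) \<Rightarrow> thicken r D \<subseteq> W c"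
  proof
    fix s assume "s \<in> S"
    then show "\<forall>\<^sub>F r in at_right 0. case s of (c, D) \<Rightarrow> thicken r D \<subseteq> W c"
      using eventually_thicken_subset[of "snd s" "W (fst s)"] assms(2)[of "fst s" "snd s"]
        cell_familyD(2)[OF assms(1), of "fst s" "snd s"] by (simp add: split_beta)
  qed
qed

lemma eventually_cell_family_enlarge:
  assumes "cell_family S"
  shows "\<forall>\<^sub>F r in at_right 0. cell_family (enlarge r S)"
proof -
  have "\<forall>\<^sub>F r in at_right 0. \<forall>(c, D)\<in>S. thicken r D \<subseteq> crange c"
    by (rule eventually_cells_in_open[OF assms]) (use assms open_crange in \<open>auto simp: cell_family_def\<close>)
  then show ?thesis
    by eventually_elim (use assms in \<open>auto intro!: cell_family_enlarge\<close>)
qed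

lemma compact_cells_union:
  assumes "cell_family S" shows "compact (cells_union S)"
  unfolding cells_union_def using assms compact_cell by (auto simp: cell_family_def intro!: compact_UN)

text \<open>Each point gets a closed coordinate ball inside the image of \<open>W\<close>, and the
  corresponding open balls form the cover. Since the compact balls lie in an open image, the cells
  can later be thickened without leaving \<open>W\<close>.\<close>

lemma compact_cell_cover:
  assumes "compact K" "open W" "K \<subseteq> W"
  shows "\<exists>S. cell_family S \<and> K \<subseteq> cells_union S \<and> (\<forall>(c, D)\<in>S. D \<subseteq> cmap c ` (cdom c \<inter> W))"
proof -
  have "\<exists>c r. c \<in> A \<and> p \<in> cdom c \<and> r > 0 \<and> cball (cmap c p) r \<subseteq> cmap c ` (cdom c \<inter> W)" if "p \<in> K" for p
  proof -
    obtain c where c: "c \<in> A" "p \<in> cdom c" using ex_chart by blast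
    moreover have "cmap c p \<in> cmap c ` (cdom c \<inter> W)" using c that assms(3) by auto
    ultimately show ?thesis
      using open_cmap_image[OF c(1) assms(2)] unfolding open_contains_cball by meson
  qed
  then obtain c r where cr: "\<And>p. p \<in> K \<Longrightarrow> c p \<in> A \<and> p \<in> cdom (c p) \<and> r p > 0 \<and>
      cball (cmap (c p) p) (r p) \<subseteq> cmap (c p) ` (cdom (c p) \<inter> W)" by metis
  let ?U = "\<lambda>p. cell (c p) (ball (cmap (c p) p) (r p))"
  have "\<forall>p\<in>K. open (?U p)" using cr open_cell by auto
  moreover have "K \<subseteq> (\<Union>p\<in>K. ?U p)" using cr by (auto simp: cell_def)
  ultimately obtain P where P: "P \<subseteq> K" "finite P" "K \<subseteq> (\<Union>p\<in>P. ?U p)"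
    using compactE_image[OF assms(1), of K ?U thesis] by blast
  let ?S = "(\<lambda>p. (c p, cball (cmap (c p) p) (r p))) ` P"
  have "cball (cmap (c p) p) (r p) \<subseteq> crange (c p)" if "p \<in> P" for p
    using cr[of p] that P(1) unfolding crange_def by blast
  then have "cell_family ?S" using P(1,2) cr unfolding cell_family_def by auto
  moreover have "?U p \<subseteq> cells_union ?S" if "p \<in> P" for p
    using that by (auto simp: cells_union_def cell_def)
  then have "K \<subseteq> cells_union ?S" using P(3) by blast
  moreover have "\<forall>(c, D)\<in>?S. D \<subseteq> cmap c ` (cdom c \<inter> W)" using P(1) cr by auto
  ultimately show ?thesis by blast
qed

end

section \<open>Words of controls and attainable vector fields\<close>

context smooth_manifold
begin

text \<open>The equation is required on the open unit interval, so that steps with different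
  controls can be glued, and in every chart around the current point, so that no chart is attached
  to a trajectory.\<close>

definition step :: "('k::finite \<Rightarrow> ('m, 'e) vector_field) \<Rightarrow> real ^ 'k \<Rightarrow> 'm \<Rightarrow> 'm \<Rightarrow> bool" where
  "step f v p q \<longleftrightarrow> (\<exists>x::real \<Rightarrow> 'm. continuous_on {0..1} x \<and> x 0 = p \<and> x 1 = q \<and>
     (\<forall>t\<in>{0<..<1}. \<forall>c\<in>A. x t \<in> cdom c \<longrightarrow>
        ((\<lambda>s. cmap c (x s)) has_vector_derivative control_field f (\<lambda>_. v) t c (x t)) (at t)))"

text \<open>A relation and not a map, since solutions for unit time need not exist from every
  point.\<close>

primrec reach :: "('k::finite \<Rightarrow> ('m, 'e) vector_field) \<Rightarrow> (real ^ 'k) list \<Rightarrow> 'm \<Rightarrow> 'm \<Rightarrow> bool" where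
  "reach f [] p q \<longleftrightarrow> p = q"
| "reach f (v # w) p q \<longleftrightarrow> (\<exists>r. step f v p r \<and> reach f w r q)"

lemma reach_append: "reach f (w @ w') p q \<longleftrightarrow> (\<exists>r. reach f w p r \<and> reach f w' r q)"
  by (induction w arbitrary: p) auto

text \<open>The word is fixed before the point, which is what steering an ensemble means. The
  endpoint \<open>q\<close> comes before the chart: one and the same point is compared with the
  start in every chart whose cell contains the start.\<close>

definition steers ::
    "('k::finite \<Rightarrow> ('m, 'e) vector_field) \<Rightarrow> (real ^ 'k) list \<Rightarrow> (('m, 'e) chart \<times> 'e set) set \<Rightarrow>
     (('m, 'e) chart \<Rightarrow> 'm \<Rightarrow> 'm \<Rightarrow> bool) \<Rightarrow> bool" where
  "steers f w S R \<longleftrightarrow> (\<forall>p\<in>cells_union S. \<exists>q. reach f w p q \<and>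
     (\<forall>(c, D)\<in>S. p \<in> cell c D \<longrightarrow> q \<in> cdom c \<and> R c p q))"

text \<open>
  Elements of the Lie algebra need not be complete, and no flow is constructed for them. A field
  counts as attainable if words of controls reproduce its Euler steps up to \<open>o(h)\<close>, with
  the same word for all points of a compact family of cells.
\<close>

definition attainable ::
    "('k::finite \<Rightarrow> ('m, 'e) vector_field) \<Rightarrow> ('m, 'e) vector_field \<Rightarrow> bool" where
  "attainable f X \<longleftrightarrow> (\<forall>S e. cell_family S \<longrightarrow> 0 < e \<longrightarrow> (\<forall>\<^sub>F h in at_right 0. \<exists>w.
     steers f w S (\<lambda>c p q. norm (cmap c q - cmap c p - h *\<^sub>R X c p) \<le> h * e)))"

text \<open>Each step starts from a point that may have left the cells of \<open>S\<close> but not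
  their \<open>r\<close>-thickening, hence the hypotheses on \<open>enlarge r S\<close>; the budget
  in \<open>nh\<close> keeps the total displacement below \<open>r\<close>. The fields may change
  from step to step, as they do along the diffeotopy.\<close>

lemma steers_chain:
  assumes "\<And>j. j < n \<Longrightarrow>
      steers f (w j) (enlarge r S) (\<lambda>c p q. norm (cmap c q - cmap c p - h *\<^sub>R X j c p) \<le> h * e)"
    and B: "\<And>j c D p. j < n \<Longrightarrow> (c, D) \<in> S \<Longrightarrow> p \<in> cell c (thicken r D) \<Longrightarrow> norm (X j c p) \<le> B"
    and nh: "real n * h * (B + e) \<le> r" "0 \<le> h" "0 \<le> B + e" and p: "p \<in> cells_union S"
  shows "\<exists>xs. xs 0 = p \<and> reach f (concat (map w [0..<n])) p (xs n) \<and>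
    (\<forall>(c, D)\<in>S. p \<in> cell c D \<longrightarrow>
      (\<forall>j\<le>n. xs j \<in> cdom c \<and> norm (cmap c (xs j) - cmap c p) \<le> real j * h * (B + e)) \<and>
      (\<forall>j<n. norm (cmap c (xs (Suc j)) - cmap c (xs j) - h *\<^sub>R X j c (xs j)) \<le> h * e))"
proof -
  define I where "I j x \<longleftrightarrow> (\<forall>(c, D)\<in>S. p \<in> cell c D \<longrightarrow>
      x \<in> cdom c \<and> norm (cmap c x - cmap c p) \<le> real j * h * (B + e))" for j x
  define Q where "Q j x y \<longleftrightarrow> reach f (w j) x y \<and> (\<forall>(c, D)\<in>S. p \<in> cell c D \<longrightarrow>
      norm (cmap c y - cmap c x - h *\<^sub>R X j c x) \<le> h * e)" for j x y
  have small: "real j * h * (B + e) \<le> r" if "j \<le> n" for j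
  proof -
    have "real j * (h * (B + e)) \<le> real n * (h * (B + e))"
      using that nh by (intro mult_right_mono) auto
    then show ?thesis using nh by (simp add: mult.assoc)
  qed
  have next_point: "\<exists>y. I (Suc j) y \<and> Q j x y" if "j < n" "I j x" for j x
  proof -
    have mem: "x \<in> cell c (thicken r D)" if "(c, D) \<in> S" "p \<in> cell c D" for c D
      using \<open>I j x\<close> that small[of j] \<open>j < n\<close> unfolding I_def
      by (intro mem_cell_thicken[of p]) fastforce+
    obtain c0 D0 where "(c0, D0) \<in> S" "p \<in> cell c0 D0" using p by (auto simp: mem_cells_union)
    then have "x \<in> cells_union (enlarge r S)"
      using mem unfolding mem_cells_union enlarge_def by force
    then obtain y where y: "reach f (w j) x y" "\<And>c D. (c, D) \<in> enlarge r S \<Longrightarrow> x \<in> cell c D \<Longrightarrow>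
        y \<in> cdom c \<and> norm (cmap c y - cmap c x - h *\<^sub>R X j c x) \<le> h * e"
      using assms(1)[OF \<open>j < n\<close>] unfolding steers_def by blast
    have *: "y \<in> cdom c \<and> norm (cmap c y - cmap c x - h *\<^sub>R X j c x) \<le> h * e"
      if "(c, D) \<in> S" "p \<in> cell c D" for c D
    proof (rule y(2))
      show "(c, thicken r D) \<in> enlarge r S" using that(1) by (force simp: enlarge_def)
    qed (rule mem[OF that])
    have "norm (cmap c y - cmap c p) \<le> real (Suc j) * h * (B + e)"
      if "(c, D) \<in> S" "p \<in> cell c D" for c D
    proof -
      have "norm (h *\<^sub>R X j c x) \<le> h * B"
        using B[OF \<open>j < n\<close> that(1) mem[OF that]] nh(2) by (simp add: mult_left_mono)
      moreover have "cmap c y - cmap c p = (cmap c y - cmap c x - h *\<^sub>R X j c x) + h *\<^sub>R X j c x +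
          (cmap c x - cmap c p)" by simp
      moreover have "norm (cmap c x - cmap c p) \<le> real j * h * (B + e)"
        using \<open>I j x\<close> that unfolding I_def by blast
      ultimately have "norm (cmap c y - cmap c p) \<le> h * e + h * B + real j * h * (B + e)"
        using *[OF that] norm_triangle_mono by metis
      then show ?thesis by (simp add: algebra_simps)
    qed
    then show ?thesis using y(1) * unfolding I_def Q_def by blast
  qed
  have "\<exists>xs. \<forall>j. ((j \<le> n \<longrightarrow> I j (xs j)) \<and> (j = 0 \<longrightarrow> xs j = p)) \<and> (j < n \<longrightarrow> Q j (xs j) (xs (Suc j)))"
  proof -
    have "\<exists>x. (0 \<le> n \<longrightarrow> I 0 x) \<and> ((0::nat) = 0 \<longrightarrow> x = p)"
      by (auto simp: I_def cell_def)
    \<comment> \<open>Beyond \<open>n\<close> the requirements are vacuous. They are stated as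
      implications because the choice principle produces an infinite sequence.\<close>
    moreover have "\<exists>y. ((Suc j \<le> n \<longrightarrow> I (Suc j) y) \<and> (Suc j = 0 \<longrightarrow> y = p)) \<and> (j < n \<longrightarrow> Q j x y)"
      if "(j \<le> n \<longrightarrow> I j x) \<and> (j = 0 \<longrightarrow> x = p)" for j x
      using next_point[of j x] that by (cases "j < n") auto
    ultimately show ?thesis
      using dependent_nat_choice[of "\<lambda>j x. (j \<le> n \<longrightarrow> I j x) \<and> (j = 0 \<longrightarrow> x = p)"
        "\<lambda>j x y. j < n \<longrightarrow> Q j x y"] by blast
  qed
  then obtain xs where xs: "xs 0 = p" "\<And>j. j \<le> n \<Longrightarrow> I j (xs j)" "\<And>j. j < n \<Longrightarrow> Q j (xs j) (xs (Suc j))"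
    by blast
  have "reach f (concat (map w [0..<j])) p (xs j)" if "j \<le> n" for j
    using that
  proof (induction j)
    case (Suc j)
    then show ?case using xs(3)[of j] unfolding Q_def by (auto simp: reach_append)
  qed (simp add: xs(1))
  then show ?thesis using xs unfolding I_def Q_def by (intro exI[of _ xs]) fastforce
qed

end

section \<open>Expansions along Euler polygons\<close>

text \<open>One step contributes the error \<open>h * e\<close> and \<open>h\<close> times the
  deviation \<open>w\<close> of the field from its frozen value \<open>a\<close>; these
  contributions add up.\<close>

lemma euler_polygon_first_order:
  fixes y F :: "nat \<Rightarrow> 'a::real_normed_vector"
  assumes "0 \<le> h" "\<And>j. j < n \<Longrightarrow> norm (y (Suc j) - y j - h *\<^sub>R F j) \<le> h * e"
    and "\<And>j. j < n \<Longrightarrow> norm (F j - a) \<le> w" and "j \<le> n"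
  shows "norm (y j - y 0 - (real j * h) *\<^sub>R a) \<le> real j * h * (w + e)"
  using \<open>j \<le> n\<close>
proof (induction j)
  case (Suc j)
  have eq: "y (Suc j) - y 0 - (real (Suc j) * h) *\<^sub>R a =
      (y j - y 0 - (real j * h) *\<^sub>R a) + (y (Suc j) - y j - h *\<^sub>R F j) + h *\<^sub>R (F j - a)"
    by (simp add: algebra_simps)
  have b: "norm (h *\<^sub>R (F j - a)) \<le> h * w"
    using assms(1) assms(3)[of j] Suc.prems by (simp add: mult_left_mono)
  have "norm (y (Suc j) - y j - h *\<^sub>R F j) \<le> h * e" using assms(2) Suc.prems by simp
  from norm_triangle_mono[OF norm_triangle_mono[OF Suc.IH this] b]
  have "norm (y (Suc j) - y 0 - (real (Suc j) * h) *\<^sub>R a) \<le> real j * h * (w + e) + h * e + h * w"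
    unfolding eq using Suc.prems by simp
  then show ?case by (simp add: algebra_simps)
qed simp

text \<open>A polygon evaluates the field at the left ends of the time intervals, so its second
  order term is the sum of \<open>h * (real i * h)\<close> over \<open>i < j\<close>, which is the
  coefficient in the statement. Its defect against half the square of \<open>real j * h\<close>
  vanishes as the substeps shrink.\<close>

lemma euler_polygon_second_order:
  fixes y F :: "nat \<Rightarrow> 'a::real_normed_vector"
  assumes "0 \<le> h" "linear L" "\<And>v. norm (L v) \<le> N * norm v"
    and "\<And>j. j < n \<Longrightarrow> norm (y (Suc j) - y j - h *\<^sub>R F j) \<le> h * e"
    and "\<And>j. j < n \<Longrightarrow> norm (F j - a - L (y j - y 0)) \<le> w"
    and "\<And>j. j < n \<Longrightarrow> norm (y j - y 0 - (real j * h) *\<^sub>R a) \<le> w'"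
    and "0 \<le> N" and "j \<le> n"
  shows "norm (y j - y 0 - (real j * h) *\<^sub>R a - (((real j * h)\<^sup>2 - real j * h\<^sup>2) / 2) *\<^sub>R L a)
    \<le> real j * h * (w + N * w' + e)"
  using \<open>j \<le> n\<close>
proof (induction j)
  case (Suc j)
  have coeff: "((real (Suc j) * h)\<^sup>2 - real (Suc j) * h\<^sup>2) / 2 = ((real j * h)\<^sup>2 - real j * h\<^sup>2) / 2 + h * (real j * h)"
    by (simp add: power2_eq_square algebra_simps add_divide_distrib diff_divide_distrib)
  have eq: "y (Suc j) - y 0 - (real (Suc j) * h) *\<^sub>R a - (((real (Suc j) * h)\<^sup>2 - real (Suc j) * h\<^sup>2) / 2) *\<^sub>R L a =
      (y j - y 0 - (real j * h) *\<^sub>R a - (((real j * h)\<^sup>2 - real j * h\<^sup>2) / 2) *\<^sub>R L a)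
      + (y (Suc j) - y j - h *\<^sub>R F j) + h *\<^sub>R (F j - a - L (y j - y 0))
      + h *\<^sub>R L (y j - y 0 - (real j * h) *\<^sub>R a)"
    unfolding coeff
    by (simp only: linear_diff[OF assms(2)] linear_cmul[OF assms(2)]) (simp add: algebra_simps)
  have b: "norm (h *\<^sub>R (F j - a - L (y j - y 0))) \<le> h * w"
    using assms(1) assms(5)[of j] Suc.prems by (simp add: mult_left_mono)
  have c: "norm (h *\<^sub>R L (y j - y 0 - (real j * h) *\<^sub>R a)) \<le> h * (N * w')"
  proof -
    have "norm (L (y j - y 0 - (real j * h) *\<^sub>R a)) \<le> N * w'"
      using assms(3)[of "y j - y 0 - (real j * h) *\<^sub>R a"] assms(6)[of j] Suc.prems
        mult_left_mono[OF _ \<open>0 \<le> N\<close>, of "norm (y j - y 0 - (real j * h) *\<^sub>R a)" w'] by linarith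
    then show ?thesis using assms(1) by (simp add: mult_left_mono)
  qed
  have "norm (y (Suc j) - y j - h *\<^sub>R F j) \<le> h * e" using assms(4) Suc.prems by simp
  from norm_triangle_mono[OF norm_triangle_mono[OF norm_triangle_mono[OF Suc.IH this] b] c]
  have "norm (y (Suc j) - y 0 - (real (Suc j) * h) *\<^sub>R a
      - (((real (Suc j) * h)\<^sup>2 - real (Suc j) * h\<^sup>2) / 2) *\<^sub>R L a)
    \<le> real j * h * (w + N * w' + e) + h * e + h * w + h * (N * w')"
    unfolding eq using Suc.prems by simp
  then show ?case by (simp add: algebra_simps)
qed simp

text \<open>Turns a statement about all small steps into an exact subdivision of a prescribed length
  \<open>s\<close>.\<close>

lemma eventually_at_right_0_quotient:
  assumes "\<forall>\<^sub>F h in at_right (0::real). P h" "0 < s"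
  shows "\<exists>n>0. P (s / real n)"
proof -
  obtain b where b: "b > 0" "\<And>y. 0 < y \<Longrightarrow> y < b \<Longrightarrow> P y"
    using assms(1) unfolding eventually_at_right_field by blast
  obtain n where n: "s / b < real n" using reals_Archimedean2 by blast
  then have "n > 0" using assms(2) b(1) by (intro gr0I) (auto simp: field_simps)
  moreover have "s / real n < b" using n b(1) \<open>n > 0\<close> by (simp add: field_simps)
  ultimately show ?thesis using b(2) assms(2) by (metis divide_pos_pos of_nat_0_less_iff)
qed

section \<open>Vector fields on compact cells\<close>

context smooth_manifold
begin

text \<open>This predicate and the next two concern coordinate representations and contain no
  transformation law. Closure under brackets is then a matter of calculus; the transformation law
  for elements of the Lie algebra is derived later, from attainability.\<close>

definition C0_field :: "('m, 'e) vector_field \<Rightarrow> bool" where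
  "C0_field X \<longleftrightarrow> (\<forall>c\<in>A. continuous_on (crange c) (\<lambda>x. X c (cinv c x)))"

definition C1_field :: "('m, 'e) vector_field \<Rightarrow> bool" where
  "C1_field X \<longleftrightarrow> (\<forall>c\<in>A. Ck_on (Suc 0) (crange c) (\<lambda>x. X c (cinv c x)))"

definition smooth_field :: "('m, 'e) vector_field \<Rightarrow> bool" where
  "smooth_field X \<longleftrightarrow> (\<forall>c\<in>A. smooth_on (crange c) (\<lambda>x. X c (cinv c x)))"

lemma chart_deriv_eq:
  "chart_deriv c F p v = frechet_derivative (\<lambda>x. F (cinv c x)) (at (cmap c p)) v"
  by (simp add: chart_deriv_def o_def)

lemma C1_field_C0: "C1_field X \<Longrightarrow> C0_field X"
  unfolding C1_field_def C0_field_def by (metis Ck_on.simps(1) Ck_on_SucD)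

lemma smooth_field_C1: "smooth_field X \<Longrightarrow> C1_field X"
  unfolding C1_field_def smooth_field_def using smooth_onD by blast

text \<open>The coordinate derivative of \<open>X\<close> along \<open>Z\<close>, which depends on
  the chart; the antisymmetric combination in the bracket is invariant.
  \<open>field_deriv X X\<close> is the acceleration of the integral curves of \<open>X\<close> in
  coordinates.\<close>

definition field_deriv :: "('m, 'e) vector_field \<Rightarrow> ('m, 'e) vector_field \<Rightarrow> ('m, 'e) vector_field" where
  "field_deriv X Z c p = chart_deriv c (X c) p (Z c p)"

lemma smooth_field_deriv:
  assumes "smooth_field X" "smooth_field Z" shows "smooth_field (field_deriv X Z)"
  unfolding smooth_field_def
proof
  fix c assume c: "c \<in> A"
  have "smooth_on (crange c) (\<lambda>x. frechet_derivative (\<lambda>x. X c (cinv c x)) (at x) (Z c (cinv c x)))"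
    using assms c open_crange[OF c] by (intro smooth_on_directional_derivative) (auto simp: smooth_field_def)
  moreover have "field_deriv X Z c (cinv c x) = frechet_derivative (\<lambda>x. X c (cinv c x)) (at x) (Z c (cinv c x))"
    if "x \<in> crange c" for x
    using cmap_cinv[OF c that] by (simp add: field_deriv_def chart_deriv_eq)
  ultimately show "smooth_on (crange c) (\<lambda>x. field_deriv X Z c (cinv c x))"
    by (subst smooth_on_cong[OF open_crange[OF c]])
qed

lemma lie_bracket_eq: "lie_bracket X Z = (\<lambda>c p. field_deriv Z X c p + (-1) *\<^sub>R field_deriv X Z c p)"
  by (simp add: lie_bracket_def field_deriv_def fun_eq_iff)

lemma smooth_field_add:
  assumes "smooth_field X" "smooth_field Z" shows "smooth_field (\<lambda>c p. X c p + Z c p)"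
  using assms open_crange unfolding smooth_field_def by (auto intro!: smooth_on_add)

lemma smooth_field_cmul:
  assumes "smooth_field X" shows "smooth_field (\<lambda>c p. r *\<^sub>R X c p)"
  using assms open_crange unfolding smooth_field_def by (auto intro!: smooth_on_cmul)

lemma smooth_lie_algebra:
  assumes "\<And>j. smooth_field (f j)" "X \<in> lie_algebra f" shows "smooth_field X"
  using assms(2)
proof induction
  case (bracket X Z)
  then show ?case
    unfolding lie_bracket_eq by (intro smooth_field_add smooth_field_cmul smooth_field_deriv)
qed (rule assms(1) smooth_field_add smooth_field_cmul; assumption?)+

section \<open>Coordinate bounds and moduli of continuity of fields, uniform over cells\<close>

lemma C1_field_has_derivative:
  assumes "C1_field X" "c \<in> A" "p \<in> cdom c"
  shows "((\<lambda>x. X c (cinv c x)) has_derivative chart_deriv c (X c) p) (at (cmap c p))"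
  using Ck_on_has_derivative[of 0 "crange c" "\<lambda>x. X c (cinv c x)" "cmap c p"] assms cmap_in[OF assms(2,3)]
  unfolding C1_field_def chart_deriv_eq by simp

lemma linear_chart_deriv:
  assumes "C1_field X" "c \<in> A" "p \<in> cdom c" shows "linear (chart_deriv c (X c) p)"
  using C1_field_has_derivative[OF assms] has_derivative_linear by blast

lemma chart_deriv_cmul:
  assumes "C1_field X" "c \<in> A" "p \<in> cdom c"
  shows "chart_deriv c (\<lambda>p. r *\<^sub>R X c p) p v = r *\<^sub>R chart_deriv c (X c) p v"
proof -
  have "((\<lambda>x. r *\<^sub>R X c (cinv c x)) has_derivative (\<lambda>v. r *\<^sub>R chart_deriv c (X c) p v)) (at (cmap c p))"
    by (rule has_derivative_scaleR_right[OF C1_field_has_derivative[OF assms]])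
  from frechet_derivative_at[OF this] show ?thesis
    by (simp add: chart_deriv_eq fun_eq_iff)
qed

text \<open>The filter is arbitrary: bounds are found along \<open>at_top\<close>, moduli along
  \<open>at_right 0\<close>. Eventual statements can be conjoined, so one constant serves several
  fields and all cells.\<close>

lemma eventually_cells:
  assumes "cell_family S"
    and "\<And>c D. (c, D) \<in> S \<Longrightarrow> c \<in> A \<Longrightarrow> compact D \<Longrightarrow> D \<subseteq> crange c \<Longrightarrow> open (crange c) \<Longrightarrow>
      \<forall>\<^sub>F d in F. \<forall>x\<in>D. P c d x"
  shows "\<forall>\<^sub>F d in F. \<forall>(c, D)\<in>S. \<forall>p\<in>cell c D. P c d (cmap c p)"
proof -
  have "\<forall>\<^sub>F d in F. \<forall>s\<in>S. \<forall>p\<in>cell (fst s) (snd s). P (fst s) d (cmap (fst s) p)"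
  proof (rule eventually_ball_finite)
    show "finite S" using assms(1) by (simp add: cell_family_def)
    show "\<forall>s\<in>S. \<forall>\<^sub>F d in F. \<forall>p\<in>cell (fst s) (snd s). P (fst s) d (cmap (fst s) p)"
    proof
      fix s assume s: "s \<in> S"
      then have "\<forall>\<^sub>F d in F. \<forall>x\<in>snd s. P (fst s) d x"
        using assms(2)[of "fst s" "snd s"] cell_familyD(1-3)[OF assms(1), of "fst s" "snd s"] open_crange by auto
      then show "\<forall>\<^sub>F d in F. \<forall>p\<in>cell (fst s) (snd s). P (fst s) d (cmap (fst s) p)"
        by eventually_elim (auto simp: cell_def)
    qed
  qed
  then show ?thesis by eventually_elim auto
qed

lemma field_bound:
  assumes "C0_field X" "cell_family S"
  shows "\<forall>\<^sub>F B in at_top. \<forall>(c, D)\<in>S. \<forall>p\<in>cell c D. norm (X c p) \<le> B"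
proof -
  have "\<forall>\<^sub>F B in at_top. \<forall>(c, D)\<in>S. \<forall>p\<in>cell c D. norm (X c (cinv c (cmap c p))) \<le> B"
  proof (rule eventually_cells[OF assms(2)])
    fix c D assume c: "c \<in> A" "compact D" "D \<subseteq> crange c"
    then obtain B where "\<forall>x\<in>D. norm (X c (cinv c x)) \<le> B"
      using compact_bound[of "crange c" "\<lambda>x. X c (cinv c x)" D] assms(1) unfolding C0_field_def by auto
    show "\<forall>\<^sub>F B in at_top. \<forall>x\<in>D. norm (X c (cinv c x)) \<le> B"
      using eventually_ge_at_top[of B]
    proof eventually_elim
      case (elim C)
      then show ?case using \<open>\<forall>x\<in>D. norm (X c (cinv c x)) \<le> B\<close> by (meson order_trans)
    qed
  qed
  then show ?thesis
  proof eventually_elim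
    case (elim B)
    have "norm (X c p) \<le> B" if "(c, D) \<in> S" "p \<in> cell c D" for c D p
    proof -
      have "norm (X c (cinv c (cmap c p))) \<le> B" using elim that by blast
      then show ?thesis using cinv_cmap[OF cell_familyD(1)[OF assms(2) that(1)]] that by (simp add: cell_def)
    qed
    then show ?case by blast
  qed
qed

lemma field_deriv_bound:
  assumes "C1_field X" "cell_family S"
  shows "\<forall>\<^sub>F N in at_top. \<forall>(c, D)\<in>S. \<forall>p\<in>cell c D. \<forall>v. norm (chart_deriv c (X c) p v) \<le> N * norm v"
  unfolding chart_deriv_eq
proof (rule eventually_cells[OF assms(2)])
  fix c D assume c: "c \<in> A" "compact D" "D \<subseteq> crange c"
  then obtain B where B: "\<forall>x\<in>D. \<forall>v. norm (frechet_derivative (\<lambda>x. X c (cinv c x)) (at x) v) \<le> B * norm v"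
    using C1_derivative_bound[of "crange c" "\<lambda>x. X c (cinv c x)" D] assms(1) unfolding C1_field_def by auto
  show "\<forall>\<^sub>F N in at_top. \<forall>x\<in>D. \<forall>v. norm (frechet_derivative (\<lambda>x. X c (cinv c x)) (at x) v) \<le> N * norm v"
    using eventually_ge_at_top[of B]
  proof eventually_elim
    case (elim N)
    then show ?case using B order_trans[OF _ mult_right_mono[OF elim norm_ge_zero]] by blast
  qed
qed

lemma field_uniformly_continuous:
  assumes "C0_field X" "cell_family S" "e > 0"
  shows "\<forall>\<^sub>F d in at_right 0. \<forall>(c, D)\<in>S. \<forall>p\<in>cell c D. \<forall>q\<in>cdom c.
    norm (cmap c q - cmap c p) \<le> d \<longrightarrow> norm (X c q - X c p) \<le> e"
proof -
  have "\<forall>\<^sub>F d in at_right 0. \<forall>(c, D)\<in>S. \<forall>p\<in>cell c D. \<forall>y. norm (y - cmap c p) \<le> d \<longrightarrow>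
      y \<in> crange c \<and> dist (X c (cinv c y)) (X c (cinv c (cmap c p))) \<le> e"
    by (rule eventually_cells[OF assms(2)], rule uniformly_continuous_near)
      (use assms in \<open>auto simp: C0_field_def\<close>)
  then show ?thesis
  proof eventually_elim
    case (elim d)
    have "norm (X c q - X c p) \<le> e"
      if "(c, D) \<in> S" "p \<in> cell c D" "q \<in> cdom c" "norm (cmap c q - cmap c p) \<le> d" for c D p q
    proof -
      have "dist (X c (cinv c (cmap c q))) (X c (cinv c (cmap c p))) \<le> e" using elim that by blast
      then show ?thesis
        using cell_familyD(1)[OF assms(2) that(1)] that by (simp add: cell_def cinv_cmap dist_norm)
    qed
    then show ?case by blast
  qed
qed

lemma field_strict_derivative:
  assumes "C1_field X" "cell_family S" "e > 0"
  shows "\<forall>\<^sub>F d in at_right 0. \<forall>(c, D)\<in>S. \<forall>p\<in>cell c D. \<forall>q\<in>cdom c. norm (cmap c q - cmap c p) \<le> d \<longrightarrow>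
    norm (X c q - X c p - chart_deriv c (X c) p (cmap c q - cmap c p)) \<le> e * norm (cmap c q - cmap c p)"
proof -
  have "\<forall>\<^sub>F d in at_right 0. \<forall>(c, D)\<in>S. \<forall>p\<in>cell c D. \<forall>y z. norm (y - cmap c p) \<le> d \<longrightarrow>
      norm (z - cmap c p) \<le> d \<longrightarrow> y \<in> crange c \<and>
      norm (X c (cinv c y) - X c (cinv c z) - frechet_derivative (\<lambda>x. X c (cinv c x)) (at (cmap c p)) (y - z))
        \<le> e * norm (y - z)"
    by (rule eventually_cells[OF assms(2)], rule C1_strict_derivative)
      (use assms in \<open>auto simp: C1_field_def\<close>)
  then show ?thesis
  proof eventually_elim
    case (elim d)
    have "norm (X c q - X c p - chart_deriv c (X c) p (cmap c q - cmap c p)) \<le> e * norm (cmap c q - cmap c p)"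
      if cD: "(c, D) \<in> S" "p \<in> cell c D" "q \<in> cdom c" "norm (cmap c q - cmap c p) \<le> d" for c D p q
    proof -
      have "norm (cmap c p - cmap c p) \<le> d" using order_trans[OF norm_ge_zero cD(4)] by simp
      then have "norm (X c (cinv c (cmap c q)) - X c (cinv c (cmap c p))
          - frechet_derivative (\<lambda>x. X c (cinv c x)) (at (cmap c p)) (cmap c q - cmap c p))
        \<le> e * norm (cmap c q - cmap c p)"
        using elim cD by blast
      then show ?thesis
        using cell_familyD(1)[OF assms(2) cD(1)] cD by (simp add: cell_def cinv_cmap chart_deriv_eq)
    qed
    then show ?case by blast
  qed
qed

section \<open>Monotonicity and composition of steering relations\<close>

lemma steers_mono:
  assumes "steers f w S R"
    and "\<And>c D p q. (c, D) \<in> S \<Longrightarrow> p \<in> cell c D \<Longrightarrow> q \<in> cdom c \<Longrightarrow> R c p q \<Longrightarrow> R' c p q"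
  shows "steers f w S R'"
  unfolding steers_def
proof
  fix p assume "p \<in> cells_union S"
  then obtain q where "reach f w p q" "\<And>c D. (c, D) \<in> S \<Longrightarrow> p \<in> cell c D \<Longrightarrow> q \<in> cdom c \<and> R c p q"
    using assms(1) unfolding steers_def by blast
  then show "\<exists>q. reach f w p q \<and> (\<forall>(c, D)\<in>S. p \<in> cell c D \<longrightarrow> q \<in> cdom c \<and> R' c p q)"
    using assms(2) by blast
qed

text \<open>The second word starts from the intermediate point, which is known only to lie within
  \<open>r\<close> of the start; therefore it has to steer the enlarged family.\<close>

lemma steers_append:
  assumes "steers f w S R" "steers f w' (enlarge r S) R'"
    and "\<And>c D p q. (c, D) \<in> S \<Longrightarrow> p \<in> cell c D \<Longrightarrow> q \<in> cdom c \<Longrightarrow> R c p q \<Longrightarrow>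
      norm (cmap c q - cmap c p) \<le> r"
  shows "steers f (w @ w') S (\<lambda>c p q. \<exists>m\<in>cdom c. R c p m \<and> R' c m q)"
  unfolding steers_def
proof
  fix p assume p: "p \<in> cells_union S"
  then obtain m where m: "reach f w p m"
    "\<And>c D. (c, D) \<in> S \<Longrightarrow> p \<in> cell c D \<Longrightarrow> m \<in> cdom c \<and> R c p m"
    using assms(1) unfolding steers_def by blast
  have mem: "m \<in> cell c (thicken r D)" if "(c, D) \<in> S" "p \<in> cell c D" for c D
    using mem_cell_thicken assms(3) m(2) that by meson
  have enl: "(c, thicken r D) \<in> enlarge r S" if "(c, D) \<in> S" for c D
    using that by (force simp: enlarge_def)
  have "m \<in> cells_union (enlarge r S)"
    using p mem enl unfolding mem_cells_union by blast
  then obtain q where q: "reach f w' m q"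
    "\<And>c D. (c, D) \<in> enlarge r S \<Longrightarrow> m \<in> cell c D \<Longrightarrow> q \<in> cdom c \<and> R' c m q"
    using assms(2) unfolding steers_def by blast
  have "q \<in> cdom c \<and> (\<exists>m\<in>cdom c. R c p m \<and> R' c m q)" if "(c, D) \<in> S" "p \<in> cell c D" for c D
    using q(2)[OF enl mem] m(2) that by blast
  then show "\<exists>q. reach f (w @ w') p q \<and>
      (\<forall>(c, D)\<in>S. p \<in> cell c D \<longrightarrow> q \<in> cdom c \<and> (\<exists>m\<in>cdom c. R c p m \<and> R' c m q))"
    using m(1) q(1) unfolding reach_append by blast
qed

section \<open>Iterating attainable steps\<close>

text \<open>The length \<open>s\<close> is given and the substep \<open>s / real n\<close> is chosen
  after it, so small that attainability applies with accuracy \<open>e\<close>. The predicate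
  \<open>P\<close> lets the user of the lemma impose one more smallness condition on the same
  substep.\<close>

lemma attainable_iterate:
  assumes "attainable f X" "cell_family (enlarge r S)"
    and B: "\<forall>(c, D)\<in>S. \<forall>p\<in>cell c (thicken r D). norm (X c p) \<le> B" and "0 \<le> B"
    and s: "0 < s" "s * (B + 1) \<le> r" and e: "0 < e" "e \<le> 1"
    and P: "\<forall>\<^sub>F h in at_right 0. P h"
  shows "\<exists>n w. n > 0 \<and> P (s / real n) \<and> (\<forall>p\<in>cells_union S. \<exists>xs. xs 0 = p \<and> reach f w p (xs n) \<and>
    (\<forall>(c, D)\<in>S. p \<in> cell c D \<longrightarrow>
      (\<forall>j\<le>n. xs j \<in> cdom c \<and> norm (cmap c (xs j) - cmap c p) \<le> s * (B + 1)) \<and>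
      (\<forall>j<n. norm (cmap c (xs (Suc j)) - cmap c (xs j) - (s / real n) *\<^sub>R X c (xs j)) \<le> s / real n * e)))"
proof -
  have ev: "\<forall>\<^sub>F h in at_right 0. P h \<and> (\<exists>w. steers f w (enlarge r S)
      (\<lambda>c p q. norm (cmap c q - cmap c p - h *\<^sub>R X c p) \<le> h * e))"
    using assms(1,2) e(1) P unfolding attainable_def by (simp add: eventually_conj)
  then obtain n w where n: "n > 0" "P (s / real n)" and w: "steers f w (enlarge r S)
      (\<lambda>c p q. norm (cmap c q - cmap c p - (s / real n) *\<^sub>R X c p) \<le> s / real n * e)"
    using eventually_at_right_0_quotient[OF ev s(1)] by auto
  let ?h = "s / real n"
  have nh: "real n * ?h = s" using n by simp
  have sBe: "s * (B + e) \<le> s * (B + 1)" using s(1) e by simp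
  have "\<exists>xs. xs 0 = p \<and> reach f (concat (map (\<lambda>_. w) [0..<n])) p (xs n) \<and>
    (\<forall>(c, D)\<in>S. p \<in> cell c D \<longrightarrow>
      (\<forall>j\<le>n. xs j \<in> cdom c \<and> norm (cmap c (xs j) - cmap c p) \<le> s * (B + 1)) \<and>
      (\<forall>j<n. norm (cmap c (xs (Suc j)) - cmap c (xs j) - ?h *\<^sub>R X c (xs j)) \<le> ?h * e))"
    if p: "p \<in> cells_union S" for p
  proof -
    have "\<exists>xs. xs 0 = p \<and> reach f (concat (map (\<lambda>_. w) [0..<n])) p (xs n) \<and>
      (\<forall>(c, D)\<in>S. p \<in> cell c D \<longrightarrow>
        (\<forall>j\<le>n. xs j \<in> cdom c \<and> norm (cmap c (xs j) - cmap c p) \<le> real j * ?h * (B + e)) \<and>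
        (\<forall>j<n. norm (cmap c (xs (Suc j)) - cmap c (xs j) - ?h *\<^sub>R X c (xs j)) \<le> ?h * e))" (is "\<exists>xs. ?Q xs")
    proof (rule steers_chain[where X = "\<lambda>_. X" and r = r and B = B, OF w _ _ _ _ p])
      show "norm (X c q) \<le> B" if "(c, D) \<in> S" "q \<in> cell c (thicken r D)" for c D q
        using B that by blast
      show "real n * ?h * (B + e) \<le> r" unfolding nh using sBe s(2) by linarith
    qed (use s e \<open>0 \<le> B\<close> in auto)
    then obtain xs where xs: "?Q xs" by blast
    have "real j * ?h * (B + e) \<le> s * (B + 1)" if "j \<le> n" for j
    proof -
      have "real j * ?h \<le> real n * ?h" using that s(1) by (intro mult_right_mono) auto
      then have "real j * ?h * (B + e) \<le> s * (B + e)"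
        unfolding nh using \<open>0 \<le> B\<close> e by (intro mult_right_mono) auto
      then show ?thesis using sBe by linarith
    qed
    moreover have "norm (cmap c (xs j) - cmap c p) \<le> real j * ?h * (B + e)"
      if "(c, D) \<in> S" "p \<in> cell c D" "j \<le> n" for c D j
      using xs that by blast
    ultimately have "norm (cmap c (xs j) - cmap c p) \<le> s * (B + 1)"
      if "(c, D) \<in> S" "p \<in> cell c D" "j \<le> n" for c D j
      using that by (meson order_trans)
    then show ?thesis using xs by (intro exI[of _ xs]) blast
  qed
  then show ?thesis using n by blast
qed

text \<open>Attainability gives no control of the step length below which it holds. Here
  \<open>s\<close> is restricted only by \<open>s * (B + 1) \<le> r\<close>: the substeps absorb the
  dependence on \<open>X\<close>, and what remains is the variation of \<open>X\<close> over the
  distance \<open>s * (B + 1)\<close>, bounded through \<open>L\<close>. This is the uniformity for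
  which the C1 bound in the approximating condition is used.\<close>

lemma attainable_uniform_step:
  assumes "attainable f X" "cell_family (enlarge r S)"
    and B: "\<forall>(c, D)\<in>S. \<forall>p\<in>cell c (thicken r D). norm (X c p) \<le> B" and "0 \<le> B"
    and L: "\<forall>(c, D)\<in>S. \<forall>p\<in>cell c D. \<forall>q\<in>cdom c. norm (cmap c q - cmap c p) \<le> r \<longrightarrow>
      norm (X c q - X c p) \<le> L * norm (cmap c q - cmap c p)" and "0 \<le> L"
    and s: "0 < s" "s * (B + 1) \<le> r" and e: "0 < e"
  shows "\<exists>w. steers f w S (\<lambda>c p q. norm (cmap c q - cmap c p - s *\<^sub>R X c p) \<le> s * (L * (s * (B + 1)) + e))"
proof -
  \<comment> \<open>\<open>attainable_iterate\<close> asks for an accuracy of at most 1, so that the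
    displacement stays below \<open>s * (B + 1)\<close>.\<close>
  let ?e = "min 1 e"
  have e: "0 < ?e" "?e \<le> 1" "?e \<le> e" using e by auto
  obtain n w where n: "n > 0" and w: "\<forall>p\<in>cells_union S. \<exists>xs. xs 0 = p \<and> reach f w p (xs n) \<and>
    (\<forall>(c, D)\<in>S. p \<in> cell c D \<longrightarrow>
      (\<forall>j\<le>n. xs j \<in> cdom c \<and> norm (cmap c (xs j) - cmap c p) \<le> s * (B + 1)) \<and>
      (\<forall>j<n. norm (cmap c (xs (Suc j)) - cmap c (xs j) - (s / real n) *\<^sub>R X c (xs j)) \<le> s / real n * ?e))"
    using attainable_iterate[OF assms(1,2) B \<open>0 \<le> B\<close> s e(1,2) eventually_at_right_less]
    by (elim exE conjE) (rule that)
  have nh: "real n * (s / real n) = s" using n by simp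
  have "steers f w S (\<lambda>c p q. norm (cmap c q - cmap c p - s *\<^sub>R X c p) \<le> s * (L * (s * (B + 1)) + e))"
    unfolding steers_def
  proof
    fix p assume p: "p \<in> cells_union S"
    obtain xs where xs: "xs 0 = p" "reach f w p (xs n)" and xs': "\<forall>(c, D)\<in>S. p \<in> cell c D \<longrightarrow>
      (\<forall>j\<le>n. xs j \<in> cdom c \<and> norm (cmap c (xs j) - cmap c p) \<le> s * (B + 1)) \<and>
      (\<forall>j<n. norm (cmap c (xs (Suc j)) - cmap c (xs j) - (s / real n) *\<^sub>R X c (xs j)) \<le> s / real n * ?e)"
      using bspec[OF w p] by (elim exE conjE) (rule that)
    have dom: "xs n \<in> cdom c" if "(c, D) \<in> S" "p \<in> cell c D" for c D
      using xs' that by blast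
    have "norm (cmap c (xs n) - cmap c p - s *\<^sub>R X c p) \<le> s * (L * (s * (B + 1)) + e)"
      if cD: "(c, D) \<in> S" "p \<in> cell c D" for c D
    proof -
      have near: "\<forall>j\<le>n. xs j \<in> cdom c \<and> norm (cmap c (xs j) - cmap c p) \<le> s * (B + 1)"
        and euler: "\<forall>j<n. norm (cmap c (xs (Suc j)) - cmap c (xs j) - (s / real n) *\<^sub>R X c (xs j)) \<le> s / real n * ?e"
        using xs' cD by blast+
      have "norm (X c (xs j) - X c p) \<le> L * (s * (B + 1))" if "j < n" for j
      proof -
        have *: "norm (cmap c (xs j) - cmap c p) \<le> s * (B + 1)" "xs j \<in> cdom c" using near that by auto
        moreover have "norm (cmap c (xs j) - cmap c p) \<le> r" using * s(2) by linarith
        ultimately have "norm (X c (xs j) - X c p) \<le> L * norm (cmap c (xs j) - cmap c p)"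
          using L cD by blast
        then show ?thesis using *(1) \<open>0 \<le> L\<close> by (meson mult_left_mono order_trans)
      qed
      then have "norm (cmap c (xs n) - cmap c (xs 0) - (real n * (s / real n)) *\<^sub>R X c p)
          \<le> real n * (s / real n) * (L * (s * (B + 1)) + ?e)"
        by (intro euler_polygon_first_order[of _ n "\<lambda>j. cmap c (xs j)" "\<lambda>j. X c (xs j)"])
          (use s euler in auto)
      then show ?thesis
        unfolding nh xs(1) using s(1) e(3) by (elim order_trans) (intro mult_left_mono; simp)
    qed
    then show "\<exists>q. reach f w p q \<and> (\<forall>(c, D)\<in>S. p \<in> cell c D \<longrightarrow>
        q \<in> cdom c \<and> norm (cmap c q - cmap c p - s *\<^sub>R X c p) \<le> s * (L * (s * (B + 1)) + e))"
      using xs(2) dom by blast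
  qed
  then show ?thesis by blast
qed

end

section \<open>Attainable fields form a Lie algebra\<close>

lemma ex_small_positive: "\<forall>\<^sub>F r in at_right (0::real). P r \<Longrightarrow> \<exists>r>0. P r"
  unfolding eventually_at_right_field using dense by blast

lemma eventually_small_mult:
  assumes "0 < r" shows "\<forall>\<^sub>F h in at_right (0::real). h * C \<le> r"
proof -
  have "h * C \<le> r" if "0 < h" "h < r / (\<bar>C\<bar> + 1)" for h
  proof -
    have "h * C \<le> h * (\<bar>C\<bar> + 1)" using that by (intro mult_left_mono) auto
    also have "\<dots> \<le> r" using that by (simp add: field_simps add_pos_nonneg)
    finally show ?thesis .
  qed
  moreover have "0 < r / (\<bar>C\<bar> + 1)" using assms by (simp add: add_pos_nonneg add.commute)
  ultimately show ?thesis unfolding eventually_at_right_field by blast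
qed

lemma eventually_at_right_0_cmul:
  assumes "\<forall>\<^sub>F h in at_right (0::real). P h" "0 < r"
  shows "\<forall>\<^sub>F h in at_right 0. P (r * h)"
proof -
  obtain b where b: "b > 0" "\<And>y. 0 < y \<Longrightarrow> y < b \<Longrightarrow> P y"
    using assms(1) unfolding eventually_at_right_field by blast
  have "P (r * h)" if "0 < h" "h < b / r" for h
    using b(2)[of "r * h"] that assms(2) by (simp add: field_simps)
  moreover have "0 < b / r" using b(1) assms(2) by simp
  ultimately show ?thesis unfolding eventually_at_right_field by blast
qed

lemma eventually_at_right_0_sqrt:
  assumes "\<forall>\<^sub>F h in at_right (0::real). P h"
  shows "\<forall>\<^sub>F h in at_right 0. P (sqrt h)"
proof -
  obtain b where b: "b > 0" "\<And>y. 0 < y \<Longrightarrow> y < b \<Longrightarrow> P y"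
    using assms(1) unfolding eventually_at_right_field by blast
  have "P (sqrt h)" if "0 < h" "h < b\<^sup>2" for h
    using b that by (intro b(2)) (auto intro: real_less_lsqrt)
  moreover have "0 < b\<^sup>2" using b(1) by simp
  ultimately show ?thesis unfolding eventually_at_right_field by blast
qed

text \<open>
  The points \<open>x0, \<dots>, x4\<close> are reached by steps along the fields \<open>X\<close>, \<open>Y\<close>,
  \<open>-X\<close>, \<open>-Y\<close>, whose values at \<open>x0\<close> are \<open>u\<close> and \<open>t\<close> and whose derivatives there
  are \<open>PX\<close> and \<open>PY\<close>.
\<close>

lemma commutator_expansion:
  fixes x0 x1 x2 x3 x4 :: "'a::real_normed_vector"
  assumes lin: "linear PX" "linear PY" and N: "\<And>v. norm (PX v) \<le> N * norm v" "\<And>v. norm (PY v) \<le> N * norm v"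
    and step: "norm (x1 - x0 - s *\<^sub>R u - (s\<^sup>2 / 2) *\<^sub>R PX u) \<le> s\<^sup>2 * e"
      "norm (x2 - x1 - s *\<^sub>R Y1 - (s\<^sup>2 / 2) *\<^sub>R YY1) \<le> s\<^sup>2 * e"
      "norm (x3 - x2 + s *\<^sub>R X2 - (s\<^sup>2 / 2) *\<^sub>R XX2) \<le> s\<^sup>2 * e"
      "norm (x4 - x3 + s *\<^sub>R Y3 - (s\<^sup>2 / 2) *\<^sub>R YY3) \<le> s\<^sup>2 * e"
    and cont: "norm (YY1 - PY t) \<le> e" "norm (XX2 - PX u) \<le> e" "norm (YY3 - PY t) \<le> e"
    and diff: "norm (Y1 - t - PY (x1 - x0)) \<le> s * e" "norm (X2 - u - PX (x2 - x0)) \<le> s * e"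
      "norm (Y3 - t - PY (x3 - x0)) \<le> s * e"
    and first: "norm (x1 - x0 - s *\<^sub>R u) \<le> s * e" "norm (x2 - x0 - s *\<^sub>R (u + t)) \<le> s * e"
      "norm (x3 - x0 - s *\<^sub>R t) \<le> s * e"
    and "0 \<le> s" "0 \<le> N"
  shows "norm (x4 - x0 - s\<^sup>2 *\<^sub>R (PY u - PX t)) \<le> s\<^sup>2 * ((9 + 3 * N) * e)"
proof -
  have e: "0 \<le> e" using order_trans[OF norm_ge_zero cont(1)] .
  have a: "norm ((s\<^sup>2 / 2) *\<^sub>R v) \<le> s\<^sup>2 * (e / 2)" if "norm v \<le> e" for v :: 'a
    using mult_left_mono[OF that zero_le_power2[of s]] by simp
  have b: "norm (s *\<^sub>R v) \<le> s\<^sup>2 * e" if "norm v \<le> s * e" for v :: 'a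
    using mult_left_mono[OF that \<open>0 \<le> s\<close>] \<open>0 \<le> s\<close> by (simp add: power2_eq_square mult_ac)
  have c: "norm (s *\<^sub>R P v) \<le> s\<^sup>2 * (N * e)"
    if "\<And>v. norm (P v) \<le> N * norm v" "norm v \<le> s * e" for P :: "'a \<Rightarrow> 'a" and v
  proof -
    have "norm (P v) \<le> N * (s * e)"
      using that(1)[of v] mult_left_mono[OF that(2) \<open>0 \<le> N\<close>] by linarith
    from mult_left_mono[OF this \<open>0 \<le> s\<close>] show ?thesis
      using \<open>0 \<le> s\<close> by (simp add: power2_eq_square mult_ac)
  qed
  have eq: "x4 - x0 - s\<^sup>2 *\<^sub>R (PY u - PX t) =
     (x1 - x0 - s *\<^sub>R u - (s\<^sup>2 / 2) *\<^sub>R PX u) + (x2 - x1 - s *\<^sub>R Y1 - (s\<^sup>2 / 2) *\<^sub>R YY1)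
     + (x3 - x2 + s *\<^sub>R X2 - (s\<^sup>2 / 2) *\<^sub>R XX2) + (x4 - x3 + s *\<^sub>R Y3 - (s\<^sup>2 / 2) *\<^sub>R YY3)
     + (s\<^sup>2 / 2) *\<^sub>R (YY1 - PY t) + (s\<^sup>2 / 2) *\<^sub>R (XX2 - PX u) + (s\<^sup>2 / 2) *\<^sub>R (YY3 - PY t)
     + s *\<^sub>R (Y1 - t - PY (x1 - x0)) - s *\<^sub>R (X2 - u - PX (x2 - x0)) - s *\<^sub>R (Y3 - t - PY (x3 - x0))
     + s *\<^sub>R PY (x1 - x0 - s *\<^sub>R u) - s *\<^sub>R PX (x2 - x0 - s *\<^sub>R (u + t)) - s *\<^sub>R PY (x3 - x0 - s *\<^sub>R t)"
  proof -
    have half: "(s\<^sup>2 / 2) *\<^sub>R v + (s\<^sup>2 / 2) *\<^sub>R v = s\<^sup>2 *\<^sub>R v" for v :: 'a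
      by (simp flip: scaleR_add_left)
    show ?thesis
      using half[of "PX u"] half[of "PY t"]
      by (simp add: linear_diff[OF lin(1)] linear_diff[OF lin(2)] linear_cmul[OF lin(1)]
          linear_cmul[OF lin(2)] linear_add[OF lin(1)] linear_add[OF lin(2)] power2_eq_square algebra_simps)
  qed
  have sum: "norm (a1 + a2 + a3 + a4 + b1 + b2 + b3 + c1 - c2 - c3 + d1 - d2 - d3)
      \<le> norm a1 + norm a2 + norm a3 + norm a4 + norm b1 + norm b2 + norm b3 + norm c1 + norm c2 + norm c3
        + norm d1 + norm d2 + norm d3" for a1 a2 a3 a4 b1 b2 b3 c1 c2 c3 d1 d2 d3 :: 'a
    by (intro norm_triangle_le_diff norm_triangle_le add_mono order_refl)
  have "norm (x4 - x0 - s\<^sup>2 *\<^sub>R (PY u - PX t)) \<le>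
      s\<^sup>2 * e + s\<^sup>2 * e + s\<^sup>2 * e + s\<^sup>2 * e + s\<^sup>2 * (e / 2) + s\<^sup>2 * (e / 2) + s\<^sup>2 * (e / 2)
      + s\<^sup>2 * e + s\<^sup>2 * e + s\<^sup>2 * e + s\<^sup>2 * (N * e) + s\<^sup>2 * (N * e) + s\<^sup>2 * (N * e)"
    unfolding eq
    by (rule order_trans[OF sum]) (intro add_mono step a[OF cont(1)] a[OF cont(2)] a[OF cont(3)]
        b[OF diff(1)] b[OF diff(2)] b[OF diff(3)] c[OF N(1)] c[OF N(2)] first)
  also have "\<dots> = s\<^sup>2 * ((17 / 2 + 3 * N) * e)" by (simp add: algebra_simps)
  also have "\<dots> \<le> s\<^sup>2 * ((9 + 3 * N) * e)" using e by (intro mult_left_mono mult_right_mono) auto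
  finally show ?thesis .
qed

context smooth_manifold
begin

lemma mem_enlarge: "(\<forall>(c, D)\<in>enlarge r S. P c D) \<longleftrightarrow> (\<forall>(c, D)\<in>S. P c (thicken r D))"
  by (auto simp: enlarge_def)

lemma attainable_zero: "attainable f (\<lambda>c p. 0)"
proof -
  have "steers f [] S (\<lambda>c p q. norm (cmap c q - cmap c p - h *\<^sub>R 0) \<le> h * e)" if "0 < h" "0 < e" for S h e
    using that by (auto simp: steers_def cell_def)
  then show ?thesis
    unfolding attainable_def by (auto intro!: eventually_mono[OF eventually_at_right_less])
qed

text \<open>The words are concatenated. The second one moves along \<open>Z\<close> at the
  intermediate point instead of \<open>p\<close>; continuity of \<open>Z\<close> pays for this with
  one of the three parts of \<open>e\<close>.\<close>

lemma attainable_add: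
  assumes "attainable f X" "attainable f Z" "C0_field X" "C0_field Z"
  shows "attainable f (\<lambda>c p. X c p + Z c p)"
  unfolding attainable_def
proof (intro allI impI)
  fix S and e :: real assume S: "cell_family S" and "0 < e"
  define e' where "e' = e / 3"
  have e': "0 < e'" "e' + e' + e' = e" using \<open>0 < e\<close> by (simp_all add: e'_def)
  obtain r where r: "r > 0" "cell_family (enlarge r S)" "\<forall>(c, D)\<in>S. \<forall>p\<in>cell c D. \<forall>q\<in>cdom c.
      norm (cmap c q - cmap c p) \<le> r \<longrightarrow> norm (Z c q - Z c p) \<le> e'"
    using ex_small_positive[OF eventually_conj[OF eventually_cell_family_enlarge[OF S]
        field_uniformly_continuous[OF assms(4) S e'(1)]]] by (elim exE conjE) (rule that)
  obtain B where B: "\<forall>(c, D)\<in>S. \<forall>p\<in>cell c D. norm (X c p) \<le> B"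
    using eventually_happens'[OF _ field_bound[OF assms(3) S]] by auto
  have "\<forall>\<^sub>F h in at_right 0. 0 < h \<and> h * (B + e') \<le> r \<and>
      (\<exists>w. steers f w S (\<lambda>c p q. norm (cmap c q - cmap c p - h *\<^sub>R X c p) \<le> h * e')) \<and>
      (\<exists>w. steers f w (enlarge r S) (\<lambda>c p q. norm (cmap c q - cmap c p - h *\<^sub>R Z c p) \<le> h * e'))"
    using assms(1,2) S r(1,2) e'(1) unfolding attainable_def
    by (intro eventually_conj eventually_small_mult eventually_at_right_less) auto
  then show "\<forall>\<^sub>F h in at_right 0. \<exists>w. steers f w S
      (\<lambda>c p q. norm (cmap c q - cmap c p - h *\<^sub>R (X c p + Z c p)) \<le> h * e)"
  proof eventually_elim
    case (elim h)
    then obtain w w' where h: "0 < h" "h * (B + e') \<le> r"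
      and w: "steers f w S (\<lambda>c p q. norm (cmap c q - cmap c p - h *\<^sub>R X c p) \<le> h * e')"
      and w': "steers f w' (enlarge r S) (\<lambda>c p q. norm (cmap c q - cmap c p - h *\<^sub>R Z c p) \<le> h * e')"
      by (elim exE conjE) (rule that)
    have near: "norm (cmap c q - cmap c p) \<le> r"
      if "(c, D) \<in> S" "p \<in> cell c D" "norm (cmap c q - cmap c p - h *\<^sub>R X c p) \<le> h * e'" for c D p q
    proof -
      have "norm (X c p) \<le> B" using B that by blast
      then have "norm (h *\<^sub>R X c p) \<le> h * B" using h(1) by (simp add: mult_left_mono)
      from norm_triangle_mono[OF that(3) this] show ?thesis using h(2) by (simp add: algebra_simps)
    qed
    have "steers f (w @ w') S (\<lambda>c p q. \<exists>m\<in>cdom c. norm (cmap c m - cmap c p - h *\<^sub>R X c p) \<le> h * e' \<and>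
        norm (cmap c q - cmap c m - h *\<^sub>R Z c m) \<le> h * e')"
      by (rule steers_append[OF w w' near])
    then have "steers f (w @ w') S (\<lambda>c p q. norm (cmap c q - cmap c p - h *\<^sub>R (X c p + Z c p)) \<le> h * e)"
    proof (rule steers_mono, elim bexE conjE)
      fix c D p q m
      assume cD: "(c, D) \<in> S" "p \<in> cell c D" "m \<in> cdom c"
        and m: "norm (cmap c m - cmap c p - h *\<^sub>R X c p) \<le> h * e'"
          "norm (cmap c q - cmap c m - h *\<^sub>R Z c m) \<le> h * e'"
      have "norm (Z c m - Z c p) \<le> e'" using r(3) cD near[OF cD(1,2) m(1)] by blast
      then have "norm (h *\<^sub>R (Z c m - Z c p)) \<le> h * e'" using h(1) by (simp add: mult_left_mono)
      from norm_triangle_mono[OF norm_triangle_mono[OF m] this]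
      have "norm (cmap c q - cmap c p - h *\<^sub>R (X c p + Z c p)) \<le> h * e' + h * e' + h * e'"
        by (simp add: algebra_simps)
      then show "norm (cmap c q - cmap c p - h *\<^sub>R (X c p + Z c p)) \<le> h * e"
        unfolding e'(2)[symmetric] by (simp add: algebra_simps)
    qed
    then show ?case by blast
  qed
qed

text \<open>A step \<open>h\<close> along the scaled field is a step \<open>r * h\<close> along
  \<open>X\<close>. Words are not run backwards, so \<open>r\<close> is positive and the negative of
  a field is treated as an attainable field of its own.\<close>

lemma attainable_cmul:
  assumes "attainable f X" "0 < r"
  shows "attainable f (\<lambda>c p. r *\<^sub>R X c p)"
  unfolding attainable_def
proof (intro allI impI)
  fix S and e :: real assume S: "cell_family S" and "0 < e"
  then have er: "0 < e / r" using assms(2) by simp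
  have "\<forall>\<^sub>F h in at_right 0. \<exists>w. steers f w S (\<lambda>c p q. norm (cmap c q - cmap c p - h *\<^sub>R X c p) \<le> h * (e / r))"
    using assms(1) S er unfolding attainable_def by blast
  from eventually_at_right_0_cmul[OF this assms(2)]
  show "\<forall>\<^sub>F h in at_right 0. \<exists>w. steers f w S
      (\<lambda>c p q. norm (cmap c q - cmap c p - h *\<^sub>R (r *\<^sub>R X c p)) \<le> h * e)"
    using assms(2) by (simp add: mult.commute)
qed

text \<open>Attainability promises an error \<open>o(h)\<close>. Repeating steps of length
  \<open>s / real n\<close> with a relative error of order \<open>s\<close> produces a polygon that
  agrees with the second order Taylor polynomial of the integral curve up to
  \<open>o(s\<^sup>2)\<close>.\<close>

lemma attainable_second_order:
  assumes X: "attainable f X" "C1_field X" and S: "cell_family S" and e: "0 < e"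
  shows "\<forall>\<^sub>F s in at_right 0. \<exists>w. steers f w S (\<lambda>c p q.
    norm (cmap c q - cmap c p - s *\<^sub>R X c p - (s\<^sup>2 / 2) *\<^sub>R field_deriv X X c p) \<le> s\<^sup>2 * e)"
proof -
  obtain r where r: "r > 0" "cell_family (enlarge r S)"
    using ex_small_positive[OF eventually_cell_family_enlarge[OF S]] by blast
  obtain B where B: "0 \<le> B" "\<forall>(c, D)\<in>S. \<forall>p\<in>cell c (thicken r D). norm (X c p) \<le> B"
    using eventually_happens'[OF _ eventually_conj[OF eventually_ge_at_top[of 0]
          field_bound[OF C1_field_C0[OF X(2)] r(2)]]] by (auto simp: mem_enlarge)
  obtain N where N: "0 \<le> N" "\<forall>(c, D)\<in>S. \<forall>p\<in>cell c D. \<forall>v. norm (chart_deriv c (X c) p v) \<le> N * norm v"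
    using eventually_happens'[OF _ eventually_conj[OF eventually_ge_at_top[of 0]
          field_deriv_bound[OF X(2) S]]] by auto
  \<comment> \<open>The error is split into five parts of size \<open>s\<^sup>2 * e / 5\<close>: one
    from linearising \<open>X\<close>, two from the first order error inside the derivative, one
    from the substeps, one from the diagonal term of the polygon. This constant serves the first
    part.\<close>
  define e2 where "e2 = e / 5 / (B + 1)"
  have e2: "0 < e2" "e2 * (B + 1) = e / 5" using e B(1) by (simp_all add: e2_def field_simps)
  obtain d where d: "d > 0" "\<forall>(c, D)\<in>S. \<forall>p\<in>cell c D. \<forall>q\<in>cdom c. norm (cmap c q - cmap c p) \<le> d \<longrightarrow>
    norm (X c q - X c p - chart_deriv c (X c) p (cmap c q - cmap c p)) \<le> e2 * norm (cmap c q - cmap c p)"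
    using ex_small_positive[OF field_strict_derivative[OF X(2) S e2(1)]] by (elim exE conjE) (rule that)
  have "\<forall>\<^sub>F s in at_right 0. 0 < s \<and> s * (B + 1) \<le> r \<and> s * (B + 1) \<le> d \<and> s * (N * (N + e2) * (B + 1)) \<le> e / 5"
    using r d e by (intro eventually_conj eventually_small_mult eventually_at_right_less) auto
  then show ?thesis
  proof eventually_elim
    case (elim s)
    then have s: "0 < s" "s * (B + 1) \<le> r" "s * (B + 1) \<le> d" "s * (N * (N + e2) * (B + 1)) \<le> e / 5" by auto
    \<comment> \<open>The relative accuracy of the substeps is of order \<open>s\<close>, which is
      what turns first order accuracy into second order. The other two bounds serve
      \<open>attainable_iterate\<close> and the factor \<open>N\<close>.\<close>
    define e' where "e' = min 1 (min (s * e / 5) (e / 5 / (N + 1)))"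
    have e': "0 < e'" "e' \<le> 1" "e' \<le> s * e / 5" and Ne': "N * e' \<le> e / 5"
    proof -
      show "0 < e'" "e' \<le> 1" using s e N(1) by (auto simp: e'_def)
      show "e' \<le> s * e / 5" unfolding e'_def by (meson min.cobounded1 min.cobounded2 order_trans)
      have "N * e' \<le> (N + 1) * (e / 5 / (N + 1))"
        using N(1) \<open>0 < e'\<close> by (intro mult_mono) (auto simp: e'_def)
      also have "\<dots> = e / 5" using N(1) by (simp add: field_simps)
      finally show "N * e' \<le> e / 5" .
    qed
    have se: "0 < s * e / 5" using s(1) e by simp
    \<comment> \<open>The additional condition on \<open>n\<close> makes the diagonal term of the
      polygon, with coefficient \<open>s * (s / real n) / 2\<close>, negligible.\<close>
    obtain n w where n: "n > 0" "s / real n * (N * B) \<le> s * e / 5" and w: "\<forall>p\<in>cells_union S. \<exists>xs. xs 0 = p \<and> reach f w p (xs n) \<and>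
      (\<forall>(c, D)\<in>S. p \<in> cell c D \<longrightarrow>
        (\<forall>j\<le>n. xs j \<in> cdom c \<and> norm (cmap c (xs j) - cmap c p) \<le> s * (B + 1)) \<and>
        (\<forall>j<n. norm (cmap c (xs (Suc j)) - cmap c (xs j) - (s / real n) *\<^sub>R X c (xs j)) \<le> s / real n * e'))"
      using attainable_iterate[OF X(1) r(2) B(2,1) s(1,2) e'(1,2) eventually_small_mult[OF se, of "N * B"]]
      by (elim exE conjE) (rule that)
    let ?h = "s / real n"
    have nh: "real n * ?h = s" using n by simp
    have "steers f w S (\<lambda>c p q.
      norm (cmap c q - cmap c p - s *\<^sub>R X c p - (s\<^sup>2 / 2) *\<^sub>R field_deriv X X c p) \<le> s\<^sup>2 * e)"
      unfolding steers_def
    proof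
      fix p assume p: "p \<in> cells_union S"
      obtain xs where xs: "xs 0 = p" "reach f w p (xs n)" and xs': "\<forall>(c, D)\<in>S. p \<in> cell c D \<longrightarrow>
        (\<forall>j\<le>n. xs j \<in> cdom c \<and> norm (cmap c (xs j) - cmap c p) \<le> s * (B + 1)) \<and>
        (\<forall>j<n. norm (cmap c (xs (Suc j)) - cmap c (xs j) - ?h *\<^sub>R X c (xs j)) \<le> ?h * e')"
        using bspec[OF w p] by (elim exE conjE) (rule that)
      have dom: "xs n \<in> cdom c" if "(c, D) \<in> S" "p \<in> cell c D" for c D
        using xs' that by blast
      have "norm (cmap c (xs n) - cmap c p - s *\<^sub>R X c p - (s\<^sup>2 / 2) *\<^sub>R field_deriv X X c p) \<le> s\<^sup>2 * e"
        if cD: "(c, D) \<in> S" "p \<in> cell c D" for c D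
      proof -
        have near: "\<forall>j\<le>n. xs j \<in> cdom c \<and> norm (cmap c (xs j) - cmap c p) \<le> s * (B + 1)"
          and euler: "\<forall>j<n. norm (cmap c (xs (Suc j)) - cmap c (xs j) - ?h *\<^sub>R X c (xs j)) \<le> ?h * e'"
          using xs' cD by blast+
        have c: "c \<in> A" "p \<in> cdom c" using cell_familyD(1)[OF S cD(1)] cD(2) by (auto simp: cell_def)
        let ?L = "chart_deriv c (X c) p" and ?y = "\<lambda>j. cmap c (xs j)"
        have L: "linear ?L" "\<And>v. norm (?L v) \<le> N * norm v"
          using linear_chart_deriv[OF X(2) c] N(2) cD by blast+
        have D: "norm (X c (xs j) - X c p - ?L (?y j - ?y 0)) \<le> e2 * (s * (B + 1))" if "j < n" for j
        proof -
          have *: "norm (?y j - ?y 0) \<le> s * (B + 1)" "xs j \<in> cdom c" using near that xs(1) by auto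
          moreover have "norm (?y j - cmap c p) \<le> d" using * s(3) xs(1) by simp
          ultimately have "norm (X c (xs j) - X c p - ?L (?y j - ?y 0)) \<le> e2 * norm (?y j - ?y 0)"
            using d(2) cD xs(1) by blast
          then show ?thesis using mult_left_mono[OF *(1), of e2] e2(1) by linarith
        qed
        have C: "norm (X c (xs j) - X c p) \<le> (N + e2) * (s * (B + 1))" if "j < n" for j
        proof -
          have "norm (?y j - ?y 0) \<le> s * (B + 1)" using near that xs(1) by auto
          then have "norm (?L (?y j - ?y 0)) \<le> N * (s * (B + 1))"
            using L(2)[of "?y j - ?y 0"] mult_left_mono[OF _ N(1)] order_trans by blast
          from norm_triangle_mono[OF D[OF that] this] show ?thesis by (simp add: algebra_simps)
        qed
        define w' where "w' = s * ((N + e2) * (s * (B + 1)) + e')"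
        have first: "norm (?y j - ?y 0 - (real j * ?h) *\<^sub>R X c p) \<le> w'" if "j \<le> n" for j
        proof -
          have "norm (?y j - ?y 0 - (real j * ?h) *\<^sub>R X c p) \<le> real j * ?h * ((N + e2) * (s * (B + 1)) + e')"
            using s(1) euler C that by (intro euler_polygon_first_order[of _ n _ "\<lambda>j. X c (xs j)"]) auto
          also have "\<dots> \<le> w'"
          proof -
            have "real j * ?h \<le> real n * ?h" using that s(1) by (intro mult_right_mono) auto
            then show ?thesis unfolding w'_def nh
              using N(1) e2(1) s(1) B(1) e'(1) by (intro mult_right_mono) auto
          qed
          finally show ?thesis .
        qed
        have second: "norm (?y n - ?y 0 - (real n * ?h) *\<^sub>R X c p
            - (((real n * ?h)\<^sup>2 - real n * ?h\<^sup>2) / 2) *\<^sub>R ?L (X c p))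
          \<le> real n * ?h * (e2 * (s * (B + 1)) + N * w' + e')"
          using s(1) euler L D first N(1)
          by (intro euler_polygon_second_order[of _ _ _ n _ "\<lambda>j. X c (xs j)"]) auto
        have "real n * ?h\<^sup>2 = s * ?h" using n by (simp add: power2_eq_square)
        then have "norm (?y n - ?y 0 - s *\<^sub>R X c p - ((s\<^sup>2 - s * ?h) / 2) *\<^sub>R ?L (X c p))
          \<le> s * (e2 * (s * (B + 1)) + N * w' + e')"
          using second unfolding nh by simp
        moreover have "norm ((s * ?h / 2) *\<^sub>R ?L (X c p)) \<le> s * (s * e / 5)"
        proof -
          have "p \<in> cell c (thicken r D)" using cD(2) thicken_base[of r D] r(1) by (auto simp: cell_def)
          then have "norm (X c p) \<le> B" using B(2) cD(1) by blast
          then have "norm (?L (X c p)) \<le> N * B"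
            using L(2)[of "X c p"] mult_left_mono[OF _ N(1)] order_trans by blast
          then have "(s * ?h / 2) * norm (?L (X c p)) \<le> (s * ?h / 2) * (N * B)"
            using s(1) by (intro mult_left_mono) auto
          then have "norm ((s * ?h / 2) *\<^sub>R ?L (X c p)) \<le> (s * ?h / 2) * (N * B)"
            using s(1) by simp
          also have "\<dots> = s * (?h * (N * B)) / 2" by simp
          also have "\<dots> \<le> s * (s * e / 5) / 2"
            using n(2) s(1) by (intro divide_right_mono mult_left_mono) auto
          also have "\<dots> \<le> s * (s * e / 5)" using s(1) e by simp
          finally show ?thesis .
        qed
        ultimately have total: "norm ((?y n - ?y 0 - s *\<^sub>R X c p - ((s\<^sup>2 - s * ?h) / 2) *\<^sub>R ?L (X c p)) - (s * ?h / 2) *\<^sub>R ?L (X c p))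
          \<le> s * (e2 * (s * (B + 1)) + N * w' + e') + s * (s * e / 5)"
          by (meson add_mono norm_triangle_ineq4 order_trans)
        have split: "(?y n - ?y 0 - s *\<^sub>R X c p - ((s\<^sup>2 - s * ?h) / 2) *\<^sub>R ?L (X c p)) - (s * ?h / 2) *\<^sub>R ?L (X c p)
          = ?y n - cmap c p - s *\<^sub>R X c p - (s\<^sup>2 / 2) *\<^sub>R field_deriv X X c p"
          unfolding field_deriv_def xs(1) by (simp add: diff_divide_distrib scaleR_diff_left)
        have "s * (e2 * (s * (B + 1)) + N * w' + e') + s * (s * e / 5) \<le> s\<^sup>2 * e"
        proof -
          have "e2 * (s * (B + 1)) = s * (e / 5)" using e2(2) by (metis mult.left_commute)
          moreover have "N * w' \<le> s * (e / 5 + e / 5)"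
          proof -
            have "N * w' = s * (s * (N * (N + e2) * (B + 1)) + N * e')"
              unfolding w'_def by (simp add: algebra_simps)
            also have "\<dots> \<le> s * (e / 5 + e / 5)"
              using s(1,4) Ne' by (intro mult_left_mono add_mono) auto
            finally show ?thesis .
          qed
          ultimately have "e2 * (s * (B + 1)) + N * w' + e' + s * e / 5 \<le> s * e"
            using e'(3) by (simp add: algebra_simps)
          from mult_left_mono[OF this, of s] show ?thesis
            using s(1) by (simp add: power2_eq_square algebra_simps)
        qed
        from order_trans[OF total this] show ?thesis unfolding split .
      qed
      then show "\<exists>q. reach f w p q \<and> (\<forall>(c, D)\<in>S. p \<in> cell c D \<longrightarrow> q \<in> cdom c \<and>
          norm (cmap c q - cmap c p - s *\<^sub>R X c p - (s\<^sup>2 / 2) *\<^sub>R field_deriv X X c p) \<le> s\<^sup>2 * e)"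
        using xs(2) dom by blast
    qed
    then show ?case by blast
  qed
qed

lemma field_deriv_uminus:
  assumes "C1_field X" "c \<in> A" "p \<in> cdom c"
  shows "field_deriv (\<lambda>c p. (-1) *\<^sub>R X c p) (\<lambda>c p. (-1) *\<^sub>R X c p) c p = field_deriv X X c p"
  unfolding field_deriv_def chart_deriv_cmul[OF assms] linear_cmul[OF linear_chart_deriv[OF assms]] by simp

lemma C1_field_cmul:
  assumes "C1_field X" shows "C1_field (\<lambda>c p. r *\<^sub>R X c p)"
  using assms open_crange unfolding C1_field_def by (auto intro!: Ck_on_scaleR Ck_on_const simp del: Ck_on.simps)

text \<open>Reversing a field changes the sign of the velocity but not of the acceleration, since
  the differentiated field and the direction both change sign.\<close>

lemma attainable_second_order_uminus:
  assumes "attainable f (\<lambda>c p. (-1) *\<^sub>R X c p)" "C1_field X" "cell_family S" "0 < e"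
  shows "\<forall>\<^sub>F s in at_right 0. \<exists>w. steers f w S (\<lambda>c p q.
    norm (cmap c q - cmap c p + s *\<^sub>R X c p - (s\<^sup>2 / 2) *\<^sub>R field_deriv X X c p) \<le> s\<^sup>2 * e)"
  using attainable_second_order[OF assms(1) C1_field_cmul[OF assms(2)] assms(3,4)]
proof eventually_elim
  case (elim s)
  then obtain w where w: "steers f w S (\<lambda>c p q. norm (cmap c q - cmap c p - s *\<^sub>R ((-1) *\<^sub>R X c p)
      - (s\<^sup>2 / 2) *\<^sub>R field_deriv (\<lambda>c p. (-1) *\<^sub>R X c p) (\<lambda>c p. (-1) *\<^sub>R X c p) c p) \<le> s\<^sup>2 * e)"
    by (elim exE) (rule that)
  have "steers f w S (\<lambda>c p q.
      norm (cmap c q - cmap c p + s *\<^sub>R X c p - (s\<^sup>2 / 2) *\<^sub>R field_deriv X X c p) \<le> s\<^sup>2 * e)"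
  proof (rule steers_mono[OF w])
    fix c D p q
    assume cD: "(c, D) \<in> S" "p \<in> cell c D"
      and q: "norm (cmap c q - cmap c p - s *\<^sub>R ((-1) *\<^sub>R X c p)
      - (s\<^sup>2 / 2) *\<^sub>R field_deriv (\<lambda>c p. (-1) *\<^sub>R X c p) (\<lambda>c p. (-1) *\<^sub>R X c p) c p) \<le> s\<^sup>2 * e"
    have "field_deriv (\<lambda>c p. (-1) *\<^sub>R X c p) (\<lambda>c p. (-1) *\<^sub>R X c p) c p = field_deriv X X c p"
      using field_deriv_uminus[OF assms(2) cell_familyD(1)[OF assms(3) cD(1)]] cD(2) by (simp add: cell_def)
    then show "norm (cmap c q - cmap c p + s *\<^sub>R X c p - (s\<^sup>2 / 2) *\<^sub>R field_deriv X X c p) \<le> s\<^sup>2 * e"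
      using q by simp
  qed
  then show ?case by blast
qed

text \<open>Steps of length \<open>s\<close> along \<open>X\<close>, \<open>Z\<close>,
  \<open>-X\<close>, \<open>-Z\<close> move a point by \<open>s\<^sup>2\<close> times the bracket,
  up to \<open>o(s\<^sup>2)\<close>. A step \<open>h\<close> along the bracket therefore takes
  \<open>s = sqrt h\<close>, and each of the four motions has to be accurate to second order in
  \<open>s\<close>.\<close>

lemma attainable_bracket:
  assumes X: "attainable f X" "attainable f (\<lambda>c p. (-1) *\<^sub>R X c p)" "smooth_field X"
    and Z: "attainable f Z" "attainable f (\<lambda>c p. (-1) *\<^sub>R Z c p)" "smooth_field Z"
  shows "attainable f (lie_bracket X Z)"
  unfolding attainable_def
proof (intro allI impI)
  fix S and e :: real assume S: "cell_family S" and e: "0 < e"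
  note X1 = smooth_field_C1[OF X(3)] and Z1 = smooth_field_C1[OF Z(3)]
  note X0 = C1_field_C0[OF X1] and Z0 = C1_field_C0[OF Z1]
  have XX: "C0_field (field_deriv X X)" and ZZ: "C0_field (field_deriv Z Z)"
    using X(3) Z(3) C1_field_C0 smooth_field_C1 smooth_field_deriv by blast+
  obtain r where r: "r > 0" "cell_family (enlarge r S)"
    using ex_small_positive[OF eventually_cell_family_enlarge[OF S]] by blast
  have "\<forall>\<^sub>F b in at_top. 0 \<le> b \<and> (\<forall>(c, D)\<in>enlarge r S. \<forall>p\<in>cell c D. norm (X c p) \<le> b) \<and>
      (\<forall>(c, D)\<in>enlarge r S. \<forall>p\<in>cell c D. norm (Z c p) \<le> b) \<and>
      (\<forall>(c, D)\<in>enlarge r S. \<forall>p\<in>cell c D. norm (field_deriv X X c p) \<le> b) \<and>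
      (\<forall>(c, D)\<in>enlarge r S. \<forall>p\<in>cell c D. norm (field_deriv Z Z c p) \<le> b)"
    by (intro eventually_conj eventually_ge_at_top field_bound[OF X0 r(2)] field_bound[OF Z0 r(2)]
        field_bound[OF XX r(2)] field_bound[OF ZZ r(2)])
  then obtain b where b: "0 \<le> b" "\<forall>(c, D)\<in>S. \<forall>p\<in>cell c (thicken r D). norm (X c p) \<le> b"
    "\<forall>(c, D)\<in>S. \<forall>p\<in>cell c (thicken r D). norm (Z c p) \<le> b"
    "\<forall>(c, D)\<in>S. \<forall>p\<in>cell c (thicken r D). norm (field_deriv X X c p) \<le> b"
    "\<forall>(c, D)\<in>S. \<forall>p\<in>cell c (thicken r D). norm (field_deriv Z Z c p) \<le> b"
    unfolding mem_enlarge by (auto dest!: eventually_happens)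
  have "\<forall>\<^sub>F N in at_top. 0 \<le> N \<and>
      (\<forall>(c, D)\<in>S. \<forall>p\<in>cell c D. \<forall>v. norm (chart_deriv c (X c) p v) \<le> N * norm v) \<and>
      (\<forall>(c, D)\<in>S. \<forall>p\<in>cell c D. \<forall>v. norm (chart_deriv c (Z c) p v) \<le> N * norm v)"
    by (intro eventually_conj eventually_ge_at_top field_deriv_bound[OF X1 S] field_deriv_bound[OF Z1 S])
  then obtain N where N: "0 \<le> N" "\<forall>(c, D)\<in>S. \<forall>p\<in>cell c D. \<forall>v. norm (chart_deriv c (X c) p v) \<le> N * norm v"
    "\<forall>(c, D)\<in>S. \<forall>p\<in>cell c D. \<forall>v. norm (chart_deriv c (Z c) p v) \<le> N * norm v"
    by (auto dest!: eventually_happens)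
  define M where "M = 2 * b + 1"
  \<comment> \<open>The divisor is the constant of \<open>commutator_expansion\<close>.\<close>
  define \<eta> where "\<eta> = e / (9 + 3 * N)"
  \<comment> \<open>After three motions the first order error has grown to
    \<open>5 * \<eta>'\<close>. The bound 1 enters the estimate of the displacements.\<close>
  define \<eta>' where "\<eta>' = min 1 (\<eta> / 5)"
  \<comment> \<open>The intermediate points are within \<open>s * (3 * M)\<close> of the start, so
    linearising the fields there costs at most \<open>s * \<eta>\<close>.\<close>
  define e2 where "e2 = \<eta> / (3 * M)"
  have "0 < M" "0 < \<eta>" using e N(1) b(1) by (auto simp: M_def \<eta>_def)
  moreover have "\<eta>' \<le> \<eta> / 5" unfolding \<eta>'_def by simp
  ultimately have pos: "0 < M" "0 < \<eta>" "0 < \<eta>'" "0 < e2" "\<eta>' \<le> 1" "5 * \<eta>' \<le> \<eta>"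
    by (auto simp: \<eta>'_def e2_def)
  have eta: "(9 + 3 * N) * \<eta> = e" and e2: "e2 * (3 * M) = \<eta>"
    using N(1) pos(1) by (simp_all add: \<eta>_def e2_def)
  have "\<forall>\<^sub>F d in at_right 0. d * 1 \<le> r \<and>
      (\<forall>(c, D)\<in>S. \<forall>p\<in>cell c D. \<forall>q\<in>cdom c. norm (cmap c q - cmap c p) \<le> d \<longrightarrow> norm (X c q - X c p) \<le> \<eta>') \<and>
      (\<forall>(c, D)\<in>S. \<forall>p\<in>cell c D. \<forall>q\<in>cdom c. norm (cmap c q - cmap c p) \<le> d \<longrightarrow> norm (Z c q - Z c p) \<le> \<eta>') \<and>
      (\<forall>(c, D)\<in>S. \<forall>p\<in>cell c D. \<forall>q\<in>cdom c. norm (cmap c q - cmap c p) \<le> d \<longrightarrow>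
        norm (field_deriv X X c q - field_deriv X X c p) \<le> \<eta>) \<and>
      (\<forall>(c, D)\<in>S. \<forall>p\<in>cell c D. \<forall>q\<in>cdom c. norm (cmap c q - cmap c p) \<le> d \<longrightarrow>
        norm (field_deriv Z Z c q - field_deriv Z Z c p) \<le> \<eta>) \<and>
      (\<forall>(c, D)\<in>S. \<forall>p\<in>cell c D. \<forall>q\<in>cdom c. norm (cmap c q - cmap c p) \<le> d \<longrightarrow>
        norm (X c q - X c p - chart_deriv c (X c) p (cmap c q - cmap c p)) \<le> e2 * norm (cmap c q - cmap c p)) \<and>
      (\<forall>(c, D)\<in>S. \<forall>p\<in>cell c D. \<forall>q\<in>cdom c. norm (cmap c q - cmap c p) \<le> d \<longrightarrow>
        norm (Z c q - Z c p - chart_deriv c (Z c) p (cmap c q - cmap c p)) \<le> e2 * norm (cmap c q - cmap c p))"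
    by (intro eventually_conj eventually_small_mult r field_uniformly_continuous[OF X0 S]
        field_uniformly_continuous[OF Z0 S] field_uniformly_continuous[OF XX S]
        field_uniformly_continuous[OF ZZ S] field_strict_derivative[OF X1 S]
        field_strict_derivative[OF Z1 S] pos)
  from ex_small_positive[OF this] obtain d where d: "d > 0" "d * 1 \<le> r"
    and cX: "\<forall>(c, D)\<in>S. \<forall>p\<in>cell c D. \<forall>q\<in>cdom c. norm (cmap c q - cmap c p) \<le> d \<longrightarrow> norm (X c q - X c p) \<le> \<eta>'"
    and cZ: "\<forall>(c, D)\<in>S. \<forall>p\<in>cell c D. \<forall>q\<in>cdom c. norm (cmap c q - cmap c p) \<le> d \<longrightarrow> norm (Z c q - Z c p) \<le> \<eta>'"
    and cXX: "\<forall>(c, D)\<in>S. \<forall>p\<in>cell c D. \<forall>q\<in>cdom c. norm (cmap c q - cmap c p) \<le> d \<longrightarrow>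
        norm (field_deriv X X c q - field_deriv X X c p) \<le> \<eta>"
    and cZZ: "\<forall>(c, D)\<in>S. \<forall>p\<in>cell c D. \<forall>q\<in>cdom c. norm (cmap c q - cmap c p) \<le> d \<longrightarrow>
        norm (field_deriv Z Z c q - field_deriv Z Z c p) \<le> \<eta>"
    and dX: "\<forall>(c, D)\<in>S. \<forall>p\<in>cell c D. \<forall>q\<in>cdom c. norm (cmap c q - cmap c p) \<le> d \<longrightarrow>
        norm (X c q - X c p - chart_deriv c (X c) p (cmap c q - cmap c p)) \<le> e2 * norm (cmap c q - cmap c p)"
    and dZ: "\<forall>(c, D)\<in>S. \<forall>p\<in>cell c D. \<forall>q\<in>cdom c. norm (cmap c q - cmap c p) \<le> d \<longrightarrow>
        norm (Z c q - Z c p - chart_deriv c (Z c) p (cmap c q - cmap c p)) \<le> e2 * norm (cmap c q - cmap c p)"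
    by (elim exE conjE) (rule that)
  \<comment> \<open>The condition \<open>s * (b + 1) \<le> \<eta>'\<close> converts second order
    statements into first order ones. The last three words act on the enlarged family because they
    start at displaced points.\<close>
  have "\<forall>\<^sub>F s in at_right 0. 0 < s \<and> s * 1 \<le> 1 \<and> s * (3 * M) \<le> d \<and> s * (b + 1) \<le> \<eta>' \<and>
      (\<exists>w. steers f w S (\<lambda>c p q.
        norm (cmap c q - cmap c p - s *\<^sub>R X c p - (s\<^sup>2 / 2) *\<^sub>R field_deriv X X c p) \<le> s\<^sup>2 * \<eta>')) \<and>
      (\<exists>w. steers f w (enlarge r S) (\<lambda>c p q.
        norm (cmap c q - cmap c p - s *\<^sub>R Z c p - (s\<^sup>2 / 2) *\<^sub>R field_deriv Z Z c p) \<le> s\<^sup>2 * \<eta>')) \<and>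
      (\<exists>w. steers f w (enlarge r S) (\<lambda>c p q.
        norm (cmap c q - cmap c p + s *\<^sub>R X c p - (s\<^sup>2 / 2) *\<^sub>R field_deriv X X c p) \<le> s\<^sup>2 * \<eta>')) \<and>
      (\<exists>w. steers f w (enlarge r S) (\<lambda>c p q.
        norm (cmap c q - cmap c p + s *\<^sub>R Z c p - (s\<^sup>2 / 2) *\<^sub>R field_deriv Z Z c p) \<le> s\<^sup>2 * \<eta>'))"
    by (intro eventually_conj eventually_small_mult eventually_at_right_less d pos zero_less_one
        attainable_second_order[OF X(1) X1 S] attainable_second_order[OF Z(1) Z1 r(2)]
        attainable_second_order_uminus[OF X(2) X1 r(2)] attainable_second_order_uminus[OF Z(2) Z1 r(2)])
  then have "\<forall>\<^sub>F s in at_right 0. 0 < s \<and> (\<exists>w. steers f w S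
      (\<lambda>c p q. norm (cmap c q - cmap c p - s\<^sup>2 *\<^sub>R lie_bracket X Z c p) \<le> s\<^sup>2 * e))"
  proof eventually_elim
    case (elim s)
    then obtain w1 w2 w3 w4 where s: "0 < s" "s * 1 \<le> 1" "s * (3 * M) \<le> d" "s * (b + 1) \<le> \<eta>'"
      and w1: "steers f w1 S (\<lambda>c p q.
        norm (cmap c q - cmap c p - s *\<^sub>R X c p - (s\<^sup>2 / 2) *\<^sub>R field_deriv X X c p) \<le> s\<^sup>2 * \<eta>')"
      and w2: "steers f w2 (enlarge r S) (\<lambda>c p q.
        norm (cmap c q - cmap c p - s *\<^sub>R Z c p - (s\<^sup>2 / 2) *\<^sub>R field_deriv Z Z c p) \<le> s\<^sup>2 * \<eta>')"
      and w3: "steers f w3 (enlarge r S) (\<lambda>c p q.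
        norm (cmap c q - cmap c p + s *\<^sub>R X c p - (s\<^sup>2 / 2) *\<^sub>R field_deriv X X c p) \<le> s\<^sup>2 * \<eta>')"
      and w4: "steers f w4 (enlarge r S) (\<lambda>c p q.
        norm (cmap c q - cmap c p + s *\<^sub>R Z c p - (s\<^sup>2 / 2) *\<^sub>R field_deriv Z Z c p) \<le> s\<^sup>2 * \<eta>')"
      by (elim exE conjE) (rule that)
    have ss: "s\<^sup>2 \<le> s" using s(1,2) by (simp add: power2_eq_square mult_left_le)
    have first: "norm (z - s *\<^sub>R V) \<le> s * \<eta>'"
      if "norm (z - s *\<^sub>R V - (s\<^sup>2 / 2) *\<^sub>R W) \<le> s\<^sup>2 * \<eta>'" "norm W \<le> b" for z V W :: 'e
    proof -
      have "norm ((s\<^sup>2 / 2) *\<^sub>R W) \<le> (s\<^sup>2 / 2) * b" using that(2) by (simp add: mult_left_mono)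
      from norm_triangle_mono[OF that(1) this] have "norm (z - s *\<^sub>R V) \<le> s\<^sup>2 * \<eta>' + (s\<^sup>2 / 2) * b" by simp
      also have "\<dots> \<le> s\<^sup>2 * 1 + s\<^sup>2 * b"
        using pos(5) b(1) by (intro add_mono mult_left_mono mult_right_mono) auto
      also have "\<dots> = s * (s * (b + 1))" by (simp add: power2_eq_square algebra_simps)
      also have "\<dots> \<le> s * \<eta>'" using s(1,4) by (intro mult_left_mono) auto
      finally show ?thesis .
    qed
    have size: "norm z \<le> s * M"
      if "norm (z - s *\<^sub>R V - (s\<^sup>2 / 2) *\<^sub>R W) \<le> s\<^sup>2 * \<eta>'" "norm W \<le> b" "norm V \<le> b" for z V W :: 'e
    proof -
      have "norm (s *\<^sub>R V) \<le> s * b" using that(3) s(1) by (simp add: mult_left_mono)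
      from norm_triangle_mono[OF first[OF that(1,2)] this] have "norm z \<le> s * \<eta>' + s * b" by simp
      also have "\<dots> \<le> s * 1 + s * (2 * b)" using pos(5) s(1) b(1) by (intro add_mono mult_left_mono) auto
      finally show ?thesis by (simp add: M_def algebra_simps)
    qed
    have sM: "s * M \<le> d" "s * M + s * M \<le> d" "s * M + s * M + s * M \<le> d"
    proof -
      have "0 < s * M" "s * (3 * M) = s * M + s * M + s * M" using s(1) pos(1) by simp_all
      then show "s * M \<le> d" "s * M + s * M \<le> d" "s * M + s * M + s * M \<le> d" using s(3) by linarith+
    qed
    have base: "p \<in> cell c (thicken r D)" if "p \<in> cell c D" for c D p
      using that thicken_base[of r D] r(1) by (auto simp: cell_def)
    have mem: "q \<in> cell c (thicken r D)" if "p \<in> cell c D" "q \<in> cdom c" "norm (cmap c q - cmap c p) \<le> d" for c D p q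
      using mem_cell_thicken[OF that(1,2)] that(3) d(2) by simp
    have near1: "norm (cmap c q - cmap c p) \<le> s * M"
      if "(c, D) \<in> S" "p \<in> cell c (thicken r D)"
        "norm (cmap c q - cmap c p - s *\<^sub>R X c p - (s\<^sup>2 / 2) *\<^sub>R field_deriv X X c p) \<le> s\<^sup>2 * \<eta>'" for c D p q
      by (rule size[OF that(3)]) (use b that in blast)+
    have near2: "norm (cmap c q - cmap c p) \<le> s * M"
      if "(c, D) \<in> S" "p \<in> cell c (thicken r D)"
        "norm (cmap c q - cmap c p - s *\<^sub>R Z c p - (s\<^sup>2 / 2) *\<^sub>R field_deriv Z Z c p) \<le> s\<^sup>2 * \<eta>'" for c D p q
      by (rule size[OF that(3)]) (use b that in blast)+
    have near3: "norm (cmap c q - cmap c p) \<le> s * M"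
      if "(c, D) \<in> S" "p \<in> cell c (thicken r D)"
        "norm (cmap c q - cmap c p + s *\<^sub>R X c p - (s\<^sup>2 / 2) *\<^sub>R field_deriv X X c p) \<le> s\<^sup>2 * \<eta>'" for c D p q
    proof -
      have "norm (field_deriv X X c p) \<le> b" "norm (- X c p) \<le> b" using b(2,4) that(1,2) by fastforce+
      then show ?thesis using size[of "cmap c q - cmap c p" "- X c p" "field_deriv X X c p"] that(3) by simp
    qed
    have two: "norm (cmap c m2 - cmap c p) \<le> s * M + s * M \<and> m1 \<in> cell c (thicken r D)"
      if "(c, D) \<in> S" "p \<in> cell c D" "m1 \<in> cdom c"
        "norm (cmap c m1 - cmap c p - s *\<^sub>R X c p - (s\<^sup>2 / 2) *\<^sub>R field_deriv X X c p) \<le> s\<^sup>2 * \<eta>'"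
        "norm (cmap c m2 - cmap c m1 - s *\<^sub>R Z c m1 - (s\<^sup>2 / 2) *\<^sub>R field_deriv Z Z c m1) \<le> s\<^sup>2 * \<eta>'" for c D p m1 m2
    proof -
      have 1: "norm (cmap c m1 - cmap c p) \<le> s * M" by (rule near1[OF that(1) base[OF that(2)] that(4)])
      then have m1: "m1 \<in> cell c (thicken r D)" using mem[OF that(2,3)] sM(1) by linarith
      from norm_triangle_mono[OF 1 near2[OF that(1) m1 that(5)]] m1 show ?thesis by simp
    qed
    have three: "norm (cmap c m3 - cmap c p) \<le> s * M + s * M + s * M \<and> m2 \<in> cell c (thicken r D)"
      if "(c, D) \<in> S" "p \<in> cell c D" "m1 \<in> cdom c" "m2 \<in> cdom c"
        "norm (cmap c m1 - cmap c p - s *\<^sub>R X c p - (s\<^sup>2 / 2) *\<^sub>R field_deriv X X c p) \<le> s\<^sup>2 * \<eta>'"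
        "norm (cmap c m2 - cmap c m1 - s *\<^sub>R Z c m1 - (s\<^sup>2 / 2) *\<^sub>R field_deriv Z Z c m1) \<le> s\<^sup>2 * \<eta>'"
        "norm (cmap c m3 - cmap c m2 + s *\<^sub>R X c m2 - (s\<^sup>2 / 2) *\<^sub>R field_deriv X X c m2) \<le> s\<^sup>2 * \<eta>'" for c D p m1 m2 m3
    proof -
      have 1: "norm (cmap c m2 - cmap c p) \<le> s * M + s * M" using two[OF that(1,2,3,5,6)] by blast
      then have m2: "m2 \<in> cell c (thicken r D)" using mem[OF that(2,4)] sM(2) by linarith
      from norm_triangle_mono[OF 1 near3[OF that(1) m2 that(7)]] m2 show ?thesis by simp
    qed
    have "steers f (w1 @ w2) S (\<lambda>c p q. \<exists>m1\<in>cdom c.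
        norm (cmap c m1 - cmap c p - s *\<^sub>R X c p - (s\<^sup>2 / 2) *\<^sub>R field_deriv X X c p) \<le> s\<^sup>2 * \<eta>' \<and>
        norm (cmap c q - cmap c m1 - s *\<^sub>R Z c m1 - (s\<^sup>2 / 2) *\<^sub>R field_deriv Z Z c m1) \<le> s\<^sup>2 * \<eta>')"
      by (rule steers_append[OF w1 w2]) (use near1 base sM(1) d(2) in fastforce)
    from steers_append[OF this w3] have "steers f ((w1 @ w2) @ w3) S (\<lambda>c p q. \<exists>m2\<in>cdom c. (\<exists>m1\<in>cdom c.
        norm (cmap c m1 - cmap c p - s *\<^sub>R X c p - (s\<^sup>2 / 2) *\<^sub>R field_deriv X X c p) \<le> s\<^sup>2 * \<eta>' \<and>
        norm (cmap c m2 - cmap c m1 - s *\<^sub>R Z c m1 - (s\<^sup>2 / 2) *\<^sub>R field_deriv Z Z c m1) \<le> s\<^sup>2 * \<eta>') \<and>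
        norm (cmap c q - cmap c m2 + s *\<^sub>R X c m2 - (s\<^sup>2 / 2) *\<^sub>R field_deriv X X c m2) \<le> s\<^sup>2 * \<eta>')"
      using two sM(2) d(2) by fastforce
    from steers_append[OF this w4] have "steers f (((w1 @ w2) @ w3) @ w4) S (\<lambda>c p q. \<exists>m3\<in>cdom c. (\<exists>m2\<in>cdom c. (\<exists>m1\<in>cdom c.
        norm (cmap c m1 - cmap c p - s *\<^sub>R X c p - (s\<^sup>2 / 2) *\<^sub>R field_deriv X X c p) \<le> s\<^sup>2 * \<eta>' \<and>
        norm (cmap c m2 - cmap c m1 - s *\<^sub>R Z c m1 - (s\<^sup>2 / 2) *\<^sub>R field_deriv Z Z c m1) \<le> s\<^sup>2 * \<eta>') \<and>
        norm (cmap c m3 - cmap c m2 + s *\<^sub>R X c m2 - (s\<^sup>2 / 2) *\<^sub>R field_deriv X X c m2) \<le> s\<^sup>2 * \<eta>') \<and>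
        norm (cmap c q - cmap c m3 + s *\<^sub>R Z c m3 - (s\<^sup>2 / 2) *\<^sub>R field_deriv Z Z c m3) \<le> s\<^sup>2 * \<eta>')"
      using three sM(3) d(2) by fastforce
    then have "steers f (((w1 @ w2) @ w3) @ w4) S
      (\<lambda>c p q. norm (cmap c q - cmap c p - s\<^sup>2 *\<^sub>R lie_bracket X Z c p) \<le> s\<^sup>2 * e)"
    proof (rule steers_mono, elim bexE conjE)
      fix c D p q m1 m2 m3
      assume cD: "(c, D) \<in> S" "p \<in> cell c D" and m: "m1 \<in> cdom c" "m2 \<in> cdom c" "m3 \<in> cdom c"
        and E1: "norm (cmap c m1 - cmap c p - s *\<^sub>R X c p - (s\<^sup>2 / 2) *\<^sub>R field_deriv X X c p) \<le> s\<^sup>2 * \<eta>'"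
        and E2: "norm (cmap c m2 - cmap c m1 - s *\<^sub>R Z c m1 - (s\<^sup>2 / 2) *\<^sub>R field_deriv Z Z c m1) \<le> s\<^sup>2 * \<eta>'"
        and E3: "norm (cmap c m3 - cmap c m2 + s *\<^sub>R X c m2 - (s\<^sup>2 / 2) *\<^sub>R field_deriv X X c m2) \<le> s\<^sup>2 * \<eta>'"
        and E4: "norm (cmap c q - cmap c m3 + s *\<^sub>R Z c m3 - (s\<^sup>2 / 2) *\<^sub>R field_deriv Z Z c m3) \<le> s\<^sup>2 * \<eta>'"
      have c: "c \<in> A" "p \<in> cdom c" using cell_familyD(1)[OF S cD(1)] cD(2) by (auto simp: cell_def)
      have s3: "s * (3 * M) = s * M + s * M + s * M" "0 < s * M" using s(1) pos(1) by simp_all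
      have n1: "norm (cmap c m1 - cmap c p) \<le> s * (3 * M)" "norm (cmap c m1 - cmap c p) \<le> d"
        using near1[OF cD(1) base[OF cD(2)] E1] sM s3 by linarith+
      have n2: "norm (cmap c m2 - cmap c p) \<le> s * (3 * M)" "norm (cmap c m2 - cmap c p) \<le> d"
        using two[OF cD m(1) E1 E2] sM s3 by linarith+
      have n3: "norm (cmap c m3 - cmap c p) \<le> s * (3 * M)" "norm (cmap c m3 - cmap c p) \<le> d"
        using three[OF cD m(1,2) E1 E2 E3] sM s3 by linarith+
      have m12: "m1 \<in> cell c (thicken r D)" "m2 \<in> cell c (thicken r D)"
        using two[OF cD m(1) E1 E2] three[OF cD m(1,2) E1 E2 E3] by auto
      have lift: "s\<^sup>2 * \<eta>' \<le> s\<^sup>2 * \<eta>" using pos(3,6) by (intro mult_left_mono) auto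
      have strict: "e2 * norm v \<le> s * \<eta>" if "norm v \<le> s * (3 * M)" for v :: 'e
      proof -
        have "e2 * norm v \<le> e2 * (s * (3 * M))" using that pos(4) by (intro mult_left_mono) auto
        also have "\<dots> = s * (e2 * (3 * M))" by simp
        finally show ?thesis unfolding e2 .
      qed
      have cZ': "norm (s *\<^sub>R (Z c m1 - Z c p)) \<le> s * \<eta>'" and cX': "norm (s *\<^sub>R (X c m2 - X c p)) \<le> s * \<eta>'"
      proof -
        have "norm (Z c m1 - Z c p) \<le> \<eta>'" using cZ cD m(1) n1(2) by blast
        then show "norm (s *\<^sub>R (Z c m1 - Z c p)) \<le> s * \<eta>'" using s(1) by (simp add: mult_left_mono)
        have "norm (X c m2 - X c p) \<le> \<eta>'" using cX cD m(2) n2(2) by blast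
        then show "norm (s *\<^sub>R (X c m2 - X c p)) \<le> s * \<eta>'" using s(1) by (simp add: mult_left_mono)
      qed
      have f1: "norm (cmap c m1 - cmap c p - s *\<^sub>R X c p) \<le> s * \<eta>'"
        by (rule first[OF E1]) (use b(4) cD(1) base[OF cD(2)] in blast)
      have f12: "norm (cmap c m2 - cmap c m1 - s *\<^sub>R Z c m1) \<le> s * \<eta>'"
        by (rule first[OF E2]) (use b(5) cD(1) m12(1) in blast)
      have f23: "norm (cmap c m3 - cmap c m2 - s *\<^sub>R (- X c m2)) \<le> s * \<eta>'"
      proof (rule first)
        show "norm (field_deriv X X c m2) \<le> b" using b(4) cD(1) m12(2) by blast
      qed (use E3 in simp)
      from norm_triangle_mono[OF norm_triangle_mono[OF f1 f12] cZ']
      have f2: "norm (cmap c m2 - cmap c p - s *\<^sub>R (X c p + Z c p)) \<le> s * (3 * \<eta>')"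
        by (simp add: algebra_simps)
      have "norm (- (s *\<^sub>R (X c m2 - X c p))) \<le> s * \<eta>'" using cX' by simp
      from norm_triangle_mono[OF norm_triangle_mono[OF f2 f23] this]
      have f3: "norm (cmap c m3 - cmap c p - s *\<^sub>R Z c p) \<le> s * (5 * \<eta>')"
        by (simp add: algebra_simps)
      have le: "s * \<eta>' \<le> s * \<eta>" "s * (3 * \<eta>') \<le> s * \<eta>" "s * (5 * \<eta>') \<le> s * \<eta>"
        using s(1) pos(3,6) by auto
      have "norm (cmap c q - cmap c p - s\<^sup>2 *\<^sub>R (chart_deriv c (Z c) p (X c p) - chart_deriv c (X c) p (Z c p)))
        \<le> s\<^sup>2 * ((9 + 3 * N) * \<eta>)"
      proof (rule commutator_expansion[where PX = "chart_deriv c (X c) p" and PY = "chart_deriv c (Z c) p"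
            and u = "X c p" and t = "Z c p"])
        show "linear (chart_deriv c (X c) p)" "linear (chart_deriv c (Z c) p)"
          using linear_chart_deriv[OF X1 c] linear_chart_deriv[OF Z1 c] by auto
        show "norm (chart_deriv c (X c) p v) \<le> N * norm v" "norm (chart_deriv c (Z c) p v) \<le> N * norm v" for v
          using N cD by blast+
        show "norm (cmap c m1 - cmap c p - s *\<^sub>R X c p - (s\<^sup>2 / 2) *\<^sub>R chart_deriv c (X c) p (X c p)) \<le> s\<^sup>2 * \<eta>"
          using E1 lift unfolding field_deriv_def by linarith
        show "norm (cmap c m2 - cmap c m1 - s *\<^sub>R Z c m1 - (s\<^sup>2 / 2) *\<^sub>R field_deriv Z Z c m1) \<le> s\<^sup>2 * \<eta>"
          using E2 lift by linarith
        show "norm (cmap c m3 - cmap c m2 + s *\<^sub>R X c m2 - (s\<^sup>2 / 2) *\<^sub>R field_deriv X X c m2) \<le> s\<^sup>2 * \<eta>"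
          using E3 lift by linarith
        show "norm (cmap c q - cmap c m3 + s *\<^sub>R Z c m3 - (s\<^sup>2 / 2) *\<^sub>R field_deriv Z Z c m3) \<le> s\<^sup>2 * \<eta>"
          using E4 lift by linarith
        show "norm (field_deriv Z Z c m1 - chart_deriv c (Z c) p (Z c p)) \<le> \<eta>"
          "norm (field_deriv Z Z c m3 - chart_deriv c (Z c) p (Z c p)) \<le> \<eta>"
          unfolding field_deriv_def[of Z Z c p, symmetric] using cZZ cD m n1(2) n3(2) by blast+
        show "norm (field_deriv X X c m2 - chart_deriv c (X c) p (X c p)) \<le> \<eta>"
          unfolding field_deriv_def[of X X c p, symmetric] using cXX cD m n2(2) by blast
        show "norm (Z c m1 - Z c p - chart_deriv c (Z c) p (cmap c m1 - cmap c p)) \<le> s * \<eta>"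
          by (rule order_trans[OF _ strict[OF n1(1)]]) (use dZ cD m n1(2) in blast)
        show "norm (X c m2 - X c p - chart_deriv c (X c) p (cmap c m2 - cmap c p)) \<le> s * \<eta>"
          by (rule order_trans[OF _ strict[OF n2(1)]]) (use dX cD m n2(2) in blast)
        show "norm (Z c m3 - Z c p - chart_deriv c (Z c) p (cmap c m3 - cmap c p)) \<le> s * \<eta>"
          by (rule order_trans[OF _ strict[OF n3(1)]]) (use dZ cD m n3(2) in blast)
      qed (use order_trans[OF f1 le(1)] order_trans[OF f2 le(2)] order_trans[OF f3 le(3)] s(1) N(1) in simp_all)
      then show "norm (cmap c q - cmap c p - s\<^sup>2 *\<^sub>R lie_bracket X Z c p) \<le> s\<^sup>2 * e"
        unfolding eta lie_bracket_def .
    qed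
    then show ?case using s(1) by blast
  qed
  \<comment> \<open>\<open>sqrt h\<close> is substituted for \<open>s\<close>; positivity of
    \<open>h\<close> allows its square to be rewritten as \<open>h\<close>.\<close>
  from eventually_conj[OF eventually_at_right_less[of 0] eventually_at_right_0_sqrt[OF this]]
  show "\<forall>\<^sub>F h in at_right 0. \<exists>w. steers f w S
      (\<lambda>c p q. norm (cmap c q - cmap c p - h *\<^sub>R lie_bracket X Z c p) \<le> h * e)"
    by (rule eventually_mono) auto
qed

text \<open>The induction carries \<open>X\<close> and \<open>-X\<close> together: brackets need
  motion in both directions, and scaling by a negative number exchanges the two.\<close>

lemma lie_algebra_attainable:
  assumes "\<And>j. attainable f (f j)" "\<And>j. attainable f (\<lambda>c p. (-1) *\<^sub>R f j c p)" "\<And>j. smooth_field (f j)"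
    and "X \<in> lie_algebra f"
  shows "attainable f X"
proof -
  have "attainable f X \<and> attainable f (\<lambda>c p. (-1) *\<^sub>R X c p)"
    using assms(4)
  proof induction
    case (generator j)
    then show ?case using assms by blast
  next
    case (add X Z)
    note C0 = C1_field_C0[OF smooth_field_C1[OF smooth_lie_algebra[OF assms(3)]]]
    note C0' = C1_field_C0[OF C1_field_cmul[OF smooth_field_C1[OF smooth_lie_algebra[OF assms(3)]]]]
    have "attainable f (\<lambda>c p. X c p + Z c p)"
      using add by (intro attainable_add C0) auto
    moreover have "attainable f (\<lambda>c p. (-1) *\<^sub>R X c p + (-1) *\<^sub>R Z c p)"
      using add by (intro attainable_add C0') auto
    ultimately show ?case by (simp add: scaleR_add_right)
  next
    case (scale X r)
    consider "r = 0" | "r > 0" | "r < 0" by linarith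
    then show ?case
    proof cases
      case 1
      then show ?thesis using attainable_zero by simp
    next
      case 2
      then show ?thesis
        using attainable_cmul[OF conjunct1[OF scale.IH] 2] attainable_cmul[OF conjunct2[OF scale.IH] 2] by simp
    next
      case 3
      then have "0 < - r" by simp
      from attainable_cmul[OF conjunct1[OF scale.IH] this] attainable_cmul[OF conjunct2[OF scale.IH] this]
      show ?thesis by simp
    qed
  next
    case (bracket X Z)
    then have s: "smooth_field X" "smooth_field Z" using smooth_lie_algebra[OF assms(3)] by auto
    \<comment> \<open>Antisymmetry of the bracket supplies the reversed field.\<close>
    have "(\<lambda>c p. (-1) *\<^sub>R lie_bracket X Z c p) = lie_bracket Z X"
      by (simp add: fun_eq_iff lie_bracket_def)
    then show ?case
      using attainable_bracket[of f X Z] attainable_bracket[of f Z X] bracket s by simp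
  qed
  then show ?thesis ..
qed

end

section \<open>Flows of the control system\<close>

text \<open>On the unit interval the Lipschitz constant 1/2 makes the Picard operator a contraction
  in the supremum norm. As \<open>G\<close> is bounded and defined everywhere, the operator maps
  bounded functions to bounded functions.\<close>

lemma picard_unit_interval:
  fixes G :: "'a::euclidean_space \<Rightarrow> 'a"
  assumes Lip: "\<And>x y. norm (G x - G y) \<le> 1 / 2 * norm (x - y)" and bound: "\<And>x. norm (G x) \<le> b"
  shows "\<exists>y. y 0 = a \<and> (\<forall>t\<in>{0..1}. (y has_vector_derivative G (y t)) (at t within {0..1::real}))"
proof -
  \<comment> \<open>The clamped upper limit makes \<open>P u\<close> constant on either side of the
    unit interval, so that it lies in the complete space of bounded continuous functions on the
    line.\<close>
  define P :: "(real \<Rightarrow>\<^sub>C 'a) \<Rightarrow> real \<Rightarrow> 'a"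
    where "P u t = a + integral {0..max 0 (min 1 t)} (\<lambda>s. G (apply_bcontfun u s))" for u t
  have contG: "continuous_on S G" for S
  proof -
    have "(1 / 2)-lipschitz_on S G"
      using Lip by (intro lipschitz_onI) (auto simp: dist_norm)
    then show ?thesis by (rule lipschitz_on_continuous_on)
  qed
  have cont: "continuous_on {x..y} (\<lambda>s. G (apply_bcontfun u s))" for u x y
    by (rule continuous_on_compose2[OF contG[of UNIV]]) auto
  have bcont: "P u \<in> bcontfun" for u
  proof (rule bcontfun_normI)
    have "continuous_on {0..1} (\<lambda>t. integral {0..t} (\<lambda>s. G (apply_bcontfun u s)))"
      by (rule indefinite_integral_continuous_1[OF integrable_continuous_real[OF cont]])
    then have "continuous_on UNIV (\<lambda>t. integral {0..max 0 (min 1 t)} (\<lambda>s. G (apply_bcontfun u s)))"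
      by (rule continuous_on_compose2) (auto intro!: continuous_intros)
    then show "continuous_on UNIV (P u)" unfolding P_def by (intro continuous_intros)
    fix t :: real
    let ?t = "max 0 (min 1 t)"
    have b: "0 \<le> b" using order_trans[OF norm_ge_zero bound] .
    have "norm (integral {0..?t} (\<lambda>s. G (apply_bcontfun u s))) \<le> b * measure lborel (cbox 0 ?t)"
      using integrable_integral[OF integrable_continuous_real[OF cont]] bound b
      by (intro has_integral_bound) auto
    also have "\<dots> \<le> b" using b by (simp add: mult_left_le)
    finally show "norm (P u t) \<le> norm a + b"
      unfolding P_def by (meson add_left_mono norm_triangle_ineq order_trans)
  qed
  have "\<exists>!u. Bcontfun (P u) = u"
  proof (rule banach_fix_type[of "1 / 2"], simp, simp, intro allI dist_bound)
    fix u v :: "real \<Rightarrow>\<^sub>C 'a" and t :: real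
    let ?t = "max 0 (min 1 t)"
    have "norm (G (apply_bcontfun u s) - G (apply_bcontfun v s)) \<le> 1 / 2 * dist u v" for s
      using Lip[of "apply_bcontfun u s" "apply_bcontfun v s"] dist_bounded[of u s v] by (simp add: dist_norm)
    moreover have "((\<lambda>s. G (apply_bcontfun u s) - G (apply_bcontfun v s)) has_integral
        integral {0..?t} (\<lambda>s. G (apply_bcontfun u s)) - integral {0..?t} (\<lambda>s. G (apply_bcontfun v s))) (cbox 0 ?t)"
      using has_integral_diff[OF integrable_integral[OF integrable_continuous_real[OF cont]]
          integrable_integral[OF integrable_continuous_real[OF cont]]] by simp
    ultimately have "norm (integral {0..?t} (\<lambda>s. G (apply_bcontfun u s)) - integral {0..?t} (\<lambda>s. G (apply_bcontfun v s)))
        \<le> 1 / 2 * dist u v * measure lborel (cbox 0 ?t)"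
      by (intro has_integral_bound[where f = "\<lambda>s. G (apply_bcontfun u s) - G (apply_bcontfun v s)"]) auto
    also have "\<dots> \<le> 1 / 2 * dist u v" by (simp add: mult_left_le)
    finally show "dist (apply_bcontfun (Bcontfun (P u)) t) (apply_bcontfun (Bcontfun (P v)) t) \<le> 1 / 2 * dist u v"
      unfolding Bcontfun_inverse[OF bcont] P_def by (simp add: dist_norm)
  qed
  then obtain u where u: "Bcontfun (P u) = u" by blast
  let ?y = "apply_bcontfun u"
  have y: "?y t = P u t" for t using Bcontfun_inverse[OF bcont, of u] u by simp
  have "(?y has_vector_derivative G (?y t)) (at t within {0..1})" if t: "t \<in> {0..1}" for t
  proof (rule has_vector_derivative_transform[OF t])
    show "((\<lambda>t. a + integral {0..t} (\<lambda>s. G (?y s))) has_vector_derivative G (?y t)) (at t within {0..1})"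
      using has_vector_derivative_add[OF has_vector_derivative_const
          integral_has_vector_derivative[OF cont t], of a] by simp
    show "?y x = a + integral {0..x} (\<lambda>s. G (?y s))" if "x \<in> {0..1}" for x
      unfolding y[of x] using that by (simp add: P_def)
  qed
  moreover have "?y 0 = a" unfolding y by (simp add: P_def)
  ultimately show ?thesis by blast
qed

lemma norm_diff_le_of_vector_derivative:
  fixes y :: "real \<Rightarrow> 'a::real_inner"
  assumes "continuous_on {a..b} y" "a \<le> b" "\<And>t. a < t \<Longrightarrow> t < b \<Longrightarrow> (y has_vector_derivative y' t) (at t)"
    and "\<And>t. a < t \<Longrightarrow> t < b \<Longrightarrow> norm (y' t) \<le> B"
  shows "norm (y b - y a) \<le> (b - a) * B"
proof (cases "a = b")
  case False
  have "\<exists>t\<in>{a<..<b}. norm (y b - y a) \<le> norm ((b - a) *\<^sub>R y' t)"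
    using mvt_general[of a b y "\<lambda>t h. h *\<^sub>R y' t"] assms False by (auto simp: has_vector_derivative_def)
  then obtain t where "a < t" "t < b" "norm (y b - y a) \<le> norm ((b - a) *\<^sub>R y' t)" by auto
  moreover have "norm ((b - a) *\<^sub>R y' t) \<le> (b - a) * B"
    using assms(2) assms(4)[of t] \<open>a < t\<close> \<open>t < b\<close> by (simp add: mult_left_mono)
  ultimately show ?thesis by linarith
qed simp

context smooth_manifold
begin

lemma vector_derivative_change_chart:
  assumes "c \<in> A" "c' \<in> A" "y t \<in> crange c" "cinv c (y t) \<in> cdom c'"
    and y: "(y has_vector_derivative v) (at t)"
  shows "((\<lambda>s. cmap c' (cinv c (y s))) has_vector_derivative transition_deriv c c' (cinv c (y t)) v) (at t)"
proof -
  have "((cmap c' \<circ> cinv c) has_derivative transition_deriv c c' (cinv c (y t))) (at (y t))"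
    using transition_has_derivative[OF assms(1,2) cinv_in[OF assms(1,3)] assms(4)] cmap_cinv[OF assms(1,3)] by simp
  then have "((cmap c' \<circ> cinv c) has_derivative transition_deriv c c' (cinv c (y t))) (at (y t) within y ` UNIV)"
    by (rule has_derivative_at_withinI)
  from vector_derivative_diff_chain_within[OF y this] show ?thesis by (simp add: o_def)
qed

text \<open>The field is controlled on a coordinate ball only. Composition with the closest point
  projection onto the ball extends it to the whole space with the same bound and Lipschitz constant.
  The solution moves by at most \<open>h * B \<le> r\<close>, so it stays where the projection is
  the identity.\<close>

lemma local_flow:
  assumes X: "is_vector_field A X" and v: "control_field f (\<lambda>_. v) = (\<lambda>t c p. h *\<^sub>R X c p)"
    and c: "c \<in> A" "p \<in> cdom c" "cball (cmap c p) r \<subseteq> crange c" "0 \<le> r"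
    and B: "\<And>z. z \<in> cball (cmap c p) r \<Longrightarrow> norm (X c (cinv c z)) \<le> B"
    and L: "\<And>z z'. z \<in> cball (cmap c p) r \<Longrightarrow> z' \<in> cball (cmap c p) r \<Longrightarrow>
      norm (X c (cinv c z) - X c (cinv c z')) \<le> L * norm (z - z')"
    and h: "0 \<le> h" "h * B \<le> r" "h * L \<le> 1 / 2" "0 \<le> L"
  shows "\<exists>x. continuous_on {0..1} x \<and> x 0 = p \<and>
    (\<forall>t\<in>{0..1}. x t \<in> cdom c \<and> norm (cmap c (x t) - cmap c p) \<le> h * B) \<and>
    (\<forall>t\<in>{0<..<1}. \<forall>c'\<in>A. x t \<in> cdom c' \<longrightarrow>
        ((\<lambda>s. cmap c' (x s)) has_vector_derivative control_field f (\<lambda>_. v) t c' (x t)) (at t))"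
proof -
  let ?x0 = "cmap c p" and ?K = "cball (cmap c p) r"
  define \<pi> where "\<pi> = closest_point ?K"
  have K: "convex ?K" "closed ?K" "?K \<noteq> {}" using c(4) by auto
  have \<pi>: "\<pi> z \<in> ?K" for z unfolding \<pi>_def by (rule closest_point_in_set[OF K(2,3)])
  define G where "G z = h *\<^sub>R X c (cinv c (\<pi> z))" for z
  have lip: "norm (G z - G z') \<le> 1 / 2 * norm (z - z')" for z z'
  proof -
    have "norm (G z - G z') = h * norm (X c (cinv c (\<pi> z)) - X c (cinv c (\<pi> z')))"
      unfolding G_def using h(1) by (simp flip: scaleR_diff_right)
    also have "\<dots> \<le> h * (L * norm (\<pi> z - \<pi> z'))" using L[OF \<pi> \<pi>] h(1) by (intro mult_left_mono)
    also have "\<dots> \<le> h * (L * norm (z - z'))"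
      using closest_point_lipschitz[OF K, of z z'] h(1,4) unfolding \<pi>_def
      by (intro mult_left_mono) (auto simp: dist_norm)
    also have "\<dots> \<le> 1 / 2 * norm (z - z')"
      unfolding mult.assoc[symmetric] using h(3) by (intro mult_right_mono) auto
    finally show ?thesis .
  qed
  have bound: "norm (G z) \<le> h * B" for z
    unfolding G_def using B[OF \<pi>] h(1) by (simp add: mult_left_mono)
  obtain y where y: "y 0 = ?x0" "\<And>t. t \<in> {0..1} \<Longrightarrow> (y has_vector_derivative G (y t)) (at t within {0..1::real})"
    using picard_unit_interval[OF lip bound, of ?x0] by blast
  have cont: "continuous_on {0..1} y"
    using has_vector_derivative_continuous[OF y(2)] by (simp add: continuous_on_eq_continuous_within)
  have der: "(y has_vector_derivative G (y t)) (at t)" if "t \<in> {0<..<1}" for t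
    using y(2)[of t] that at_within_interior[of t "{0..1}"] by auto
  have near: "norm (y t - ?x0) \<le> h * B" if t: "t \<in> {0..1}" for t
  proof -
    have "norm (y t - y 0) \<le> (t - 0) * (h * B)"
      using t bound der
      by (intro norm_diff_le_of_vector_derivative[of _ _ _ "\<lambda>t. G (y t)"] continuous_on_subset[OF cont]) auto
    also have "\<dots> \<le> h * B" using t order_trans[OF norm_ge_zero bound] by (simp add: mult_left_le_one_le)
    finally show ?thesis using y(1) by simp
  qed
  have inK: "y t \<in> ?K" if "t \<in> {0..1}" for t
    using near[OF that] h(2) by (simp add: dist_norm norm_minus_commute)
  then have inc: "y t \<in> crange c" if "t \<in> {0..1}" for t using c(3) that by blast
  define x where "x t = cinv c (y t)" for t
  have "continuous_on {0..1} x"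
    unfolding x_def by (rule continuous_on_compose2[OF continuous_cinv[OF c(1)] cont]) (use inc in auto)
  moreover have "x 0 = p" unfolding x_def y(1) by (rule cinv_cmap[OF c(1,2)])
  moreover have "x t \<in> cdom c \<and> norm (cmap c (x t) - cmap c p) \<le> h * B" if "t \<in> {0..1}" for t
    unfolding x_def using cinv_in[OF c(1) inc[OF that]] cmap_cinv[OF c(1) inc[OF that]] near[OF that] by simp
  moreover have "((\<lambda>s. cmap c' (x s)) has_vector_derivative control_field f (\<lambda>_. v) t c' (x t)) (at t)"
    if t: "t \<in> {0<..<1}" and c': "c' \<in> A" "x t \<in> cdom c'" for t c'
  proof -
    have t': "t \<in> {0..1}" using t by simp
    have xt: "x t \<in> cdom c" unfolding x_def by (rule cinv_in[OF c(1) inc[OF t']])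
    have "\<pi> (y t) = y t" unfolding \<pi>_def by (rule closest_point_self[OF inK[OF t']])
    then have "G (y t) = h *\<^sub>R X c (x t)" by (simp add: G_def x_def)
    moreover have "transition_deriv c c' (x t) (X c (x t)) = X c' (x t)"
      using X xt c c' unfolding is_vector_field_def by fastforce
    ultimately have "transition_deriv c c' (x t) (G (y t)) = control_field f (\<lambda>_. v) t c' (x t)"
      using linear_cmul[OF linear_transition_deriv[OF c(1) c'(1) xt c'(2)]] v by simp
    then show ?thesis
      using vector_derivative_change_chart[OF c(1) c'(1) inc[OF t'] _ der[OF t]] c'(2) unfolding x_def by simp
  qed
  ultimately show ?thesis by blast
qed

section \<open>Attainability of the generators\<close>

lemma cells_change_near:
  assumes S: "cell_family S" and S': "cell_family S'" and e: "0 < e"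
  shows "\<exists>d>0. \<forall>(c, D)\<in>S. \<forall>(c', D')\<in>S'. \<forall>p q. p \<in> cell c D \<longrightarrow> p \<in> cell c' D' \<longrightarrow> q \<in> cdom c \<longrightarrow>
    norm (cmap c q - cmap c p) \<le> d \<longrightarrow> q \<in> cdom c' \<and> norm (cmap c' q - cmap c' p) \<le> e"
proof -
  have "\<forall>\<^sub>F d in at_right 0. \<forall>s\<in>S. \<forall>s'\<in>S'. \<forall>p q. p \<in> cell (fst s) (snd s) \<longrightarrow> p \<in> cell (fst s') (snd s') \<longrightarrow>
      q \<in> cdom (fst s) \<longrightarrow> norm (cmap (fst s) q - cmap (fst s) p) \<le> d \<longrightarrow>
      q \<in> cdom (fst s') \<and> norm (cmap (fst s') q - cmap (fst s') p) \<le> e"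
  proof (rule eventually_ball_finite[OF cell_familyD(4)[OF S]], rule ballI,
      rule eventually_ball_finite[OF cell_familyD(4)[OF S']], rule ballI)
    fix s s' assume "s \<in> S" "s' \<in> S'"
    then have "(fst s, snd s) \<in> S" "(fst s', snd s') \<in> S'" by auto
    then show "\<forall>\<^sub>F d in at_right 0. \<forall>p q. p \<in> cell (fst s) (snd s) \<longrightarrow> p \<in> cell (fst s') (snd s') \<longrightarrow>
      q \<in> cdom (fst s) \<longrightarrow> norm (cmap (fst s) q - cmap (fst s) p) \<le> d \<longrightarrow>
      q \<in> cdom (fst s') \<and> norm (cmap (fst s') q - cmap (fst s') p) \<le> e"
      using cell_familyD(1-3)[OF S] cell_familyD(1-3)[OF S'] e by (intro chart_change_near)
  qed
  from ex_small_positive[OF this] show ?thesis by (simp add: split_beta)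
qed

text \<open>A constant control runs \<open>h\<close> times the field for unit time. The solution is
  constructed in one chart around \<open>p\<close>, while the estimate is required in all charts of
  the family whose cells contain \<open>p\<close>, with a common step size.\<close>

lemma attainable_generator:
  assumes X: "C1_field X" "is_vector_field A X"
    and v: "\<And>h. \<exists>v. control_field f (\<lambda>_. v) = (\<lambda>t c p. h *\<^sub>R X c p)"
  shows "attainable f X"
  unfolding attainable_def
proof (intro allI impI)
  fix S and e :: real assume S: "cell_family S" and e: "0 < e"
  obtain r where r: "r > 0" "cell_family (enlarge r S)"
    using ex_small_positive[OF eventually_cell_family_enlarge[OF S]] by blast
  have "\<forall>\<^sub>F b in at_top. 0 \<le> b \<and> (\<forall>(c, D)\<in>enlarge r S. \<forall>p\<in>cell c D. norm (X c p) \<le> b) \<and>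
      (\<forall>(c, D)\<in>enlarge r S. \<forall>p\<in>cell c D. \<forall>v. norm (chart_deriv c (X c) p v) \<le> b * norm v)"
    by (intro eventually_conj eventually_ge_at_top field_bound[OF C1_field_C0[OF X(1)] r(2)]
        field_deriv_bound[OF X(1) r(2)])
  then obtain B where B: "0 \<le> B" "\<forall>(c, D)\<in>S. \<forall>p\<in>cell c (thicken r D). norm (X c p) \<le> B"
    "\<forall>(c, D)\<in>S. \<forall>p\<in>cell c (thicken r D). \<forall>v. norm (chart_deriv c (X c) p v) \<le> B * norm v"
    unfolding mem_enlarge by (auto dest!: eventually_happens)
  obtain e' where e': "e' > 0" "\<forall>(c, D)\<in>S. \<forall>p\<in>cell c D. \<forall>q\<in>cdom c.
      norm (cmap c q - cmap c p) \<le> e' \<longrightarrow> norm (X c q - X c p) \<le> e"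
    using ex_small_positive[OF field_uniformly_continuous[OF C1_field_C0[OF X(1)] S e]]
    by (elim exE conjE) (rule that)
  \<comment> \<open>A path within \<open>d\<close> of \<open>p\<close> in the chart of construction
    is within \<open>e'\<close> of it in every other relevant chart, where the field then changes by
    at most \<open>e\<close>.\<close>
  obtain d where d: "d > 0" "\<forall>(c, D)\<in>S. \<forall>(c', D')\<in>S. \<forall>p q. p \<in> cell c D \<longrightarrow> p \<in> cell c' D' \<longrightarrow> q \<in> cdom c \<longrightarrow>
      norm (cmap c q - cmap c p) \<le> d \<longrightarrow> q \<in> cdom c' \<and> norm (cmap c' q - cmap c' p) \<le> e'"
    using cells_change_near[OF S S e'(1)] by (elim exE conjE) (rule that)
  have "\<forall>\<^sub>F h in at_right 0. 0 < h \<and> h * B \<le> r \<and> h * B \<le> d \<and> h * B \<le> 1 / 2"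
    using r(1) d(1) by (intro eventually_conj eventually_small_mult eventually_at_right_less) auto
  then show "\<forall>\<^sub>F h in at_right 0. \<exists>w. steers f w S
      (\<lambda>c p q. norm (cmap c q - cmap c p - h *\<^sub>R X c p) \<le> h * e)"
  proof eventually_elim
    case (elim h)
    obtain v where v: "control_field f (\<lambda>_. v) = (\<lambda>t c p. h *\<^sub>R X c p)" using assms(3) by blast
    have "steers f [v] S (\<lambda>c p q. norm (cmap c q - cmap c p - h *\<^sub>R X c p) \<le> h * e)"
      unfolding steers_def
    proof
      fix p assume "p \<in> cells_union S"
      then obtain c D where cD: "(c, D) \<in> S" "p \<in> cell c D" by (auto simp: mem_cells_union)
      have c: "c \<in> A" "p \<in> cdom c" "cmap c p \<in> D"
        using cell_familyD(1)[OF S cD(1)] cD(2) by (auto simp: cell_def)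
      have ball: "cball (cmap c p) r \<subseteq> thicken r D" using c(3) by (auto simp: thicken_def)
      have "(c, thicken r D) \<in> enlarge r S" using cD(1) by (force simp: enlarge_def)
      then have thick: "thicken r D \<subseteq> crange c" using cell_familyD(3)[OF r(2)] by blast
      have mem: "cinv c z \<in> cell c (thicken r D)" if "z \<in> cball (cmap c p) r" for z
        using that ball thick cinv_in[OF c(1)] cmap_cinv[OF c(1)] by (force simp: cell_def)
      have bound: "norm (X c (cinv c z)) \<le> B" if "z \<in> cball (cmap c p) r" for z
        using B(2) mem[OF that] cD(1) by blast
      have lip: "norm (X c (cinv c z) - X c (cinv c z')) \<le> B * norm (z - z')"
        if "z \<in> cball (cmap c p) r" "z' \<in> cball (cmap c p) r" for z z'
      proof (rule Lipschitz_on_convex[OF convex_cball _ _ that])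
        fix x assume x: "x \<in> cball (cmap c p) r"
        have xc: "cmap c (cinv c x) = x" using x ball thick cmap_cinv[OF c(1)] by blast
        show "((\<lambda>x. X c (cinv c x)) has_derivative chart_deriv c (X c) (cinv c x)) (at x)"
          using C1_field_has_derivative[OF X(1) c(1), of "cinv c x"] mem[OF x] xc by (simp add: cell_def)
        show "norm (chart_deriv c (X c) (cinv c x) v) \<le> B * norm v" for v
          using B(3) mem[OF x] cD(1) by blast
      qed
      have hB: "0 \<le> h" "h * B \<le> r" "h * B \<le> 1 / 2" "0 \<le> r" "h * B \<le> d" using elim r(1) by auto
      have "\<exists>x. continuous_on {0..1} x \<and> x 0 = p \<and>
        (\<forall>t\<in>{0..1}. x t \<in> cdom c \<and> norm (cmap c (x t) - cmap c p) \<le> h * B) \<and>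
        (\<forall>t\<in>{0<..<1}. \<forall>c'\<in>A. x t \<in> cdom c' \<longrightarrow>
          ((\<lambda>s. cmap c' (x s)) has_vector_derivative control_field f (\<lambda>_. v) t c' (x t)) (at t))"
        by (rule local_flow[OF X(2) v c(1,2) subset_trans[OF ball thick] hB(4) bound lip hB(1,2,3) B(1)])
      then obtain x where x: "continuous_on {0..1} x" "x 0 = p"
        "\<forall>t\<in>{0..1}. x t \<in> cdom c \<and> norm (cmap c (x t) - cmap c p) \<le> h * B"
        "\<forall>t\<in>{0<..<1}. \<forall>c'\<in>A. x t \<in> cdom c' \<longrightarrow>
          ((\<lambda>s. cmap c' (x s)) has_vector_derivative control_field f (\<lambda>_. v) t c' (x t)) (at t)"
        by (elim exE conjE) (rule that)
      have "step f v p (x 1)" unfolding step_def using x(1,2,4) by blast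
      moreover have "x 1 \<in> cdom c' \<and> norm (cmap c' (x 1) - cmap c' p - h *\<^sub>R X c' p) \<le> h * e"
        if cD': "(c', D') \<in> S" "p \<in> cell c' D'" for c' D'
      proof -
        have c': "c' \<in> A" using cell_familyD(1)[OF S cD'(1)] .
        have in': "x t \<in> cdom c' \<and> norm (cmap c' (x t) - cmap c' p) \<le> e'" if "t \<in> {0..1}" for t
        proof -
          have "x t \<in> cdom c" "norm (cmap c (x t) - cmap c p) \<le> d" using bspec[OF x(3) that] hB(5) by auto
          then show ?thesis using d(2) cD cD' by blast
        qed
        \<comment> \<open>The deviation from the line with the initial velocity; its derivative is
          \<open>h\<close> times the change of the field along the path.\<close>
        let ?\<psi> = "\<lambda>t. cmap c' (x t) - t *\<^sub>R (h *\<^sub>R X c' p)"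
        have "norm (?\<psi> 1 - ?\<psi> 0) \<le> (1 - 0) * (h * e)"
        proof (rule norm_diff_le_of_vector_derivative)
          have "continuous_on {0..1} (\<lambda>t. cmap c' (x t))"
            by (rule continuous_on_compose2[OF continuous_cmap[OF c'] x(1)]) (use in' in auto)
          then show "continuous_on {0..1} ?\<psi>" by (intro continuous_intros)
          fix t :: real assume t: "0 < t" "t < 1"
          then have "((\<lambda>s. cmap c' (x s)) has_vector_derivative h *\<^sub>R X c' (x t)) (at t)"
            using bspec[OF x(4), of t] c' in'[of t] unfolding v by simp
          then show "(?\<psi> has_vector_derivative h *\<^sub>R X c' (x t) - h *\<^sub>R X c' p) (at t)"
            by (intro has_vector_derivative_diff) (auto intro!: derivative_eq_intros)
          have "norm (X c' (x t) - X c' p) \<le> e" using e'(2) cD' in'[of t] t by fastforce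
          then show "norm (h *\<^sub>R X c' (x t) - h *\<^sub>R X c' p) \<le> h * e"
            using elim by (simp flip: scaleR_diff_right)
        qed simp
        then show ?thesis using in'[of 1] x(2) by (simp add: algebra_simps)
      qed
      ultimately show "\<exists>q. reach f [v] p q \<and> (\<forall>(c, D)\<in>S. p \<in> cell c D \<longrightarrow>
          q \<in> cdom c \<and> norm (cmap c q - cmap c p - h *\<^sub>R X c p) \<le> h * e)"
        by auto
    qed
    then show ?case by blast
  qed
qed

lemma control_field_axis:
  "control_field f (\<lambda>_. h *\<^sub>R axis j 1) = (\<lambda>t c p. h *\<^sub>R f j c p)"
proof -
  have "(\<Sum>i\<in>UNIV. ((h *\<^sub>R axis j 1) $ i) *\<^sub>R f i c p) = (\<Sum>i\<in>UNIV. if i = j then h *\<^sub>R f j c p else 0)" for c p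
    by (rule sum.cong) (auto simp: axis_def)
  then show ?thesis by (simp add: control_field_def fun_eq_iff)
qed

lemma is_vector_field_cmul:
  assumes "is_vector_field A X" shows "is_vector_field A (\<lambda>c p. r *\<^sub>R X c p)"
  unfolding is_vector_field_def
proof (intro ballI)
  fix c c' p assume c: "c \<in> A" "c' \<in> A" "p \<in> cdom c \<inter> cdom c'"
  then have "X c' p = transition_deriv c c' p (X c p)"
    using assms unfolding is_vector_field_def by blast
  then show "r *\<^sub>R X c' p = transition_deriv c c' p (r *\<^sub>R X c p)"
    using linear_cmul[OF linear_transition_deriv[of c c' p]] c by simp
qed

lemma smooth_vector_fieldD:
  "smooth_vector_field A X \<Longrightarrow> smooth_field X" "smooth_vector_field A X \<Longrightarrow> is_vector_field A X"
  unfolding smooth_vector_field_def smooth_field_def by auto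

lemma smooth_lie_algebra_attainable:
  assumes "\<And>j. smooth_vector_field A (f j)" "X \<in> lie_algebra f"
  shows "attainable f X"
proof (rule lie_algebra_attainable[OF _ _ smooth_vector_fieldD(1)[OF assms(1)] assms(2)])
  fix j
  note s = smooth_field_C1[OF smooth_vector_fieldD(1)[OF assms(1)], of j] smooth_vector_fieldD(2)[OF assms(1), of j]
  show "attainable f (f j)"
    by (rule attainable_generator[OF s]) (use control_field_axis in blast)
  show "attainable f (\<lambda>c p. (-1) *\<^sub>R f j c p)"
  proof (rule attainable_generator[OF C1_field_cmul[OF s(1)] is_vector_field_cmul[OF s(2)]])
    show "\<exists>v. control_field f (\<lambda>_. v) = (\<lambda>t c p. h *\<^sub>R (-1) *\<^sub>R f j c p)" for h
      using control_field_axis[of f "- h" j] by (intro exI[of _ "(- h) *\<^sub>R axis j 1"]) simp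
  qed
qed

end

section \<open>Words of controls played as admissible controls\<close>

context smooth_manifold
begin

lemma reach_path:
  assumes "reach f w p q"
  shows "\<exists>x. continuous_on {0..real (length w)} x \<and> x 0 = p \<and> x (real (length w)) = q \<and>
    (\<forall>i<length w. \<forall>t\<in>{real i<..<real i + 1}. \<forall>c\<in>A. x t \<in> cdom c \<longrightarrow>
      ((\<lambda>s. cmap c (x s)) has_vector_derivative control_field f (\<lambda>_. w ! i) t c (x t)) (at t))"
  using assms
proof (induction w arbitrary: p)
  case Nil
  then show ?case by (intro exI[of _ "\<lambda>_. p"]) auto
next
  case (Cons v w)
  then obtain r where r: "step f v p r" "reach f w r q" by auto
  obtain y where y: "continuous_on {0..1} y" "y 0 = p" "y 1 = r"
    "\<And>t c. t \<in> {0<..<1} \<Longrightarrow> c \<in> A \<Longrightarrow> y t \<in> cdom c \<Longrightarrow>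
      ((\<lambda>s. cmap c (y s)) has_vector_derivative control_field f (\<lambda>_. v) t c (y t)) (at t)"
    using r(1) unfolding step_def by blast
  obtain z where z: "continuous_on {0..real (length w)} z" "z 0 = r" "z (real (length w)) = q"
    and z': "\<And>i t c. i < length w \<Longrightarrow> t \<in> {real i<..<real i + 1} \<Longrightarrow> c \<in> A \<Longrightarrow> z t \<in> cdom c \<Longrightarrow>
      ((\<lambda>s. cmap c (z s)) has_vector_derivative control_field f (\<lambda>_. w ! i) t c (z t)) (at t)"
    using Cons.IH[OF r(2)] by blast
  define x where "x t = (if t \<le> 1 then y t else z (t - 1))" for t
  have "continuous_on ({0..1} \<union> {1..1 + real (length w)}) x"
    unfolding x_def
  proof (rule continuous_on_cases)
    show "continuous_on {1..1 + real (length w)} (\<lambda>t. z (t - 1))"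
      by (rule continuous_on_compose2[OF z(1)]) (auto intro!: continuous_intros)
  qed (use y z in auto)
  moreover have "{0..1} \<union> {1..1 + real (length w)} = {0..real (length (v # w))}" by auto
  moreover have "x 0 = p" "x (real (length (v # w))) = q"
    using y z by (auto simp: x_def)
  moreover have "((\<lambda>s. cmap c (x s)) has_vector_derivative control_field f (\<lambda>_. (v # w) ! i) t c (x t)) (at t)"
    if i: "i < length (v # w)" and t: "t \<in> {real i<..<real i + 1}" and c: "c \<in> A" "x t \<in> cdom c" for i t c
  proof (cases i)
    case 0
    then have t1: "t \<in> {0<..<1}" "x t = y t" using t by (auto simp: x_def)
    have "((\<lambda>s. cmap c (y s)) has_vector_derivative control_field f (\<lambda>_. v) t c (y t)) (at t)"
      using y(4)[OF t1(1) c(1)] c(2) t1(2) by simp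
    then have "((\<lambda>s. cmap c (x s)) has_vector_derivative control_field f (\<lambda>_. v) t c (y t)) (at t)"
      by (rule has_vector_derivative_transform_within_open[where S = "{0<..<1}"])
        (use t1 in \<open>auto simp: x_def\<close>)
    then show ?thesis using t1(2) 0 by simp
  next
    case (Suc k)
    then have t1: "1 < t" "x t = z (t - 1)" using t by (auto simp: x_def)
    have "((\<lambda>s. cmap c (z s)) has_vector_derivative control_field f (\<lambda>_. w ! k) (t - 1) c (z (t - 1))) (at (t - 1))"
      by (rule z') (use i t c Suc t1 in auto)
    moreover have "((\<lambda>s. s - 1) has_vector_derivative 1) (at t)"
      by (auto intro!: derivative_eq_intros)
    ultimately have "((\<lambda>s. cmap c (z (s - 1))) has_vector_derivative control_field f (\<lambda>_. w ! k) t c (z (t - 1))) (at t)"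
      using vector_diff_chain_at[of "\<lambda>s. s - 1" 1 t "\<lambda>s. cmap c (z s)"] by (simp add: o_def control_field_def)
    then have "((\<lambda>s. cmap c (x s)) has_vector_derivative control_field f (\<lambda>_. w ! k) t c (z (t - 1))) (at t)"
      by (rule has_vector_derivative_transform_within_open[where S = "{1<..}"])
        (use t1 in \<open>auto simp: x_def\<close>)
    then show ?thesis using t1(2) Suc by simp
  qed
  ultimately show ?case by (intro exI[of _ x]) auto
qed

text \<open>
  A word of unit-time controls is played on \<open>[0,T]\<close> at constant speed. Since the system is
  linear in the control, the duration of a word is irrelevant.
\<close>

definition word_control :: "real \<Rightarrow> (real ^ 'k) list \<Rightarrow> real \<Rightarrow> real ^ 'k" where
  "word_control T w t = (let k = real (length w) / T; i = nat \<lfloor>t * k\<rfloor> in if i < length w then k *\<^sub>R w ! i else 0)"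

lemma admissible_word_control: "admissible_control T (word_control T w)"
proof -
  let ?k = "real (length w) / T"
  define F where "F i = (if i < length w then ?k *\<^sub>R w ! i else 0)" for i
  have eq: "word_control T w = (\<lambda>t. F (nat \<lfloor>t * ?k\<rfloor>))"
    by (simp add: word_control_def F_def Let_def fun_eq_iff)
  \<comment> \<open>A function of the integer part: every map out of the discrete natural numbers is
    measurable.\<close>
  have "(\<lambda>t. F (nat \<lfloor>t * ?k\<rfloor>)) \<in> borel_measurable borel" by measurable
  then have "(\<lambda>t. F (nat \<lfloor>t * ?k\<rfloor>)) \<in> borel_measurable lborel" by simp
  then have "word_control T w \<in> borel_measurable (lebesgue_on {0..T})"
    unfolding eq by (intro measurable_restrict_space1 measurable_completion)
  moreover have "norm (word_control T w t) \<le> (\<Sum>i<length w. norm (?k *\<^sub>R w ! i))" for t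
    unfolding eq F_def by (auto intro!: member_le_sum[of _ _ "\<lambda>i. norm (?k *\<^sub>R w ! i)"] sum_nonneg simp del: norm_scaleR)
  ultimately show ?thesis unfolding admissible_control_def by blast
qed

text \<open>The rescaled path solves the equation except at the finitely many switching times, which
  the fundamental theorem of calculus tolerates. The word is nonempty so that the speed
  \<open>k\<close> is positive.\<close>

lemma reach_flow_value:
  assumes "reach f w p q" "w \<noteq> []" "0 < T"
  shows "flow_value A (control_field f (word_control T w)) T p q"
proof -
  define n where "n = length w"
  define k where "k = real n / T"
  have n: "0 < n" and k: "0 < k" "T * k = real n" using assms(2,3) by (auto simp: n_def k_def)
  obtain x where x: "continuous_on {0..real n} x" "x 0 = p" "x (real n) = q"
    and x': "\<And>i t c. i < n \<Longrightarrow> t \<in> {real i<..<real i + 1} \<Longrightarrow> c \<in> A \<Longrightarrow> x t \<in> cdom c \<Longrightarrow>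
      ((\<lambda>s. cmap c (x s)) has_vector_derivative control_field f (\<lambda>_. w ! i) t c (x t)) (at t)"
    using reach_path[OF assms(1)] unfolding n_def by blast
  define y where "y t = x (t * k)" for t
  have range: "t * k \<in> {0..real n}" if "t \<in> {0..T}" for t
    using that k mult_right_mono[of t T k] by auto
  have cont: "continuous_on {0..T} y"
    unfolding y_def by (rule continuous_on_compose2[OF x(1)]) (use range in \<open>auto intro!: continuous_intros\<close>)
  have "((\<lambda>t. control_field f (word_control T w) t c (y t)) has_integral cmap c (y b) - cmap c (y a)) {a..b}"
    if c: "c \<in> A" and ab: "0 \<le> a" "a \<le> b" "b \<le> T" "y ` {a..b} \<subseteq> cdom c" for c a b
  proof (rule fundamental_theorem_of_calculus_interior_strong[of "(\<lambda>i. real i / k) ` {..n}"])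
    show "continuous_on {a..b} (\<lambda>t. cmap c (y t))"
      by (rule continuous_on_compose2[OF continuous_cmap[OF c] continuous_on_subset[OF cont]]) (use ab in auto)
    fix t assume t: "t \<in> {a<..<b} - (\<lambda>i. real i / k) ` {..n}"
    define i where "i = nat \<lfloor>t * k\<rfloor>"
    have pos: "0 < t * k" using t ab k(1) by simp
    have "t * k < T * k" using t ab k(1) by (intro mult_strict_right_mono) auto
    moreover have i: "real i \<le> t * k" "t * k < real i + 1" using pos unfolding i_def by linarith+
    ultimately have "i < n" using k(2) by linarith
    moreover have "real i \<noteq> t * k"
    proof
      assume "real i = t * k"
      then have "t = real i / k" using k(1) by simp
      then show False using t \<open>i < n\<close> by auto
    qed
    ultimately have "((\<lambda>s. cmap c (x s)) has_vector_derivative control_field f (\<lambda>_. w ! i) (t * k) c (x (t * k))) (at (t * k))"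
      using i c ab(4) t unfolding y_def by (intro x') auto
    moreover have "((\<lambda>s. s * k) has_vector_derivative k) (at t)"
      by (auto intro!: derivative_eq_intros)
    ultimately have "((\<lambda>s. cmap c (x (s * k))) has_vector_derivative
        k *\<^sub>R control_field f (\<lambda>_. w ! i) (t * k) c (x (t * k))) (at t)"
      using vector_diff_chain_at[of "\<lambda>s. s * k" k t "\<lambda>s. cmap c (x s)"] by (simp add: o_def)
    moreover have "k *\<^sub>R control_field f (\<lambda>_. w ! i) (t * k) c (x (t * k)) = control_field f (word_control T w) t c (y t)"
      using \<open>i < n\<close> unfolding control_field_def word_control_def y_def Let_def
      by (simp add: scaleR_sum_right flip: n_def k_def i_def)
    ultimately show "((\<lambda>t. cmap c (y t)) has_vector_derivative control_field f (word_control T w) t c (y t)) (at t)"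
      unfolding y_def by simp
  qed (use ab in auto)
  then have "trajectory A (control_field f (word_control T w)) T y"
    using cont unfolding trajectory_def by blast
  moreover have "y 0 = p" "y T = q" using x(2,3) k(2) by (auto simp: y_def)
  ultimately show ?thesis unfolding flow_value_def by blast
qed

end

section \<open>The metric in charts\<close>

locale riemannian = smooth_manifold A
  for A :: "('m::t2_space, 'e::euclidean_space) chart set" +
  fixes g :: "('m, 'e) metric_tensor"
  assumes metric: "riemannian_metric A g"
begin

lemma
  assumes "c \<in> A" "p \<in> cdom c"
  shows metric_bilinear: "bilinear (g c p)" and metric_sym: "g c p v w = g c p w v"
    and metric_pos: "v \<noteq> 0 \<Longrightarrow> 0 < g c p v v"
proof -
  have "\<forall>c\<in>A. \<forall>p\<in>cdom c. bilinear (g c p) \<and> (\<forall>v w. g c p v w = g c p w v) \<and> (\<forall>v. v \<noteq> 0 \<longrightarrow> 0 < g c p v v)"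
    using metric unfolding riemannian_metric_def by (elim conjE)
  then have "bilinear (g c p) \<and> (\<forall>v w. g c p v w = g c p w v) \<and> (\<forall>v. v \<noteq> 0 \<longrightarrow> 0 < g c p v v)"
    using assms by (elim ballE) auto
  then show "bilinear (g c p)" "g c p v w = g c p w v" "v \<noteq> 0 \<Longrightarrow> 0 < g c p v v" by simp_all
qed

lemma metric_change:
  assumes "c \<in> A" "c' \<in> A" "p \<in> cdom c" "p \<in> cdom c'"
  shows "g c p v w = g c' p (transition_deriv c c' p v) (transition_deriv c c' p w)"
proof -
  have "\<forall>c\<in>A. \<forall>c'\<in>A. \<forall>p\<in>cdom c \<inter> cdom c'. \<forall>v w.
      g c p v w = g c' p (transition_deriv c c' p v) (transition_deriv c c' p w)"
    using metric unfolding riemannian_metric_def by (elim conjE)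
  then show ?thesis using assms by blast
qed

lemma metric_smooth: "c \<in> A \<Longrightarrow> smooth_on (crange c) (\<lambda>x. g c (cinv c x) v w)"
  using metric unfolding riemannian_metric_def by (elim conjE) blast

lemma metric_nonneg: "c \<in> A \<Longrightarrow> p \<in> cdom c \<Longrightarrow> 0 \<le> g c p v v"
  using metric_pos[of c p v] bilinear_lzero[OF metric_bilinear[of c p]] by (cases "v = 0") auto

lemma gnorm_nonneg: "c \<in> A \<Longrightarrow> p \<in> cdom c \<Longrightarrow> 0 \<le> gnorm g c p v"
  unfolding gnorm_def using metric_nonneg by simp

lemma gnorm_scaleR: "c \<in> A \<Longrightarrow> p \<in> cdom c \<Longrightarrow> gnorm g c p (r *\<^sub>R v) = \<bar>r\<bar> * gnorm g c p v"
  unfolding gnorm_def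
  by (simp add: bilinear_lmul[OF metric_bilinear] bilinear_rmul[OF metric_bilinear] real_sqrt_mult flip: mult.assoc)

lemma gnorm_change:
  assumes "c \<in> A" "c' \<in> A" "p \<in> cdom c" "p \<in> cdom c'"
  shows "gnorm g c' p (transition_deriv c c' p v) = gnorm g c p v"
  unfolding gnorm_def using metric_change[OF assms] by simp

lemma bilinear_basis_expansion:
  fixes b :: "'e \<Rightarrow> 'e \<Rightarrow> real"
  assumes "bilinear b"
  shows "b v w = (\<Sum>i\<in>Basis. \<Sum>j\<in>Basis. (v \<bullet> i) * (w \<bullet> j) * b i j)"
proof -
  have l: "linear (\<lambda>v. b v w)" "linear (\<lambda>w. b v w)" for v w
    using assms unfolding bilinear_def by auto
  have "b v w = (\<Sum>i\<in>Basis. (v \<bullet> i) * b i w)"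
    using linear_basis_expansion[OF l(1), of v] by simp
  also have "\<dots> = (\<Sum>i\<in>Basis. (v \<bullet> i) * (\<Sum>j\<in>Basis. (w \<bullet> j) * b i j))"
    using linear_basis_expansion[OF l(2), of _ w] by simp
  finally show ?thesis by (simp add: sum_distrib_left mult_ac)
qed

lemma metric_continuous:
  assumes "c \<in> A"
  shows "continuous_on (crange c \<times> UNIV) (\<lambda>(x, v). g c (cinv c x) v v)"
proof -
  have "continuous_on (crange c \<times> UNIV)
      (\<lambda>z. \<Sum>i\<in>Basis. \<Sum>j\<in>Basis. (snd z \<bullet> i) * (snd z \<bullet> j) * g c (cinv c (fst z)) i j)"
  proof (intro continuous_intros)
    fix i j :: 'e
    have "continuous_on (crange c) (\<lambda>x. g c (cinv c x) i j)"
      using smooth_onD[OF metric_smooth[OF assms], of 0] by simp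
    then show "continuous_on (crange c \<times> UNIV) (\<lambda>z. g c (cinv c (fst z)) i j)"
      by (rule continuous_on_compose2) (auto intro!: continuous_intros)
  qed
  then show ?thesis
    by (rule continuous_on_eq)
      (auto simp: bilinear_basis_expansion[OF metric_bilinear[OF assms cinv_in[OF assms]]])
qed

text \<open>The quadratic form is continuous and positive on the compact product of \<open>D\<close>
  and the unit sphere; homogeneity extends the bounds to all vectors.\<close>

lemma gnorm_bounds:
  assumes c: "c \<in> A" and D: "compact D" "D \<subseteq> crange c"
  shows "\<exists>m>0. \<exists>M>0. \<forall>x\<in>D. \<forall>v. m * norm v \<le> gnorm g c (cinv c x) v \<and> gnorm g c (cinv c x) v \<le> M * norm v"
proof (cases "D = {}")
  case True
  then show ?thesis using gt_ex[of "0::real"] by simp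
next
  case False
  let ?K = "D \<times> sphere (0::'e) 1" and ?\<phi> = "\<lambda>(x, v). g c (cinv c x) v v"
  obtain b :: 'e where "b \<in> Basis" using nonempty_Basis by blast
  then have K: "compact ?K" "?K \<noteq> {}" using D(1) False by (auto intro!: compact_Times)
  have cont: "continuous_on ?K ?\<phi>"
    by (rule continuous_on_subset[OF metric_continuous[OF c]]) (use D in auto)
  obtain x0 v0 where min: "(x0, v0) \<in> ?K" "\<And>z. z \<in> ?K \<Longrightarrow> ?\<phi> (x0, v0) \<le> ?\<phi> z"
    using continuous_attains_inf[OF K cont] by force
  obtain x1 v1 where max: "(x1, v1) \<in> ?K" "\<And>z. z \<in> ?K \<Longrightarrow> ?\<phi> z \<le> ?\<phi> (x1, v1)"
    using continuous_attains_sup[OF K cont] by force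
  define m where "m = sqrt (?\<phi> (x0, v0))"
  define M where "M = sqrt (?\<phi> (x1, v1))"
  have pos: "0 < ?\<phi> z" if "z \<in> ?K" for z
  proof -
    have "fst z \<in> crange c" "snd z \<noteq> 0" using that D(2) by auto
    then show ?thesis using metric_pos[OF c cinv_in[OF c], of "fst z" "snd z"] by (simp add: split_beta)
  qed
  have "m * norm v \<le> gnorm g c (cinv c x) v \<and> gnorm g c (cinv c x) v \<le> M * norm v" if x: "x \<in> D" for x v
  proof (cases "v = 0")
    case True
    then show ?thesis
      using gnorm_scaleR[OF c cinv_in[OF c], of x 0 v] x D(2) by (auto simp: subset_eq)
  next
    case False
    let ?u = "v /\<^sub>R norm v"
    have u: "(x, ?u) \<in> ?K" using x False by simp
    have "gnorm g c (cinv c x) v = norm v * gnorm g c (cinv c x) ?u"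
      using gnorm_scaleR[OF c cinv_in[OF c], of x "norm v" ?u] x D(2) False by (auto simp: subset_eq)
    moreover have "m \<le> gnorm g c (cinv c x) ?u" "gnorm g c (cinv c x) ?u \<le> M"
      using min(2)[OF u] max(2)[OF u] unfolding m_def M_def gnorm_def by simp_all
    ultimately show ?thesis by (simp add: mult.commute[of m] mult.commute[of M] mult_left_mono)
  qed
  moreover have "m > 0" "M > 0" unfolding m_def M_def using pos min(1) max(1) by auto
  ultimately show ?thesis by blast
qed

lemma eventually_gnorm_upper:
  assumes "cell_family S"
  shows "\<forall>\<^sub>F M in at_top. \<forall>(c, D)\<in>S. \<forall>p\<in>cell c D. \<forall>v. gnorm g c p v \<le> M * norm v"
proof -
  have "\<forall>\<^sub>F M in at_top. \<forall>(c, D)\<in>S. \<forall>p\<in>cell c D. \<forall>v. gnorm g c (cinv c (cmap c p)) v \<le> M * norm v"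
  proof (rule eventually_cells[OF assms])
    fix c D assume c: "c \<in> A" "compact D" "D \<subseteq> crange c"
    obtain M where M: "\<forall>x\<in>D. \<forall>v. gnorm g c (cinv c x) v \<le> M * norm v"
      using gnorm_bounds[OF c] by blast
    show "\<forall>\<^sub>F M in at_top. \<forall>x\<in>D. \<forall>v. gnorm g c (cinv c x) v \<le> M * norm v"
      using eventually_ge_at_top[of M]
    proof eventually_elim
      case (elim N)
      then show ?case using M order_trans[OF _ mult_right_mono[OF elim norm_ge_zero]] by blast
    qed
  qed
  then show ?thesis
  proof eventually_elim
    case (elim m)
    have "cinv c (cmap c p) = p" if "(c, D) \<in> S" "p \<in> cell c D" for c D p
      using cinv_cmap[OF cell_familyD(1)[OF assms that(1)]] that(2) by (simp add: cell_def)
    then show ?case using elim by fastforce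
  qed
qed

lemma eventually_gnorm_lower:
  assumes "cell_family S"
  shows "\<forall>\<^sub>F m in at_right 0. \<forall>(c, D)\<in>S. \<forall>p\<in>cell c D. \<forall>v. m * norm v \<le> gnorm g c p v"
proof -
  have "\<forall>\<^sub>F m in at_right 0. \<forall>(c, D)\<in>S. \<forall>p\<in>cell c D. \<forall>v. m * norm v \<le> gnorm g c (cinv c (cmap c p)) v"
  proof (rule eventually_cells[OF assms])
    fix c D assume c: "c \<in> A" "compact D" "D \<subseteq> crange c"
    obtain m where m: "m > 0" "\<forall>x\<in>D. \<forall>v. m * norm v \<le> gnorm g c (cinv c x) v"
      using gnorm_bounds[OF c] by blast
    have "\<forall>\<^sub>F r in at_right (0::real). r * 1 \<le> m" by (rule eventually_small_mult[OF m(1)])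
    then show "\<forall>\<^sub>F m in at_right 0. \<forall>x\<in>D. \<forall>v. m * norm v \<le> gnorm g c (cinv c x) v"
    proof eventually_elim
      case (elim r)
      then have "r * norm v \<le> m * norm v" for v :: 'e by (intro mult_right_mono) auto
      then show ?case using m(2) order_trans by blast
    qed
  qed
  then show ?thesis
  proof eventually_elim
    case (elim m)
    have "cinv c (cmap c p) = p" if "(c, D) \<in> S" "p \<in> cell c D" for c D p
      using cinv_cmap[OF cell_familyD(1)[OF assms that(1)]] that(2) by (simp add: cell_def)
    then show ?case using elim by fastforce
  qed
qed

lemma tangent_norm_chart:
  assumes c: "c \<in> A" "p \<in> cdom c" and v: "v (chart_at A p) = transition_deriv c (chart_at A p) p (v c)"
  shows "tangent_norm A g p v = gnorm g c p (v c)"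
  unfolding tangent_norm_def v using gnorm_change[OF c(1) chart_at(1) c(2) chart_at(2)] .

text \<open>The coordinate segment is a competitor in the infimum. Convexity keeps it in
  \<open>C\<close>, where its speed is at most \<open>M\<close> times its coordinate speed.\<close>

lemma riemannian_dist_le:
  assumes c: "c \<in> A" and pq: "p \<in> cdom c" "q \<in> cdom c"
    and C: "convex C" "C \<subseteq> crange c" "cmap c p \<in> C" "cmap c q \<in> C"
    and M: "\<And>z v. z \<in> C \<Longrightarrow> gnorm g c (cinv c z) v \<le> M * norm v"
  shows "riemannian_dist A g p q \<le> M * norm (cmap c q - cmap c p)"
proof -
  let ?v = "cmap c q - cmap c p"
  define l where "l t = cmap c p + t *\<^sub>R ?v" for t
  define \<sigma> where "\<sigma> t = cinv c (l t)" for t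
  have lC: "l t \<in> C" if "t \<in> {0..1}" for t
  proof -
    have "l t = (1 - t) *\<^sub>R cmap c p + t *\<^sub>R cmap c q" by (simp add: l_def algebra_simps)
    then show ?thesis using convexD[OF C(1,3,4), of "1 - t" t] that by simp
  qed
  then have lc: "l t \<in> crange c" if "t \<in> {0..1}" for t using C(2) that by blast
  have \<sigma>c: "\<sigma> t \<in> cdom c" if "t \<in> {0..1}" for t unfolding \<sigma>_def by (rule cinv_in[OF c lc[OF that]])
  have l': "(l has_vector_derivative ?v) (at t)" for t
    unfolding l_def by (auto intro!: derivative_eq_intros)
  have der: "((\<lambda>s. cmap c' (\<sigma> s)) has_vector_derivative transition_deriv c c' (\<sigma> t) ?v) (at t)"
    if "c' \<in> A" "t \<in> {0..1}" "\<sigma> t \<in> cdom c'" for c' t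
    using vector_derivative_change_chart[OF c that(1) lc[OF that(2)] _ l'] that(3) unfolding \<sigma>_def by simp
  have cl: "continuous_on S l" for S unfolding l_def by (intro continuous_intros)
  have "piecewise_C1_curve A \<sigma>"
    unfolding piecewise_C1_curve_def
  proof (intro conjI ballI allI impI)
    show "continuous_on {0..1} \<sigma>"
      unfolding \<sigma>_def by (rule continuous_on_compose2[OF continuous_cinv[OF c] cl]) (use lc in auto)
    fix c' a b assume c': "c' \<in> A" and ab: "0 \<le> a \<and> a \<le> b \<and> b \<le> 1 \<and> \<sigma> ` {a..b} \<subseteq> cdom c'"
    have ov: "l t \<in> overlap c c'" if "t \<in> {a..b}" for t
    proof -
      have "t \<in> {0..1}" "\<sigma> t \<in> cdom c'" using ab that by auto
      then show ?thesis
        using overlapI[OF \<sigma>c, of t c'] cmap_cinv[OF c lc, of t] by (simp add: \<sigma>_def)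
    qed
    have "continuous_on (overlap c c') (\<lambda>x. frechet_derivative (cmap c' \<circ> cinv c) (at x) ?v)"
      using smooth_onD[OF smooth_transition[OF c c'], of 1] by simp
    then have cont: "continuous_on {a..b} (\<lambda>t. frechet_derivative (cmap c' \<circ> cinv c) (at (l t)) ?v)"
      by (rule continuous_on_compose2[OF _ cl]) (use ov in auto)
    have "transition_deriv c c' (\<sigma> t) ?v = frechet_derivative (cmap c' \<circ> cinv c) (at (l t)) ?v"
      if "t \<in> {a..b}" for t
      using cmap_cinv[OF c lc, of t] ab that by (simp add: transition_deriv_def \<sigma>_def)
    then have "continuous_on {a..b} (\<lambda>t. transition_deriv c c' (\<sigma> t) ?v)"
      by (intro continuous_on_eq[OF cont]) simp
    moreover have "\<forall>t\<in>{a..b}. ((cmap c' \<circ> \<sigma>) has_vector_derivative transition_deriv c c' (\<sigma> t) ?v) (at t)"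
      using der[OF c'] ab by (auto simp: o_def)
    ultimately have "(cmap c' \<circ> \<sigma>) C1_differentiable_on {a..b}"
      unfolding C1_differentiable_on_def by (intro exI[of _ "\<lambda>t. transition_deriv c c' (\<sigma> t) ?v"] conjI)
    then show "(cmap c' \<circ> \<sigma>) piecewise_C1_differentiable_on {a..b}"
      by (rule C1_differentiable_imp_piecewise)
  qed
  moreover have "\<sigma> 0 = p" "\<sigma> 1 = q" using cinv_cmap[OF c] pq by (simp_all add: \<sigma>_def l_def)
  moreover
  have speed: "speed A g \<sigma> t = gnorm g c (\<sigma> t) ?v" if t: "t \<in> {0..1}" for t
  proof -
    let ?c = "chart_at A (\<sigma> t)"
    have "vector_derivative (\<lambda>s. cmap ?c (\<sigma> s)) (at t) = transition_deriv c ?c (\<sigma> t) ?v"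
      by (rule vector_derivative_at[OF der[OF chart_at(1) t chart_at(2)]])
    then show ?thesis
      unfolding speed_def tangent_norm_def
      using gnorm_change[OF c chart_at(1) \<sigma>c[OF t] chart_at(2)] by simp
  qed
  have "continuous_on {0..1} (\<lambda>t. gnorm g c (\<sigma> t) ?v)"
  proof -
    have "continuous_on {0..1} (\<lambda>t. g c (cinv c (l t)) ?v ?v)"
      by (rule continuous_on_compose2[of "crange c" "\<lambda>x. g c (cinv c x) ?v ?v", OF _ cl])
        (use smooth_onD[OF metric_smooth[OF c], of 0] lc in auto)
    then show ?thesis unfolding gnorm_def \<sigma>_def by (intro continuous_intros)
  qed
  then obtain L where L: "((\<lambda>t. gnorm g c (\<sigma> t) ?v) has_integral L) {0..1}"
    using integrable_continuous_real by blast
  then have "(speed A g \<sigma> has_integral L) {0..1}"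
    by (rule has_integral_eq[rotated]) (use speed in simp)
  ultimately have "L \<in> {L. \<exists>\<sigma>. piecewise_C1_curve A \<sigma> \<and> \<sigma> 0 = p \<and> \<sigma> 1 = q \<and> (speed A g \<sigma> has_integral L) {0..1}}"
    by blast
  \<comment> \<open>A real infimum is known to lie below the elements of a set only if the set is
    bounded below.\<close>
  moreover have "bdd_below {L. \<exists>\<sigma>. piecewise_C1_curve A \<sigma> \<and> \<sigma> 0 = p \<and> \<sigma> 1 = q \<and> (speed A g \<sigma> has_integral L) {0..1}}"
  proof (rule bdd_belowI[of _ 0])
    fix L assume "L \<in> {L. \<exists>\<sigma>. piecewise_C1_curve A \<sigma> \<and> \<sigma> 0 = p \<and> \<sigma> 1 = q \<and> (speed A g \<sigma> has_integral L) {0..1}}"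
    then obtain \<sigma> where "(speed A g \<sigma> has_integral L) {0..1}" by blast
    then show "0 \<le> L"
      by (rule has_integral_nonneg) (simp add: speed_def tangent_norm_def gnorm_nonneg chart_at)
  qed
  ultimately have "riemannian_dist A g p q \<le> L"
    unfolding riemannian_dist_def by (intro cInf_lower)
  also have "L \<le> M * norm ?v"
  proof -
    have "((\<lambda>_. M * norm ?v) has_integral M * norm ?v) {0..1::real}"
      using has_integral_const_real[of "M * norm ?v" 0 1] by simp
    then show ?thesis by (rule has_integral_le[OF L]) (use M[OF lC] in \<open>simp add: \<sigma>_def\<close>)
  qed
  finally show ?thesis .
qed

end

section \<open>Chart invariance\<close>

lemma nonneg_le_all_positive:
  fixes a b :: real
  assumes "\<And>e. 0 < e \<Longrightarrow> e \<le> 1 \<Longrightarrow> a \<le> e * b" shows "a \<le> 0"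
proof (rule ccontr)
  assume "\<not> a \<le> 0"
  then have a: "0 < a" by simp
  define e where "e = min 1 (a / (2 * (\<bar>b\<bar> + 1)))"
  have e: "0 < e" "e \<le> 1" using a by (auto simp: e_def add_nonneg_pos)
  have "e * b \<le> e * (\<bar>b\<bar> + 1)" using e by (intro mult_left_mono) auto
  also have "\<dots> \<le> a / (2 * (\<bar>b\<bar> + 1)) * (\<bar>b\<bar> + 1)" unfolding e_def by (intro mult_right_mono) auto
  also have "\<dots> = a / 2" using add_nonneg_pos[of "\<bar>b\<bar>" 1] by (simp add: field_simps)
  also have "\<dots> < a" using a by simp
  finally show False using assms[OF e] by simp
qed

context smooth_manifold
begin

text \<open>
  An attainable field is recovered from the endpoints of short trajectories, which exist
  independently of charts. So no transformation law for Lie brackets is needed.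
\<close>

lemma attainable_is_vector_field:
  assumes "attainable f X" shows "is_vector_field A X"
  unfolding is_vector_field_def
proof (intro ballI)
  fix c c' p assume c: "c \<in> A" "c' \<in> A" and p: "p \<in> cdom c \<inter> cdom c'"
  define x where "x = cmap c p"
  define \<Phi> where "\<Phi> = cmap c' \<circ> cinv c"
  define \<tau> where "\<tau> = transition_deriv c c' p"
  have lin: "linear \<tau>" unfolding \<tau>_def using linear_transition_deriv c p by blast
  obtain N where N: "0 < N" "\<And>v. norm (\<tau> v) \<le> norm v * N"
    using bounded_linear.pos_bounded[of \<tau>] lin linear_conv_bounded_linear by blast
  have "norm (X c' p - \<tau> (X c p)) \<le> e * (1 + (norm (X c p) + 1) + N)" if e: "0 < e" "e \<le> 1" for e
  proof -
    \<comment> \<open>Two cells consisting of the point \<open>p\<close> alone: a word for this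
      family yields one endpoint \<open>q\<close> whose coordinates are estimated in both
      charts.\<close>
    let ?S = "{(c, {cmap c p}), (c', {cmap c' p})}"
    have S: "cell_family ?S"
      unfolding cell_family_def using c p by (auto simp: crange_def)
    have \<Phi>1: "Ck_on (Suc 0) (overlap c c') \<Phi>"
      unfolding \<Phi>_def by (rule smooth_onD[OF smooth_transition[OF c]])
    have xo: "{x} \<subseteq> overlap c c'" using overlapI[of p c c'] p by (simp add: x_def)
    from ex_small_positive[OF C1_strict_derivative[OF \<Phi>1 open_overlap[OF c] compact_sing xo e(1)]]
    obtain d where d: "d > 0" "\<And>y. norm (y - x) \<le> d \<Longrightarrow> norm (\<Phi> y - \<Phi> x - \<tau> (y - x)) \<le> e * norm (y - x)"
      unfolding \<tau>_def transition_deriv_def \<Phi>_def[symmetric] x_def[symmetric] by fastforce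
    have "\<forall>\<^sub>F h in at_right 0. 0 < h \<and> h * (norm (X c p) + 1) \<le> d \<and>
        (\<exists>w. steers f w ?S (\<lambda>c p q. norm (cmap c q - cmap c p - h *\<^sub>R X c p) \<le> h * e))"
      using assms S e(1) d(1) unfolding attainable_def
      by (intro eventually_conj eventually_small_mult eventually_at_right_less) auto
    from eventually_happens'[OF _ this] obtain h w where h: "0 < h" "h * (norm (X c p) + 1) \<le> d"
      and w: "steers f w ?S (\<lambda>c p q. norm (cmap c q - cmap c p - h *\<^sub>R X c p) \<le> h * e)"
      by auto
    have "p \<in> cells_union ?S" using p by (auto simp: mem_cells_union cell_def)
    then obtain q where q: "\<forall>(a, D)\<in>?S. p \<in> cell a D \<longrightarrow>
        q \<in> cdom a \<and> norm (cmap a q - cmap a p - h *\<^sub>R X a p) \<le> h * e"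
      using w unfolding steers_def by blast
    have q1: "q \<in> cdom c" "norm (cmap c q - x - h *\<^sub>R X c p) \<le> h * e"
      and q2: "q \<in> cdom c'" "norm (cmap c' q - cmap c' p - h *\<^sub>R X c' p) \<le> h * e"
      using q p by (auto simp: cell_def x_def)
    have hX: "norm (h *\<^sub>R X c p) \<le> h * norm (X c p)" using h(1) by simp
    have size: "norm (cmap c q - x) \<le> h * (norm (X c p) + e)"
      using norm_triangle_mono[OF q1(2) hX] by (simp add: algebra_simps)
    also have le: "\<dots> \<le> h * (norm (X c p) + 1)" using h(1) e(2) by (intro mult_left_mono) auto
    also note h(2)
    finally have "norm (\<Phi> (cmap c q) - \<Phi> x - \<tau> (cmap c q - x)) \<le> e * norm (cmap c q - x)" by (rule d(2))
    also have "\<dots> \<le> e * (h * (norm (X c p) + 1))" using size le e(1) by (intro mult_left_mono) auto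
    finally have 1: "norm (cmap c' q - cmap c' p - \<tau> (cmap c q - x)) \<le> e * (h * (norm (X c p) + 1))"
      using cinv_cmap[OF c(1)] q1(1) p by (simp add: \<Phi>_def x_def)
    have 2: "norm (\<tau> (cmap c q - x - h *\<^sub>R X c p)) \<le> h * e * N"
      using N(2)[of "cmap c q - x - h *\<^sub>R X c p"] mult_right_mono[OF q1(2), of N] N(1) by linarith
    have "norm (- (cmap c' q - cmap c' p - h *\<^sub>R X c' p)) \<le> h * e"
      unfolding norm_minus_cancel by (rule q2(2))
    from norm_triangle_mono[OF norm_triangle_mono[OF this 1] 2]
    have "norm (h *\<^sub>R (X c' p - \<tau> (X c p))) \<le> h * (e * (1 + (norm (X c p) + 1) + N))"
      by (simp add: linear_diff[OF lin] linear_add[OF lin] linear_cmul[OF lin] algebra_simps)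
    then show ?thesis using h(1) by simp
  qed
  then have "norm (X c' p - \<tau> (X c p)) \<le> 0" by (rule nonneg_le_all_positive)
  then show "X c' p = transition_deriv c c' p (X c p)" unfolding \<tau>_def by simp
qed

subsection \<open>The second derivative of a transition map\<close>

text \<open>The second derivative of the coordinate change, with outer direction \<open>u\<close>
  and inner direction \<open>v\<close>. It is the inhomogeneous term in the transformation of
  coordinate derivatives and, with the opposite sign, of the Christoffel map.\<close>

definition transition_hessian ::
    "('m, 'e) chart \<Rightarrow> ('m, 'e) chart \<Rightarrow> 'm \<Rightarrow> 'e \<Rightarrow> 'e \<Rightarrow> 'e" where
  "transition_hessian c c' p u v =
     frechet_derivative (\<lambda>y. frechet_derivative (cmap c' \<circ> cinv c) (at y) v) (at (cmap c p)) u"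

context
  fixes c c' p assumes c: "c \<in> A" "c' \<in> A" and p: "p \<in> cdom c" "p \<in> cdom c'"
begin

lemma transition_hessian_sym: "transition_hessian c c' p u v = transition_hessian c c' p v u"
  unfolding transition_hessian_def
  by (rule second_derivative_symmetric[OF smooth_onD[OF smooth_transition[OF c]] open_overlap[OF c] overlapI[OF p]])

lemma transition_hessian_has_derivative:
  "((\<lambda>y. frechet_derivative (cmap c' \<circ> cinv c) (at y) v) has_derivative (\<lambda>u. transition_hessian c c' p u v))
    (at (cmap c p))"
  unfolding transition_hessian_def
  by (rule Ck_on_has_derivative[OF smooth_onD[OF smooth_on_derivative[OF smooth_transition[OF c]]] overlapI[OF p]])

text \<open>Linearity in \<open>u\<close> is that of a derivative; in the other argument it follows
  by symmetry.\<close>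

lemma linear_transition_hessian: "linear (\<lambda>u. transition_hessian c c' p u v)"
  "linear (transition_hessian c c' p u)"
proof -
  show lin: "linear (\<lambda>u. transition_hessian c c' p u v)" for v
    using transition_hessian_has_derivative has_derivative_linear by blast
  have "transition_hessian c c' p u = (\<lambda>v. transition_hessian c c' p v u)"
    by (rule ext) (rule transition_hessian_sym)
  then show "linear (transition_hessian c c' p u)" using lin[of u] by simp
qed

text \<open>A product rule for a derivative applied to a moving vector. Expansion in the basis
  reduces it to fixed directions, for which the second derivative is available.\<close>

lemma transition_deriv_apply_has_derivative:
  assumes Z: "(Z has_derivative DZ) (at (cmap c p))"
  shows "((\<lambda>y. frechet_derivative (cmap c' \<circ> cinv c) (at y) (Z y)) has_derivative
    (\<lambda>u. transition_deriv c c' p (DZ u) + transition_hessian c c' p u (Z (cmap c p)))) (at (cmap c p))"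
proof -
  let ?D = "\<lambda>y. frechet_derivative (cmap c' \<circ> cinv c) (at y)"
  let ?x = "cmap c p"
  have "((\<lambda>y. \<Sum>b\<in>Basis. (Z y \<bullet> b) *\<^sub>R ?D y b) has_derivative
      (\<lambda>u. \<Sum>b\<in>Basis. (Z ?x \<bullet> b) *\<^sub>R transition_hessian c c' p u b + (DZ u \<bullet> b) *\<^sub>R ?D ?x b)) (at ?x)"
    by (intro has_derivative_sum has_derivative_scaleR has_derivative_inner_left Z
        transition_hessian_has_derivative)
  moreover have "(\<Sum>b\<in>Basis. (Z ?x \<bullet> b) *\<^sub>R transition_hessian c c' p u b + (DZ u \<bullet> b) *\<^sub>R ?D ?x b)
      = transition_deriv c c' p (DZ u) + transition_hessian c c' p u (Z ?x)" for u
    using linear_basis_expansion[OF linear_transition_hessian(2), of u "Z ?x"]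
      linear_basis_expansion[OF linear_transition_deriv[OF c p], of "DZ u"]
    by (simp add: sum.distrib transition_deriv_def)
  ultimately have "((\<lambda>y. \<Sum>b\<in>Basis. (Z y \<bullet> b) *\<^sub>R ?D y b) has_derivative
      (\<lambda>u. transition_deriv c c' p (DZ u) + transition_hessian c c' p u (Z ?x))) (at ?x)" by simp
  then show ?thesis
  proof (rule has_derivative_transform_within_open[OF _ open_overlap[OF c] overlapI[OF p]])
    fix y assume y: "y \<in> overlap c c'"
    have "linear (?D y)"
      using Ck_on_has_derivative[OF smooth_onD[OF smooth_transition[OF c], of "Suc 0"] y] has_derivative_linear by blast
    then show "(\<Sum>b\<in>Basis. (Z y \<bullet> b) *\<^sub>R ?D y b) = ?D y (Z y)"
      by (rule linear_basis_expansion[symmetric])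
  qed
qed

text \<open>The transformation law of \<open>X\<close> expresses one function of the
  \<open>c\<close>-coordinates in two ways; differentiating both gives the identity.\<close>

lemma chart_deriv_change:
  assumes X: "is_vector_field A X" "C1_field X"
  shows "chart_deriv c' (X c') p (transition_deriv c c' p v) =
    transition_deriv c c' p (chart_deriv c (X c) p v) + transition_hessian c c' p v (X c p)"
proof -
  let ?x = "cmap c p" and ?\<Phi> = "cmap c' \<circ> cinv c"
  have \<Phi>x: "?\<Phi> ?x = cmap c' p" using cinv_cmap[OF c(1) p(1)] by simp
  have l: "((\<lambda>y. X c' (cinv c' (?\<Phi> y))) has_derivative
      (\<lambda>v. chart_deriv c' (X c') p (transition_deriv c c' p v))) (at ?x)"
    using has_derivative_compose[OF transition_has_derivative[OF c p]
        C1_field_has_derivative[OF X(2) c(2) p(2), folded \<Phi>x]] .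
  have r: "((\<lambda>y. X c' (cinv c' (?\<Phi> y))) has_derivative
      (\<lambda>v. transition_deriv c c' p (chart_deriv c (X c) p v) + transition_hessian c c' p v (X c (cinv c ?x)))) (at ?x)"
  proof (rule has_derivative_transform_within_open[OF _ open_overlap[OF c] overlapI[OF p]])
    show "((\<lambda>y. frechet_derivative ?\<Phi> (at y) (X c (cinv c y))) has_derivative
      (\<lambda>v. transition_deriv c c' p (chart_deriv c (X c) p v) + transition_hessian c c' p v (X c (cinv c ?x)))) (at ?x)"
      by (rule transition_deriv_apply_has_derivative[OF C1_field_has_derivative[OF X(2) c(1) p(1)]])
    fix y assume y: "y \<in> overlap c c'"
    have q: "cinv c y \<in> cdom c \<inter> cdom c'" using overlapD[OF c(1) y] by blast
    have "X c' (cinv c y) = transition_deriv c c' (cinv c y) (X c (cinv c y))"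
      using X(1) c q unfolding is_vector_field_def by blast
    then show "frechet_derivative ?\<Phi> (at y) (X c (cinv c y)) = X c' (cinv c' (?\<Phi> y))"
      using cmap_cinv[OF c(1) overlapD(1)[OF c(1) y]] cinv_cmap[OF c(2)] q by (simp add: transition_deriv_def)
  qed
  show ?thesis
    using fun_cong[OF has_derivative_unique[OF l r], of v] cinv_cmap[OF c(1) p(1)] by simp
qed

end

end

context riemannian
begin

subsection \<open>The Christoffel map\<close>

definition metric_deriv :: "('m, 'e) chart \<Rightarrow> 'm \<Rightarrow> 'e \<Rightarrow> 'e \<Rightarrow> 'e \<Rightarrow> real" where
  "metric_deriv c p u v w = chart_deriv c (\<lambda>q. g c q v w) p u"

context
  fixes c p assumes c: "c \<in> A" and p: "p \<in> cdom c"
begin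

lemma metric_has_derivative:
  "((\<lambda>x. g c (cinv c x) v w) has_derivative (\<lambda>u. metric_deriv c p u v w)) (at (cmap c p))"
  unfolding metric_deriv_def chart_deriv_def o_def
  by (rule Ck_on_has_derivative[OF smooth_onD[OF metric_smooth[OF c]] cmap_in[OF c p]])

lemma metric_deriv_eqI:
  assumes "(F has_derivative D) (at (cmap c p))" "\<And>x. x \<in> crange c \<Longrightarrow> F x = g c (cinv c x) v w"
  shows "metric_deriv c p u v w = D u"
  using fun_cong[OF has_derivative_unique[OF metric_has_derivative has_derivative_transform_within_open[OF assms(1)
        open_crange[OF c] cmap_in[OF c p] assms(2)]]] by simp

lemma linear_metric_deriv:
  "linear (\<lambda>u. metric_deriv c p u v w)" "linear (\<lambda>v. metric_deriv c p u v w)" "linear (\<lambda>w. metric_deriv c p u v w)"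
proof -
  show "linear (\<lambda>u. metric_deriv c p u v w)"
    using metric_has_derivative has_derivative_linear by blast
  note l = linear_iff[THEN iffD2]
  have bil: "bilinear (g c (cinv c x))" if "x \<in> crange c" for x
    using metric_bilinear[OF c cinv_in[OF c that]] .
  show "linear (\<lambda>v. metric_deriv c p u v w)"
  proof (rule l, intro conjI allI)
    show "metric_deriv c p u (v + v') w = metric_deriv c p u v w + metric_deriv c p u v' w" for v v'
      by (rule metric_deriv_eqI[OF has_derivative_add[OF metric_has_derivative metric_has_derivative]])
        (simp add: bilinear_ladd[OF bil])
    show "metric_deriv c p u (r *\<^sub>R v) w = r *\<^sub>R metric_deriv c p u v w" for r v
      by (rule metric_deriv_eqI[OF has_derivative_scaleR_right[OF metric_has_derivative]])
        (simp add: bilinear_lmul[OF bil])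
  qed
  show "linear (\<lambda>w. metric_deriv c p u v w)"
  proof (rule l, intro conjI allI)
    show "metric_deriv c p u v (w + w') = metric_deriv c p u v w + metric_deriv c p u v w'" for w w'
      by (rule metric_deriv_eqI[OF has_derivative_add[OF metric_has_derivative metric_has_derivative]])
        (simp add: bilinear_radd[OF bil])
    show "metric_deriv c p u v (r *\<^sub>R w) = r *\<^sub>R metric_deriv c p u v w" for r w
      by (rule metric_deriv_eqI[OF has_derivative_scaleR_right[OF metric_has_derivative]])
        (simp add: bilinear_rmul[OF bil])
  qed
qed

lemma metric_nondegenerate:
  assumes "\<And>z. g c p u z = g c p u' z" shows "u = u'"
proof (rule ccontr)
  assume "u \<noteq> u'"
  moreover have "g c p (u - u') (u - u') = 0"
    using assms bilinear_lsub[OF metric_bilinear[OF c p]] by simp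
  ultimately show False using metric_pos[OF c p, of "u - u'"] by simp
qed

text \<open>The map that sends a vector to the coordinates of its linear form is injective by
  nondegeneracy, hence surjective in finite dimension.\<close>

lemma metric_represents:
  assumes "linear K" shows "\<exists>u. \<forall>z. g c p u z = K z"
proof -
  note b = metric_bilinear[OF c p]
  have lin: "linear (\<lambda>z. g c p u z)" "linear (\<lambda>u. g c p u z)" for u z
    using b unfolding bilinear_def by auto
  define G where "G u = (\<Sum>i\<in>Basis. g c p u i *\<^sub>R i)" for u
  have G: "G u \<bullet> z = g c p u z" for u z
    using linear_basis_expansion[OF lin(1), of u z] by (simp add: G_def inner_sum_left inner_commute[of z] mult.commute)
  have "linear G"
    unfolding G_def by (intro linear_compose_sum ballI linear_compose[of "\<lambda>u. g c p u i" "\<lambda>r. r *\<^sub>R i" for i, unfolded o_def] lin)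
      (auto intro!: linearI simp: algebra_simps)
  moreover have "inj G"
  proof (rule injI)
    fix u u' assume "G u = G u'"
    then show "u = u'" using G metric_nondegenerate by metis
  qed
  ultimately have "surj G" using linear_injective_imp_surjective by blast
  then obtain u where u: "G u = (\<Sum>i\<in>Basis. K i *\<^sub>R i)" by (metis surjD)
  have "g c p u z = K z" for z
    unfolding G[symmetric] u using linear_basis_expansion[OF assms, of z]
    by (simp add: inner_sum_left inner_commute[of z] mult.commute)
  then show ?thesis by blast
qed

text \<open>Justifies the description operator in \<open>christoffel\<close>: the right side is
  linear in \<open>z\<close>, so the metric represents it by a vector, and nondegeneracy makes the
  vector unique.\<close>

lemma christoffel_eq:
  "g c p (christoffel g c p v w) z = (metric_deriv c p v w z + metric_deriv c p w v z - metric_deriv c p z v w) / 2"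
proof -
  let ?K = "\<lambda>z. (metric_deriv c p v w z + metric_deriv c p w v z - metric_deriv c p z v w) / 2"
  have "linear ?K"
    by (intro linearI)
      (simp_all add: linear_add[OF linear_metric_deriv(1)] linear_add[OF linear_metric_deriv(3)]
        linear_cmul[OF linear_metric_deriv(1)] linear_cmul[OF linear_metric_deriv(3)]
        algebra_simps add_divide_distrib diff_divide_distrib)
  then obtain u where u: "\<forall>z. g c p u z = ?K z" using metric_represents by blast
  have "\<exists>!u. \<forall>z. g c p u z = ?K z"
  proof (rule ex1I[where a = u])
    show "u' = u" if "\<forall>z. g c p u' z = ?K z" for u'
      by (rule metric_nondegenerate) (simp only: u[rule_format] that[rule_format])
  qed (rule u)
  from theI'[OF this] show ?thesis
    unfolding christoffel_def metric_deriv_def by blast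
qed

end

end

section \<open>Transformation laws for the Christoffel map and the covariant derivative\<close>

context riemannian
begin

lemma bilinear_metric_deriv: "c \<in> A \<Longrightarrow> p \<in> cdom c \<Longrightarrow> bilinear (metric_deriv c p u)"
  unfolding bilinear_def using linear_metric_deriv by simp

text \<open>The metric in \<open>c\<close> is the pullback of the metric in \<open>c'\<close>. The
  product rule differentiates the coefficients and the two arguments, and each argument contributes
  a Hessian term.\<close>

lemma metric_deriv_change:
  assumes c: "c \<in> A" "c' \<in> A" and p: "p \<in> cdom c" "p \<in> cdom c'"
  defines "\<tau> \<equiv> transition_deriv c c' p" and "H \<equiv> transition_hessian c c' p"
  shows "metric_deriv c p u v w =
    metric_deriv c' p (\<tau> u) (\<tau> v) (\<tau> w) + g c' p (H u v) (\<tau> w) + g c' p (\<tau> v) (H u w)"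
proof -
  let ?x = "cmap c p" and ?\<Phi> = "cmap c' \<circ> cinv c"
  let ?D = "\<lambda>y. frechet_derivative ?\<Phi> (at y)"
  have \<Phi>x: "?\<Phi> ?x = cmap c' p" and x: "cinv c' (?\<Phi> ?x) = p"
    using cinv_cmap[OF c(1) p(1)] cinv_cmap[OF c(2) p(2)] by simp_all
  have D: "?D ?x = \<tau>" by (simp add: \<tau>_def transition_deriv_def)
  have der: "((\<lambda>y. ?D y v \<bullet> i) has_derivative (\<lambda>u. H u v \<bullet> i)) (at ?x)" for v i
    unfolding H_def by (intro has_derivative_inner_left transition_hessian_has_derivative c p)
  have derg: "((\<lambda>y. g c' (cinv c' (?\<Phi> y)) i j) has_derivative (\<lambda>u. metric_deriv c' p (\<tau> u) i j)) (at ?x)" for i j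
    unfolding \<tau>_def
    using has_derivative_compose[OF transition_has_derivative[OF c p]
        metric_has_derivative[OF c(2) p(2), folded \<Phi>x]] .
  have "((\<lambda>y. \<Sum>i\<in>Basis. \<Sum>j\<in>Basis. (?D y v \<bullet> i) * (?D y w \<bullet> j) * g c' (cinv c' (?\<Phi> y)) i j) has_derivative
      (\<lambda>u. \<Sum>i\<in>Basis. \<Sum>j\<in>Basis. (?D ?x v \<bullet> i) * (?D ?x w \<bullet> j) * metric_deriv c' p (\<tau> u) i j
        + ((?D ?x v \<bullet> i) * (H u w \<bullet> j) + (H u v \<bullet> i) * (?D ?x w \<bullet> j)) * g c' (cinv c' (?\<Phi> ?x)) i j)) (at ?x)"
    by (intro has_derivative_sum has_derivative_mult der derg)
  moreover have "(\<Sum>i\<in>Basis. \<Sum>j\<in>Basis. (?D ?x v \<bullet> i) * (?D ?x w \<bullet> j) * metric_deriv c' p (\<tau> u) i j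
        + ((?D ?x v \<bullet> i) * (H u w \<bullet> j) + (H u v \<bullet> i) * (?D ?x w \<bullet> j)) * g c' (cinv c' (?\<Phi> ?x)) i j)
    = metric_deriv c' p (\<tau> u) (\<tau> v) (\<tau> w) + g c' p (H u v) (\<tau> w) + g c' p (\<tau> v) (H u w)" for u
    unfolding D x bilinear_basis_expansion[OF metric_bilinear[OF c(2) p(2)], of "H u v"]
      bilinear_basis_expansion[OF metric_bilinear[OF c(2) p(2)], of "\<tau> v"]
      bilinear_basis_expansion[OF bilinear_metric_deriv[OF c(2) p(2)], of "\<tau> u" "\<tau> v"]
    by (simp add: sum.distrib distrib_right algebra_simps)
  ultimately have "((\<lambda>y. \<Sum>i\<in>Basis. \<Sum>j\<in>Basis. (?D y v \<bullet> i) * (?D y w \<bullet> j) * g c' (cinv c' (?\<Phi> y)) i j) has_derivative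
      (\<lambda>u. metric_deriv c' p (\<tau> u) (\<tau> v) (\<tau> w) + g c' p (H u v) (\<tau> w) + g c' p (\<tau> v) (H u w))) (at ?x)"
    by simp
  then have "((\<lambda>y. g c (cinv c y) v w) has_derivative
      (\<lambda>u. metric_deriv c' p (\<tau> u) (\<tau> v) (\<tau> w) + g c' p (H u v) (\<tau> w) + g c' p (\<tau> v) (H u w))) (at ?x)"
  proof (rule has_derivative_transform_within_open[OF _ open_overlap[OF c] overlapI[OF p]])
    fix y assume y: "y \<in> overlap c c'"
    have q: "cinv c y \<in> cdom c" "cinv c y \<in> cdom c'" using overlapD[OF c(1) y] by auto
    have "g c (cinv c y) v w = g c' (cinv c y) (?D y v) (?D y w)"
      using metric_change[OF c q, of v w] cmap_cinv[OF c(1) overlapD(1)[OF c(1) y]]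
      by (simp add: transition_deriv_def)
    then show "(\<Sum>i\<in>Basis. \<Sum>j\<in>Basis. (?D y v \<bullet> i) * (?D y w \<bullet> j) * g c' (cinv c' (?\<Phi> y)) i j) = g c (cinv c y) v w"
      using bilinear_basis_expansion[OF metric_bilinear[OF c(2) q(2)], of "?D y v" "?D y w"]
        cinv_cmap[OF c(2) q(2)] by simp
  qed
  from fun_cong[OF has_derivative_unique[OF metric_has_derivative[OF c(1) p(1)] this]] show ?thesis .
qed

text \<open>Of the six Hessian terms in the Koszul formula four cancel by symmetry; the remaining
  two are equal and compensate the factor 1/2. Every test vector \<open>z'\<close> of the other
  chart is the image of some \<open>z\<close>, and nondegeneracy concludes.\<close>

lemma christoffel_change:
  assumes c: "c \<in> A" "c' \<in> A" and p: "p \<in> cdom c" "p \<in> cdom c'"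
  shows "christoffel g c' p (transition_deriv c c' p v) (transition_deriv c c' p w) + transition_hessian c c' p v w
    = transition_deriv c c' p (christoffel g c p v w)"
proof (rule metric_nondegenerate[OF c(2) p(2)])
  fix z'
  let ?\<tau> = "transition_deriv c c' p" and ?H = "transition_hessian c c' p"
  define z where "z = transition_deriv c' c p z'"
  have z': "z' = ?\<tau> z" unfolding z_def using transition_deriv_inverse[OF c(2,1) p(2,1)] by simp
  note ch = metric_deriv_change[OF c p]
  note sym = transition_hessian_sym[OF c p]
  have "g c' p (?\<tau> (christoffel g c p v w)) z' = g c p (christoffel g c p v w) z"
    unfolding z' using metric_change[OF c p] by simp
  also have "\<dots> = (metric_deriv c p v w z + metric_deriv c p w v z - metric_deriv c p z v w) / 2"
    by (rule christoffel_eq[OF c(1) p(1)])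
  also have "\<dots> = (metric_deriv c' p (?\<tau> v) (?\<tau> w) z' + metric_deriv c' p (?\<tau> w) (?\<tau> v) z'
      - metric_deriv c' p z' (?\<tau> v) (?\<tau> w)) / 2 + g c' p (?H v w) z'"
    unfolding ch[of v w z] ch[of w v z] ch[of z v w] z' sym[of w v] sym[of z v] sym[of z w]
      metric_sym[OF c(2) p(2), of "?\<tau> w" "?H v z"] by (simp add: field_simps)
  also have "\<dots> = g c' p (christoffel g c' p (?\<tau> v) (?\<tau> w)) z' + g c' p (?H v w) z'"
    using christoffel_eq[OF c(2) p(2), of "?\<tau> v" "?\<tau> w" z'] by simp
  also have "\<dots> = g c' p (christoffel g c' p (?\<tau> v) (?\<tau> w) + ?H v w) z'"
    using bilinear_ladd[OF metric_bilinear[OF c(2) p(2)]] by simp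
  finally show "g c' p (christoffel g c' p (?\<tau> v) (?\<tau> w) + ?H v w) z' = g c' p (?\<tau> (christoffel g c p v w)) z'" ..
qed

lemma christoffel_scaleR:
  assumes c: "c \<in> A" and p: "p \<in> cdom c"
  shows "christoffel g c p (r *\<^sub>R v) w = r *\<^sub>R christoffel g c p v w"
proof (rule metric_nondegenerate[OF c p])
  show "g c p (christoffel g c p (r *\<^sub>R v) w) z = g c p (r *\<^sub>R christoffel g c p v w) z" for z
    unfolding bilinear_lmul[OF metric_bilinear[OF c p]] christoffel_eq[OF c p]
      linear_cmul[OF linear_metric_deriv(1)[OF c p]] linear_cmul[OF linear_metric_deriv(2)[OF c p]]
    by (simp add: algebra_simps)
qed

subsection \<open>Covariant derivatives of vector fields\<close>

lemma nabla_1: "nabla g 1 X c p [v] = chart_deriv c (X c) p v + christoffel g c p v (X c p)"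
  by (simp add: nabla_def cov_deriv_def)

text \<open>The Hessian terms of \<open>chart_deriv_change\<close> and
  \<open>christoffel_change\<close> cancel, so the covariant derivative may be computed in any
  chart.\<close>

lemma nabla_change:
  assumes c: "c \<in> A" "c' \<in> A" and p: "p \<in> cdom c" "p \<in> cdom c'"
    and X: "is_vector_field A X" "C1_field X"
  shows "nabla g 1 X c' p [transition_deriv c c' p v] = transition_deriv c c' p (nabla g 1 X c p [v])"
proof -
  have "X c' p = transition_deriv c c' p (X c p)"
    using X(1) c p unfolding is_vector_field_def by blast
  then show ?thesis
    unfolding nabla_1 chart_deriv_change[OF c p X] linear_add[OF linear_transition_deriv[OF c p]]
      christoffel_change[OF c p, symmetric] by simp
qed

lemma nabla_scaleR:
  assumes "c \<in> A" "p \<in> cdom c" "C1_field X"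
  shows "nabla g 1 X c p [r *\<^sub>R v] = r *\<^sub>R nabla g 1 X c p [v]"
  unfolding nabla_1 christoffel_scaleR[OF assms(1,2)] linear_cmul[OF linear_chart_deriv[OF assms(3,1,2)]]
  by (simp add: scaleR_add_right)

section \<open>Uniform coordinate bounds for the Christoffel map\<close>

lemma metric_deriv_bound:
  assumes S: "cell_family S"
  shows "\<forall>\<^sub>F B in at_top. \<forall>(c, D)\<in>S. \<forall>p\<in>cell c D. \<forall>u v w.
    \<bar>metric_deriv c p u v w\<bar> \<le> B * (norm u * norm v * norm w)"
proof -
  have "\<forall>\<^sub>F B in at_top. \<forall>i\<in>Basis. \<forall>j\<in>Basis. \<forall>(c, D)\<in>S. \<forall>p\<in>cell c D. \<forall>u.
      norm (frechet_derivative (\<lambda>x. g c (cinv c x) i j) (at (cmap c p)) u) \<le> B * norm u"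
  proof (rule eventually_ball_finite[OF finite_Basis], rule ballI, rule eventually_ball_finite[OF finite_Basis], rule ballI)
    fix i j :: 'e
    show "\<forall>\<^sub>F B in at_top. \<forall>(c, D)\<in>S. \<forall>p\<in>cell c D. \<forall>u.
      norm (frechet_derivative (\<lambda>x. g c (cinv c x) i j) (at (cmap c p)) u) \<le> B * norm u"
    proof (rule eventually_cells[OF S])
      fix c D assume c: "c \<in> A" "compact D" "D \<subseteq> crange c"
      obtain B where B: "\<forall>x\<in>D. \<forall>u. norm (frechet_derivative (\<lambda>x. g c (cinv c x) i j) (at x) u) \<le> B * norm u"
        using C1_derivative_bound[OF smooth_onD[OF metric_smooth[OF c(1)]] c(2,3)] by blast
      show "\<forall>\<^sub>F B in at_top. \<forall>x\<in>D. \<forall>u. norm (frechet_derivative (\<lambda>x. g c (cinv c x) i j) (at x) u) \<le> B * norm u"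
        using eventually_ge_at_top[of B]
      proof eventually_elim
        case (elim N)
        then show ?case using B order_trans[OF _ mult_right_mono[OF elim norm_ge_zero]] by blast
      qed
    qed
  qed
  from eventually_happens'[OF _ eventually_conj[OF eventually_ge_at_top[of 0] this]]
  obtain B where B: "0 \<le> B" "\<forall>i\<in>Basis. \<forall>j\<in>Basis. \<forall>(c, D)\<in>S. \<forall>p\<in>cell c D. \<forall>u.
      norm (frechet_derivative (\<lambda>x. g c (cinv c x) i j) (at (cmap c p)) u) \<le> B * norm u" by auto
  let ?n = "real DIM('e)"
  have "\<bar>metric_deriv c p u v w\<bar> \<le> ?n * (?n * B) * (norm u * norm v * norm w)"
    if cD: "(c, D) \<in> S" "p \<in> cell c D" for c D p u v w
  proof -
    have c: "c \<in> A" "p \<in> cdom c" using cell_familyD(1)[OF S cD(1)] cD(2) by (auto simp: cell_def)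
    have "\<bar>metric_deriv c p u v w\<bar> \<le> (\<Sum>i\<in>Basis. \<Sum>j\<in>Basis. \<bar>(v \<bullet> i) * (w \<bullet> j) * metric_deriv c p u i j\<bar>)"
      unfolding bilinear_basis_expansion[OF bilinear_metric_deriv[OF c], of u v w]
      by (intro order_trans[OF sum_abs] sum_mono sum_abs)
    also have "\<dots> \<le> (\<Sum>i\<in>(Basis :: 'e set). \<Sum>j\<in>(Basis :: 'e set). norm v * norm w * (B * norm u))"
    proof (intro sum_mono)
      fix i j :: 'e assume ij: "i \<in> Basis" "j \<in> Basis"
      have "norm (frechet_derivative (\<lambda>x. g c (cinv c x) i j) (at (cmap c p)) u) \<le> B * norm u"
        using B(2) ij cD by blast
      then have "\<bar>metric_deriv c p u i j\<bar> \<le> B * norm u"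
        by (simp add: metric_deriv_def chart_deriv_eq)
      then show "\<bar>(v \<bullet> i) * (w \<bullet> j) * metric_deriv c p u i j\<bar> \<le> norm v * norm w * (B * norm u)"
        unfolding abs_mult using Basis_le_norm ij by (intro mult_mono) auto
    qed
    also have "\<dots> = ?n * (?n * B) * (norm u * norm v * norm w)" by (simp add: mult_ac)
    finally show ?thesis .
  qed
  then have *: "\<forall>(c, D)\<in>S. \<forall>p\<in>cell c D. \<forall>u v w.
    \<bar>metric_deriv c p u v w\<bar> \<le> ?n * (?n * B) * (norm u * norm v * norm w)" by blast
  show ?thesis
    using eventually_ge_at_top[of "?n * (?n * B)"]
  proof eventually_elim
    case (elim N)
    have "0 \<le> norm u * norm v * norm w" for u v w :: 'e by simp
    then show ?case using * order_trans[OF _ mult_right_mono[OF elim]] by blast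
  qed
qed

text \<open>The Koszul formula is tested with the Christoffel vector itself: the left side is at
  least \<open>m\<^sup>2\<close> times its squared norm, while the bound for the right side is
  linear in its norm.\<close>

lemma christoffel_bound:
  assumes S: "cell_family S"
  shows "\<exists>G\<ge>0. \<forall>(c, D)\<in>S. \<forall>p\<in>cell c D. \<forall>v w. norm (christoffel g c p v w) \<le> G * (norm v * norm w)"
proof -
  obtain B where B: "0 \<le> B" "\<forall>(c, D)\<in>S. \<forall>p\<in>cell c D. \<forall>u v w.
    \<bar>metric_deriv c p u v w\<bar> \<le> B * (norm u * norm v * norm w)"
    using eventually_happens'[OF _ eventually_conj[OF eventually_ge_at_top[of 0] metric_deriv_bound[OF S]]] by auto
  obtain m where m: "m > 0" "\<forall>(c, D)\<in>S. \<forall>p\<in>cell c D. \<forall>v. m * norm v \<le> gnorm g c p v"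
    using ex_small_positive[OF eventually_gnorm_lower[OF S]] by (elim exE conjE) (rule that)
  have "norm (christoffel g c p v w) \<le> 3 / 2 * B / m\<^sup>2 * (norm v * norm w)"
    if cD: "(c, D) \<in> S" "p \<in> cell c D" for c D p v w
  proof (cases "christoffel g c p v w = 0")
    case True
    then show ?thesis using B(1) by simp
  next
    case False
    let ?u = "christoffel g c p v w"
    have c: "c \<in> A" "p \<in> cdom c" using cell_familyD(1)[OF S cD(1)] cD(2) by (auto simp: cell_def)
    have b: "\<bar>metric_deriv c p u v w\<bar> \<le> B * (norm u * norm v * norm w)" for u v w using B(2) cD by blast
    have "m * norm ?u \<le> gnorm g c p ?u" using m(2) cD by blast
    then have "(m * norm ?u)\<^sup>2 \<le> (gnorm g c p ?u)\<^sup>2" using m(1) by (intro power_mono) auto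
    also have "\<dots> = g c p ?u ?u" unfolding gnorm_def using metric_nonneg[OF c] by simp
    also have "\<dots> = (metric_deriv c p v w ?u + metric_deriv c p w v ?u - metric_deriv c p ?u v w) / 2"
      by (rule christoffel_eq[OF c])
    also have "\<dots> \<le> 3 / 2 * B * (norm v * norm w * norm ?u)"
      using b[of v w ?u] b[of w v ?u] b[of ?u v w] by (simp add: mult_ac)
    finally have "norm ?u * (m\<^sup>2 * norm ?u) \<le> norm ?u * (3 / 2 * B * (norm v * norm w))"
      by (simp add: power2_eq_square mult_ac)
    then have "m\<^sup>2 * norm ?u \<le> 3 / 2 * B * (norm v * norm w)" using False by simp
    then show ?thesis using m(1) by (simp add: field_simps)
  qed
  moreover have "0 \<le> 3 / 2 * B / m\<^sup>2" using B(1) by simp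
  ultimately show ?thesis by blast
qed

section \<open>The pointwise content of the C1 seminorm\<close>

lemma nabla_norm_0:
  assumes "is_vector_field A X" "c \<in> A" "p \<in> cdom c"
  shows "nabla_norm A g 0 X p = gnorm g c p (X c p)"
proof -
  let ?c = "chart_at A p"
  have "{gnorm g ?c p (nabla g 0 X ?c p vs) | vs. length vs = 0 \<and> (\<forall>v\<in>set vs. gnorm g ?c p v \<le> 1)} =
      {gnorm g ?c p (X ?c p)}"
    by (auto simp: nabla_def)
  moreover have "X ?c p = transition_deriv c ?c p (X c p)"
    using assms chart_at[of p] unfolding is_vector_field_def by blast
  ultimately show ?thesis
    unfolding nabla_norm_def Let_def using gnorm_change[OF assms(2) chart_at(1) assms(3) chart_at(2)] by simp
qed

text \<open>The norm is defined in the chart selected by \<open>chart_at\<close>. Invariance of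
  lengths and of the covariant derivative moves the supremum to any other chart around the
  point.\<close>

lemma nabla_norm_1_set:
  assumes X: "is_vector_field A X" "C1_field X" and c: "c \<in> A" "p \<in> cdom c"
  shows "nabla_norm A g 1 X p = Sup ((\<lambda>v. gnorm g c p (nabla g 1 X c p [v])) ` {v. gnorm g c p v \<le> 1})"
proof -
  let ?c = "chart_at A p"
  let ?\<tau> = "transition_deriv c ?c p"
  have "{gnorm g ?c p (nabla g 1 X ?c p vs) | vs. length vs = 1 \<and> (\<forall>v\<in>set vs. gnorm g ?c p v \<le> 1)} =
      {gnorm g ?c p (nabla g 1 X ?c p [v]) | v. gnorm g ?c p v \<le> 1}"
    by (auto simp: length_Suc_conv)
  also have "\<dots> = {gnorm g ?c p (nabla g 1 X ?c p [?\<tau> v]) | v. gnorm g ?c p (?\<tau> v) \<le> 1}"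
    using transition_deriv_inverse[OF chart_at(1) c(1) chart_at(2) c(2)] by (metis (no_types, opaque_lifting))
  also have "\<dots> = (\<lambda>v. gnorm g c p (nabla g 1 X c p [v])) ` {v. gnorm g c p v \<le> 1}"
    using gnorm_change[OF c(1) chart_at(1) c(2) chart_at(2)]
      nabla_change[OF c(1) chart_at(1) c(2) chart_at(2) X] by auto
  finally show ?thesis unfolding nabla_norm_def Let_def by simp
qed

text \<open>Real suprema carry information only for bounded sets. This supplies the boundedness,
  both for the supremum over directions at a point and for the supremum over a compact set.\<close>

lemma nabla_cell_bound:
  assumes X: "C1_field X" and S: "cell_family S"
  shows "\<exists>U. \<forall>(c, D)\<in>S. \<forall>p\<in>cell c D. gnorm g c p (X c p) \<le> U \<and>
    (\<forall>v. gnorm g c p v \<le> 1 \<longrightarrow> gnorm g c p (nabla g 1 X c p [v]) \<le> U)"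
proof -
  have "\<forall>\<^sub>F M in at_top. 0 \<le> M \<and> (\<forall>(c, D)\<in>S. \<forall>p\<in>cell c D. \<forall>v. gnorm g c p v \<le> M * norm v) \<and>
      (\<forall>(c, D)\<in>S. \<forall>p\<in>cell c D. norm (X c p) \<le> M) \<and>
      (\<forall>(c, D)\<in>S. \<forall>p\<in>cell c D. \<forall>v. norm (chart_deriv c (X c) p v) \<le> M * norm v)"
    by (intro eventually_conj eventually_ge_at_top eventually_gnorm_upper[OF S]
        field_bound[OF C1_field_C0[OF X] S] field_deriv_bound[OF X S])
  then obtain M where M: "0 \<le> M" "\<forall>(c, D)\<in>S. \<forall>p\<in>cell c D. \<forall>v. gnorm g c p v \<le> M * norm v"
    "\<forall>(c, D)\<in>S. \<forall>p\<in>cell c D. norm (X c p) \<le> M"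
    "\<forall>(c, D)\<in>S. \<forall>p\<in>cell c D. \<forall>v. norm (chart_deriv c (X c) p v) \<le> M * norm v"
    by (auto dest!: eventually_happens)
  obtain G where G: "0 \<le> G" "\<forall>(c, D)\<in>S. \<forall>p\<in>cell c D. \<forall>v w. norm (christoffel g c p v w) \<le> G * (norm v * norm w)"
    using christoffel_bound[OF S] by (elim exE conjE) (rule that)
  obtain m where m: "m > 0" "\<forall>(c, D)\<in>S. \<forall>p\<in>cell c D. \<forall>v. m * norm v \<le> gnorm g c p v"
    using ex_small_positive[OF eventually_gnorm_lower[OF S]] by (elim exE conjE) (rule that)
  \<comment> \<open>The first summand bounds the length of the field. In the second,
    \<open>1 / m\<close> bounds the coordinate norm of vectors of length at most 1, and the two
    terms come from the coordinate derivative and from the Christoffel map.\<close>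
  define U where "U = M * M + M * (M / m + G * (M / m))"
  have "gnorm g c p (X c p) \<le> U \<and> (\<forall>v. gnorm g c p v \<le> 1 \<longrightarrow> gnorm g c p (nabla g 1 X c p [v]) \<le> U)"
    if cD: "(c, D) \<in> S" "p \<in> cell c D" for c D p
  proof (intro conjI allI impI)
    have g: "gnorm g c p v \<le> M * norm v" for v using M(2) cD by blast
    have x: "norm (X c p) \<le> M" using M(3) cD by blast
    have nn: "0 \<le> M * M" "0 \<le> M * (M / m + G * (M / m))" using M(1) G(1) m(1) by simp_all
    have "gnorm g c p (X c p) \<le> M * M" using g[of "X c p"] mult_left_mono[OF x M(1)] by linarith
    then show "gnorm g c p (X c p) \<le> U" using nn unfolding U_def by linarith
    fix v assume v: "gnorm g c p v \<le> 1"
    have "m * norm v \<le> gnorm g c p v" using m(2) cD by blast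
    then have nv: "norm v \<le> 1 / m" using v m(1) by (simp add: field_simps)
    have "norm (chart_deriv c (X c) p v) \<le> M * norm v" using M(4) cD by blast
    then have 1: "norm (chart_deriv c (X c) p v) \<le> M / m" using mult_left_mono[OF nv M(1)] by simp
    have "norm (christoffel g c p v (X c p)) \<le> G * (norm v * norm (X c p))" using G(2) cD by blast
    also have "\<dots> \<le> G * (1 / m * M)" using nv x G(1) m(1) by (intro mult_left_mono mult_mono) auto
    finally have "norm (christoffel g c p v (X c p)) \<le> G * (M / m)" by simp
    from norm_triangle_mono[OF 1 this]
    have "norm (nabla g 1 X c p [v]) \<le> M / m + G * (M / m)" unfolding nabla_1 .
    then have "gnorm g c p (nabla g 1 X c p [v]) \<le> M * (M / m + G * (M / m))"
      using g[of "nabla g 1 X c p [v]"] mult_left_mono[OF _ M(1)] order_trans by blast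
    then show "gnorm g c p (nabla g 1 X c p [v]) \<le> U" using nn unfolding U_def by linarith
  qed
  then show ?thesis by blast
qed

lemma nabla_norm_1_upper:
  assumes X: "is_vector_field A X" "C1_field X" and c: "c \<in> A" "p \<in> cdom c"
    and "\<And>v. gnorm g c p v \<le> 1 \<Longrightarrow> gnorm g c p (nabla g 1 X c p [v]) \<le> U"
  shows "nabla_norm A g 1 X p \<le> U"
  unfolding nabla_norm_1_set[OF X c]
proof (rule cSUP_least)
  have "gnorm g c p 0 \<le> 1" using gnorm_scaleR[OF c, of 0 0] by simp
  then show "{v. gnorm g c p v \<le> 1} \<noteq> {}" by blast
qed (use assms in auto)

lemma nabla_norm_1_lower:
  assumes X: "is_vector_field A X" "C1_field X" and c: "c \<in> A" "p \<in> cdom c" and v: "gnorm g c p v \<le> 1"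
  shows "gnorm g c p (nabla g 1 X c p [v]) \<le> nabla_norm A g 1 X p"
  unfolding nabla_norm_1_set[OF X c]
proof (rule cSUP_upper)
  have S: "cell_family {(c, {cmap c p})}" using c by (auto simp: cell_family_def crange_def)
  obtain U where "\<forall>v. gnorm g c p v \<le> 1 \<longrightarrow> gnorm g c p (nabla g 1 X c p [v]) \<le> U"
    using nabla_cell_bound[OF X(2) S] c(2) by (auto simp: cell_def)
  then show "bdd_above ((\<lambda>v. gnorm g c p (nabla g 1 X c p [v])) ` {v. gnorm g c p v \<le> 1})"
    by (intro bdd_aboveI2[of _ _ U]) auto
qed (use v in simp)

text \<open>A bound on the seminorm passes to a point because the supremum over \<open>K\<close> is
  bounded above, which a finite cover of \<open>K\<close> by cells shows. Both summands are
  nonnegative, so each is below \<open>l\<close>.\<close>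

lemma C1_seminorm_less:
  assumes X: "is_vector_field A X" "C1_field X" and K: "compact K" "C1_seminorm A g K X < l"
    and p: "p \<in> K" and c: "c \<in> A" "p \<in> cdom c"
  shows "gnorm g c p (X c p) \<le> l" "gnorm g c p v \<le> 1 \<Longrightarrow> gnorm g c p (nabla g 1 X c p [v]) \<le> l"
proof -
  obtain S where S: "cell_family S" "K \<subseteq> cells_union S"
    using compact_cell_cover[OF K(1) open_UNIV] by auto
  obtain U where U: "\<forall>(c, D)\<in>S. \<forall>p\<in>cell c D. gnorm g c p (X c p) \<le> U \<and>
    (\<forall>v. gnorm g c p v \<le> 1 \<longrightarrow> gnorm g c p (nabla g 1 X c p [v]) \<le> U)"
    using nabla_cell_bound[OF X(2) S(1)] by (elim exE) (rule that)
  have "(\<Sum>k\<le>1. nabla_norm A g k X q) \<le> U + U" if "q \<in> K" for q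
  proof -
    have "q \<in> cells_union S" using S(2) that by blast
    then obtain a D where a: "(a, D) \<in> S" "q \<in> cell a D" by (auto simp: mem_cells_union)
    have c: "a \<in> A" "q \<in> cdom a" using cell_familyD(1)[OF S(1) a(1)] a(2) by (auto simp: cell_def)
    have "nabla_norm A g 0 X q \<le> U" unfolding nabla_norm_0[OF X(1) c] using U a by blast
    moreover have "nabla_norm A g 1 X q \<le> U" by (rule nabla_norm_1_upper[OF X c]) (use U a in blast)
    ultimately show ?thesis by simp
  qed
  then have "bdd_above ((\<lambda>q. \<Sum>k\<le>1. nabla_norm A g k X q) ` K)" by (intro bdd_aboveI2) auto
  then have "(\<Sum>k\<le>1. nabla_norm A g k X p) < l"
    using cSUP_upper[OF p] K(2) unfolding C1_seminorm_def by (meson le_less_trans)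
  then have sum: "nabla_norm A g 0 X p + nabla_norm A g 1 X p < l" by simp
  have "gnorm g c p 0 \<le> 1" using gnorm_scaleR[OF c, of 0 0] by simp
  then have "0 \<le> nabla_norm A g 1 X p"
    using nabla_norm_1_lower[OF X c] gnorm_nonneg[OF c] order_trans by blast
  then show "gnorm g c p (X c p) \<le> l" using sum unfolding nabla_norm_0[OF X(1) c] by linarith
  have "0 \<le> nabla_norm A g 0 X p" unfolding nabla_norm_0[OF X(1) c] using gnorm_nonneg[OF c] .
  then show "gnorm g c p (nabla g 1 X c p [v]) \<le> l" if "gnorm g c p v \<le> 1"
    using sum nabla_norm_1_lower[OF X c that] by linarith
qed

text \<open>The radius \<open>l\<close> bounds covariant derivatives in the metric, whereas tracking
  needs bounds for coordinate derivatives. The difference is the Christoffel term, so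
  \<open>B\<close> depends on \<open>l\<close>, the metric and the cells, and is the same for all
  fields in the ball.\<close>

lemma lie_ball_bounds:
  assumes K: "compact K" and S: "cell_family S" "cells_union S \<subseteq> K" and l: "0 \<le> l"
  shows "\<exists>B\<ge>0. \<forall>X. is_vector_field A X \<longrightarrow> C1_field X \<longrightarrow> C1_seminorm A g K X < l \<longrightarrow>
    (\<forall>(c, D)\<in>S. \<forall>p\<in>cell c D. norm (X c p) \<le> B \<and> (\<forall>v. norm (chart_deriv c (X c) p v) \<le> B * norm v))"
proof -
  obtain M where M: "0 \<le> M" "\<forall>(c, D)\<in>S. \<forall>p\<in>cell c D. \<forall>v. gnorm g c p v \<le> M * norm v"
    using eventually_happens'[OF _ eventually_conj[OF eventually_ge_at_top[of 0] eventually_gnorm_upper[OF S(1)]]] by auto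
  obtain G where G: "0 \<le> G" "\<forall>(c, D)\<in>S. \<forall>p\<in>cell c D. \<forall>v w. norm (christoffel g c p v w) \<le> G * (norm v * norm w)"
    using christoffel_bound[OF S(1)] by (elim exE conjE) (rule that)
  obtain m where m: "m > 0" "\<forall>(c, D)\<in>S. \<forall>p\<in>cell c D. \<forall>v. m * norm v \<le> gnorm g c p v"
    using ex_small_positive[OF eventually_gnorm_lower[OF S(1)]] by (elim exE conjE) (rule that)
  \<comment> \<open>\<open>l / m\<close> bounds the coordinate norm of \<open>X\<close>. The
    parenthesis bounds its coordinate derivative, seen as the covariant derivative minus the
    Christoffel term.\<close>
  define B where "B = l / m + (l * M / m + G * (l / m))"
  have nn: "0 \<le> l / m" "0 \<le> l * M / m + G * (l / m)" using l m(1) M(1) G(1) by simp_all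
  have "norm (X c p) \<le> B \<and> (\<forall>v. norm (chart_deriv c (X c) p v) \<le> B * norm v)"
    if X: "is_vector_field A X" "C1_field X" "C1_seminorm A g K X < l" and cD: "(c, D) \<in> S" "p \<in> cell c D" for X c D p
  proof (intro conjI allI)
    have c: "c \<in> A" "p \<in> cdom c" using cell_familyD(1)[OF S(1) cD(1)] cD(2) by (auto simp: cell_def)
    have "p \<in> cells_union S" using cD unfolding mem_cells_union by blast
    then have p: "p \<in> K" using S(2) by blast
    have low: "m * norm v \<le> gnorm g c p v" for v using m(2) cD by blast
    note bnd = C1_seminorm_less[OF X(1,2) K X(3) p c]
    have x: "norm (X c p) \<le> l / m" using low[of "X c p"] bnd(1) m(1) by (simp add: field_simps)
    then show "norm (X c p) \<le> B" using nn unfolding B_def by linarith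
    fix v
    have "gnorm g c p (nabla g 1 X c p [v]) \<le> l * gnorm g c p v"
    proof (cases "v = 0")
      case True
      have "nabla g 1 X c p [0] = 0" using nabla_scaleR[OF c X(2), of 0 0] by simp
      then show ?thesis using True gnorm_scaleR[OF c, of 0 0] by simp
    next
      case False
      define r where "r = gnorm g c p v"
      have r: "r > 0" using metric_pos[OF c False] unfolding r_def gnorm_def by simp
      have "gnorm g c p (v /\<^sub>R r) \<le> 1" unfolding gnorm_scaleR[OF c] using r r_def by simp
      from bnd(2)[OF this] have "gnorm g c p (nabla g 1 X c p [v]) / r \<le> l"
        unfolding nabla_scaleR[OF c X(2)] gnorm_scaleR[OF c] using r by (simp add: divide_inverse mult.commute)
      then show ?thesis using r unfolding r_def by (simp add: field_simps)
    qed
    also have "\<dots> \<le> l * (M * norm v)" using M(2) cD l by (intro mult_left_mono) blast+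
    finally have "m * norm (nabla g 1 X c p [v]) \<le> l * (M * norm v)" using low[of "nabla g 1 X c p [v]"] by linarith
    then have 1: "norm (nabla g 1 X c p [v]) \<le> l * M / m * norm v" using m(1) by (simp add: field_simps)
    have "norm (christoffel g c p v (X c p)) \<le> G * (norm v * norm (X c p))" using G(2) cD by blast
    also have "\<dots> \<le> G * (norm v * (l / m))" using x G(1) by (intro mult_left_mono) auto
    finally have "norm (- christoffel g c p v (X c p)) \<le> G * (norm v * (l / m))" by simp
    from norm_triangle_mono[OF 1 this]
    have "norm (chart_deriv c (X c) p v) \<le> l * M / m * norm v + G * (norm v * (l / m))" unfolding nabla_1 by simp
    also have "\<dots> = (l * M / m + G * (l / m)) * norm v" by (simp add: algebra_simps)
    also have "\<dots> \<le> B * norm v" using nn unfolding B_def by (intro mult_right_mono) auto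
    finally show "norm (chart_deriv c (X c) p v) \<le> B * norm v" .
  qed
  moreover have "0 \<le> B" using nn unfolding B_def by linarith
  ultimately show ?thesis by blast
qed

text \<open>An infimum over the empty set of reals would say nothing, so the approximating condition
  is exploited only after an element of the ball, the zero field, is exhibited.\<close>

lemma lie_ball_nonempty:
  assumes "0 < l" "K \<noteq> {}" shows "lie_ball A g f l K \<noteq> {}"
proof -
  define Z :: "('m, 'e) vector_field" where "Z = (\<lambda>c p. 0)"
  \<comment> \<open>The zero field is a generator scaled by 0; which generator is
    immaterial.\<close>
  have "(\<lambda>c p. 0 *\<^sub>R f undefined c p) \<in> lie_algebra f" by (intro lie_algebra.scale lie_algebra.generator)
  then have mem: "Z \<in> lie_algebra f" by (simp add: Z_def)
  have Z: "is_vector_field A Z" "C1_field Z"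
    using linear_0[OF linear_transition_deriv] Ck_on_const[OF open_crange]
    by (auto simp: is_vector_field_def C1_field_def Z_def simp del: Ck_on.simps)
  have "(\<Sum>k\<le>1. nabla_norm A g k Z p) \<le> 0" for p
  proof -
    let ?c = "chart_at A p"
    note c = chart_at[of p]
    have S: "cell_family {(?c, {cmap ?c p})}" using c by (auto simp: cell_family_def crange_def)
    have g0: "gnorm g ?c p 0 = 0" using gnorm_scaleR[OF c, of 0 0] by simp
    have "christoffel g ?c p v 0 = 0" for v
    proof -
      obtain G where "\<forall>v w. norm (christoffel g ?c p v w) \<le> G * (norm v * norm w)"
        using christoffel_bound[OF S] c(2) by (auto simp: cell_def)
      then have "norm (christoffel g ?c p v 0) \<le> G * (norm v * norm (0::'e))" by blast
      then show ?thesis by simp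
    qed
    moreover have "chart_deriv ?c (Z ?c) p v = 0" for v
      unfolding chart_deriv_eq Z_def by simp
    ultimately have "nabla g 1 Z ?c p [v] = 0" for v unfolding nabla_1 by (simp add: Z_def)
    then have "nabla_norm A g 1 Z p \<le> 0" by (intro nabla_norm_1_upper[OF Z c]) (simp add: g0)
    then show ?thesis using nabla_norm_0[OF Z(1) c] g0 by (simp add: Z_def)
  qed
  then have "C1_seminorm A g K Z \<le> 0" unfolding C1_seminorm_def by (intro cSUP_least assms)
  then show ?thesis using mem assms(1) unfolding lie_ball_def by auto
qed

end

section \<open>Trajectories of a time-variant field\<close>

context smooth_manifold
begin

lemma mem_of_cmap_image:
  assumes "c \<in> A" "p \<in> cdom c" "cmap c p \<in> cmap c ` (cdom c \<inter> W)" shows "p \<in> W"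
proof -
  obtain q where "q \<in> cdom c" "q \<in> W" "cmap c p = cmap c q" using assms(3) by blast
  then show ?thesis using cinv_cmap[OF assms(1), of q] cinv_cmap[OF assms(1,2)] by simp
qed

text \<open>With \<open>v = 0\<close> this bounds the displacement; with \<open>v\<close> the value
  of the field at the start it measures the deviation from an Euler step.\<close>

lemma trajectory_increment:
  assumes x: "trajectory A Z T x" and c: "c \<in> A" and ab: "0 \<le> a" "a \<le> b" "b \<le> T" "x ` {a..b} \<subseteq> cdom c"
    and B: "\<And>t. t \<in> {a..b} \<Longrightarrow> norm (Z t c (x t) - v) \<le> B" and "0 \<le> B"
  shows "norm (cmap c (x b) - cmap c (x a) - (b - a) *\<^sub>R v) \<le> B * (b - a)"
proof -
  have "((\<lambda>t. Z t c (x t)) has_integral cmap c (x b) - cmap c (x a)) {a..b}"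
    using x c ab unfolding trajectory_def by blast
  moreover have "((\<lambda>t. v) has_integral (b - a) *\<^sub>R v) {a..b}"
    using has_integral_const_real[of v a b] ab(2) by simp
  ultimately have "((\<lambda>t. Z t c (x t) - v) has_integral cmap c (x b) - cmap c (x a) - (b - a) *\<^sub>R v) (cbox a b)"
    using has_integral_diff by simp
  from has_integral_bound[OF \<open>0 \<le> B\<close> this] show ?thesis using B ab(2) by simp
qed

text \<open>The integral equation in \<open>c\<close> is available only as long as the path is in
  the chart, so staying there and the displacement bound are proved together, by considering the
  first time at which the open ball is left.\<close>

lemma trajectory_stays:
  assumes x: "trajectory A Z T x" and c: "c \<in> A" "x a \<in> cdom c" and ab: "0 \<le> a" "a \<le> b" "b \<le> T"
    and r: "cball (cmap c (x a)) r \<subseteq> crange c"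
    and B: "\<And>t z. t \<in> {a..b} \<Longrightarrow> z \<in> cball (cmap c (x a)) r \<Longrightarrow> norm (Z t c (cinv c z)) \<le> B"
    and small: "B * (b - a) < r" and "0 \<le> B" and t: "t \<in> {a..b}"
  shows "x t \<in> cdom c \<and> norm (cmap c (x t) - cmap c (x a)) \<le> B * (t - a)"
proof -
  let ?x0 = "cmap c (x a)"
  have r0: "0 < r" using small \<open>0 \<le> B\<close> ab(2) by (meson le_less_trans mult_nonneg_nonneg diff_ge_0_iff_ge)
  let ?U = "cell c (ball ?x0 r)" and ?V = "cell c (cball ?x0 r)"
  have UV: "?U \<subseteq> ?V" "?V \<subseteq> cdom c" by (auto simp: cell_def)
  have openU: "open ?U" by (rule open_cell[OF c(1) open_ball])
  \<comment> \<open>Compact cells are closed because the manifold is Hausdorff.\<close>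
  have closedV: "closed ?V" using compact_cell[OF c(1) compact_cball r] by (rule compact_imp_closed)
  have cont: "continuous_on {a..b} x"
    using x ab unfolding trajectory_def by (auto intro: continuous_on_subset)
  have est: "norm (cmap c (x s) - ?x0) \<le> B * (s - a)" if s: "s \<in> {a..b}" "x ` {a..s} \<subseteq> ?V" for s
  proof -
    have "norm (Z t c (x t) - 0) \<le> B" if "t \<in> {a..s}" for t
    proof -
      have "x t \<in> ?V" using s(2) that by blast
      then show ?thesis
        using B[of t "cmap c (x t)"] cinv_cmap[OF c(1)] that s(1) by (simp add: cell_def)
    qed
    then show ?thesis
      using trajectory_increment[OF x c(1) ab(1), of s 0 B] s ab UV(2) \<open>0 \<le> B\<close> by auto
  qed
  define bad where "bad = {a..b} \<inter> x -` (- ?U)"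
  have "bad = {}"
  proof (rule ccontr)
    assume ne: "bad \<noteq> {}"
    have "closed bad"
      unfolding bad_def using openU by (intro continuous_closed_preimage[OF cont]) auto
    moreover have bdd: "bdd_below bad" unfolding bad_def by (intro bdd_belowI[of _ a]) auto
    ultimately have mem: "Inf bad \<in> bad" using closed_contains_Inf[OF ne] by blast
    define s where "s = Inf bad"
    have s: "s \<in> {a..b}" "x s \<notin> ?U" using mem unfolding s_def bad_def by auto
    have before: "x t \<in> ?U" if "t \<in> {a..<s}" for t
    proof (rule ccontr)
      assume "x t \<notin> ?U"
      then have "t \<in> bad" using that s(1) unfolding bad_def by auto
      then show False using cInf_lower[OF _ bdd, of t] that unfolding s_def by simp
    qed
    have "x a \<in> ?U" using c(2) r0 by (simp add: cell_def)
    then have as: "a < s" using s by (metis atLeastAtMost_iff less_eq_real_def)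
    \<comment> \<open>Before \<open>s\<close> the path lies in the open cell; passing to the closure
      shows that \<open>x s\<close> is still in the closed one, hence in the chart.\<close>
    have "closed ({a..s} \<inter> x -` ?V)"
      by (rule continuous_closed_preimage[OF continuous_on_subset[OF cont]]) (use s closedV in auto)
    moreover have "{a..<s} \<subseteq> {a..s} \<inter> x -` ?V" using subsetD[OF UV(1) before] by auto
    ultimately have "closure {a..<s} \<subseteq> {a..s} \<inter> x -` ?V" by (intro closure_minimal)
    then have sub: "x ` {a..s} \<subseteq> ?V" using as by auto
    have "x s \<in> ?V" using sub as by auto
    \<comment> \<open>The strict inequality in \<open>small\<close> places the exit point inside the
      open ball, against its choice.\<close>
    have "norm (cmap c (x s) - ?x0) \<le> B * (s - a)" by (rule est[OF s(1) sub])
    also have "\<dots> \<le> B * (b - a)" using s(1) \<open>0 \<le> B\<close> by (intro mult_left_mono) auto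
    also note small
    finally have "x s \<in> ?U" using \<open>x s \<in> ?V\<close> by (simp add: cell_def dist_norm norm_minus_commute)
    then show False using s(2) by blast
  qed
  then have "x ` {a..b} \<subseteq> ?U" unfolding bad_def by auto
  then have inV: "x s \<in> ?V" if "s \<in> {a..b}" for s using UV(1) that by blast
  then have "x ` {a..t} \<subseteq> ?V" using t by auto
  moreover have "x t \<in> ?V" by (rule inV[OF t])
  ultimately show ?thesis using est[OF t] UV(2) by blast
qed

section \<open>Flow tubes of a C1 time-variant field\<close>

context
  fixes T :: real and Y :: "real \<Rightarrow> ('m, 'e) vector_field"
  assumes Y: "C1_time_variant_field A T Y"
begin

lemma time_field_continuous:
  assumes "c \<in> A"
  shows "continuous_on ({0..T} \<times> crange c) (\<lambda>z. Y (fst z) c (cinv c (snd z)))"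
    "continuous_on ({0..T} \<times> crange c) (\<lambda>z. chart_deriv c (Y (fst z) c) (cinv c (snd z)) v)"
proof -
  have Y1: "continuous_on ({0..T} \<times> cdom c) (\<lambda>z. Y (fst z) c (snd z))"
    and Y2: "continuous_on ({0..T} \<times> cdom c) (\<lambda>z. chart_deriv c (Y (fst z) c) (snd z) v)"
    using Y assms unfolding C1_time_variant_field_def by (auto simp: split_beta)
  have cont: "continuous_on ({0..T} \<times> crange c) (\<lambda>z. (fst z, cinv c (snd z)))"
    by (intro continuous_on_Pair continuous_on_compose2[OF continuous_cinv[OF assms]] continuous_intros) auto
  have sub: "(\<lambda>z. (fst z, cinv c (snd z))) ` ({0..T} \<times> crange c) \<subseteq> {0..T} \<times> cdom c"
    using cinv_in[OF assms] by auto
  show "continuous_on ({0..T} \<times> crange c) (\<lambda>z. Y (fst z) c (cinv c (snd z)))"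
    "continuous_on ({0..T} \<times> crange c) (\<lambda>z. chart_deriv c (Y (fst z) c) (cinv c (snd z)) v)"
    using continuous_on_compose2[OF Y1 cont sub] continuous_on_compose2[OF Y2 cont sub] by simp_all
qed

lemma time_field_bound:
  assumes S: "cell_family S"
  shows "\<forall>\<^sub>F B in at_top. \<forall>(c, D)\<in>S. \<forall>p\<in>cell c D. \<forall>t\<in>{0..T}. norm (Y t c p) \<le> B"
proof -
  have "\<forall>\<^sub>F B in at_top. \<forall>(c, D)\<in>S. \<forall>p\<in>cell c D. \<forall>t\<in>{0..T}. norm (Y t c (cinv c (cmap c p))) \<le> B"
  proof (rule eventually_cells[OF S])
    fix c D assume c: "c \<in> A" "compact D" "D \<subseteq> crange c"
    have "compact ({0..T} \<times> D)" by (intro compact_Times c(2)) auto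
    then have "bounded ((\<lambda>z. Y (fst z) c (cinv c (snd z))) ` ({0..T} \<times> D))"
      by (intro compact_imp_bounded compact_continuous_image
          continuous_on_subset[OF time_field_continuous(1)[OF c(1)]]) (use c(3) in auto)
    then obtain B where B: "\<And>t x. t \<in> {0..T} \<Longrightarrow> x \<in> D \<Longrightarrow> norm (Y t c (cinv c x)) \<le> B"
      unfolding bounded_iff by force
    show "\<forall>\<^sub>F B in at_top. \<forall>x\<in>D. \<forall>t\<in>{0..T}. norm (Y t c (cinv c x)) \<le> B"
      using eventually_ge_at_top[of B] by eventually_elim (use B order_trans in blast)
  qed
  then show ?thesis
  proof eventually_elim
    case (elim B)
    have "cinv c (cmap c p) = p" if "(c, D) \<in> S" "p \<in> cell c D" for c D p
      using cinv_cmap[OF cell_familyD(1)[OF S that(1)]] that(2) by (simp add: cell_def)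
    then show ?case using elim by fastforce
  qed
qed

lemma time_field_has_derivative:
  assumes "t \<in> {0..T}" "c \<in> A" "p \<in> cdom c"
  shows "((\<lambda>x. Y t c (cinv c x)) has_derivative chart_deriv c (Y t c) p) (at (cmap c p))"
proof -
  have "(Y t c \<circ> cinv c) differentiable (at (cmap c p))"
    using Y assms unfolding C1_time_variant_field_def by blast
  then show ?thesis using frechet_derivative_works unfolding chart_deriv_def o_def by blast
qed

lemma time_field_Lipschitz:
  assumes c: "c \<in> A" and D: "compact D" "D \<subseteq> crange c" "convex D"
  shows "\<exists>N\<ge>0. \<forall>t\<in>{0..T}. \<forall>x\<in>D. \<forall>y\<in>D. norm (Y t c (cinv c x) - Y t c (cinv c y)) \<le> N * norm (x - y)"
proof -
  have "compact ({0..T} \<times> D)" by (intro compact_Times D(1)) auto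
  then have "bounded ((\<lambda>z. chart_deriv c (Y (fst z) c) (cinv c (snd z)) b) ` ({0..T} \<times> D))" for b
    by (intro compact_imp_bounded compact_continuous_image
        continuous_on_subset[OF time_field_continuous(2)[OF c]]) (use D(2) in auto)
  then have "\<exists>B. \<forall>t\<in>{0..T}. \<forall>x\<in>D. norm (chart_deriv c (Y t c) (cinv c x) b) \<le> B" for b
    unfolding bounded_iff by force
  then obtain B where B: "\<And>b t x. t \<in> {0..T} \<Longrightarrow> x \<in> D \<Longrightarrow> norm (chart_deriv c (Y t c) (cinv c x) b) \<le> B b" by metis
  define N where "N = Max (insert 0 (B ` (Basis :: 'e set)))"
  have N: "0 \<le> N" "\<And>b. b \<in> Basis \<Longrightarrow> B b \<le> N" unfolding N_def by (rule Max_ge; simp)+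
  have "norm (Y t c (cinv c x) - Y t c (cinv c y)) \<le> real DIM('e) * N * norm (x - y)"
    if t: "t \<in> {0..T}" and xy: "x \<in> D" "y \<in> D" for t x y
  proof (rule Lipschitz_on_convex[OF D(3) _ _ xy])
    fix z assume z: "z \<in> D"
    have zc: "cinv c z \<in> cdom c" "cmap c (cinv c z) = z" using z D(2) cinv_in[OF c] cmap_cinv[OF c] by auto
    show der: "((\<lambda>x. Y t c (cinv c x)) has_derivative chart_deriv c (Y t c) (cinv c z)) (at z)"
      using time_field_has_derivative[OF t c zc(1)] zc(2) by simp
    show "norm (chart_deriv c (Y t c) (cinv c z) v) \<le> real DIM('e) * N * norm v" for v
      by (rule norm_linear_le_basis[OF has_derivative_linear[OF der]]) (use B[OF t z] N(2) order_trans in blast)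
  qed
  then show ?thesis using N(1) by (intro exI[of _ "real DIM('e) * N"]) auto
qed

lemma time_field_uniformly_continuous:
  assumes S: "cell_family S" and e: "0 < e"
  shows "\<forall>\<^sub>F d in at_right 0. \<forall>(c, D)\<in>S. \<forall>p\<in>cell c D. \<forall>t\<in>{0..T}. \<forall>s\<in>{0..T}. \<forall>q\<in>cell c D.
    \<bar>s - t\<bar> \<le> d \<longrightarrow> norm (cmap c q - cmap c p) \<le> d \<longrightarrow> norm (Y s c q - Y t c p) \<le> e"
proof -
  have "\<forall>\<^sub>F d in at_right 0. \<forall>s\<in>S. \<forall>p\<in>cell (fst s) (snd s). \<forall>t\<in>{0..T}. \<forall>t'\<in>{0..T}. \<forall>q\<in>cell (fst s) (snd s).
    \<bar>t' - t\<bar> \<le> d \<longrightarrow> norm (cmap (fst s) q - cmap (fst s) p) \<le> d \<longrightarrow> norm (Y t' (fst s) q - Y t (fst s) p) \<le> e"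
  proof (rule eventually_ball_finite[OF cell_familyD(4)[OF S]], rule ballI)
    fix s assume s: "s \<in> S"
    obtain c D where cD: "s = (c, D)" by (cases s)
    have c: "c \<in> A" "compact D" "D \<subseteq> crange c" using cell_familyD(1-3)[OF S] s unfolding cD by auto
    have "compact ({0..T} \<times> D)" by (intro compact_Times c(2)) auto
    then have "uniformly_continuous_on ({0..T} \<times> D) (\<lambda>z. Y (fst z) c (cinv c (snd z)))"
      by (intro compact_uniformly_continuous continuous_on_subset[OF time_field_continuous(1)[OF c(1)]])
        (use c(3) in auto)
    then obtain d where d: "d > 0" "\<And>z z'. z \<in> {0..T} \<times> D \<Longrightarrow> z' \<in> {0..T} \<times> D \<Longrightarrow> dist z' z < d \<Longrightarrow>
        dist (Y (fst z') c (cinv c (snd z'))) (Y (fst z) c (cinv c (snd z))) < e"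
      unfolding uniformly_continuous_on_def using e by metis
    have "norm (Y t' c q - Y t c p) \<le> e"
      if h: "h < d / 2" and pq: "p \<in> cell c D" "q \<in> cell c D" and t: "t \<in> {0..T}" "t' \<in> {0..T}"
        and near: "\<bar>t' - t\<bar> \<le> h" "norm (cmap c q - cmap c p) \<le> h" for h p q t t'
    proof -
      have "dist (t', cmap c q) (t, cmap c p) \<le> dist t' t + dist (cmap c q) (cmap c p)"
        unfolding dist_Pair_Pair by (rule sqrt_sum_squares_le_sum) auto
      also have "\<dots> < d" using near h by (simp add: dist_norm)
      finally have "dist (Y t' c (cinv c (cmap c q))) (Y t c (cinv c (cmap c p))) < e"
        using d(2)[of "(t, cmap c p)" "(t', cmap c q)"] pq t by (simp add: cell_def)
      then show ?thesis using cinv_cmap[OF c(1)] pq by (simp add: cell_def dist_norm)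
    qed
    then show "\<forall>\<^sub>F d in at_right 0. \<forall>p\<in>cell (fst s) (snd s). \<forall>t\<in>{0..T}. \<forall>t'\<in>{0..T}. \<forall>q\<in>cell (fst s) (snd s).
      \<bar>t' - t\<bar> \<le> d \<longrightarrow> norm (cmap (fst s) q - cmap (fst s) p) \<le> d \<longrightarrow> norm (Y t' (fst s) q - Y t (fst s) p) \<le> e"
      unfolding cD fst_conv snd_conv eventually_at_right_field using d(1)
      by (intro exI[of _ "d / 2"] conjI allI impI ballI) auto
  qed
  then show ?thesis by eventually_elim fastforce
qed

text \<open>
  Continuous dependence on the initial point, in a form that can be chained over time intervals
  without reference to charts.
\<close>

lemma local_flow_tube:
  assumes x0: "trajectory A Y T x0" and s: "s \<in> {0..T}"
  shows "\<exists>d>0. \<forall>a b. a \<le> s \<and> s \<le> b \<and> b - a < d \<longrightarrow> 0 \<le> a \<longrightarrow> b \<le> T \<longrightarrow>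
    (\<forall>V W. open V \<longrightarrow> x0 b \<in> V \<longrightarrow> open W \<longrightarrow> x0 ` {a..b} \<subseteq> W \<longrightarrow>
    (\<exists>U. open U \<and> x0 a \<in> U \<and> (\<forall>x. trajectory A Y T x \<longrightarrow> x a \<in> U \<longrightarrow> x b \<in> V \<and> x ` {a..b} \<subseteq> W)))"
proof -
  obtain c where c: "c \<in> A" "x0 s \<in> cdom c" using ex_chart by blast
  obtain \<rho>' where \<rho>': "\<rho>' > 0" "cball (cmap c (x0 s)) \<rho>' \<subseteq> crange c"
    using open_crange[OF c(1)] cmap_in[OF c] unfolding open_contains_cball by meson
  \<comment> \<open>Of the three thirds of \<open>\<rho>'\<close>, one is for the reference
    trajectory, one for the initial deviation, and one for the motion of the perturbed
    trajectory.\<close>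
  define \<rho> where "\<rho> = \<rho>' / 3"
  have \<rho>: "\<rho> > 0" "3 * \<rho> = \<rho>'" using \<rho>'(1) by (simp_all add: \<rho>_def)
  let ?D = "cball (cmap c (x0 s)) \<rho>'"
  have S: "cell_family {(c, ?D)}" using c(1) \<rho>'(2) by (simp add: cell_family_def)
  obtain B where B: "0 \<le> B" "\<And>t p. t \<in> {0..T} \<Longrightarrow> p \<in> cell c ?D \<Longrightarrow> norm (Y t c p) \<le> B"
    using eventually_happens'[OF _ eventually_conj[OF eventually_ge_at_top[of 0] time_field_bound[OF S]]] by auto
  obtain N where N: "0 \<le> N" "\<And>t x y. t \<in> {0..T} \<Longrightarrow> x \<in> ?D \<Longrightarrow> y \<in> ?D \<Longrightarrow>
      norm (Y t c (cinv c x) - Y t c (cinv c y)) \<le> N * norm (x - y)"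
    using time_field_Lipschitz[OF c(1) compact_cball \<rho>'(2) convex_cball] by blast
  have cont: "continuous_on {0..T} x0" using x0 unfolding trajectory_def by blast
  have "open (cell c (ball (cmap c (x0 s)) \<rho>))" by (rule open_cell[OF c(1) open_ball])
  moreover have "x0 s \<in> cell c (ball (cmap c (x0 s)) \<rho>)" using c(2) \<rho>(1) by (simp add: cell_def)
  moreover have "(x0 \<longlongrightarrow> x0 s) (at s within {0..T})" using cont s unfolding continuous_on_def by blast
  ultimately have "\<forall>\<^sub>F t in at s within {0..T}. x0 t \<in> cell c (ball (cmap c (x0 s)) \<rho>)"
    using topological_tendstoD by blast
  then obtain d1 where d1: "d1 > 0" "\<And>t. t \<in> {0..T} \<Longrightarrow> t \<noteq> s \<Longrightarrow> dist t s < d1 \<Longrightarrow>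
      x0 t \<in> cell c (ball (cmap c (x0 s)) \<rho>)"
    unfolding eventually_at by blast
  \<comment> \<open>The three conditions keep perturbed trajectories in the chart, make the
    Lipschitz growth of the deviation at most one half, and keep \<open>x0\<close> near
    \<open>x0 s\<close>.\<close>
  have "\<forall>\<^sub>F h in at_right 0. h * B \<le> \<rho> / 2 \<and> h * N \<le> 1 / 2 \<and> h * 1 \<le> d1"
    using \<rho>(1) d1(1) by (intro eventually_conj eventually_small_mult) auto
  from ex_small_positive[OF this] obtain d where d: "d > 0" "d * B \<le> \<rho> / 2" "d * N \<le> 1 / 2" "d \<le> d1" by auto
  have main: "\<exists>U. open U \<and> x0 a \<in> U \<and> (\<forall>x. trajectory A Y T x \<longrightarrow> x a \<in> U \<longrightarrow> x b \<in> V \<and> x ` {a..b} \<subseteq> W)"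
    if ab: "0 \<le> a" "b \<le> T" "a \<le> s" "s \<le> b" "b - a < d" and V: "open V" "x0 b \<in> V" and W: "open W" "x0 ` {a..b} \<subseteq> W"
    for a b V W
  proof -
    have near: "x0 t \<in> cell c (ball (cmap c (x0 s)) \<rho>)" if "t \<in> {a..b}" for t
    proof (cases "t = s")
      case True
      then show ?thesis using c(2) \<rho>(1) by (simp add: cell_def)
    next
      case False
      then show ?thesis using d1(2)[of t] that ab d(4) by (auto simp: dist_real_def)
    qed
    then have x0c: "x0 t \<in> cdom c" "norm (cmap c (x0 t) - cmap c (x0 s)) < \<rho>" if "t \<in> {a..b}" for t
      using near[OF that] by (simp_all add: cell_def dist_norm norm_minus_commute)
    let ?u = "\<lambda>t. cmap c (x0 t)"
    have cont_y0: "continuous_on {a..b} ?u"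
      by (rule continuous_on_compose2[OF continuous_cmap[OF c(1)] continuous_on_subset[OF cont]])
        (use x0c ab in auto)
    have "compact (?u ` {a..b})" by (rule compact_continuous_image[OF cont_y0]) simp
    moreover have "?u ` {a..b} \<subseteq> cmap c ` (cdom c \<inter> W)" using x0c W(2) by auto
    ultimately have evW: "\<forall>\<^sub>F e in at_right 0. thicken e (?u ` {a..b}) \<subseteq> cmap c ` (cdom c \<inter> W)"
      using eventually_thicken_subset open_cmap_image[OF c(1) W(1)] by blast
    have b: "b \<in> {a..b}" using ab by simp
    then have "{?u b} \<subseteq> cmap c ` (cdom c \<inter> V)" using x0c V(2) by auto
    then have evV: "\<forall>\<^sub>F e in at_right 0. thicken e {?u b} \<subseteq> cmap c ` (cdom c \<inter> V)"
      by (rule eventually_thicken_subset[OF compact_sing open_cmap_image[OF c(1) V(1)]])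
    have "\<forall>\<^sub>F e in at_right 0. e * 1 \<le> \<rho>" by (rule eventually_small_mult[OF \<rho>(1)])
    from ex_small_positive[OF eventually_conj[OF this eventually_conj[OF evW evV]]]
    obtain e where e: "e > 0" "e \<le> \<rho>" "thicken e (?u ` {a..b}) \<subseteq> cmap c ` (cdom c \<inter> W)"
      "thicken e {?u b} \<subseteq> cmap c ` (cdom c \<inter> V)" by auto
    have a: "a \<in> {a..b}" using ab by simp
    let ?U = "cell c (ball (?u a) (e / 2))"
    have "x b \<in> V \<and> x ` {a..b} \<subseteq> W" if x: "trajectory A Y T x" and xU: "x a \<in> ?U" for x
    proof -
      let ?y = "\<lambda>t. cmap c (x t)"
      have xa: "x a \<in> cdom c" "norm (?y a - ?u a) < e / 2"
        using xU by (auto simp: cell_def dist_norm norm_minus_commute)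
      have "norm (?y a - cmap c (x0 s)) \<le> e / 2 + \<rho>"
        using norm_triangle_mono[OF less_imp_le[OF xa(2)] less_imp_le[OF x0c(2)[OF a]]] by simp
      then have ball: "cball (?y a) \<rho> \<subseteq> ?D"
        using e(2) \<rho> by (intro cball_subset_cball_iff[THEN iffD2]) (auto simp: dist_norm)
      have stay: "x t \<in> cdom c \<and> norm (?y t - ?y a) \<le> B * (t - a)" if t: "t \<in> {a..b}" for t
      proof (rule trajectory_stays[OF x c(1) xa(1) ab(1) _ ab(2) subset_trans[OF ball \<rho>'(2)] _ _ B(1) t])
        show "a \<le> b" using ab by simp
        show "norm (Y t c (cinv c z)) \<le> B" if "t \<in> {a..b}" "z \<in> cball (?y a) \<rho>" for t z
        proof (rule B(2))
          show "cinv c z \<in> cell c ?D"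
            using that(2) ball \<rho>'(2) cinv_in[OF c(1)] cmap_cinv[OF c(1)] by (force simp: cell_def)
        qed (use that ab in auto)
        have "B * (b - a) \<le> B * d" using B(1) ab(5) by (intro mult_left_mono) auto
        then show "B * (b - a) < \<rho>" using d(2) \<rho>(1) by (simp add: mult.commute)
      qed
      have inD: "?y t \<in> ?D" "?u t \<in> ?D" if t: "t \<in> {a..b}" for t
      proof -
        have "B * (t - a) \<le> B * d" using t B(1) ab(5) by (intro mult_left_mono) auto
        then have "norm (?y t - ?y a) \<le> \<rho>" using stay[OF t] d(2) \<rho>(1) by (simp add: mult.commute)
        then have "?y t \<in> cball (?y a) \<rho>" by (simp add: dist_norm norm_minus_commute)
        then show "?y t \<in> ?D" using ball by blast
        show "?u t \<in> ?D" using x0c(2)[OF t] \<rho> by (auto simp: dist_norm norm_minus_commute)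
      qed
      have "continuous_on {0..T} x" using x unfolding trajectory_def by blast
      then have cont_y: "continuous_on {a..b} ?y"
        by (intro continuous_on_compose2[OF continuous_cmap[OF c(1)] continuous_on_subset])
          (use stay ab in auto)
      \<comment> \<open>At the time \<open>m\<close> of largest distance, that distance is at most
        the initial one plus half of itself. This replaces a Gronwall estimate.\<close>
      obtain m where m: "m \<in> {a..b}" "\<And>t. t \<in> {a..b} \<Longrightarrow> norm (?y t - ?u t) \<le> norm (?y m - ?u m)"
      proof -
        have "\<exists>m\<in>{a..b}. \<forall>t\<in>{a..b}. norm (?y t - ?u t) \<le> norm (?y m - ?u m)"
          by (rule continuous_attains_sup) (use a in \<open>auto intro!: continuous_intros cont_y cont_y0\<close>)
        then show thesis using that by blast
      qed
      let ?m = "norm (?y m - ?u m)"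
      have int: "((\<lambda>t. Y t c (x t) - Y t c (x0 t)) has_integral (?y m - ?y a) - (?u m - ?u a)) (cbox a m)"
      proof (unfold box_real, rule has_integral_diff)
        have sub: "x ` {a..m} \<subseteq> cdom c" "x0 ` {a..m} \<subseteq> cdom c" using stay x0c(1) m(1) by auto
        show "((\<lambda>t. Y t c (x t)) has_integral ?y m - ?y a) {a..m}"
          using x c(1) ab m(1) sub(1) unfolding trajectory_def by simp
        show "((\<lambda>t. Y t c (x0 t)) has_integral ?u m - ?u a) {a..m}"
          using x0 c(1) ab m(1) sub(2) unfolding trajectory_def by simp
      qed
      have "norm (Y t c (x t) - Y t c (x0 t)) \<le> N * ?m" if t: "t \<in> cbox a m" for t
      proof -
        have t': "t \<in> {a..b}" using t m(1) by simp
        have "norm (Y t c (x t) - Y t c (x0 t)) \<le> N * norm (?y t - ?u t)"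
          using N(2)[OF _ inD[OF t'], of t] cinv_cmap[OF c(1)] stay[OF t'] x0c(1)[OF t'] t' ab by simp
        then show ?thesis using mult_left_mono[OF m(2)[OF t'] N(1)] by linarith
      qed
      then have "norm ((?y m - ?y a) - (?u m - ?u a)) \<le> N * ?m * measure lborel (cbox a m)"
        using N(1) by (intro has_integral_bound[OF _ int]) auto
      also have "\<dots> = (m - a) * N * ?m" using m(1) by simp
      also have "\<dots> \<le> 1 / 2 * ?m"
      proof (rule mult_right_mono)
        have "(m - a) * N \<le> d * N" using m(1) ab(5) N(1) by (intro mult_right_mono) auto
        then show "(m - a) * N \<le> 1 / 2" using d(3) by linarith
      qed simp
      finally have "norm ((?y m - ?y a) - (?u m - ?u a)) \<le> 1 / 2 * ?m" .
      from norm_triangle_mono[OF this less_imp_le[OF xa(2)]] have "?m \<le> e" by (simp add: algebra_simps)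
      then have close: "norm (?y t - ?u t) \<le> e" if "t \<in> {a..b}" for t using m(2)[OF that] by linarith
      have "?y t \<in> cmap c ` (cdom c \<inter> W)" if "t \<in> {a..b}" for t
        using e(3) thickenI[of "?u t" "?u ` {a..b}" "?y t" e] close[OF that] that by blast
      moreover have "?y b \<in> cmap c ` (cdom c \<inter> V)"
        using e(4) thickenI[of "?u b" "{?u b}" "?y b" e] close[OF b] by blast
      ultimately show ?thesis using stay b mem_of_cmap_image[OF c(1)] by blast
    qed
    moreover have "open ?U" by (rule open_cell[OF c(1) open_ball])
    moreover have "x0 a \<in> ?U" using x0c(1)[OF a] e(1) by (simp add: cell_def)
    ultimately show ?thesis by blast
  qed
  show ?thesis by (intro exI[of _ d] conjI allI impI d(1) main) auto
qed

text \<open>Short intervals are glued by bisection. The local form allows an arbitrary open target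
  \<open>V\<close> at the right end, so the set \<open>U\<close> of one interval can be the target
  of the preceding one.\<close>

lemma flow_tube:
  assumes x0: "trajectory A Y T x0" and T: "0 \<le> T" and W: "open W" "x0 ` {0..T} \<subseteq> W"
  shows "\<exists>U. open U \<and> x0 0 \<in> U \<and> (\<forall>x. trajectory A Y T x \<longrightarrow> x 0 \<in> U \<longrightarrow> x ` {0..T} \<subseteq> W)"
proof -
  define Q where "Q a b \<longleftrightarrow> (0 \<le> a \<longrightarrow> b \<le> T \<longrightarrow> (\<forall>V W. open V \<longrightarrow> x0 b \<in> V \<longrightarrow> open W \<longrightarrow> x0 ` {a..b} \<subseteq> W \<longrightarrow>
    (\<exists>U. open U \<and> x0 a \<in> U \<and> (\<forall>x. trajectory A Y T x \<longrightarrow> x a \<in> U \<longrightarrow> x b \<in> V \<and> x ` {a..b} \<subseteq> W))))" for a b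
  have "Q 0 T"
  proof (rule Bolzano[OF T])
    fix a b c assume Q: "Q a b" "Q b c" and abc: "a \<le> b" "b \<le> c"
    show "Q a c"
      unfolding Q_def
    proof (intro impI allI)
      fix V W assume ac: "0 \<le> a" "c \<le> T" and V: "open V" "x0 c \<in> V" and W: "open W" "x0 ` {a..c} \<subseteq> W"
      have W': "x0 ` {a..b} \<subseteq> W" "x0 ` {b..c} \<subseteq> W" using W(2) abc by (auto simp: image_subset_iff)
      obtain U' where U': "open U'" "x0 b \<in> U'"
        "\<And>x. trajectory A Y T x \<Longrightarrow> x b \<in> U' \<Longrightarrow> x c \<in> V \<and> x ` {b..c} \<subseteq> W"
        using Q(2) abc ac V W(1) W'(2) unfolding Q_def by (meson order_trans)
      obtain U where U: "open U" "x0 a \<in> U"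
        "\<And>x. trajectory A Y T x \<Longrightarrow> x a \<in> U \<Longrightarrow> x b \<in> U' \<and> x ` {a..b} \<subseteq> W"
        using Q(1) abc ac U'(1,2) W(1) W'(1) unfolding Q_def by (meson order_trans)
      have "{a..c} = {a..b} \<union> {b..c}" using abc by auto
      then have "x c \<in> V \<and> x ` {a..c} \<subseteq> W" if "trajectory A Y T x" "x a \<in> U" for x
        using U(3)[OF that] U'(3)[OF that(1)] by (simp add: image_Un)
      then show "\<exists>U. open U \<and> x0 a \<in> U \<and> (\<forall>x. trajectory A Y T x \<longrightarrow> x a \<in> U \<longrightarrow> x c \<in> V \<and> x ` {a..c} \<subseteq> W)"
        using U(1,2) by blast
    qed
  next
    fix s assume "0 \<le> s" "s \<le> T"
    then show "\<exists>d>0. \<forall>a b. a \<le> s \<and> s \<le> b \<and> b - a < d \<longrightarrow> Q a b"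
      unfolding Q_def by (intro local_flow_tube[OF x0]) simp
  qed
  then show ?thesis unfolding Q_def using W by (meson T open_UNIV UNIV_I order_refl)
qed

text \<open>Each single trajectory has a tube inside a compact subset of \<open>W\<close>; by
  continuity of \<open>\<alpha>\<close> a neighbourhood of the parameter stays in it, and finitely
  many neighbourhoods cover \<open>\<Theta>\<close>. No continuity of the trajectories in the
  parameter is given beforehand.\<close>

lemma compact_flow_tube:
  assumes \<Theta>: "compact \<Theta>" "continuous_on \<Theta> \<alpha>" and T: "0 \<le> T"
    and x: "\<And>\<theta>. \<theta> \<in> \<Theta> \<Longrightarrow> trajectory A Y T (x \<theta>)" "\<And>\<theta>. \<theta> \<in> \<Theta> \<Longrightarrow> x \<theta> 0 = \<alpha> \<theta>"
    and W: "open W" "\<And>\<theta>. \<theta> \<in> \<Theta> \<Longrightarrow> x \<theta> ` {0..T} \<subseteq> W"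
  shows "\<exists>K. compact K \<and> K \<subseteq> W \<and> (\<forall>\<theta>\<in>\<Theta>. x \<theta> ` {0..T} \<subseteq> K)"
proof -
  have "\<exists>O' K. open O' \<and> \<theta> \<in> O' \<and> compact K \<and> K \<subseteq> W \<and> (\<forall>\<theta>'\<in>O' \<inter> \<Theta>. x \<theta>' ` {0..T} \<subseteq> K)" if \<theta>: "\<theta> \<in> \<Theta>" for \<theta>
  proof -
    have "continuous_on {0..T} (x \<theta>)" using x(1)[OF \<theta>] unfolding trajectory_def by blast
    then have "compact (x \<theta> ` {0..T})" by (rule compact_continuous_image) simp
    from compact_cell_cover[OF this W(1) W(2)[OF \<theta>]]
    obtain S where S: "cell_family S" "x \<theta> ` {0..T} \<subseteq> cells_union S" "\<forall>(c, D)\<in>S. D \<subseteq> cmap c ` (cdom c \<inter> W)"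
      by (elim exE conjE) (rule that)
    have "\<forall>\<^sub>F r in at_right 0. \<forall>(c, D)\<in>S. thicken r D \<subseteq> cmap c ` (cdom c \<inter> W)"
      by (rule eventually_cells_in_open[OF S(1)])
        (use S(3) open_cmap_image[OF cell_familyD(1)[OF S(1)] W(1)] in blast)
    from ex_small_positive[OF this]
    obtain r where r: "r > 0" "\<forall>(c, D)\<in>S. thicken r D \<subseteq> cmap c ` (cdom c \<inter> W)" by (elim exE conjE) (rule that)
    let ?K = "cells_union (enlarge r S)"
    have "thicken r D \<subseteq> crange c" if "(c, D) \<in> S" for c D using r(2) that by (force simp: crange_def)
    then have fam: "cell_family (enlarge r S)" by (rule cell_family_enlarge[OF S(1)])
    have "p \<in> W" if p: "p \<in> ?K" for p
    proof -
      obtain c D where cD: "(c, D) \<in> S" "p \<in> cell c (thicken r D)"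
        using p by (auto simp: mem_cells_union enlarge_def)
      then have "cmap c p \<in> cmap c ` (cdom c \<inter> W)" "p \<in> cdom c" using r(2) by (auto simp: cell_def)
      then show ?thesis using mem_of_cmap_image[OF cell_familyD(1)[OF S(1) cD(1)]] by blast
    qed
    then have KW: "?K \<subseteq> W" by blast
    \<comment> \<open>An open set between the cells of \<open>S\<close> and their closed
      enlargement, since \<open>flow_tube\<close> asks for an open tube.\<close>
    define V where "V = (\<Union>(c, D)\<in>S. cell c (\<Union>z\<in>D. ball z r))"
    have "open (cell c (\<Union>z\<in>D. ball z r))" if "(c, D) \<in> S" for c D
      by (rule open_cell[OF cell_familyD(1)[OF S(1) that]]) auto
    then have "open V" unfolding V_def by (intro open_UN) auto
    moreover have "cells_union S \<subseteq> V"
    proof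
      fix p assume "p \<in> cells_union S"
      then obtain c D where cD: "(c, D) \<in> S" "p \<in> cell c D" by (auto simp: mem_cells_union)
      then have "p \<in> cell c (\<Union>z\<in>D. ball z r)" using r(1) by (auto simp: cell_def intro!: bexI[of _ "cmap c p"])
      then show "p \<in> V" unfolding V_def using cD(1) by blast
    qed
    then have "x \<theta> ` {0..T} \<subseteq> V" using S(2) by blast
    ultimately obtain U where U: "open U" "x \<theta> 0 \<in> U" "\<forall>z. trajectory A Y T z \<longrightarrow> z 0 \<in> U \<longrightarrow> z ` {0..T} \<subseteq> V"
      using flow_tube[OF x(1)[OF \<theta>] T, of V] by blast
    have VK: "V \<subseteq> ?K"
    proof
      fix p assume "p \<in> V"
      then obtain c D where cD: "(c, D) \<in> S" "p \<in> cell c (\<Union>z\<in>D. ball z r)" unfolding V_def by auto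
      then have "p \<in> cell c (thicken r D)" by (force simp: cell_def thicken_def)
      moreover have "(c, thicken r D) \<in> enlarge r S" using cD(1) by (force simp: enlarge_def)
      ultimately show "p \<in> ?K" unfolding mem_cells_union by blast
    qed
    obtain O' where O': "open O'" "O' \<inter> \<Theta> = \<alpha> -` U \<inter> \<Theta>"
      using \<Theta>(2) U(1) unfolding continuous_on_open_invariant by blast
    have "x \<theta>' ` {0..T} \<subseteq> ?K" if "\<theta>' \<in> O' \<inter> \<Theta>" for \<theta>'
    proof -
      have "x \<theta>' 0 \<in> U" using that O'(2) x(2)[of \<theta>'] by auto
      then show ?thesis using U(3) x(1)[of \<theta>'] that VK by blast
    qed
    moreover have "\<theta> \<in> O'" using O'(2) U(2) x(2)[OF \<theta>] \<theta> by auto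
    ultimately show ?thesis using O'(1) KW compact_cells_union[OF fam] by blast
  qed
  then obtain N K where NK: "\<And>\<theta>. \<theta> \<in> \<Theta> \<Longrightarrow> open (N \<theta>) \<and> \<theta> \<in> N \<theta> \<and> compact (K \<theta>) \<and> K \<theta> \<subseteq> W \<and>
      (\<forall>\<theta>'\<in>N \<theta> \<inter> \<Theta>. x \<theta>' ` {0..T} \<subseteq> K \<theta>)" by metis
  have "\<And>\<theta>. \<theta> \<in> \<Theta> \<Longrightarrow> open (N \<theta>)" "\<Theta> \<subseteq> (\<Union>\<theta>\<in>\<Theta>. N \<theta>)" using NK by auto
  then obtain P where P: "P \<subseteq> \<Theta>" "finite P" "\<Theta> \<subseteq> (\<Union>\<theta>\<in>P. N \<theta>)"
    using compactE_image[OF \<Theta>(1), of \<Theta> N thesis] by blast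
  have "compact (\<Union>\<theta>\<in>P. K \<theta>)" using P NK by (intro compact_UN) auto
  moreover have "(\<Union>\<theta>\<in>P. K \<theta>) \<subseteq> W" using P NK by blast
  moreover have "x \<theta> ` {0..T} \<subseteq> (\<Union>\<theta>\<in>P. K \<theta>)" if \<theta>: "\<theta> \<in> \<Theta>" for \<theta>
  proof -
    obtain \<theta>0 where "\<theta>0 \<in> P" "\<theta> \<in> N \<theta>0" using P(3) \<theta> by blast
    then show ?thesis using NK[of \<theta>0] P(1) \<theta> by blast
  qed
  ultimately show ?thesis by (intro exI[of _ "\<Union>\<theta>\<in>P. K \<theta>"] conjI ballI)
qed

end

end

section \<open>Tracking the diffeotopy\<close>

text \<open>The factor of one step, \<open>1 + L * h\<close>, is at most
  \<open>exp (L * h)\<close>.\<close>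

lemma discrete_gronwall:
  fixes E :: "nat \<Rightarrow> real"
  assumes "0 \<le> L" "0 \<le> h" "0 \<le> k" "0 \<le> E 0"
    and "\<And>j. j < n \<Longrightarrow> E (Suc j) \<le> (1 + L * h) * E j + h * k" and "j \<le> n"
  shows "E j \<le> exp (L * (real j * h)) * (E 0 + real j * h * k)"
  using \<open>j \<le> n\<close>
proof (induction j)
  case (Suc j)
  let ?F = "E 0 + real j * h * k"
  have F: "0 \<le> ?F" using assms by simp
  have one: "1 \<le> exp (L * (real (Suc j) * h))" using assms by simp
  have "E (Suc j) \<le> (1 + L * h) * E j + h * k" using assms(5) Suc.prems by simp
  also have "\<dots> \<le> (1 + L * h) * (exp (L * (real j * h)) * ?F) + h * k"
    using Suc assms(1,2) by (intro add_right_mono mult_left_mono) auto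
  also have "\<dots> \<le> exp (L * h) * (exp (L * (real j * h)) * ?F) + exp (L * (real (Suc j) * h)) * (h * k)"
  proof (rule add_mono)
    show "(1 + L * h) * (exp (L * (real j * h)) * ?F) \<le> exp (L * h) * (exp (L * (real j * h)) * ?F)"
      using F exp_ge_add_one_self[of "L * h"] by (intro mult_right_mono) auto
    show "h * k \<le> exp (L * (real (Suc j) * h)) * (h * k)"
      using mult_right_mono[OF one, of "h * k"] assms(2,3) by simp
  qed
  also have "\<dots> = exp (L * (real (Suc j) * h)) * (E 0 + real (Suc j) * h * k)"
  proof -
    have "exp (L * h) * exp (L * (real j * h)) = exp (L * (real (Suc j) * h))"
      by (simp add: algebra_simps flip: exp_add)
    then show ?thesis by (simp add: algebra_simps)
  qed
  finally show ?case .
qed simp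

lemma enlargeI: "(c, D) \<in> S \<Longrightarrow> (c, thicken r D) \<in> enlarge r S"
  by (force simp: enlarge_def)

lemma enlargeE:
  assumes "(c, E) \<in> enlarge r S" obtains D where "(c, D) \<in> S" "E = thicken r D"
  using assms by (auto simp: enlarge_def)

context smooth_manifold
begin

text \<open>The second point is the reference: closeness is demanded in each chart of the family
  whose cell contains it. A reference outside all cells imposes nothing; the points of the moving
  ensemble always lie in \<open>cells_union S\<close>.\<close>

definition near ::
    "(('m, 'e) chart \<times> 'e set) set \<Rightarrow> real \<Rightarrow> 'm \<Rightarrow> 'm \<Rightarrow> bool" where
  "near S d q p \<longleftrightarrow> (\<forall>(c, D)\<in>S. p \<in> cell c D \<longrightarrow> q \<in> cdom c \<and> norm (cmap c q - cmap c p) \<le> d)"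

text \<open>The tolerance at the start makes the notion composable: the final error of one interval
  is the initial error of the next. The word may depend on the accuracy but not on the member of the
  ensemble.\<close>

definition ensemble_steerable ::
    "('k::finite \<Rightarrow> ('m, 'e) vector_field) \<Rightarrow> (('m, 'e) chart \<times> 'e set) set \<Rightarrow> 'p set \<Rightarrow>
     (real \<Rightarrow> 'p \<Rightarrow> 'm) \<Rightarrow> real \<Rightarrow> real \<Rightarrow> bool" where
  "ensemble_steerable f S \<Theta> \<gamma> a b \<longleftrightarrow> (\<forall>e>0. \<exists>d>0. \<exists>w. \<forall>\<theta>\<in>\<Theta>. \<forall>p.
     near S d p (\<gamma> a \<theta>) \<longrightarrow> (\<exists>q. reach f w p q \<and> near S e q (\<gamma> b \<theta>)))"

lemma ensemble_steerable_refl: "ensemble_steerable f S \<Theta> \<gamma> a a"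
  unfolding ensemble_steerable_def
proof (intro allI impI)
  fix e :: real assume "0 < e"
  then show "\<exists>d>0. \<exists>w. \<forall>\<theta>\<in>\<Theta>. \<forall>p. near S d p (\<gamma> a \<theta>) \<longrightarrow> (\<exists>q. reach f w p q \<and> near S e q (\<gamma> a \<theta>))"
    by (intro exI[of _ e] conjI exI[of _ "[]"]) auto
qed

lemma ensemble_steerable_trans:
  assumes "ensemble_steerable f S \<Theta> \<gamma> a b" "ensemble_steerable f S \<Theta> \<gamma> b c"
  shows "ensemble_steerable f S \<Theta> \<gamma> a c"
  unfolding ensemble_steerable_def
proof (intro allI impI)
  fix e :: real assume "0 < e"
  then obtain d w where d: "0 < d" and w: "\<forall>\<theta>\<in>\<Theta>. \<forall>p. near S d p (\<gamma> b \<theta>) \<longrightarrow> (\<exists>q. reach f w p q \<and> near S e q (\<gamma> c \<theta>))"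
    using assms(2) unfolding ensemble_steerable_def by blast
  obtain d' w' where d': "0 < d'" and w': "\<forall>\<theta>\<in>\<Theta>. \<forall>p. near S d' p (\<gamma> a \<theta>) \<longrightarrow> (\<exists>q. reach f w' p q \<and> near S d q (\<gamma> b \<theta>))"
    using assms(1) d unfolding ensemble_steerable_def by blast
  have "\<forall>\<theta>\<in>\<Theta>. \<forall>p. near S d' p (\<gamma> a \<theta>) \<longrightarrow> (\<exists>q. reach f (w' @ w) p q \<and> near S e q (\<gamma> c \<theta>))"
    using w w' unfolding reach_append by meson
  then show "\<exists>d>0. \<exists>w. \<forall>\<theta>\<in>\<Theta>. \<forall>p. near S d p (\<gamma> a \<theta>) \<longrightarrow> (\<exists>q. reach f w p q \<and> near S e q (\<gamma> c \<theta>))"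
    using d' by blast
qed

lemma field_Lipschitz:
  assumes X: "C1_field X" and c: "c \<in> A" and C: "convex C" "C \<subseteq> crange c"
    and B: "\<And>p v. p \<in> cell c C \<Longrightarrow> norm (chart_deriv c (X c) p v) \<le> B * norm v"
    and pq: "p \<in> cell c C" "q \<in> cell c C"
  shows "norm (X c q - X c p) \<le> B * norm (cmap c q - cmap c p)"
proof -
  have "norm (X c (cinv c (cmap c q)) - X c (cinv c (cmap c p))) \<le> B * norm (cmap c q - cmap c p)"
  proof (rule Lipschitz_on_convex[OF C(1)])
    fix x assume x: "x \<in> C"
    then have xc: "cinv c x \<in> cdom c" "cmap c (cinv c x) = x" using C(2) cinv_in[OF c] cmap_cinv[OF c] by auto
    then have mem: "cinv c x \<in> cell c C" using x by (simp add: cell_def)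
    show "((\<lambda>x. X c (cinv c x)) has_derivative chart_deriv c (X c) (cinv c x)) (at x)"
      using C1_field_has_derivative[OF X c xc(1)] xc(2) by simp
    show "norm (chart_deriv c (X c) (cinv c x) v) \<le> B * norm v" for v by (rule B[OF mem])
  qed (use pq in \<open>auto simp: cell_def\<close>)
  then show ?thesis using cinv_cmap[OF c] pq by (simp add: cell_def)
qed

end

section \<open>Euler polygons on one short time interval\<close>

context riemannian
begin

text \<open>On an interval shorter than \<open>\<tau>\<close> a reference trajectory and the
  controlled points following it stay in one enlarged cell, so they are compared in a single chart.
  \<open>\<tau>\<close> depends on \<open>r\<close> and on bounds for \<open>Y\<close> and for the
  whole ball of fields, but neither on the accuracy nor on the fields chosen at the nodes, so a
  uniform subdivision of \<open>[0,T]\<close> is possible.\<close>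

lemma steerable_on_short_intervals:
  fixes f :: "'k::finite \<Rightarrow> ('m, 'e) vector_field"
  assumes Y: "C1_time_variant_field A T Y"
    and traj: "\<And>\<theta>. \<theta> \<in> \<Theta> \<Longrightarrow> trajectory A Y T (\<lambda>t. \<gamma> t \<theta>)"
    and f: "\<And>j. smooth_vector_field A (f j)"
    and S: "cell_family S" and tube: "\<And>t \<theta>. t \<in> {0..T} \<Longrightarrow> \<theta> \<in> \<Theta> \<Longrightarrow> \<gamma> t \<theta> \<in> cells_union S"
    and K: "compact K" and r: "0 < r" "cell_family (enlarge (4 * r) S)" "cells_union (enlarge (4 * r) S) \<subseteq> K"
    and l: "0 \<le> l" and approx: "\<And>t e. t \<in> {0..T} \<Longrightarrow> 0 < e \<Longrightarrow> \<exists>X\<in>lie_ball A g f l K. \<forall>\<theta>\<in>\<Theta>.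
      tangent_norm A g (\<gamma> t \<theta>) (\<lambda>c. Y t c (\<gamma> t \<theta>) - X c (\<gamma> t \<theta>)) < e"
  shows "\<exists>\<tau>>0. \<forall>a b. 0 \<le> a \<longrightarrow> a \<le> b \<longrightarrow> b \<le> T \<longrightarrow> b - a < \<tau> \<longrightarrow> ensemble_steerable f S \<Theta> \<gamma> a b"
proof -
  obtain B where B: "0 \<le> B" "\<forall>X. is_vector_field A X \<longrightarrow> C1_field X \<longrightarrow> C1_seminorm A g K X < l \<longrightarrow>
    (\<forall>(c, D)\<in>S. \<forall>p\<in>cell c (thicken (4 * r) D). norm (X c p) \<le> B \<and> (\<forall>v. norm (chart_deriv c (X c) p v) \<le> B * norm v))"
    using lie_ball_bounds[OF K r(2,3) l] unfolding mem_enlarge by (elim exE conjE) (rule that)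
  obtain BY where BY: "0 \<le> BY" "\<forall>(c, D)\<in>S. \<forall>p\<in>cell c (thicken (4 * r) D). \<forall>t\<in>{0..T}. norm (Y t c p) \<le> BY"
    using eventually_happens'[OF _ eventually_conj[OF eventually_ge_at_top[of 0] time_field_bound[OF Y r(2)]]]
    unfolding mem_enlarge by auto
  obtain m where m: "m > 0" "\<forall>(c, D)\<in>S. \<forall>p\<in>cell c (thicken (4 * r) D). \<forall>v. m * norm v \<le> gnorm g c p v"
    using ex_small_positive[OF eventually_gnorm_lower[OF r(2)]] unfolding mem_enlarge by (elim exE conjE) (rule that)
  \<comment> \<open>Three thickenings by \<open>r\<close> are used: for the initial deviation, for
    the motion during the interval, and for the substeps within one step. The factor 4 contains
    them.\<close>
  let ?E = "enlarge r S"
  have thick2: "thicken r (thicken r D) \<subseteq> thicken (4 * r) D" and thick3: "thicken r (thicken r (thicken r D)) \<subseteq> thicken (4 * r) D"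
    and thick1: "thicken r D \<subseteq> thicken (4 * r) D" for D :: "'e set"
  proof -
    show "thicken r D \<subseteq> thicken (4 * r) D" using r(1) by (intro thicken_mono) simp
    have 2: "thicken r (thicken r D) \<subseteq> thicken (r + r) D" by (rule thicken_thicken)
    also have "\<dots> \<subseteq> thicken (4 * r) D" using r(1) by (intro thicken_mono) simp
    finally show "thicken r (thicken r D) \<subseteq> thicken (4 * r) D" .
    have "thicken r (thicken r (thicken r D)) \<subseteq> thicken r (thicken (r + r) D)"
      using 2 unfolding thicken_def[of r] by blast
    also have "\<dots> \<subseteq> thicken (r + (r + r)) D" by (rule thicken_thicken)
    also have "\<dots> \<subseteq> thicken (4 * r) D" using r(1) by (intro thicken_mono) simp
    finally show "thicken r (thicken r (thicken r D)) \<subseteq> thicken (4 * r) D" .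
  qed
  have crange4: "thicken (4 * r) D \<subseteq> crange c" if "(c, D) \<in> S" for c D
    by (rule cell_familyD(3)[OF r(2) enlargeI[OF that]])
  have fam1: "cell_family ?E"
    by (rule cell_family_enlarge[OF S subset_trans[OF thick1 crange4]])
  have fam2: "cell_family (enlarge r ?E)"
    by (rule cell_family_enlarge[OF fam1]) (auto elim!: enlargeE intro: subsetD[OF subset_trans[OF thick2 crange4]])
  have fam3: "cell_family (enlarge r (enlarge r ?E))"
    by (rule cell_family_enlarge[OF fam2]) (auto elim!: enlargeE intro: subsetD[OF subset_trans[OF thick3 crange4]])
  \<comment> \<open>Within time \<open>\<tau>\<close> the reference moves by less than
    \<open>r\<close>, and the controlled point, at a rate of at most \<open>B + 1\<close>, by at
    most \<open>r\<close>.\<close>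
  have "\<forall>\<^sub>F t in at_right 0. t * BY \<le> r / 2 \<and> t * (B + 1) \<le> r"
    using r(1) by (intro eventually_conj eventually_small_mult) auto
  from ex_small_positive[OF this] obtain \<tau> where \<tau>: "\<tau> > 0" "\<tau> * BY \<le> r / 2" "\<tau> * (B + 1) \<le> r" by blast
  have "ensemble_steerable f S \<Theta> \<gamma> a b" if ab: "0 \<le> a" "a < b" "b \<le> T" "b - a < \<tau>" for a b
    unfolding ensemble_steerable_def
  proof (intro allI impI)
    fix e :: real assume e: "0 < e"
    \<comment> \<open>Accuracy in the chart of comparison that implies accuracy \<open>e\<close> in
      every chart of the family.\<close>
    obtain e' where e': "e' > 0" "\<forall>(c, D)\<in>?E. \<forall>(c', D')\<in>S. \<forall>p q. p \<in> cell c D \<longrightarrow> p \<in> cell c' D' \<longrightarrow> q \<in> cdom c \<longrightarrow>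
      norm (cmap c q - cmap c p) \<le> e' \<longrightarrow> q \<in> cdom c' \<and> norm (cmap c' q - cmap c' p) \<le> e"
      using cells_change_near[OF fam1 S e] by (elim exE conjE) (rule that)
    \<comment> \<open>The Gronwall factor involves only the uniform constant \<open>B\<close>. Hence
      the initial tolerance \<open>d\<close> and the error rate \<open>k\<close> can be chosen after
      it, each using half of \<open>e'\<close>.\<close>
    define G where "G = exp (B * (b - a))"
    define d where "d = min r (e' / (2 * G))"
    define k where "k = min 1 (e' / (2 * G * (b - a)))"
    have G: "0 < G" unfolding G_def by simp
    have dk: "0 < d" "d \<le> r" "0 < k" "k \<le> 1" using r(1) e'(1) G ab by (auto simp: d_def k_def)
    have total: "G * (d + (b - a) * k) \<le> e'"
    proof -
      have "d \<le> e' / (2 * G)" "k \<le> e' / (2 * G * (b - a))" by (simp_all add: d_def k_def)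
      then have "G * d \<le> e' / 2" "G * ((b - a) * k) \<le> e' / 2" using G ab(2) by (simp_all add: field_simps)
      then show ?thesis by (simp add: distrib_left)
    qed
    have k4: "0 < k / 4" using dk(3) by simp
    obtain u where u: "u > 0" "\<forall>(c, D)\<in>S. \<forall>p\<in>cell c (thicken (4 * r) D). \<forall>t\<in>{0..T}. \<forall>s\<in>{0..T}.
      \<forall>q\<in>cell c (thicken (4 * r) D). \<bar>s - t\<bar> \<le> u \<longrightarrow> norm (cmap c q - cmap c p) \<le> u \<longrightarrow> norm (Y s c q - Y t c p) \<le> k / 4"
      using ex_small_positive[OF time_field_uniformly_continuous[OF Y r(2) k4]]
      unfolding mem_enlarge by (elim exE conjE) (rule that)
    \<comment> \<open>This fixes the nodes: between two of them \<open>Y\<close> changes by at most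
      \<open>k / 4\<close> along a trajectory, and the Lipschitz drift of a field within one step is
      at most \<open>k / 4\<close>.\<close>
    have "\<forall>\<^sub>F h in at_right 0. h * 1 \<le> u \<and> h * BY \<le> u \<and> h * (B * (B + 1)) \<le> k / 4"
      using u(1) dk(3) by (intro eventually_conj eventually_small_mult) auto
    from eventually_at_right_0_quotient[OF this, of "b - a"] obtain n where n: "n > 0"
      and h': "(b - a) / real n * 1 \<le> u \<and> (b - a) / real n * BY \<le> u \<and> (b - a) / real n * (B * (B + 1)) \<le> k / 4"
      using ab(2) by auto
    define h where "h = (b - a) / real n"
    have h: "0 < h" "h \<le> u" "h * BY \<le> u" "h * (B * (B + 1)) \<le> k / 4" and nh: "real n * h = b - a"
      using h' n ab(2) unfolding h_def by auto
    define tm where "tm j = a + real j * h" for j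
    have tm: "a \<le> tm j" "tm j \<le> b" "tm j \<in> {0..T}" if "j \<le> n" for j
    proof -
      have "0 \<le> real j * h" "real j * h \<le> real n * h" using that h(1) by (auto intro: mult_right_mono)
      then show "a \<le> tm j" "tm j \<le> b" "tm j \<in> {0..T}" unfolding tm_def using nh ab by auto
    qed
    \<comment> \<open>One field per node serves the whole ensemble. The factor \<open>m\<close>
      converts metric length into coordinate norm.\<close>
    have "\<exists>X. j < n \<longrightarrow> X \<in> lie_ball A g f l K \<and> (\<forall>\<theta>\<in>\<Theta>.
      tangent_norm A g (\<gamma> (tm j) \<theta>) (\<lambda>c. Y (tm j) c (\<gamma> (tm j) \<theta>) - X c (\<gamma> (tm j) \<theta>)) < m * (k / 4))" for j
    proof (cases "j < n")
      case True
      then have "0 < m * (k / 4)" "tm j \<in> {0..T}" using m(1) dk(3) tm(3)[of j] by auto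
      from approx[OF this(2,1)] show ?thesis by (elim bexE) (intro exI impI conjI)
    qed simp
    then have "\<exists>X. \<forall>j. j < n \<longrightarrow> X j \<in> lie_ball A g f l K \<and> (\<forall>\<theta>\<in>\<Theta>.
      tangent_norm A g (\<gamma> (tm j) \<theta>) (\<lambda>c. Y (tm j) c (\<gamma> (tm j) \<theta>) - X j c (\<gamma> (tm j) \<theta>)) < m * (k / 4))"
      by (intro choice allI)
    then obtain X where X': "\<forall>j. j < n \<longrightarrow> X j \<in> lie_ball A g f l K \<and> (\<forall>\<theta>\<in>\<Theta>.
      tangent_norm A g (\<gamma> (tm j) \<theta>) (\<lambda>c. Y (tm j) c (\<gamma> (tm j) \<theta>) - X j c (\<gamma> (tm j) \<theta>)) < m * (k / 4))"
      by (elim exE) (rule that)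
    have X: "X j \<in> lie_ball A g f l K" if "j < n" for j
      using X'[rule_format, OF that] by (rule conjunct1)
    have X_approx: "tangent_norm A g (\<gamma> (tm j) \<theta>) (\<lambda>c. Y (tm j) c (\<gamma> (tm j) \<theta>) - X j c (\<gamma> (tm j) \<theta>)) < m * (k / 4)"
      if "j < n" "\<theta> \<in> \<Theta>" for j \<theta>
      using X'[THEN spec, THEN mp, OF that(1), THEN conjunct2, THEN bspec, OF that(2)] .
    have att: "attainable f (X j)" and vf: "is_vector_field A (X j)" and C1: "C1_field (X j)"
      and semi: "C1_seminorm A g K (X j) < l" if "j < n" for j
    proof -
      have lie: "X j \<in> lie_algebra f" using X[OF that] unfolding lie_ball_def by simp
      show "C1_seminorm A g K (X j) < l" using X[OF that] unfolding lie_ball_def by simp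
      show att: "attainable f (X j)" by (rule smooth_lie_algebra_attainable[OF f lie])
      show "is_vector_field A (X j)" by (rule attainable_is_vector_field[OF att])
      show "C1_field (X j)" by (rule smooth_field_C1[OF smooth_lie_algebra[OF smooth_vector_fieldD(1)[OF f] lie]])
    qed
    have XB: "norm (X j c p) \<le> B" "norm (chart_deriv c (X j c) p v) \<le> B * norm v"
      if "j < n" "(c, D) \<in> S" "p \<in> cell c (thicken (4 * r) D)" for j c D p v
      using B(2) vf[OF that(1)] C1[OF that(1)] semi[OF that(1)] that(2,3) by blast+
    have XL: "norm (X j c q - X j c p) \<le> B * norm (cmap c q - cmap c p)"
      if j: "j < n" and cD: "(c, D) \<in> S" and C: "convex C" "C \<subseteq> thicken (4 * r) D" and pq: "p \<in> cell c C" "q \<in> cell c C"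
      for j c D C p q
    proof (rule field_Lipschitz[OF C1[OF j] cell_familyD(1)[OF S cD] C(1) _ _ pq])
      show "C \<subseteq> crange c" using C(2) crange4[OF cD] by blast
      show "norm (chart_deriv c (X j c) p v) \<le> B * norm v" if "p \<in> cell c C" for p v
        by (rule XB(2)[OF j cD]) (use that C(2) in \<open>auto simp: cell_def\<close>)
    qed
    \<comment> \<open>The step \<open>h\<close> was chosen before the fields, which is legitimate
      because \<open>attainable_uniform_step\<close> uses only the constants of the ball.\<close>
    have "\<exists>w. steers f w (enlarge r ?E) (\<lambda>c p q. norm (cmap c q - cmap c p - h *\<^sub>R X j c p) \<le> h * (k / 2))"
      if j: "j < n" for j
    proof -
      have "\<exists>w. steers f w (enlarge r ?E) (\<lambda>c p q. norm (cmap c q - cmap c p - h *\<^sub>R X j c p)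
          \<le> h * (B * (h * (B + 1)) + k / 4))"
      proof (rule attainable_uniform_step[OF att[OF j] fam3 _ B(1) _ B(1) h(1)])
        show "\<forall>(c, D)\<in>enlarge r ?E. \<forall>p\<in>cell c (thicken r D). norm (X j c p) \<le> B"
          unfolding mem_enlarge using XB(1)[OF j] thick3 by (force simp: cell_def)
        have "norm (X j c q - X j c p) \<le> B * norm (cmap c q - cmap c p)"
          if cD: "(c, D) \<in> S" and p: "p \<in> cell c (thicken r (thicken r D))" and q: "q \<in> cdom c" "norm (cmap c q - cmap c p) \<le> r"
          for c D p q
        proof (rule XL[OF j cD, of "cball (cmap c p) r"])
          have "cball (cmap c p) r \<subseteq> thicken r (thicken r (thicken r D))"
            using p by (auto simp: cell_def thicken_def[of r "thicken r (thicken r D)"])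
          then show "cball (cmap c p) r \<subseteq> thicken (4 * r) D" using thick3 by blast
        qed (use p q r(1) in \<open>auto simp: cell_def dist_norm norm_minus_commute\<close>)
        then show "\<forall>(c, D)\<in>enlarge r ?E. \<forall>p\<in>cell c D. \<forall>q\<in>cdom c. norm (cmap c q - cmap c p) \<le> r \<longrightarrow>
            norm (X j c q - X j c p) \<le> B * norm (cmap c q - cmap c p)"
          unfolding mem_enlarge by blast
        have "h \<le> b - a" using nh n h(1) mult_right_mono[of 1 "real n" h] by simp
        then have "h * (B + 1) \<le> \<tau> * (B + 1)" using ab(4) B(1) by (intro mult_right_mono) auto
        then show "h * (B + 1) \<le> r" using \<tau>(3) by linarith
      qed (use dk(3) in simp)
      then obtain w where w: "steers f w (enlarge r ?E) (\<lambda>c p q. norm (cmap c q - cmap c p - h *\<^sub>R X j c p)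
          \<le> h * (B * (h * (B + 1)) + k / 4))" by (elim exE) (rule that)
      have "B * (h * (B + 1)) + k / 4 \<le> k / 2"
        using h(4) by (simp only: mult.left_commute[of B h])
      then have "h * (B * (h * (B + 1)) + k / 4) \<le> h * (k / 2)"
        using h(1) by (intro mult_left_mono) auto
      then have "steers f w (enlarge r ?E) (\<lambda>c p q. norm (cmap c q - cmap c p - h *\<^sub>R X j c p) \<le> h * (k / 2))"
        by (intro steers_mono[OF w]) (rule order_trans)
      then show ?thesis by blast
    qed
    then have "\<forall>j. \<exists>w. j < n \<longrightarrow>
        steers f w (enlarge r ?E) (\<lambda>c p q. norm (cmap c q - cmap c p - h *\<^sub>R X j c p) \<le> h * (k / 2))" by blast
    from choice[OF this] obtain w where w': "\<forall>j. j < n \<longrightarrow>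
        steers f (w j) (enlarge r ?E) (\<lambda>c p q. norm (cmap c q - cmap c p - h *\<^sub>R X j c p) \<le> h * (k / 2))"
      by (elim exE) (rule that)
    then have w: "steers f (w j) (enlarge r ?E) (\<lambda>c p q. norm (cmap c q - cmap c p - h *\<^sub>R X j c p) \<le> h * (k / 2))"
      if "j < n" for j using that by blast
    let ?w = "concat (map w [0..<n])"
    have "\<exists>q. reach f ?w p q \<and> near S e q (\<gamma> b \<theta>)" if \<theta>: "\<theta> \<in> \<Theta>" and p: "near S d p (\<gamma> a \<theta>)" for \<theta> p
    proof -
      have "a \<in> {0..T}" using ab by simp
      then obtain c D where cD: "(c, D) \<in> S" "\<gamma> a \<theta> \<in> cell c D" using tube \<theta> unfolding mem_cells_union by blast
      have c: "c \<in> A" "\<gamma> a \<theta> \<in> cdom c" "cmap c (\<gamma> a \<theta>) \<in> D"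
        using cell_familyD(1)[OF S cD(1)] cD(2) by (auto simp: cell_def)
      have p1: "p \<in> cdom c" "norm (cmap c p - cmap c (\<gamma> a \<theta>)) \<le> d" using p cD unfolding near_def by blast+
      have cE: "(c, thicken r D) \<in> ?E" by (rule enlargeI[OF cD(1)])
      have pE: "p \<in> cell c (thicken r D)" using mem_cell_thicken[OF cD(2) p1(1)] p1(2) dk(2) by simp
      \<comment> \<open>A convex set containing both motions: \<open>r\<close> for the initial
        deviation and \<open>r\<close> for the displacement. Convexity yields the Lipschitz bound of
        the fields.\<close>
      let ?C = "cball (cmap c (\<gamma> a \<theta>)) (2 * r)"
      have C: "?C \<subseteq> thicken (4 * r) D"
      proof -
        have "?C \<subseteq> thicken (2 * r) D" using c(3) by (auto simp: thicken_def)
        also have "\<dots> \<subseteq> thicken (4 * r) D" using r(1) by (intro thicken_mono) simp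
        finally show ?thesis .
      qed
      have C4: "q \<in> cell c (thicken (4 * r) D)" if "q \<in> cell c ?C" for q using that C by (auto simp: cell_def)
      have inC: "q \<in> cell c ?C" if "q \<in> cdom c" "norm (cmap c q - cmap c (\<gamma> a \<theta>)) \<le> 2 * r" for q
        using that by (simp add: cell_def dist_norm norm_minus_commute)
      have len: "(b - a) * BY < r" "(b - a) * (B + k / 2) \<le> r"
      proof -
        have "(b - a) * BY \<le> \<tau> * BY" using ab(4) BY(1) by (intro mult_right_mono) auto
        then show "(b - a) * BY < r" using \<tau>(2) r(1) by linarith
        have "(b - a) * (B + k / 2) \<le> \<tau> * (B + 1)" using ab B(1) dk by (intro mult_mono) auto
        then show "(b - a) * (B + k / 2) \<le> r" using \<tau>(3) by linarith
      qed
      have "\<exists>xs. xs 0 = p \<and> reach f ?w p (xs n) \<and> (\<forall>(c, D)\<in>?E. p \<in> cell c D \<longrightarrow>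
          (\<forall>j\<le>n. xs j \<in> cdom c \<and> norm (cmap c (xs j) - cmap c p) \<le> real j * h * (B + k / 2)) \<and>
          (\<forall>j<n. norm (cmap c (xs (Suc j)) - cmap c (xs j) - h *\<^sub>R X j c (xs j)) \<le> h * (k / 2)))"
      proof (rule steers_chain[where r = r and X = X, OF w])
        show "norm (X j c q) \<le> B" if j: "j < n" and E: "(c, D') \<in> ?E" and q: "q \<in> cell c (thicken r D')" for j c D' q
        proof -
          obtain D where D: "(c, D) \<in> S" "D' = thicken r D" using E by (rule enlargeE)
          show ?thesis by (rule XB(1)[OF j D(1)]) (use q thick2 D(2) in \<open>auto simp: cell_def\<close>)
        qed
        show "real n * h * (B + k / 2) \<le> r" unfolding nh by (rule len(2))
        show "p \<in> cells_union ?E" using pE cE unfolding mem_cells_union by blast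
      qed (use h(1) B(1) dk(3) in auto)
      then obtain xs where xs: "xs 0 = p" "reach f ?w p (xs n)" and xs': "\<forall>(c, D)\<in>?E. p \<in> cell c D \<longrightarrow>
          (\<forall>j\<le>n. xs j \<in> cdom c \<and> norm (cmap c (xs j) - cmap c p) \<le> real j * h * (B + k / 2)) \<and>
          (\<forall>j<n. norm (cmap c (xs (Suc j)) - cmap c (xs j) - h *\<^sub>R X j c (xs j)) \<le> h * (k / 2))"
        by (elim exE conjE) (rule that)
      have xs_near: "\<forall>j\<le>n. xs j \<in> cdom c \<and> norm (cmap c (xs j) - cmap c p) \<le> real j * h * (B + k / 2)"
        and xs_step: "\<forall>j<n. norm (cmap c (xs (Suc j)) - cmap c (xs j) - h *\<^sub>R X j c (xs j)) \<le> h * (k / 2)"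
        using xs' cE pE by blast+
      have xsC: "xs j \<in> cell c ?C" if "j \<le> n" for j
      proof (rule inC)
        show "xs j \<in> cdom c" using xs_near that by blast
        have "real j * h * (B + k / 2) \<le> real n * h * (B + k / 2)"
          using that h(1) B(1) dk(3) by (intro mult_right_mono) auto
        then have "norm (cmap c (xs j) - cmap c p) \<le> r" using xs_near that len(2) unfolding nh by force
        from norm_triangle_mono[OF this p1(2)] show "norm (cmap c (xs j) - cmap c (\<gamma> a \<theta>)) \<le> 2 * r"
          using dk(2) by simp
      qed
      note tr = traj[OF \<theta>]
      have ball: "cball (cmap c (\<gamma> a \<theta>)) r \<subseteq> ?C" using r(1) by auto
      have \<gamma>C: "\<gamma> t \<theta> \<in> cdom c \<and> norm (cmap c (\<gamma> t \<theta>) - cmap c (\<gamma> a \<theta>)) \<le> r" if t: "t \<in> {a..b}" for t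
      proof -
        have "\<gamma> t \<theta> \<in> cdom c \<and> norm (cmap c (\<gamma> t \<theta>) - cmap c (\<gamma> a \<theta>)) \<le> BY * (t - a)"
        proof (rule trajectory_stays[OF tr c(1,2) ab(1) _ ab(3)])
          show "cball (cmap c (\<gamma> a \<theta>)) r \<subseteq> crange c" using ball C crange4[OF cD(1)] by blast
          show "norm (Y t c (cinv c z)) \<le> BY" if "t \<in> {a..b}" "z \<in> cball (cmap c (\<gamma> a \<theta>)) r" for t z
          proof -
            have z: "z \<in> ?C" "z \<in> crange c" using that(2) ball C crange4[OF cD(1)] by blast+
            then have "cinv c z \<in> cell c ?C"
              using cinv_in[OF c(1) z(2)] cmap_cinv[OF c(1) z(2)] by (simp add: cell_def)
            then show ?thesis using BY(2) cD(1) C4 that(1) ab by fastforce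
          qed
        qed (use len(1) BY(1) ab t in \<open>auto simp: mult.commute\<close>)
        moreover have "BY * (t - a) \<le> BY * (b - a)" using t BY(1) by (intro mult_left_mono) auto
        ultimately show ?thesis using len(1) by (auto simp: mult.commute)
      qed
      then have \<gamma>mem: "\<gamma> t \<theta> \<in> cell c ?C" if "t \<in> {a..b}" for t
        using inC[of "\<gamma> t \<theta>"] that r(1) by fastforce
      let ?y = "\<lambda>j. cmap c (\<gamma> (tm j) \<theta>)" and ?z = "\<lambda>j. cmap c (xs j)"
      have y_step: "norm (?y (Suc j) - ?y j - h *\<^sub>R Y (tm j) c (\<gamma> (tm j) \<theta>)) \<le> k / 4 * h" if j: "j < n" for j
      proof -
        have tj: "tm j \<in> {a..b}" "tm (Suc j) \<in> {a..b}" "tm (Suc j) - tm j = h" "tm j \<le> tm (Suc j)"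
          using tm[of j] tm[of "Suc j"] j h(1) by (auto simp: tm_def algebra_simps)
        have sub: "(\<lambda>t. \<gamma> t \<theta>) ` {tm j..t} \<subseteq> cdom c" if "t \<le> tm (Suc j)" for t
          using \<gamma>C tj that by auto
        have "norm (Y t c (\<gamma> t \<theta>) - Y (tm j) c (\<gamma> (tm j) \<theta>)) \<le> k / 4" if t: "t \<in> {tm j..tm (Suc j)}" for t
        proof -
          have tab: "t \<in> {a..b}" using t tj by auto
          have "norm (cmap c (\<gamma> t \<theta>) - cmap c (\<gamma> (tm j) \<theta>) - (t - tm j) *\<^sub>R 0) \<le> BY * (t - tm j)"
          proof (rule trajectory_increment[OF tr c(1)])
            show "norm (Y s c (\<gamma> s \<theta>) - 0) \<le> BY" if "s \<in> {tm j..t}" for s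
            proof -
              have "s \<in> {a..b}" using that tj t by auto
              then show ?thesis using BY(2) cD(1) C4[OF \<gamma>mem] ab by fastforce
            qed
          qed (use sub t tj ab BY(1) in auto)
          also have "\<dots> \<le> BY * h" using t tj BY(1) by (intro mult_left_mono) auto
          finally have "norm (cmap c (\<gamma> t \<theta>) - cmap c (\<gamma> (tm j) \<theta>)) \<le> u" using h(3) by (simp add: mult.commute)
          moreover have "\<bar>t - tm j\<bar> \<le> u" using t tj h(2) by auto
          moreover have "t \<in> {0..T}" "tm j \<in> {0..T}" using tab tj ab by auto
          ultimately show ?thesis using u(2) cD(1) C4[OF \<gamma>mem[OF tab]] C4[OF \<gamma>mem[OF tj(1)]] by blast
        qed
        then have "norm (cmap c (\<gamma> (tm (Suc j)) \<theta>) - cmap c (\<gamma> (tm j) \<theta>)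
            - (tm (Suc j) - tm j) *\<^sub>R Y (tm j) c (\<gamma> (tm j) \<theta>)) \<le> k / 4 * (tm (Suc j) - tm j)"
          by (intro trajectory_increment[OF tr c(1)]) (use sub tj ab dk(3) in auto)
        then show ?thesis unfolding tj(3) .
      qed
      have approx_j: "norm (X j c (\<gamma> (tm j) \<theta>) - Y (tm j) c (\<gamma> (tm j) \<theta>)) \<le> k / 4" if j: "j < n" for j
      proof -
        let ?p = "\<gamma> (tm j) \<theta>" and ?v = "\<lambda>c. Y (tm j) c (\<gamma> (tm j) \<theta>) - X j c (\<gamma> (tm j) \<theta>)"
        have tj: "tm j \<in> {a..b}" "tm j \<in> {0..T}" using tm[of j] j by auto
        have pc: "?p \<in> cdom c" using \<gamma>C[OF tj(1)] by blast
        note ch = chart_at[of ?p]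
        have Yvf: "is_vector_field A (Y (tm j))" using Y tj(2) unfolding C1_time_variant_field_def by blast
        have "Y (tm j) (chart_at A ?p) ?p = transition_deriv c (chart_at A ?p) ?p (Y (tm j) c ?p)"
          "X j (chart_at A ?p) ?p = transition_deriv c (chart_at A ?p) ?p (X j c ?p)"
          using Yvf vf[OF j] c(1) pc ch unfolding is_vector_field_def by blast+
        then have "?v (chart_at A ?p) = transition_deriv c (chart_at A ?p) ?p (?v c)"
          by (simp add: linear_diff[OF linear_transition_deriv[OF c(1) ch(1) pc ch(2)]])
        from tangent_norm_chart[of c ?p ?v, OF c(1) pc this]
        have "gnorm g c ?p (?v c) < m * (k / 4)" using X_approx[OF j \<theta>] by simp
        moreover have "m * norm (?v c) \<le> gnorm g c ?p (?v c)" using m(2) cD(1) C4[OF \<gamma>mem[OF tj(1)]] by blast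
        ultimately have "m * norm (?v c) \<le> m * (k / 4)" by linarith
        then show ?thesis using m(1) by (simp add: norm_minus_commute)
      qed
      define E where "E j = norm (?z j - ?y j)" for j
      \<comment> \<open>The rate \<open>k\<close> is spent as \<open>k / 2\<close> on the words,
        \<open>k / 4\<close> on the variation of \<open>Y\<close> between nodes, and
        \<open>k / 4\<close> on the approximation at the node. The factor \<open>1 + B * h\<close>
        comes from evaluating the field at two different points.\<close>
      have rec: "E (Suc j) \<le> (1 + B * h) * E j + h * k" if j: "j < n" for j
      proof -
        have tj: "tm j \<in> {a..b}" using tm[of j] j by auto
        have 1: "norm (?z (Suc j) - ?z j - h *\<^sub>R X j c (xs j)) \<le> h * (k / 2)" using xs_step j by blast
        have 2: "norm (- (?y (Suc j) - ?y j - h *\<^sub>R Y (tm j) c (\<gamma> (tm j) \<theta>))) \<le> k / 4 * h"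
          unfolding norm_minus_cancel by (rule y_step[OF j])
        have "norm (X j c (xs j) - X j c (\<gamma> (tm j) \<theta>)) \<le> B * E j"
          unfolding E_def by (rule XL[OF j cD(1) convex_cball C \<gamma>mem[OF tj] xsC]) (use j in simp)
        then have 3: "norm (h *\<^sub>R (X j c (xs j) - X j c (\<gamma> (tm j) \<theta>))) \<le> h * (B * E j)"
          using h(1) by (simp add: mult_left_mono)
        have 4: "norm (h *\<^sub>R (X j c (\<gamma> (tm j) \<theta>) - Y (tm j) c (\<gamma> (tm j) \<theta>))) \<le> h * (k / 4)"
          using mult_left_mono[OF approx_j[OF j], of h] h(1) by simp
        have 5: "norm (?z j - ?y j) \<le> E j" unfolding E_def by simp
        from norm_triangle_mono[OF norm_triangle_mono[OF norm_triangle_mono[OF norm_triangle_mono[OF 5 1] 2] 3] 4]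
        have "norm (?z (Suc j) - ?y (Suc j)) \<le> E j + h * (k / 2) + k / 4 * h + h * (B * E j) + h * (k / 4)"
          by (simp add: algebra_simps)
        then show ?thesis unfolding E_def[of "Suc j"] by (simp add: algebra_simps)
      qed
      have "E n \<le> exp (B * (real n * h)) * (E 0 + real n * h * k)"
        by (rule discrete_gronwall[where n = n]) (use B(1) h(1) dk(3) rec in \<open>auto simp: E_def\<close>)
      also have "\<dots> \<le> G * (d + (b - a) * k)"
        unfolding nh G_def using p1(2) xs(1) by (intro mult_left_mono) (auto simp: E_def tm_def)
      also note total
      finally have "norm (cmap c (xs n) - cmap c (\<gamma> b \<theta>)) \<le> e'" unfolding E_def tm_def nh by simp
      moreover have "\<gamma> b \<theta> \<in> cell c (thicken r D)"
        using \<gamma>C[of b] ab mem_cell_thicken[OF cD(2)] by simp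
      moreover have "xs n \<in> cdom c" using xs_near by blast
      \<comment> \<open>The estimate in the single chart \<open>c\<close> passes to all charts of
        the family by the choice of \<open>e'\<close>.\<close>
      ultimately have "near S e (xs n) (\<gamma> b \<theta>)"
        using e'(2) cE unfolding near_def by blast
      then show ?thesis using xs(2) by blast
    qed
    then show "\<exists>d>0. \<exists>w. \<forall>\<theta>\<in>\<Theta>. \<forall>p. near S d p (\<gamma> a \<theta>) \<longrightarrow> (\<exists>q. reach f w p q \<and> near S e q (\<gamma> b \<theta>))"
      using dk(1) by blast
  qed
  \<comment> \<open>Equal endpoints are served by the empty word; they were set aside because
    \<open>k\<close> is defined with a division by \<open>b - a\<close>.\<close>
  then have "\<forall>a b. 0 \<le> a \<longrightarrow> a \<le> b \<longrightarrow> b \<le> T \<longrightarrow> b - a < \<tau> \<longrightarrow> ensemble_steerable f S \<Theta> \<gamma> a b"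
    unfolding le_less[where 'a = real] using ensemble_steerable_refl by blast
  then show ?thesis using \<tau>(1) by blast
qed

end

context smooth_manifold
begin

text \<open>Lets a zero control be put in front of a word, so that the word to be played on a time
  interval is nonempty.\<close>

lemma step_zero: "step f 0 p p"
  unfolding step_def by (intro exI[of _ "\<lambda>_. p"]) (auto simp: control_field_def)

lemma near_self: "0 \<le> d \<Longrightarrow> near S d p p"
  by (auto simp: near_def cell_def)

end

section \<open>From the infimum condition to the whole time interval\<close>

context riemannian
begin

text \<open>A small infimum yields a field with small supremum because the ball is nonempty, and a
  small supremum bounds each value because the values are bounded above. That boundedness comes from
  the cells, after both fields have been moved to a common chart.\<close>

lemma lie_ball_approximation:
  fixes f :: "'k::finite \<Rightarrow> ('m, 'e) vector_field"
  assumes Y: "C1_time_variant_field A T Y" and t: "t \<in> {0..T}"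
    and f: "\<And>j. smooth_vector_field A (f j)"
    and S: "cell_family S" and x: "\<And>\<theta>. \<theta> \<in> \<Theta> \<Longrightarrow> x \<theta> \<in> cells_union S"
    and l: "0 < l" and K: "K \<noteq> {}"
    and inf: "(INF X\<in>lie_ball A g f l K. SUP \<theta>\<in>\<Theta>.
      tangent_norm A g (x \<theta>) (\<lambda>c. Y t c (x \<theta>) - X c (x \<theta>))) < e"
  shows "\<exists>X\<in>lie_ball A g f l K. \<forall>\<theta>\<in>\<Theta>. tangent_norm A g (x \<theta>) (\<lambda>c. Y t c (x \<theta>) - X c (x \<theta>)) < e"
proof -
  have "(\<lambda>X. SUP \<theta>\<in>\<Theta>. tangent_norm A g (x \<theta>) (\<lambda>c. Y t c (x \<theta>) - X c (x \<theta>))) ` lie_ball A g f l K \<noteq> {}"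
    using lie_ball_nonempty[OF l K] by simp
  from cInf_lessD[OF this inf] obtain X where X: "X \<in> lie_ball A g f l K"
    and sup: "(SUP \<theta>\<in>\<Theta>. tangent_norm A g (x \<theta>) (\<lambda>c. Y t c (x \<theta>) - X c (x \<theta>))) < e"
    by (elim bexE imageE) simp
  have lie: "X \<in> lie_algebra f" using X unfolding lie_ball_def by simp
  have vf: "is_vector_field A X"
    by (rule attainable_is_vector_field[OF smooth_lie_algebra_attainable[OF f lie]])
  have Yvf: "is_vector_field A (Y t)" using Y t unfolding C1_time_variant_field_def by blast
  have C0: "C0_field X"
    by (rule C1_field_C0[OF smooth_field_C1[OF smooth_lie_algebra[OF smooth_vector_fieldD(1)[OF f] lie]]])
  have "\<forall>\<^sub>F B in at_top. (\<forall>(c, D)\<in>S. \<forall>p\<in>cell c D. \<forall>v. gnorm g c p v \<le> B * norm v) \<and>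
      (\<forall>(c, D)\<in>S. \<forall>p\<in>cell c D. norm (X c p) \<le> B) \<and>
      (\<forall>(c, D)\<in>S. \<forall>p\<in>cell c D. \<forall>t\<in>{0..T}. norm (Y t c p) \<le> B) \<and> 0 \<le> B"
    by (intro eventually_conj eventually_gnorm_upper[OF S] field_bound[OF C0 S] time_field_bound[OF Y S]
        eventually_ge_at_top)
  from eventually_happens'[OF trivial_limit_at_top_linorder this]
  obtain B where B: "\<forall>(c, D)\<in>S. \<forall>p\<in>cell c D. \<forall>v. gnorm g c p v \<le> B * norm v"
      "\<forall>(c, D)\<in>S. \<forall>p\<in>cell c D. norm (X c p) \<le> B"
      "\<forall>(c, D)\<in>S. \<forall>p\<in>cell c D. \<forall>t\<in>{0..T}. norm (Y t c p) \<le> B" "0 \<le> B"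
    by (elim exE conjE) (rule that)
  have bound: "tangent_norm A g (x \<theta>) (\<lambda>c. Y t c (x \<theta>) - X c (x \<theta>)) \<le> B * (B + B)" if \<theta>: "\<theta> \<in> \<Theta>" for \<theta>
  proof -
    obtain c D where cD: "(c, D) \<in> S" "x \<theta> \<in> cell c D" using x[OF \<theta>] unfolding mem_cells_union by blast
    have c: "c \<in> A" "x \<theta> \<in> cdom c" using cell_familyD(1)[OF S cD(1)] cD(2) by (auto simp: cell_def)
    note ch = chart_at[of "x \<theta>"]
    have "Y t (chart_at A (x \<theta>)) (x \<theta>) = transition_deriv c (chart_at A (x \<theta>)) (x \<theta>) (Y t c (x \<theta>))"
      "X (chart_at A (x \<theta>)) (x \<theta>) = transition_deriv c (chart_at A (x \<theta>)) (x \<theta>) (X c (x \<theta>))"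
      using Yvf vf c ch unfolding is_vector_field_def by blast+
    then have "tangent_norm A g (x \<theta>) (\<lambda>c. Y t c (x \<theta>) - X c (x \<theta>)) = gnorm g c (x \<theta>) (Y t c (x \<theta>) - X c (x \<theta>))"
      by (intro tangent_norm_chart[OF c]) (simp add: linear_diff[OF linear_transition_deriv[OF c(1) ch(1) c(2) ch(2)]])
    also have "\<dots> \<le> B * norm (Y t c (x \<theta>) - X c (x \<theta>))" using B(1) cD by blast
    also have "\<dots> \<le> B * (B + B)"
    proof (rule mult_left_mono[OF _ B(4)])
      have "norm (Y t c (x \<theta>)) \<le> B" "norm (X c (x \<theta>)) \<le> B" using B(2,3) cD t by blast+
      then show "norm (Y t c (x \<theta>) - X c (x \<theta>)) \<le> B + B" by norm
    qed
    finally show ?thesis .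
  qed
  have "tangent_norm A g (x \<theta>) (\<lambda>c. Y t c (x \<theta>) - X c (x \<theta>)) < e" if \<theta>: "\<theta> \<in> \<Theta>" for \<theta>
  proof (rule le_less_trans[OF cSUP_upper[OF \<theta>] sup])
    show "bdd_above ((\<lambda>\<theta>. tangent_norm A g (x \<theta>) (\<lambda>c. Y t c (x \<theta>) - X c (x \<theta>))) ` \<Theta>)"
      using bound by (intro bdd_aboveI2)
  qed
  then show ?thesis using X by blast
qed

text \<open>Since the length \<open>\<tau>\<close> is uniform, bisection chains short intervals from
  0 to \<open>T\<close>. The room \<open>r\<close> around the cells is recorded for the final
  comparison of coordinates with the Riemannian distance.\<close>

lemma steerable_along_diffeotopy:
  fixes f :: "'k::finite \<Rightarrow> ('m, 'e) vector_field"
  assumes Y: "C1_time_variant_field A T Y" and T: "0 \<le> T"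
    and traj: "\<And>\<theta>. \<theta> \<in> \<Theta> \<Longrightarrow> trajectory A Y T (\<lambda>t. \<gamma> t \<theta>)"
    and \<Theta>: "compact \<Theta>" "continuous_on \<Theta> (\<gamma> 0)" "\<Theta> \<noteq> {}"
    and f: "\<And>j. smooth_vector_field A (f j)"
    and approx: "lie_bracket_C0_approximating A g f T \<Theta> Y \<gamma>"
  shows "\<exists>S r. cell_family S \<and> 0 < r \<and> cell_family (enlarge r S) \<and>
    (\<forall>\<theta>\<in>\<Theta>. \<gamma> T \<theta> \<in> cells_union S) \<and> ensemble_steerable f S \<Theta> \<gamma> 0 T"
proof -
  obtain l K where l: "0 < l" and K: "compact K" "{\<gamma> t \<theta> | t \<theta>. t \<in> {0..T} \<and> \<theta> \<in> \<Theta>} \<subseteq> interior K"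
    and inf: "\<forall>t\<in>{0..T}. (INF X\<in>lie_ball A g f l K. SUP \<theta>\<in>\<Theta>.
      tangent_norm A g (\<gamma> t \<theta>) (\<lambda>c. Y t c (\<gamma> t \<theta>) - X c (\<gamma> t \<theta>))) = 0"
    using approx unfolding lie_bracket_C0_approximating_def by (elim exE conjE) (rule that)
  \<comment> \<open>The union of the trajectories is not known to be compact, so a compact set
    between it and the interior of \<open>K\<close> is produced before cells are chosen.\<close>
  have "(\<lambda>t. \<gamma> t \<theta>) ` {0..T} \<subseteq> interior K" if "\<theta> \<in> \<Theta>" for \<theta> using K(2) that by blast
  then have "\<exists>K'. compact K' \<and> K' \<subseteq> interior K \<and> (\<forall>\<theta>\<in>\<Theta>. (\<lambda>t. \<gamma> t \<theta>) ` {0..T} \<subseteq> K')"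
    by (intro compact_flow_tube[OF Y \<Theta>(1,2) T traj _ open_interior]) auto
  then obtain K' where K': "compact K'" "K' \<subseteq> interior K" "\<forall>\<theta>\<in>\<Theta>. (\<lambda>t. \<gamma> t \<theta>) ` {0..T} \<subseteq> K'"
    by (elim exE conjE) (rule that)
  obtain S where S: "cell_family S" "K' \<subseteq> cells_union S"
      "\<forall>(c, D)\<in>S. D \<subseteq> cmap c ` (cdom c \<inter> interior K)"
    using compact_cell_cover[OF K'(1) open_interior K'(2)] by blast
  have "\<forall>\<^sub>F r in at_right 0. \<forall>(c, D)\<in>S. thicken r D \<subseteq> cmap c ` (cdom c \<inter> interior K)"
  proof (rule eventually_cells_in_open[OF S(1)])
    fix c D assume "(c, D) \<in> S"
    then show "open (cmap c ` (cdom c \<inter> interior K)) \<and> D \<subseteq> cmap c ` (cdom c \<inter> interior K)"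
      using S(3) open_cmap_image[OF cell_familyD(1)[OF S(1)] open_interior] by blast
  qed
  from ex_small_positive[OF this] obtain r' where r': "0 < r'"
      "\<forall>(c, D)\<in>S. thicken r' D \<subseteq> cmap c ` (cdom c \<inter> interior K)" by blast
  \<comment> \<open>A quarter, to leave space for the repeated thickening on short
    intervals.\<close>
  define r where "r = r' / 4"
  have r: "0 < r" "4 * r = r'" using r'(1) by (auto simp: r_def)
  have crange: "thicken r' D \<subseteq> crange c" if "(c, D) \<in> S" for c D
    using r'(2) that unfolding crange_def by blast
  have fam: "cell_family (enlarge (4 * r) S)"
    unfolding r(2) by (rule cell_family_enlarge[OF S(1) crange])
  have sub: "cells_union (enlarge (4 * r) S) \<subseteq> K"
  proof
    fix p assume "p \<in> cells_union (enlarge (4 * r) S)"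
    then obtain c D where cD: "(c, D) \<in> S" "p \<in> cell c (thicken r' D)"
      unfolding r(2) mem_cells_union by (auto elim: enlargeE)
    then have "p \<in> cdom c" "cmap c p \<in> cmap c ` (cdom c \<inter> interior K)"
      using r'(2) by (auto simp: cell_def)
    from mem_of_cmap_image[OF cell_familyD(1)[OF S(1) cD(1)] this] show "p \<in> K"
      using interior_subset by blast
  qed
  have tube: "\<gamma> t \<theta> \<in> cells_union S" if "t \<in> {0..T}" "\<theta> \<in> \<Theta>" for t \<theta>
    using K'(3) S(2) that by blast
  have "K \<noteq> {}" using K'(2,3) interior_subset[of K] \<Theta>(3) T by fastforce
  have approx': "\<exists>X\<in>lie_ball A g f l K. \<forall>\<theta>\<in>\<Theta>.
      tangent_norm A g (\<gamma> t \<theta>) (\<lambda>c. Y t c (\<gamma> t \<theta>) - X c (\<gamma> t \<theta>)) < e" if "t \<in> {0..T}" "0 < e" for t e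
    by (rule lie_ball_approximation[OF Y that(1) f S(1) tube[OF that(1)] l \<open>K \<noteq> {}\<close>]) (use inf that in auto)
  have "\<exists>\<tau>>0. \<forall>a b. 0 \<le> a \<longrightarrow> a \<le> b \<longrightarrow> b \<le> T \<longrightarrow> b - a < \<tau> \<longrightarrow> ensemble_steerable f S \<Theta> \<gamma> a b"
    by (rule steerable_on_short_intervals[OF Y traj f S(1) tube K(1) r(1) fam sub less_imp_le[OF l] approx'])
  then obtain \<tau> where \<tau>: "\<tau> > 0" "\<forall>a b. 0 \<le> a \<longrightarrow> a \<le> b \<longrightarrow> b \<le> T \<longrightarrow> b - a < \<tau> \<longrightarrow> ensemble_steerable f S \<Theta> \<gamma> a b"
    by (elim exE conjE) (rule that)
  have "(0::real) \<le> 0 \<longrightarrow> 0 \<le> T \<longrightarrow> T \<le> T \<longrightarrow> ensemble_steerable f S \<Theta> \<gamma> 0 T"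
  proof (rule Bolzano[OF T, where P = "\<lambda>a b. 0 \<le> a \<longrightarrow> a \<le> b \<longrightarrow> b \<le> T \<longrightarrow> ensemble_steerable f S \<Theta> \<gamma> a b"])
    show "0 \<le> a \<longrightarrow> a \<le> c \<longrightarrow> c \<le> T \<longrightarrow> ensemble_steerable f S \<Theta> \<gamma> a c"
      if "0 \<le> a \<longrightarrow> a \<le> b \<longrightarrow> b \<le> T \<longrightarrow> ensemble_steerable f S \<Theta> \<gamma> a b"
        "0 \<le> b \<longrightarrow> b \<le> c \<longrightarrow> c \<le> T \<longrightarrow> ensemble_steerable f S \<Theta> \<gamma> b c" "a \<le> b" "b \<le> c" for a b c
      using that by (intro impI ensemble_steerable_trans[of f S \<Theta> \<gamma> a b c]) auto
    show "\<exists>d>0. \<forall>a b. a \<le> x \<and> x \<le> b \<and> b - a < d \<longrightarrow> 0 \<le> a \<longrightarrow> a \<le> b \<longrightarrow> b \<le> T \<longrightarrow>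
        ensemble_steerable f S \<Theta> \<gamma> a b" for x
      using \<tau> by (intro exI[of _ \<tau>] conjI allI impI) auto
  qed
  then have "ensemble_steerable f S \<Theta> \<gamma> 0 T" using T by simp
  moreover have "cell_family (enlarge r S)"
  proof (rule cell_family_enlarge[OF S(1)])
    fix c D assume "(c, D) \<in> S"
    then show "thicken r D \<subseteq> crange c" using crange thicken_mono[of r r' D] r by fastforce
  qed
  ultimately show ?thesis using S(1) r(1) tube T by (intro exI[of _ S] exI[of _ r] conjI ballI) auto
qed

end

theorem theorem2:
  fixes A :: "('m::{t2_space, second_countable_topology}, 'e::euclidean_space) chart set"
    and g :: "('m, 'e) metric_tensor"
    and f :: "'k::finite \<Rightarrow> ('m, 'e) vector_field"
    and \<Theta> :: "'p::euclidean_space set"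
    and \<alpha> \<omega> :: "'p \<Rightarrow> 'm"
    and \<gamma> :: "real \<Rightarrow> 'p \<Rightarrow> 'm"
    and Y :: "real \<Rightarrow> ('m, 'e) vector_field"
    and T :: real
  assumes "riemannian_manifold A g"
    and "connected (UNIV :: 'm set)"
    and "2 \<le> DIM('e)"
    and "compact \<Theta>"
    and "\<And>j. smooth_vector_field A (f j)"
    and "\<And>j. bounded_with_cov_derivs A g (f j)"
    and "continuous_on \<Theta> \<alpha>" and "continuous_on \<Theta> \<omega>"
    and "0 < T"
    and "diffeotopy A T \<Theta> Y \<gamma> \<alpha> \<omega>"
    and "lie_bracket_C0_approximating A g f T \<Theta> Y \<gamma>"
  shows "C0_approximately_steerable A g f \<Theta> \<alpha> \<omega> T"
proof -
  interpret riemannian A g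
    using assms(1) by unfold_locales (auto simp: riemannian_manifold_def)
  obtain R where Y: "C1_time_variant_field A T Y" and R: "\<forall>p. R 0 p = p \<and> trajectory A Y T (\<lambda>t. R t p)"
    and \<gamma>: "\<forall>t\<in>{0..T}. \<forall>\<theta>\<in>\<Theta>. \<gamma> t \<theta> = R t (\<alpha> \<theta>)" "\<forall>\<theta>\<in>\<Theta>. \<gamma> 0 \<theta> = \<alpha> \<theta> \<and> \<gamma> T \<theta> = \<omega> \<theta>"
    using assms(10) unfolding diffeotopy_def by (elim exE conjE) (rule that)
  have T: "0 \<le> T" using assms(9) by simp
  \<comment> \<open>\<open>\<gamma>\<close> is tied to the flow on \<open>[0,T]\<close> only, so the
    trajectory property is transferred on that interval.\<close>
  have traj: "trajectory A Y T (\<lambda>t. \<gamma> t \<theta>)" if \<theta>: "\<theta> \<in> \<Theta>" for \<theta>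
  proof -
    have tr: "trajectory A Y T (\<lambda>t. R t (\<alpha> \<theta>))" using R by blast
    have eq: "\<gamma> t \<theta> = R t (\<alpha> \<theta>)" if "t \<in> {0..T}" for t using \<gamma>(1) \<theta> that by blast
    show ?thesis
      unfolding trajectory_def
    proof (intro conjI ballI allI impI)
      show "continuous_on {0..T} (\<lambda>t. \<gamma> t \<theta>)"
        using tr eq continuous_on_cong[of "{0..T}" "{0..T}" "\<lambda>t. \<gamma> t \<theta>" "\<lambda>t. R t (\<alpha> \<theta>)"]
        unfolding trajectory_def by blast
      fix c a b assume c: "c \<in> A" and ab: "0 \<le> a \<and> a \<le> b \<and> b \<le> T \<and> (\<lambda>t. \<gamma> t \<theta>) ` {a..b} \<subseteq> cdom c"
      have eq': "\<gamma> t \<theta> = R t (\<alpha> \<theta>)" if "t \<in> {a..b}" for t using eq ab that by simp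
      then have "(\<lambda>t. R t (\<alpha> \<theta>)) ` {a..b} \<subseteq> cdom c" using ab by force
      then have "((\<lambda>t. Y t c (R t (\<alpha> \<theta>))) has_integral cmap c (R b (\<alpha> \<theta>)) - cmap c (R a (\<alpha> \<theta>))) {a..b}"
        using tr c ab unfolding trajectory_def by blast
      then show "((\<lambda>t. Y t c (\<gamma> t \<theta>)) has_integral cmap c (\<gamma> b \<theta>) - cmap c (\<gamma> a \<theta>)) {a..b}"
        using has_integral_cong[of "{a..b}" "\<lambda>t. Y t c (\<gamma> t \<theta>)" "\<lambda>t. Y t c (R t (\<alpha> \<theta>))"] eq' ab by simp
    qed
  qed
  show ?thesis
    unfolding C0_approximately_steerable_def
  proof (intro allI impI)
    fix \<epsilon> :: real assume \<epsilon>: "0 < \<epsilon>"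
    show "\<exists>u. admissible_control T u \<and> (\<forall>\<theta>\<in>\<Theta>. \<exists>q. flow_value A (control_field f u) T (\<alpha> \<theta>) q \<and>
        riemannian_dist A g (\<omega> \<theta>) q \<le> \<epsilon>)"
    proof (cases "\<Theta> = {}")
      \<comment> \<open>Without parameters any admissible control will do. In the other case a
        member of the ensemble shows that \<open>K\<close> is nonempty.\<close>
      case True
      then show ?thesis using admissible_word_control[of T "[]"] by blast
    next
      case False
      have cont: "continuous_on \<Theta> (\<gamma> 0)" using continuous_on_cong[of \<Theta> \<Theta> "\<gamma> 0" \<alpha>] assms(7) \<gamma>(2) by blast
      have "\<exists>S r. cell_family S \<and> 0 < r \<and> cell_family (enlarge r S) \<and>
          (\<forall>\<theta>\<in>\<Theta>. \<gamma> T \<theta> \<in> cells_union S) \<and> ensemble_steerable f S \<Theta> \<gamma> 0 T"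
        by (rule steerable_along_diffeotopy[OF Y T traj assms(4) cont False assms(5,11)])
      then obtain S r where S: "cell_family S" and r: "0 < r" "cell_family (enlarge r S)"
        and tube: "\<forall>\<theta>\<in>\<Theta>. \<gamma> T \<theta> \<in> cells_union S" and st: "ensemble_steerable f S \<Theta> \<gamma> 0 T"
        by (elim exE conjE) (rule that)
      obtain M where M: "\<forall>(c, D)\<in>S. \<forall>p\<in>cell c (thicken r D). \<forall>v. gnorm g c p v \<le> M * norm v" "0 < M"
        using eventually_happens'[OF _ eventually_conj[OF eventually_gnorm_upper[OF r(2)] eventually_gt_at_top[of 0]]]
        unfolding mem_enlarge by auto
      \<comment> \<open>The bound \<open>e \<le> r\<close> keeps the endpoint in the convex ball on
        which \<open>M\<close> is valid.\<close>
      define e where "e = min r (\<epsilon> / M)"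
      have e: "0 < e" "e \<le> r" "M * e \<le> \<epsilon>"
        using r(1) M(2) \<epsilon> by (auto simp: e_def min_def field_simps)
      obtain d w where d: "0 < d" and w: "\<forall>\<theta>\<in>\<Theta>. \<forall>p. near S d p (\<gamma> 0 \<theta>) \<longrightarrow> (\<exists>q. reach f w p q \<and> near S e q (\<gamma> T \<theta>))"
        using st e(1) unfolding ensemble_steerable_def by blast
      \<comment> \<open>A zero control is prepended because \<open>w\<close> may be empty, while
        only a nonempty word can be stretched over \<open>[0,T]\<close>.\<close>
      have "\<exists>q. flow_value A (control_field f (word_control T (0 # w))) T (\<alpha> \<theta>) q \<and>
          riemannian_dist A g (\<omega> \<theta>) q \<le> \<epsilon>" if \<theta>: "\<theta> \<in> \<Theta>" for \<theta>
      proof -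
        have ends: "\<gamma> 0 \<theta> = \<alpha> \<theta>" "\<gamma> T \<theta> = \<omega> \<theta>" using \<gamma>(2) \<theta> by auto
        obtain q where q: "reach f w (\<alpha> \<theta>) q" "near S e q (\<omega> \<theta>)"
          using w \<theta> near_self[of d S "\<alpha> \<theta>"] d unfolding ends[symmetric] by force
        have "reach f (0 # w) (\<alpha> \<theta>) q" using q(1) step_zero by auto
        then have "flow_value A (control_field f (word_control T (0 # w))) T (\<alpha> \<theta>) q"
          by (rule reach_flow_value) (use assms(9) in auto)
        moreover have "riemannian_dist A g (\<omega> \<theta>) q \<le> \<epsilon>"
        proof -
          obtain c D where cD: "(c, D) \<in> S" "\<omega> \<theta> \<in> cell c D" using tube \<theta> ends(2) unfolding mem_cells_union by force
          then have c: "c \<in> A" "\<omega> \<theta> \<in> cdom c" "cmap c (\<omega> \<theta>) \<in> D" and qc: "q \<in> cdom c" "norm (cmap c q - cmap c (\<omega> \<theta>)) \<le> e"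
            using cell_familyD(1)[OF S] q(2) by (auto simp: cell_def near_def)
          let ?C = "cball (cmap c (\<omega> \<theta>)) r"
          have C: "?C \<subseteq> thicken r D" using c(3) unfolding thicken_def by blast
          have Cr: "?C \<subseteq> crange c" using C cell_familyD(3)[OF r(2) enlargeI[OF cD(1)]] by blast
          have "riemannian_dist A g (\<omega> \<theta>) q \<le> M * norm (cmap c q - cmap c (\<omega> \<theta>))"
          proof (rule riemannian_dist_le[OF c(1,2) qc(1) convex_cball Cr])
            show "gnorm g c (cinv c z) v \<le> M * norm v" if "z \<in> ?C" for z v
            proof -
              have z: "z \<in> crange c" "z \<in> thicken r D" using that C Cr by auto
              then have "cinv c z \<in> cell c (thicken r D)"
                using cinv_in[OF c(1) z(1)] cmap_cinv[OF c(1) z(1)] by (simp add: cell_def)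
              then show ?thesis using M(1) cD(1) by blast
            qed
          qed (use qc(2) e r(1) in \<open>auto simp: dist_norm norm_minus_commute\<close>)
          also have "\<dots> \<le> M * e" using qc(2) M(2) by simp
          also note e(3)
          finally show ?thesis .
        qed
        ultimately show ?thesis by blast
      qed
      then show ?thesis using admissible_word_control by blast
    qed
  qed
qed

end
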